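(* Let $n,N\in\mathbb N$, $\mu\in\mathbb R$, $p\in(1,\infty)$, and let $a\in S^\mu(\mathbb R^n;\mathbb C^{N\times N})$ be quasi-hyperbolic. Define the unbounded operator $A$ in $X:=L^p(\mathbb R^n;\mathbb C^N)$ by $Au=\operatorname{op}[a]u$ and $D(A):=\{u\in X:\operatorname{op}[a]u\in X\}$. Then the Cauchy problem $$\partial_tu-Au=0\quad(t>0),\qquad u(0)=u_0$$ is well-posed in $X$ if and only if for all $T>0$ there is a $C_T>0$ such that $$\big\|e^{ta(\cdot)}\big\|_{M_p^N}\le C_T\quad(t\in[0,T]).$$ In this case, the semigroup generated by $A$ is given by $(\operatorname{op}[e^{ta(\cdot)}])_{t\ge0}$.
   Context: Notation: $\langle\xi\rangle:=(1+|\xi|^2)^{1/2}$. $S^\mu(\mathbb R^n;\mathbb C^{N\times N})$ is the set of all $a\in C^\infty(\mathbb R^n;\mathbb C^{N\times N})$ such that for each $\alpha\in\mathbb N_0^n$ there is $C_\alpha>0$ with $|\partial_\xi^\alpha a(\xi)|\le C_\alpha\langle\xi\rangle^{\mu-|\alpha|}$ for all $\xi$. For a smooth matrix function $a$ all of whose derivatives have at most polynomial growth, $\operatorname{op}[a]:=\mathscr F^{-1}a\mathscr F$ acts continuously on $\mathscr S(\mathbb R^n;\mathbb C^N)$ and on $\mathscr S'(\mathbb R^n;\mathbb C^N)$, where $(\mathscr F\varphi)(\xi)=(2\pi)^{-n/2}\int e^{ix\cdot\xi}\varphi(x)\,dx$. $a$ is quasi-hyperbolic if there is $M_a\in\mathbb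 R$ such that $\det(\lambda-a(\xi))\ne0$ for all $\xi\in\mathbb R^n$ and all $\lambda\in\mathbb C$ with $\operatorname{Re}\lambda>M_a$. $L^p$-Fourier multipliers: $m\in L^\infty(\mathbb R^n;\mathbb C^{N\times N})$ is an $L^p$-Fourier multiplier if there is $c_p>0$ such that for all $u\in\mathscr S(\mathbb R^n;\mathbb C^N)$ one has $\operatorname{op}[m]u:=\mathscr F^{-1}m\mathscr Fu\in L^p(\mathbb R^n;\mathbb C^N)$ and $\|\operatorname{op}[m]u\|_{L^p}\le c_p\|u\|_{L^p}$; then $\operatorname{op}[m]$ extends to a bounded operator on $L^p(\mathbb R^n;\mathbb C^N)$. $M_p^N$ is the space of all such $m$, with norm $\|m\|_{M_p^N}:=\|\operatorname{op}[m]\|_{L(L^p(\mathbb R^n;\mathbb C^N))}$. The stated inequality includes the assertion $e^{ta(\cdot)}\in M_p^N$. Well-posedness: for a closed densely defined operator $A$ in a Banach space $X$, the Cauchy problem is well-posed if for every $u_0\in D(A)$ there is a unique (classical) solution $u\in C^1([0,\infty),X)$ with $u(t)\in D(A)$ for $t>0$, and for all $T>0$ there is a constant $C_T>0$ such that $\|u(t)\|\le C_T\|u_0\|$ for all $t\in[0,T]$ and all $u_0\in D(A)$. (This is equivalent to $A$ generating a $C_0$-semigroup on $X$.) *)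

theory Defs
  imports "HOL-Analysis.Analysis"
begin

section \<open>Smooth functions, symbols and Schwartz functions\<close>

definition partial :: "'n \<Rightarrow> (real ^ 'n \<Rightarrow> 'b::real_normed_vector) \<Rightarrow> real ^ 'n \<Rightarrow> 'b"
  where "partial i f = (\<lambda>x. vector_derivative (\<lambda>h. f (x + h *\<^sub>R axis i 1)) (at 0))"

text \<open>
  A multi-index is represented by the list of the coordinates in which one differentiates; its
  order is the length of the list. For smooth functions the order of the differentiations
  is irrelevant, so ranging over all lists is the same as ranging over all multi-indices.
\<close>

definition iter_partial :: "'n list \<Rightarrow> (real ^ 'n \<Rightarrow> 'b::real_normed_vector) \<Rightarrow> real ^ 'n \<Rightarrow> 'b"
  where "iter_partial is f = foldr partial is f"

definition smooth :: "(real ^ 'n \<Rightarrow> 'b::real_normed_vector) \<Rightarrow> bool"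
  where "smooth f \<longleftrightarrow> (\<forall>is x. iter_partial is f differentiable (at x))"

definition japanese_bracket :: "real ^ 'n \<Rightarrow> real"
  where "japanese_bracket \<xi> = (1 + (norm \<xi>)\<^sup>2) powr (1 / 2)"

text \<open>The norm on matrices is the Euclidean norm of the library; all norms are equivalent here.\<close>

definition symbols :: "real \<Rightarrow> (real ^ 'n \<Rightarrow> complex ^ 'N ^ 'N) set"
  where "symbols \<mu> = {a. smooth a \<and>
    (\<forall>is. \<exists>C>0. \<forall>\<xi>. norm (iter_partial is a \<xi>)
        \<le> C * japanese_bracket \<xi> powr (\<mu> - real (length is)))}"

definition quasi_hyperbolic :: "(real ^ 'n \<Rightarrow> complex ^ 'N ^ 'N) \<Rightarrow> bool"
  where "quasi_hyperbolic a \<longleftrightarrow>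
    (\<exists>M::real. \<forall>\<xi>. \<forall>z::complex. Re z > M \<longrightarrow> det (mat z - a \<xi>) \<noteq> 0)"

definition schwartz :: "(real ^ 'n \<Rightarrow> 'b::real_normed_vector) set"
  where "schwartz = {\<phi>. smooth \<phi> \<and>
    (\<forall>is k. \<exists>C. \<forall>x. (1 + norm x) ^ k * norm (iter_partial is \<phi> x) \<le> C)}"

text \<open>
  Multiplication of matrices is \<open>**\<close>; the type class operation \<open>*\<close> on \<open>vec\<close>, and hence \<open>^\<close>,
  would be componentwise.
\<close>

definition mat_exp :: "complex ^ 'N ^ 'N \<Rightarrow> complex ^ 'N ^ 'N"
  where "mat_exp A = (\<Sum>k. (1 / fact k) *\<^sub>R (((**) A ^^ k) (mat 1)))"


section \<open>Fourier transform\<close>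

definition fourier :: "(real ^ 'n \<Rightarrow> complex) \<Rightarrow> real ^ 'n \<Rightarrow> complex"
  where "fourier \<phi> \<xi> = complex_of_real ((2 * pi) powr (- real CARD('n) / 2)) *
    (\<integral>x. exp (\<i> * complex_of_real (x \<bullet> \<xi>)) * \<phi> x \<partial>lborel)"

definition inv_fourier :: "(real ^ 'n \<Rightarrow> complex) \<Rightarrow> real ^ 'n \<Rightarrow> complex"
  where "inv_fourier \<psi> x = complex_of_real ((2 * pi) powr (- real CARD('n) / 2)) *
    (\<integral>\<xi>. exp (- \<i> * complex_of_real (x \<bullet> \<xi>)) * \<psi> \<xi> \<partial>lborel)"

definition fourier_vec :: "(real ^ 'n \<Rightarrow> complex ^ 'N) \<Rightarrow> real ^ 'n \<Rightarrow> complex ^ 'N"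
  where "fourier_vec u \<xi> = (\<chi> j. fourier (\<lambda>x. u x $ j) \<xi>)"

definition inv_fourier_vec :: "(real ^ 'n \<Rightarrow> complex ^ 'N) \<Rightarrow> real ^ 'n \<Rightarrow> complex ^ 'N"
  where "inv_fourier_vec v x = (\<chi> j. inv_fourier (\<lambda>\<xi>. v \<xi> $ j) x)"

text \<open>
  \<open>op[m]u\<close> for a Schwartz function \<open>u\<close>. If \<open>m\<close> is bounded and measurable (or of polynomial growth),
  then \<open>m \<F>u\<close> is integrable, so the inverse Fourier transform is given by the integral.
\<close>

definition op_fun ::
    "(real ^ 'n \<Rightarrow> complex ^ 'N ^ 'N) \<Rightarrow> (real ^ 'n \<Rightarrow> complex ^ 'N) \<Rightarrow> real ^ 'n \<Rightarrow> complex ^ 'N"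
  where "op_fun m u = inv_fourier_vec (\<lambda>\<xi>. m \<xi> *v fourier_vec u \<xi>)"

text \<open>
  Vector-valued distributions are functionals on the scalar Schwartz functions with values in
  the space of \<open>N\<close>-tuples of complex numbers; only their values on \<open>schwartz\<close> are relevant. The
  Fourier transform has a symmetric kernel, so it passes to distributions by
  \<open>(\<F>T)(\<phi>) = T(\<F>\<phi>)\<close> (the pairing is bilinear).
\<close>

type_synonym ('n, 'N) distribution = "(real ^ 'n \<Rightarrow> complex) \<Rightarrow> complex ^ 'N"

definition dist_fourier :: "('n::finite, 'N::finite) distribution \<Rightarrow> ('n, 'N) distribution"
  where "dist_fourier T = (\<lambda>\<phi>. T (fourier \<phi>))"

definition dist_inv_fourier :: "('n::finite, 'N::finite) distribution \<Rightarrow> ('n, 'N) distribution"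
  where "dist_inv_fourier T = (\<lambda>\<phi>. T (inv_fourier \<phi>))"

definition dist_mult ::
    "(real ^ 'n \<Rightarrow> complex ^ 'N ^ 'N) \<Rightarrow> ('n::finite, 'N::finite) distribution \<Rightarrow> ('n, 'N) distribution"
  where "dist_mult a T = (\<lambda>\<phi>. \<chi> i. \<Sum>j\<in>UNIV. T (\<lambda>\<xi>. a \<xi> $ i $ j * \<phi> \<xi>) $ j)"

definition op_dist ::
    "(real ^ 'n \<Rightarrow> complex ^ 'N ^ 'N) \<Rightarrow> ('n::finite, 'N::finite) distribution \<Rightarrow> ('n, 'N) distribution"
  where "op_dist a T = dist_inv_fourier (dist_mult a (dist_fourier T))"


section \<open>Lebesgue spaces\<close>

definition ae_eq :: "('a::euclidean_space \<Rightarrow> 'b::euclidean_space) \<Rightarrow> ('a \<Rightarrow> 'b) \<Rightarrow> bool"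
  where "ae_eq f g \<longleftrightarrow> f \<in> borel_measurable lborel \<and> g \<in> borel_measurable lborel \<and>
    (AE x in lborel. f x = g x)"

text \<open>
  Classes of measurable functions modulo equality almost everywhere. Every Lebesgue measurable
  function agrees almost everywhere with a Borel measurable one, so it suffices to use Borel
  measurable representatives.
\<close>

quotient_type (overloaded) ('a, 'b) ae_class =
    "'a::euclidean_space \<Rightarrow> 'b::euclidean_space" / partial: ae_eq
proof (rule part_equivpI)
  show "\<exists>f::'a \<Rightarrow> 'b. ae_eq f f"
    by (rule exI[of _ "\<lambda>_. 0"]) (simp add: ae_eq_def)
  show "symp (ae_eq :: ('a \<Rightarrow> 'b) \<Rightarrow> _)"
    by (auto simp: symp_def ae_eq_def elim: AE_mp)
  show "transp (ae_eq :: ('a \<Rightarrow> 'b) \<Rightarrow> _)"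
    by (auto simp: transp_def ae_eq_def)
qed

instantiation ae_class :: (euclidean_space, euclidean_space) real_vector
begin

lift_definition zero_ae_class :: "('a, 'b) ae_class" is "\<lambda>_. 0"
  by (simp add: ae_eq_def)

lift_definition plus_ae_class :: "('a, 'b) ae_class \<Rightarrow> ('a, 'b) ae_class \<Rightarrow> ('a, 'b) ae_class"
  is "\<lambda>f g x. f x + g x"
  by (auto simp: ae_eq_def)

lift_definition minus_ae_class :: "('a, 'b) ae_class \<Rightarrow> ('a, 'b) ae_class \<Rightarrow> ('a, 'b) ae_class"
  is "\<lambda>f g x. f x - g x"
  by (auto simp: ae_eq_def)

lift_definition uminus_ae_class :: "('a, 'b) ae_class \<Rightarrow> ('a, 'b) ae_class"
  is "\<lambda>f x. - f x"
  by (auto simp: ae_eq_def)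

lift_definition scaleR_ae_class :: "real \<Rightarrow> ('a, 'b) ae_class \<Rightarrow> ('a, 'b) ae_class"
  is "\<lambda>c f x. c *\<^sub>R f x"
  by (auto simp: ae_eq_def)

instance
  by standard (transfer; force simp: ae_eq_def algebra_simps scaleR_add_left scaleR_add_right)+

end

abbreviation class_of :: "('a::euclidean_space \<Rightarrow> 'b::euclidean_space) \<Rightarrow> ('a, 'b) ae_class"
  where "class_of \<equiv> abs_ae_class"

text \<open>
  The following three notions are defined through the representative \<open>rep_ae_class u\<close>, but do not
  depend on it, because two Borel measurable representatives agree almost everywhere.
\<close>

definition Lp :: "real \<Rightarrow> ('a::euclidean_space, 'b::euclidean_space) ae_class set"
  where "Lp p = {u. integrable lborel (\<lambda>x. norm (rep_ae_class u x) powr p)}"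

definition Lp_norm :: "real \<Rightarrow> ('a::euclidean_space, 'b::euclidean_space) ae_class \<Rightarrow> real"
  where "Lp_norm p u = (\<integral>x. norm (rep_ae_class u x) powr p \<partial>lborel) powr (1 / p)"

definition dist_of :: "(real ^ 'n, complex ^ 'N) ae_class \<Rightarrow> ('n::finite, 'N::finite) distribution"
  where "dist_of u = (\<lambda>\<phi>. \<integral>x. \<phi> x *s rep_ae_class u x \<partial>lborel)"

lemma rep_ae_class_measurable: "rep_ae_class u \<in> borel_measurable lborel"
  using Quotient3_rep_reflp[OF Quotient3_ae_class, of u] by (simp add: ae_eq_def)

lemma class_of_rep_ae_class: "class_of (rep_ae_class u) = u"
  using Quotient3_abs_rep[OF Quotient3_ae_class] .

lemma rep_class_of_AE:
  "f \<in> borel_measurable lborel \<Longrightarrow> AE x in lborel. rep_ae_class (class_of f) x = f x"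
  using rep_abs_rsp_left[OF Quotient3_ae_class, of f f] by (simp add: ae_eq_def)

lemma class_of_eq_iff:
  assumes "f \<in> borel_measurable lborel" "g \<in> borel_measurable lborel"
  shows "class_of f = class_of g \<longleftrightarrow> (AE x in lborel. f x = g x)"
  using Quotient3_rel[OF Quotient3_ae_class, of f g] assms by (simp add: ae_eq_def)


section \<open>Operators, semigroups and Cauchy problems\<close>

text \<open>
  A normed space is given by its carrier \<open>X\<close>, a subspace of the ambient vector space, and its norm
  \<open>nrm\<close>. An unbounded operator is given by its domain \<open>D\<close> and a function \<open>A\<close>, whose values
  outside of \<open>D\<close> are irrelevant. Complex spaces are regarded as real ones; none of the following
  notions depends on the scalars, apart from linearity.
\<close>

definition converges_in :: "('v::real_vector \<Rightarrow> real) \<Rightarrow> ('c \<Rightarrow> 'v) \<Rightarrow> 'v \<Rightarrow> 'c filter \<Rightarrow> bool"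
  where "converges_in nrm f l F \<longleftrightarrow> ((\<lambda>s. nrm (f s - l)) \<longlongrightarrow> 0) F"

definition linear_operator ::
    "'v::real_vector set \<Rightarrow> 'v set \<Rightarrow> ('v \<Rightarrow> 'v) \<Rightarrow> bool"
  where "linear_operator X D A \<longleftrightarrow> subspace D \<and> D \<subseteq> X \<and> A ` D \<subseteq> X \<and>
    (\<forall>x\<in>D. \<forall>y\<in>D. A (x + y) = A x + A y) \<and> (\<forall>c. \<forall>x\<in>D. A (c *\<^sub>R x) = c *\<^sub>R A x)"

definition closed_operator ::
    "'v::real_vector set \<Rightarrow> ('v \<Rightarrow> real) \<Rightarrow> 'v set \<Rightarrow> ('v \<Rightarrow> 'v) \<Rightarrow> bool"
  where "closed_operator X nrm D A \<longleftrightarrow>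
    (\<forall>s x y. (\<forall>k::nat. s k \<in> D) \<and> x \<in> X \<and> y \<in> X \<and> converges_in nrm s x sequentially \<and>
      converges_in nrm (\<lambda>k. A (s k)) y sequentially \<longrightarrow> x \<in> D \<and> A x = y)"

definition densely_defined :: "'v::real_vector set \<Rightarrow> ('v \<Rightarrow> real) \<Rightarrow> 'v set \<Rightarrow> bool"
  where "densely_defined X nrm D \<longleftrightarrow> (\<forall>x\<in>X. \<forall>e>0. \<exists>y\<in>D. nrm (y - x) < e)"

definition bounded_operator ::
    "'v::real_vector set \<Rightarrow> ('v \<Rightarrow> real) \<Rightarrow> ('v \<Rightarrow> 'v) \<Rightarrow> bool"
  where "bounded_operator X nrm B \<longleftrightarrow>
    linear_operator X X B \<and> (\<exists>K. \<forall>x\<in>X. nrm (B x) \<le> K * nrm x)"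

definition operator_norm :: "'v set \<Rightarrow> ('v \<Rightarrow> real) \<Rightarrow> ('v \<Rightarrow> 'v) \<Rightarrow> real"
  where "operator_norm X nrm B = (SUP x\<in>X. nrm (B x) / nrm x)"

definition classical_solution ::
    "'v::real_vector set \<Rightarrow> ('v \<Rightarrow> real) \<Rightarrow> 'v set \<Rightarrow> ('v \<Rightarrow> 'v) \<Rightarrow> 'v \<Rightarrow> (real \<Rightarrow> 'v) \<Rightarrow> bool"
  where "classical_solution X nrm D A u0 u \<longleftrightarrow>
    u 0 = u0 \<and> (\<forall>t\<ge>0. u t \<in> X) \<and>
    (\<exists>u'. (\<forall>t\<ge>0. u' t \<in> X \<and>
            converges_in nrm (\<lambda>s. (1 / (s - t)) *\<^sub>R (u s - u t)) (u' t) (at t within {0..}) \<and>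
            converges_in nrm u' (u' t) (at t within {0..})) \<and>
          (\<forall>t>0. u t \<in> D \<and> u' t = A (u t)))"

definition well_posed ::
    "'v::real_vector set \<Rightarrow> ('v \<Rightarrow> real) \<Rightarrow> 'v set \<Rightarrow> ('v \<Rightarrow> 'v) \<Rightarrow> bool"
  where "well_posed X nrm D A \<longleftrightarrow>
    linear_operator X D A \<and> closed_operator X nrm D A \<and> densely_defined X nrm D \<and>
    (\<forall>u0\<in>D. \<exists>u. classical_solution X nrm D A u0 u \<and>
       (\<forall>v. classical_solution X nrm D A u0 v \<longrightarrow> (\<forall>t\<ge>0. v t = u t))) \<and>
    (\<forall>T>0. \<exists>C>0. \<forall>u0\<in>D. \<forall>u. classical_solution X nrm D A u0 u \<longrightarrow>
       (\<forall>t\<in>{0..T}. nrm (u t) \<le> C * nrm u0))"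

definition C0_semigroup ::
    "'v::real_vector set \<Rightarrow> ('v \<Rightarrow> real) \<Rightarrow> (real \<Rightarrow> 'v \<Rightarrow> 'v) \<Rightarrow> bool"
  where "C0_semigroup X nrm S \<longleftrightarrow>
    (\<forall>t\<ge>0. bounded_operator X nrm (S t)) \<and>
    (\<forall>x\<in>X. S 0 x = x) \<and>
    (\<forall>s\<ge>0. \<forall>t\<ge>0. \<forall>x\<in>X. S (s + t) x = S s (S t x)) \<and>
    (\<forall>x\<in>X. converges_in nrm (\<lambda>t. S t x) x (at_right 0))"

text \<open>\<open>S\<close> is a \<open>C\<^sub>0\<close>-semigroup whose infinitesimal generator is \<open>A\<close> with domain \<open>D\<close>.\<close>

definition generates_semigroup ::
    "'v::real_vector set \<Rightarrow> ('v \<Rightarrow> real) \<Rightarrow> 'v set \<Rightarrow> ('v \<Rightarrow> 'v) \<Rightarrow> (real \<Rightarrow> 'v \<Rightarrow> 'v) \<Rightarrow> bool"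
  where "generates_semigroup X nrm D A S \<longleftrightarrow> C0_semigroup X nrm S \<and>
    D = {x \<in> X. \<exists>y\<in>X. converges_in nrm (\<lambda>h. (1 / h) *\<^sub>R (S h x - x)) y (at_right 0)} \<and>
    (\<forall>x\<in>D. A x \<in> X \<and> converges_in nrm (\<lambda>h. (1 / h) *\<^sub>R (S h x - x)) (A x) (at_right 0))"


section \<open>Fourier multipliers and the realization of a symbol\<close>

definition multipliers :: "real \<Rightarrow> (real ^ 'n \<Rightarrow> complex ^ 'N ^ 'N) set"
  where "multipliers p = {m. m \<in> borel_measurable lborel \<and>
    (\<exists>K. AE \<xi> in lborel. norm (m \<xi>) \<le> K) \<and>
    (\<exists>c>0. \<forall>u\<in>schwartz. class_of (op_fun m u) \<in> Lp p \<and>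
       Lp_norm p (class_of (op_fun m u)) \<le> c * Lp_norm p (class_of u))}"

text \<open>
  The bounded extension of \<open>op[m]\<close> to the Lebesgue space, for \<open>m \<in> multipliers p\<close>. By density of
  the Schwartz functions it is unique on \<open>Lp p\<close>; in particular, it is automatically
  complex linear.
\<close>

definition multiplier_op ::
    "real \<Rightarrow> (real ^ 'n \<Rightarrow> complex ^ 'N ^ 'N) \<Rightarrow>
      (real ^ 'n, complex ^ 'N) ae_class \<Rightarrow> (real ^ 'n, complex ^ 'N) ae_class"
  where "multiplier_op p m = (SOME B. bounded_operator (Lp p) (Lp_norm p) B \<and>
    (\<forall>u\<in>schwartz. B (class_of u) = class_of (op_fun m u)))"

definition multiplier_norm :: "real \<Rightarrow> (real ^ 'n \<Rightarrow> complex ^ 'N ^ 'N) \<Rightarrow> real"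
  where "multiplier_norm p m = operator_norm (Lp p) (Lp_norm p) (multiplier_op p m)"

text \<open>
  \<open>op[a]u \<in> L\<^sup>p\<close> is understood in the sense of tempered distributions; the operator assigns to \<open>u\<close>
  the (unique) class that represents the distribution \<open>op[a]u\<close>.
\<close>

definition represents_op ::
    "(real ^ 'n \<Rightarrow> complex ^ 'N ^ 'N) \<Rightarrow> (real ^ 'n, complex ^ 'N) ae_class \<Rightarrow>
      (real ^ 'n, complex ^ 'N) ae_class \<Rightarrow> bool"
  where "represents_op a u v \<longleftrightarrow> (\<forall>\<phi>\<in>schwartz. op_dist a (dist_of u) \<phi> = dist_of v \<phi>)"

definition Lp_domain ::
    "real \<Rightarrow> (real ^ 'n \<Rightarrow> complex ^ 'N ^ 'N) \<Rightarrow> (real ^ 'n, complex ^ 'N) ae_class set"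
  where "Lp_domain p a = {u \<in> Lp p. \<exists>v\<in>Lp p. represents_op a u v}"

definition Lp_realization ::
    "real \<Rightarrow> (real ^ 'n \<Rightarrow> complex ^ 'N ^ 'N) \<Rightarrow>
      (real ^ 'n, complex ^ 'N) ae_class \<Rightarrow> (real ^ 'n, complex ^ 'N) ae_class"
  where "Lp_realization p a u = (THE v. v \<in> Lp p \<and> represents_op a u v)"

end

theory Submission
  imports Defs "HOL-Probability.Characteristic_Functions" "HOL-Probability.Sinc_Integral"
begin

text \<open>
  Formally, the solution of \<open>u' = op[a] u\<close> with initial value \<open>u\<close> is \<open>op[exp (t a)] u\<close>; the theorem
  says that this formula defines the semigroup exactly when it can define one, that is, when its
  operators are bounded on \<open>L\<^sup>p\<close> locally uniformly in \<open>t\<close>. Everything is compared on one dense class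
  of functions, the inverse Fourier transforms of smooth functions \<open>g\<close> of compact support
  (\<open>testvec_dense\<close>).

  On this class the formula is literally correct. On the support of \<open>g\<close> the symbol and its
  derivatives are bounded, so the derivative bounds of \<open>a ^ k g\<close> grow geometrically in \<open>k\<close>
  (\<open>apow_testfun\<close>), and integration by parts turns them into pointwise bounds \<open>C B ^ k wt\<close> for the
  inverse transforms, with one fixed weight \<open>wt\<close> in every \<open>L\<^sup>p\<close> (\<open>fourier_decay\<close>,
  \<open>apow_fourier_bound\<close>). Hence the exponential series converges with all the bounds needed: the
  inverse transform of \<open>exp (t a) g\<close> is a power series in \<open>t\<close> at each point (\<open>sol_nth\<close>), and it is a
  classical solution in \<open>L\<^sup>p\<close> (\<open>sol_classical\<close>). The derivatives of \<open>exp (t a)\<close> in \<open>\<xi>\<close> never enter.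

  \<^bold>\<open>From well-posedness to multipliers.\<close> Well-posedness bounds these solutions, so
  \<open>op[exp (t a)]\<close> is bounded on the dense class. Testing with functions whose transforms
  concentrate at a point shows that the entries of \<open>exp (t a)\<close> are bounded functions
  (\<open>multiplier_pointwise_bound\<close>). Then the inequality passes from the dense class to Schwartz
  functions, by a cutoff in frequency and Fatou's lemma (\<open>op_fun_aexp_bound\<close>), and from there to the
  bounded extension (\<open>well_posed_imp_multipliers\<close>).

  \<^bold>\<open>From multipliers to the generator.\<close> Let \<open>S t\<close> be the bounded extension of \<open>op[exp (t a)]\<close>. By
  symmetry of the Fourier transform, \<open>S t x\<close> paired with a test function is \<open>x\<close> paired with a
  modified test function (\<open>S_pairing\<close>). The semigroup law and strong continuity follow on the dense
  class and extend by boundedness. The pairing is again a power series in \<open>t\<close>, now for every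
  \<open>x \<in> L\<^sup>p\<close>, whose coefficients are the pairings of \<open>x\<close> with the powers of \<open>a\<close>
  (\<open>S_pairing_eseries\<close>). Its linear coefficient is the distribution \<open>op[a] x\<close>. So if the orbit of
  \<open>x\<close> is differentiable at \<open>0\<close>, its derivative represents \<open>op[a] x\<close> and \<open>x\<close> is in the domain of the
  realization (\<open>generator_in_realization\<close>). If conversely \<open>op[a] x = y\<close> with \<open>y \<in> L\<^sup>p\<close>, the mean value
  theorem bounds the pairings of \<open>S h x - x - h y\<close>, and the duality of \<open>L\<^sup>p\<close> and \<open>L\<^sup>q\<close>, tested on
  band-limited functions only, bounds its norm (\<open>realization_orbit_derivative\<close>).

  \<^bold>\<open>From the generator to well-posedness.\<close> For a semigroup that is bounded on bounded time
  intervals, the orbits are the only classical solutions (\<open>generator_well_posed\<close>).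
\<close>

section \<open>Calculus with iterated partial derivatives\<close>

lemma iter_partial_Nil [simp]: "iter_partial [] f = f"
  by (simp add: iter_partial_def)

lemma iter_partial_Cons: "iter_partial (i # is) f = partial i (iter_partial is f)"
  by (simp add: iter_partial_def)

lemma iter_partial_snoc: "iter_partial (is @ [i]) f = iter_partial is (partial i f)"
  by (simp add: iter_partial_def)

lemma has_derivative_partial:
  assumes "(f has_derivative f') (at x)"
  shows "partial i f x = f' (axis i 1)"
proof -
  interpret bounded_linear f' using assms by (rule has_derivative_bounded_linear)
  have 1: "((\<lambda>h::real. x + h *\<^sub>R axis i 1) has_derivative (\<lambda>h. h *\<^sub>R axis i 1)) (at 0)"
    by (auto intro!: derivative_eq_intros)
  have "((\<lambda>h. f (x + h *\<^sub>R axis i 1)) has_derivative (\<lambda>h. f' (h *\<^sub>R axis i 1))) (at 0)"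
    by (rule has_derivative_compose[OF 1]) (use assms in simp)
  then have "((\<lambda>h. f (x + h *\<^sub>R axis i 1)) has_vector_derivative f' (axis i 1)) (at 0)"
    by (simp add: has_vector_derivative_def scaleR)
  then show ?thesis unfolding partial_def by (rule vector_derivative_at)
qed

text \<open>
  Truncations of smoothness at order \<open>m\<close>, which allow inductions on the number of derivatives. The
  bound in \<open>dbound\<close> is the same for all derivatives, so that a weight carries a whole estimate.
\<close>

definition diffn :: "nat \<Rightarrow> (real ^ 'n \<Rightarrow> 'b::real_normed_vector) \<Rightarrow> bool"
  where "diffn m f \<longleftrightarrow> (\<forall>is x. length is \<le> m \<longrightarrow> iter_partial is f differentiable (at x))"

definition dbound :: "nat \<Rightarrow> (real ^ 'n \<Rightarrow> real) \<Rightarrow> (real ^ 'n \<Rightarrow> 'b::real_normed_vector) \<Rightarrow> bool"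
  where "dbound m w f \<longleftrightarrow> (\<forall>is x. length is \<le> m \<longrightarrow> norm (iter_partial is f x) \<le> w x)"

lemma all_lists_Suc:
  fixes P :: "'n list \<Rightarrow> bool"
  shows "(\<forall>is. length is \<le> Suc m \<longrightarrow> P is) \<longleftrightarrow> P [] \<and> (\<forall>i is. length is \<le> m \<longrightarrow> P (is @ [i]))"
proof safe
  fix "is" :: "'n list" assume "P []" "\<forall>i is. length is \<le> m \<longrightarrow> P (is @ [i])" "length is \<le> Suc m"
  then show "P is" by (cases "is" rule: rev_cases) auto
qed auto

lemma diffn_0: "diffn 0 f \<longleftrightarrow> (\<forall>x. f differentiable (at x))"
  by (simp add: diffn_def)

lemma diffn_Suc: "diffn (Suc m) f \<longleftrightarrow> (\<forall>x. f differentiable (at x)) \<and> (\<forall>i. diffn m (partial i f))"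
  unfolding diffn_def
  using all_lists_Suc[of m "\<lambda>is. \<forall>x. iter_partial is f differentiable (at x)"]
  by (simp add: iter_partial_snoc, blast?)

lemma dbound_0: "dbound 0 w f \<longleftrightarrow> (\<forall>x. norm (f x) \<le> w x)"
  by (simp add: dbound_def)

lemma dbound_Suc: "dbound (Suc m) w f \<longleftrightarrow> (\<forall>x. norm (f x) \<le> w x) \<and> (\<forall>i. dbound m w (partial i f))"
  unfolding dbound_def
  using all_lists_Suc[of m "\<lambda>is. \<forall>x. norm (iter_partial is f x) \<le> w x"]
  by (simp add: iter_partial_snoc, blast?)

lemma smooth_diffn: "smooth f \<longleftrightarrow> (\<forall>m. diffn m f)"
  unfolding smooth_def diffn_def by blast

lemma diffn_differentiable: "diffn m f \<Longrightarrow> f differentiable (at x)"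
  by (cases m) (auto simp: diffn_0 diffn_Suc)

lemma smooth_differentiable: "smooth f \<Longrightarrow> f differentiable (at x)"
  unfolding smooth_diffn using diffn_differentiable by blast

lemma smooth_partial: "smooth f \<Longrightarrow> smooth (partial i f)"
  unfolding smooth_diffn using diffn_Suc by blast

lemma smooth_iter_partial: "smooth f \<Longrightarrow> smooth (iter_partial is f)"
  by (induction "is") (auto simp: iter_partial_Cons smooth_partial)

text \<open>
  Smoothness is the largest property of differentiable functions that is inherited by partial
  derivatives; often an invariant family is easier to find than a formula for the derivatives.
\<close>

lemma smooth_coinduct:
  assumes "P f" and "\<And>f. P f \<Longrightarrow> (\<forall>x. f differentiable (at x)) \<and> (\<forall>i. P (partial i f))"
  shows "smooth f"
proof -
  have "P f \<Longrightarrow> diffn m f" for m f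
    by (induction m arbitrary: f) (auto simp: diffn_0 diffn_Suc dest: assms(2))
  then show ?thesis using assms(1) by (simp add: smooth_diffn)
qed

lemma smooth_continuous: "smooth f \<Longrightarrow> continuous_on S f"
  by (auto intro!: continuous_at_imp_continuous_on differentiable_imp_continuous_within
      smooth_differentiable)

lemma smooth_measurable [measurable]: "smooth f \<Longrightarrow> f \<in> borel_measurable borel"
  by (rule borel_measurable_continuous_onI) (rule smooth_continuous)

lemma partial_linear:
  assumes "bounded_linear L" "\<And>x. f differentiable (at x)"
  shows "partial i (\<lambda>x. L (f x)) = (\<lambda>x. L (partial i f x))"
proof
  fix x
  obtain f' where f': "(f has_derivative f') (at x)" using assms(2) by (auto simp: differentiable_def)
  from bounded_linear.has_derivative[OF assms(1) f']
  show "partial i (\<lambda>x. L (f x)) x = L (partial i f x)"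
    by (simp add: has_derivative_partial[OF f'] has_derivative_partial)
qed

lemma partial_add:
  assumes "\<And>x. f differentiable (at x)" "\<And>x. g differentiable (at x)"
  shows "partial i (\<lambda>x. f x + g x) = (\<lambda>x. partial i f x + partial i g x)"
proof
  fix x
  obtain f' where f': "(f has_derivative f') (at x)" using assms by (auto simp: differentiable_def)
  obtain g' where g': "(g has_derivative g') (at x)" using assms by (auto simp: differentiable_def)
  from has_derivative_add[OF f' g']
  show "partial i (\<lambda>x. f x + g x) x = partial i f x + partial i g x"
    by (simp add: has_derivative_partial[OF f'] has_derivative_partial[OF g'] has_derivative_partial)
qed

lemma partial_mult:
  fixes f g :: "real ^ 'n \<Rightarrow> 'b::real_normed_algebra"
  assumes "\<And>x. f differentiable (at x)" "\<And>x. g differentiable (at x)"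
  shows "partial i (\<lambda>x. f x * g x) = (\<lambda>x. partial i f x * g x + f x * partial i g x)"
proof
  fix x
  obtain f' where f': "(f has_derivative f') (at x)" using assms by (auto simp: differentiable_def)
  obtain g' where g': "(g has_derivative g') (at x)" using assms by (auto simp: differentiable_def)
  from has_derivative_mult[OF f' g']
  show "partial i (\<lambda>x. f x * g x) x = partial i f x * g x + f x * partial i g x"
    by (simp add: has_derivative_partial[OF f'] has_derivative_partial[OF g'] has_derivative_partial add.commute)
qed

lemma partial_const [simp]: "partial i (\<lambda>x. c) = (\<lambda>x. 0)"
  by (rule ext, subst has_derivative_partial[OF has_derivative_const]) simp

lemma smooth_const [simp]: "smooth (\<lambda>x. c)"
  by (rule smooth_coinduct[where P="\<lambda>f. \<exists>c. f = (\<lambda>x. c)"]) auto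

lemma differentiable_linear:
  "bounded_linear L \<Longrightarrow> f differentiable (at x) \<Longrightarrow> (\<lambda>x. L (f x)) differentiable (at x)"
  using bounded_linear.has_derivative unfolding differentiable_def by blast

lemma smooth_linear:
  assumes "bounded_linear L" "smooth f"
  shows "smooth (\<lambda>x. L (f x))"
proof (rule smooth_coinduct[where P="\<lambda>h. \<exists>f. h = (\<lambda>x. L (f x)) \<and> smooth f"])
  fix h assume "\<exists>f. h = (\<lambda>x. L (f x)) \<and> smooth f"
  then obtain f where h: "h = (\<lambda>x. L (f x))" and f: "smooth f" by blast
  have "h differentiable (at x)" for x
    unfolding h by (rule differentiable_linear[OF assms(1) smooth_differentiable[OF f]])
  moreover have "\<exists>f. partial i h = (\<lambda>x. L (f x)) \<and> smooth f" for i
    unfolding h partial_linear[OF assms(1) smooth_differentiable[OF f]] using smooth_partial[OF f] by blast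
  ultimately show "(\<forall>x. h differentiable (at x)) \<and> (\<forall>i. \<exists>f. partial i h = (\<lambda>x. L (f x)) \<and> smooth f)"
    by blast
qed (use assms in blast)

lemma iter_partial_linear:
  assumes "bounded_linear L" "smooth f"
  shows "iter_partial is (\<lambda>x. L (f x)) = (\<lambda>x. L (iter_partial is f x))"
  by (induction "is")
     (auto simp: iter_partial_Cons assms partial_linear smooth_iter_partial smooth_differentiable)

lemma diffn_add:
  "diffn m f \<Longrightarrow> diffn m g \<Longrightarrow> diffn m (\<lambda>x. f x + g x)"
  by (induction m arbitrary: f g) (auto simp: diffn_0 diffn_Suc partial_add)

lemma smooth_add:
  "smooth f \<Longrightarrow> smooth g \<Longrightarrow> smooth (\<lambda>x. f x + g x)"
  by (simp add: smooth_diffn diffn_add)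

lemma smooth_sum:
  "finite I \<Longrightarrow> (\<And>i. i \<in> I \<Longrightarrow> smooth (f i)) \<Longrightarrow> smooth (\<lambda>x. \<Sum>i\<in>I. f i x)"
  by (induction I rule: finite_induct) (auto intro: smooth_add)

lemma diffn_le: "diffn (Suc m) f \<Longrightarrow> diffn m f"
  by (simp add: diffn_def)

lemma diffn_mult:
  fixes f g :: "real ^ 'n \<Rightarrow> 'b::real_normed_algebra"
  shows "diffn m f \<Longrightarrow> diffn m g \<Longrightarrow> diffn m (\<lambda>x. f x * g x)"
proof (induction m arbitrary: f g)
  case 0 then show ?case by (auto simp: diffn_0)
next
  case (Suc m)
  have "diffn m (\<lambda>x. partial i f x * g x + f x * partial i g x)" for i
    using Suc diffn_le[OF Suc.prems(1)] diffn_le[OF Suc.prems(2)]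
    by (intro diffn_add Suc.IH) (auto simp: diffn_Suc)
  then show ?case using Suc.prems by (simp add: diffn_Suc partial_mult)
qed

lemma smooth_mult:
  fixes f g :: "real ^ 'n \<Rightarrow> 'b::real_normed_algebra"
  shows "smooth f \<Longrightarrow> smooth g \<Longrightarrow> smooth (\<lambda>x. f x * g x)"
  by (simp add: smooth_diffn diffn_mult)

lemma dbound_nonneg: "dbound m w f \<Longrightarrow> 0 \<le> w x"
  unfolding dbound_def by (drule spec[of _ "[]"]) (auto intro: order_trans[OF norm_ge_zero])

lemma dbound_value: "dbound m w f \<Longrightarrow> norm (f x) \<le> w x"
  unfolding dbound_def by (drule spec[of _ "[]"]) auto

lemma dbound_mono: "dbound m w f \<Longrightarrow> m' \<le> m \<Longrightarrow> (\<And>x. w x \<le> w' x) \<Longrightarrow> dbound m' w' f"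
  unfolding dbound_def by (meson order_trans)

lemma dbound_weaken: "dbound m w f \<Longrightarrow> (\<And>x. w x \<le> w' x) \<Longrightarrow> dbound m w' f"
  by (rule dbound_mono[OF _ order_refl])

lemma dbound_add:
  "smooth f \<Longrightarrow> smooth g \<Longrightarrow> dbound m v f \<Longrightarrow> dbound m w g \<Longrightarrow> dbound m (\<lambda>x. v x + w x) (\<lambda>x. f x + g x)"
proof (induction m arbitrary: f g)
  case 0 then show ?case by (auto simp: dbound_0 intro: norm_add_rule_thm)
next
  case (Suc m)
  then show ?case
    by (auto simp: dbound_Suc partial_add smooth_differentiable smooth_partial intro: norm_add_rule_thm)
qed

lemma dbound_sum:
  fixes f :: "'a \<Rightarrow> real ^ 'b \<Rightarrow> 'c::real_normed_vector"
  assumes "finite I" "\<And>i. i \<in> I \<Longrightarrow> smooth (f i)" "\<And>i. i \<in> I \<Longrightarrow> dbound m (w i) (f i)"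
  shows "dbound m (\<lambda>x. \<Sum>i\<in>I. w i x) (\<lambda>x. \<Sum>i\<in>I. f i x)"
  using assms
proof (induction I rule: finite_induct)
  case empty
  have "iter_partial is (\<lambda>x :: real ^ 'b. 0 :: 'c) = (\<lambda>x. 0)" for "is"
    by (induction "is") (auto simp: iter_partial_Cons)
  then show ?case by (simp add: dbound_def)
next
  case (insert i I)
  then show ?case by (auto intro!: dbound_add smooth_sum)
qed

lemma dbound_linear:
  assumes "bounded_linear L" "smooth f" "dbound m w f" "\<And>y. norm (L y) \<le> K * norm y" "0 \<le> K"
  shows "dbound m (\<lambda>x. K * w x) (\<lambda>x. L (f x))"
  unfolding dbound_def iter_partial_linear[OF assms(1,2)]
  using assms(3-5) unfolding dbound_def by (meson mult_left_mono order_trans)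

text \<open>
  Leibniz' rule, in the form of a product of weights: each derivative doubles the number of
  terms, and only this count enters the constant.
\<close>

lemma dbound_mult:
  fixes f g :: "real ^ 'n \<Rightarrow> 'b::real_normed_algebra"
  shows "smooth f \<Longrightarrow> smooth g \<Longrightarrow> dbound m v f \<Longrightarrow> dbound m w g \<Longrightarrow>
    dbound m (\<lambda>x. 2 ^ m * (v x * w x)) (\<lambda>x. f x * g x)"
proof (induction m arbitrary: f g)
  case 0
  then show ?case
    by (auto simp: dbound_0 intro!: order_trans[OF norm_mult_ineq] mult_mono intro: order_trans[OF norm_ge_zero])
next
  case (Suc m)
  have nn: "0 \<le> v x" "0 \<le> w x" for x using Suc.prems dbound_nonneg by blast+
  have *: "dbound m v f" "dbound m w g" using Suc.prems dbound_mono[of "Suc m" _ _ m] by auto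
  have "norm (f x * g x) \<le> v x * w x" for x
    using Suc.prems nn by (auto simp: dbound_Suc intro!: order_trans[OF norm_mult_ineq] mult_mono)
  moreover have "v x * w x \<le> 2 ^ Suc m * (v x * w x)" for x
    using nn[of x] mult_right_mono[of 1 "2 ^ Suc m" "v x * w x"] by (simp del: power_Suc)
  ultimately have "norm (f x * g x) \<le> 2 ^ Suc m * (v x * w x)" for x
    using order_trans by blast
  moreover
  have "dbound m (\<lambda>x. 2 ^ m * (v x * w x) + 2 ^ m * (v x * w x))
      (\<lambda>x. partial i f x * g x + f x * partial i g x)" for i
    using Suc.prems *
    by (intro dbound_add Suc.IH smooth_mult smooth_partial) (auto simp: dbound_Suc)
  then have "dbound m (\<lambda>x. 2 ^ Suc m * (v x * w x)) (\<lambda>x. partial i f x * g x + f x * partial i g x)" for i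
    by (rule dbound_mono) auto
  ultimately show ?case
    using Suc.prems by (auto simp: dbound_Suc[of m] partial_mult smooth_differentiable simp del: power_Suc)
qed

lemma finite_lists_le: "finite {is :: 'n::finite list. length is \<le> m}"
  using finite_lists_length_le[of "UNIV :: 'n set" m] by simp

text \<open>
  There are only finitely many lists of coordinates of length at most \<open>m\<close>, so bounds for the single
  derivatives can be summed up.
\<close>

lemma dbound_exists:
  fixes f :: "real ^ 'n \<Rightarrow> 'b::real_normed_vector"
  assumes "\<And>is. \<exists>C. \<forall>x. norm (iter_partial is f x) \<le> C * w x" "\<And>x. 0 \<le> w x"
  shows "\<exists>C\<ge>0. dbound m (\<lambda>x. C * w x) f"
proof -
  obtain C where C: "\<And>is x. norm (iter_partial is f x) \<le> C is * w x" using assms(1) by metis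
  let ?L = "{is :: 'n list. length is \<le> m}"
  have "norm (iter_partial is f x) \<le> (\<Sum>is\<in>?L. \<bar>C is\<bar>) * w x" if "length is \<le> m" for "is" x
  proof -
    have "C is * w x \<le> \<bar>C is\<bar> * w x" using assms(2)[of x] by (intro mult_right_mono) auto
    also have "\<bar>C is\<bar> \<le> (\<Sum>is\<in>?L. \<bar>C is\<bar>)"
      by (rule member_le_sum) (use that finite_lists_le in auto)
    then have "\<bar>C is\<bar> * w x \<le> (\<Sum>is\<in>?L. \<bar>C is\<bar>) * w x" using assms(2)[of x] by (intro mult_right_mono) auto
    finally show ?thesis using C[of "is" x] by linarith
  qed
  then show ?thesis by (intro exI[of _ "\<Sum>is\<in>?L. \<bar>C is\<bar>"]) (auto simp: dbound_def intro: sum_nonneg)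
qed

lemma bounded_linear_coord: "bounded_linear (\<lambda>x :: real ^ 'n. x $ i)"
  by (rule bounded_linear_vec_nth)

lemma smooth_id: "smooth (\<lambda>x :: real ^ 'n. x)"
proof -
  have "partial i (\<lambda>x :: real ^ 'n. x) = (\<lambda>x. axis i 1)" for i
    by (rule ext, subst has_derivative_partial[OF has_derivative_ident]) simp
  then show ?thesis
    by (intro smooth_coinduct[where P="\<lambda>f. f = (\<lambda>x. x) \<or> (\<exists>c. f = (\<lambda>x. c))"]) auto
qed

lemma smooth_coord: "smooth (\<lambda>x :: real ^ 'n. x $ i)"
  using smooth_linear[OF bounded_linear_coord smooth_id] .

lemma smooth_of_real: "smooth f \<Longrightarrow> smooth (\<lambda>x. complex_of_real (f x))"
  by (rule smooth_linear[OF bounded_linear_of_real])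

lemma partial_coord: "partial i (\<lambda>x :: real ^ 'n. x $ j) = (\<lambda>x. if i = j then 1 else 0)"
  by (rule ext, subst has_derivative_partial[OF bounded_linear_imp_has_derivative[OF bounded_linear_coord]])
     (simp add: axis_def)


section \<open>Dilations and a smooth cut-off function\<close>

lemma partial_dilation:
  assumes "\<And>x. f differentiable (at x)"
  shows "partial i (\<lambda>x. f (e *\<^sub>R x)) = (\<lambda>x. e *\<^sub>R partial i f (e *\<^sub>R x))"
proof
  fix x
  obtain f' where f': "(f has_derivative f') (at (e *\<^sub>R x))" using assms by (auto simp: differentiable_def)
  have 1: "((\<lambda>x. e *\<^sub>R x) has_derivative (\<lambda>x. e *\<^sub>R x)) (at x)"
    by (auto intro!: derivative_eq_intros)
  from has_derivative_compose[OF 1 f'] bounded_linear.linear[OF has_derivative_bounded_linear[OF f']]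
  show "partial i (\<lambda>x. f (e *\<^sub>R x)) x = e *\<^sub>R partial i f (e *\<^sub>R x)"
    by (simp add: has_derivative_partial[OF f'] has_derivative_partial linear_cmul)
qed

lemma differentiable_dilation:
  assumes "\<And>x. f differentiable (at x)"
  shows "(\<lambda>x. f (e *\<^sub>R x)) differentiable (at x)"
  by (rule differentiable_compose[of f "\<lambda>x. e *\<^sub>R x"]) (use assms in \<open>auto simp: differentiable_def intro!: derivative_eq_intros exI\<close>)

lemma smooth_dilation:
  assumes "smooth f"
  shows "smooth (\<lambda>x. f (e *\<^sub>R x))"
proof (rule smooth_coinduct[where P="\<lambda>h. \<exists>c f. h = (\<lambda>x. c *\<^sub>R f (e *\<^sub>R x)) \<and> smooth f"])
  fix h assume "\<exists>c f. h = (\<lambda>x. c *\<^sub>R f (e *\<^sub>R x)) \<and> smooth f"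
  then obtain c f where h: "h = (\<lambda>x. c *\<^sub>R f (e *\<^sub>R x))" and f: "smooth f" by blast
  note d = differentiable_dilation[OF smooth_differentiable[OF f], where e=e]
  have "h differentiable (at x)" for x
    unfolding h by (rule differentiable_linear[OF bounded_linear_scaleR_right d])
  moreover have "\<exists>c f. partial i h = (\<lambda>x. c *\<^sub>R f (e *\<^sub>R x)) \<and> smooth f" for i
    unfolding h partial_linear[OF bounded_linear_scaleR_right d] partial_dilation[OF smooth_differentiable[OF f]]
    using smooth_partial[OF f] by (intro exI[of _ "c * e"] exI[of _ "partial i f"]) simp
  ultimately show "(\<forall>x. h differentiable (at x)) \<and> (\<forall>i. \<exists>c f. partial i h = (\<lambda>x. c *\<^sub>R f (e *\<^sub>R x)) \<and> smooth f)"
    by blast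
qed (use \<open>smooth f\<close> in \<open>auto intro!: exI[of _ 1]\<close>)

lemma iter_partial_dilation:
  assumes "smooth f"
  shows "iter_partial is (\<lambda>x. f (e *\<^sub>R x)) = (\<lambda>x. e ^ length is *\<^sub>R iter_partial is f (e *\<^sub>R x))"
proof (induction "is")
  case (Cons i "is")
  have "partial i (\<lambda>x. e ^ length is *\<^sub>R iter_partial is f (e *\<^sub>R x)) =
      (\<lambda>x. e ^ length is *\<^sub>R partial i (\<lambda>x. iter_partial is f (e *\<^sub>R x)) x)"
    by (rule partial_linear[OF bounded_linear_scaleR_right])
       (rule differentiable_dilation, rule smooth_differentiable, rule smooth_iter_partial, rule assms)
  then show ?case
    by (simp add: iter_partial_Cons Cons partial_dilation smooth_differentiable smooth_iter_partial assms ac_simps)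
qed simp

lemma partial_translation:
  assumes "\<And>x. f differentiable (at x)"
  shows "partial i (\<lambda>x. f (x + c)) = (\<lambda>x. partial i f (x + c))"
proof
  fix x
  obtain f' where f': "(f has_derivative f') (at (x + c))" using assms by (auto simp: differentiable_def)
  have 1: "((\<lambda>x. x + c) has_derivative (\<lambda>x. x)) (at x)"
    by (auto intro!: derivative_eq_intros)
  from has_derivative_compose[OF 1 f']
  show "partial i (\<lambda>x. f (x + c)) x = partial i f (x + c)"
    by (simp add: has_derivative_partial[OF f'] has_derivative_partial)
qed

lemma smooth_translation:
  assumes "smooth f"
  shows "smooth (\<lambda>x. f (x + c))"
proof -
  have d: "(\<lambda>x. g (x + c)) differentiable (at x)" if "smooth g" for g :: "real ^ 'a \<Rightarrow> 'b" and x
    by (rule differentiable_compose[of g "\<lambda>x. x + c"]) (use that in \<open>auto intro!: smooth_differentiable derivative_intros\<close>)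
  show ?thesis
    by (rule smooth_coinduct[where P="\<lambda>h. \<exists>f. h = (\<lambda>x. f (x + c)) \<and> smooth f"])
       (use assms in \<open>auto simp: partial_translation smooth_differentiable d smooth_partial\<close>)
qed

text \<open>
  The derivatives of these functions are linear combinations of functions of the same kind, so
  that smoothness follows by coinduction.
\<close>

definition flat :: "nat \<Rightarrow> real \<Rightarrow> real"
  where "flat k s = (if s \<le> 0 then 0 else exp (- 1 / s) / s ^ k)"

text \<open>
  The quadratic bound makes the function differentiable at \<open>0\<close>. It comes from one term of the
  exponential series of \<open>1 / s\<close>.
\<close>

lemma flat_le: "\<bar>flat k s\<bar> \<le> fact (k + 2) * s\<^sup>2"
proof (cases "s \<le> 0")
  case False
  then have s: "s > 0" by simp
  have "(1 / s) ^ (k + 2) / fact (k + 2) \<le> exp (1 / s)"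
    using s sum_le_suminf[OF summable_exp_generic[of "1 / s"], of "{k + 2}"]
    by (auto simp: exp_def divide_inverse_commute)
  moreover have "0 < (fact (k + 2) :: real) * s ^ (k + 2)" using s by simp
  ultimately have "1 \<le> exp (1 / s) * (fact (k + 2) * s ^ (k + 2))"
    by (simp add: mult.commute power_one_over pos_divide_le_eq divide_divide_eq_left' del: fact_Suc power_Suc add_2_eq_Suc' fact_2)
  then have "exp (- (1 / s)) \<le> fact (k + 2) * s ^ (k + 2)"
    by (simp add: exp_minus inverse_eq_divide pos_divide_le_eq mult.commute del: fact_Suc power_Suc add_2_eq_Suc' fact_2)
  then show ?thesis using False by (simp add: flat_def field_simps power_add power2_eq_square)
qed (simp add: flat_def)

lemma flat_deriv: "(flat k has_real_derivative flat (k + 2) s - real k * flat (k + 1) s) (at s)"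
proof -
  consider "s < 0" | "s = 0" | "s > 0" by linarith
  then show ?thesis
  proof cases
    case 1
    have "((\<lambda>_. 0) has_real_derivative 0) (at s)" by simp
    then have "(flat k has_real_derivative 0) (at s)"
      by (rule has_field_derivative_transform_within_open[where S="{..<0}"]) (use 1 in \<open>auto simp: flat_def\<close>)
    then show ?thesis using 1 by (simp add: flat_def)
  next
    case 2
    have "((\<lambda>h. \<bar>h\<bar> * fact (k + 2)) \<longlongrightarrow> 0) (at (0::real))" by (auto intro!: tendsto_eq_intros)
    then have "((\<lambda>h. flat k h / h) \<longlongrightarrow> 0) (at 0)"
    proof (rule Lim_null_comparison[rotated])
      show "\<forall>\<^sub>F h in at 0. norm (flat k h / h) \<le> \<bar>h\<bar> * fact (k + 2)"
        unfolding eventually_at_filter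
      proof (rule always_eventually, intro allI impI)
        fix h :: real assume "h \<noteq> 0"
        then show "norm (flat k h / h) \<le> \<bar>h\<bar> * fact (k + 2)"
          using flat_le[of k h] unfolding power2_abs[of h, symmetric]
          by (simp add: divide_le_eq power2_eq_square ac_simps del: abs_mult_self_eq)
      qed
    qed
    then show ?thesis using 2 by (simp add: DERIV_def flat_def[of _ 0])
  next
    case 3
    have "((\<lambda>s. exp (- 1 / s) / s ^ k) has_real_derivative exp (- 1 / s) / s ^ (k + 2) - real k * (exp (- 1 / s) / s ^ (k + 1))) (at s)"
      using 3
      by (auto intro!: derivative_eq_intros simp: field_simps power2_eq_square)
         (cases k; simp add: field_simps)
    then have "(flat k has_real_derivative exp (- 1 / s) / s ^ (k + 2) - real k * (exp (- 1 / s) / s ^ (k + 1))) (at s)"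
      by (rule has_field_derivative_transform_within_open[where S="{0<..}"]) (use 3 in \<open>auto simp: flat_def\<close>)
    then show ?thesis using 3 by (simp add: flat_def)
  qed
qed

lemma smooth_flat: "smooth (\<lambda>x :: real ^ 'n. flat k (1 - x \<bullet> x))"
proof -
  have d: "((\<lambda>x :: real ^ 'n. flat k (1 - x \<bullet> x)) has_derivative
      (\<lambda>v. (flat (k + 2) (1 - x \<bullet> x) - real k * flat (k + 1) (1 - x \<bullet> x)) * (- 2 * (x \<bullet> v)))) (at x)" for k x
  proof -
    have "((\<lambda>x :: real ^ 'n. 1 - x \<bullet> x) has_derivative (\<lambda>v. - 2 * (x \<bullet> v))) (at x)"
      by (auto intro!: derivative_eq_intros simp: inner_commute)
    from has_derivative_compose[OF this flat_deriv[unfolded has_field_derivative_def]]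
    show ?thesis by simp
  qed
  have p: "partial i (\<lambda>x :: real ^ 'n. flat k (1 - x \<bullet> x)) =
      (\<lambda>x. (flat (k + 2) (1 - x \<bullet> x) + - real k * flat (k + 1) (1 - x \<bullet> x)) * (- 2 * x $ i))" for k i
    by (rule ext, subst has_derivative_partial[OF d]) (simp add: inner_axis)
  have "diffn m (\<lambda>x :: real ^ 'n. flat k (1 - x \<bullet> x))" for m
  proof (induction m arbitrary: k)
    case 0 then show ?case using d by (auto simp: diffn_0 differentiable_def)
  next
    case (Suc m)
    have "diffn m (\<lambda>x :: real ^ 'n. x $ i)" "diffn m (\<lambda>x :: real ^ 'n. c)" for i and c :: real
      using smooth_coord smooth_const smooth_diffn by blast+
    then have "diffn m (\<lambda>x :: real ^ 'n. (flat (k + 2) (1 - x \<bullet> x) + - real k * flat (k + 1) (1 - x \<bullet> x)) * (- 2 * x $ i))" for i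
      by (intro diffn_mult diffn_add Suc)
    then show ?case using d by (auto simp: diffn_Suc differentiable_def p)
  qed
  then show ?thesis by (simp add: smooth_diffn)
qed

definition testfun :: "(real ^ 'n \<Rightarrow> complex) \<Rightarrow> bool"
  where "testfun f \<longleftrightarrow> smooth f \<and> (\<exists>R. \<forall>x. norm x > R \<longrightarrow> f x = 0)"

text \<open>The factor \<open>exp 1\<close> normalizes the value at the origin to \<open>1\<close>.\<close>

definition cutoff :: "real ^ 'n \<Rightarrow> complex"
  where "cutoff x = complex_of_real (exp 1 * flat 0 (1 - x \<bullet> x))"

lemma cutoff_0: "cutoff 0 = 1"
  by (simp add: cutoff_def flat_def flip: exp_add of_real_mult)

lemma smooth_cutoff: "smooth cutoff"
  unfolding cutoff_def by (intro smooth_of_real smooth_mult smooth_const smooth_flat)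

lemma cutoff_eq_0: "norm x \<ge> 1 \<Longrightarrow> cutoff x = 0"
  using mult_mono[of 1 "norm x" 1 "norm x"]
  by (auto simp: cutoff_def flat_def dot_square_norm power2_eq_square)

lemma testfun_cutoff: "testfun cutoff"
  unfolding testfun_def using smooth_cutoff cutoff_eq_0 less_imp_le by blast

lemma testfun_smooth: "testfun f \<Longrightarrow> smooth f" by (simp add: testfun_def)

lemma testfun_mult: "testfun f \<Longrightarrow> smooth g \<Longrightarrow> testfun (\<lambda>x. g x * f x)"
  by (auto simp: testfun_def intro!: smooth_mult)

lemma testfun_add: "testfun f \<Longrightarrow> testfun g \<Longrightarrow> testfun (\<lambda>x. f x + g x)"
  unfolding testfun_def
proof (intro conjI smooth_add; elim conjE exE)
  fix R S assume "\<forall>x. R < norm x \<longrightarrow> f x = 0" "\<forall>x. S < norm x \<longrightarrow> g x = 0"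
  then show "\<exists>R. \<forall>x. R < norm x \<longrightarrow> f x + g x = 0" by (intro exI[of _ "max R S"]) auto
qed

lemma testfun_const0: "testfun (\<lambda>x. 0)" by (simp add: testfun_def)

lemma testfun_sum: "finite I \<Longrightarrow> (\<And>i. i \<in> I \<Longrightarrow> testfun (f i)) \<Longrightarrow> testfun (\<lambda>x. \<Sum>i\<in>I. f i x)"
  by (induction I rule: finite_induct) (auto intro: testfun_add testfun_const0)

lemma testfun_dbound:
  fixes f :: "real ^ 'n \<Rightarrow> complex"
  assumes "testfun f"
  shows "\<exists>R\<ge>0. \<forall>m. \<exists>C\<ge>0. dbound m (\<lambda>x. C * indicator (cball 0 R) x) f"
proof -
  obtain R0 where R0: "\<And>x. norm x > R0 \<Longrightarrow> f x = 0" and sm: "smooth f" using assms by (auto simp: testfun_def)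
  define R where "R = max R0 0"
  have R: "f x = 0" if "norm x > R" for x using R0 that by (simp add: R_def)
  have van: "iter_partial is f x = 0" if "norm x > R" for "is" x
    using that
  proof (induction "is" arbitrary: x)
    case (Cons i "is")
    have "((\<lambda>_. 0) has_derivative (\<lambda>_. 0)) (at x)" by simp
    then have "(iter_partial is f has_derivative (\<lambda>_. 0)) (at x)"
    proof (rule has_derivative_transform_within_open)
      show "open (- cball (0 :: real ^ 'n) R)" by auto
    qed (use Cons in auto)
    then show ?case by (simp add: iter_partial_Cons has_derivative_partial)
  qed (use R in auto)
  have "\<exists>C. \<forall>x. norm (iter_partial is f x) \<le> C * indicator (cball 0 R) x" for "is"
  proof -
    have "compact (iter_partial is f ` cball 0 R)"
      by (intro compact_continuous_image smooth_continuous smooth_iter_partial sm compact_cball)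
    then obtain C where "\<And>x. x \<in> cball 0 R \<Longrightarrow> norm (iter_partial is f x) \<le> C"
      using compact_imp_bounded bounded_iff by (metis image_eqI)
    then show ?thesis using van by (intro exI[of _ C]) (auto simp: indicator_def)
  qed
  from dbound_exists[OF this] show ?thesis by (intro exI[of _ R]) (auto simp: R_def)
qed

lemma dbound_dilation:
  fixes f :: "real ^ 'n \<Rightarrow> complex"
  assumes "smooth f" "dbound m (\<lambda>x. C) f" "0 \<le> e" "e \<le> 1"
  shows "dbound m (\<lambda>x. C) (\<lambda>x. f (e *\<^sub>R x))"
  unfolding dbound_def iter_partial_dilation[OF assms(1)]
proof (intro allI impI)
  fix "is" :: "'n list" and x assume "length is \<le> m"
  then have *: "norm (iter_partial is f (e *\<^sub>R x)) \<le> C" using assms(2) by (simp add: dbound_def)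
  have "e ^ length is * norm (iter_partial is f (e *\<^sub>R x)) \<le> 1 * C"
    using assms * by (intro mult_mono power_le_one) auto
  then show "norm (e ^ length is *\<^sub>R iter_partial is f (e *\<^sub>R x)) \<le> C"
    using assms by simp
qed

text \<open>
  Cutting off at radius \<open>1 / e\<close> perturbs all derivatives by \<open>O(e)\<close> only, up to one power of growth;
  so for a rapidly decreasing factor the perturbation vanishes with \<open>e\<close>.
\<close>

lemma cutoff_dbound:
  "\<exists>C\<ge>0. \<forall>e. 0 \<le> e \<longrightarrow> e \<le> 1 \<longrightarrow>
     dbound m (\<lambda>x. C * e * (1 + norm x)) (\<lambda>x :: real ^ 'n. cutoff (e *\<^sub>R x) + - 1)"
proof -
  obtain R where "\<forall>m. \<exists>C\<ge>0. dbound m (\<lambda>x. C * indicator (cball 0 R) x) (cutoff :: real ^ 'n \<Rightarrow> _)"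
    using testfun_dbound[OF testfun_cutoff] by blast
  then obtain C where C: "C \<ge> 0" "dbound (Suc m) (\<lambda>x. C * indicator (cball 0 R) x) (cutoff :: real ^ 'n \<Rightarrow> _)" by blast
  have C1: "dbound (Suc m) (\<lambda>x. C) (cutoff :: real ^ 'n \<Rightarrow> _)"
    by (rule dbound_mono[OF C(2)]) (use C(1) in \<open>auto simp: indicator_def\<close>)
  have pb: "norm (partial i cutoff x) \<le> C" for i and x :: "real ^ 'n"
    using C1 dbound_value unfolding dbound_Suc by blast
  have lip: "norm (cutoff y - cutoff (0 :: real ^ 'n)) \<le> (real CARD('n) * C) * norm (y - 0)" for y :: "real ^ 'n"
  proof (rule differentiable_bound[of "UNIV :: (real ^ 'n) set" cutoff "\<lambda>x :: real ^ 'n. frechet_derivative cutoff (at x)"])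
    fix x :: "real ^ 'n"
    show d: "(cutoff has_derivative frechet_derivative cutoff (at x)) (at x within UNIV)"
      using smooth_differentiable[OF smooth_cutoff] frechet_derivative_works by blast
    show "onorm (frechet_derivative cutoff (at x)) \<le> real CARD('n) * C"
    proof (rule onorm_bound)
      fix v :: "real ^ 'n"
      interpret bounded_linear "frechet_derivative cutoff (at x)" using d by (rule has_derivative_bounded_linear)
      have "frechet_derivative cutoff (at x) v = frechet_derivative cutoff (at x) (\<Sum>i\<in>UNIV. v $ i *\<^sub>R axis i 1)"
        by (simp add: basis_expansion flip: scalar_mult_eq_scaleR)
      also have "\<dots> = (\<Sum>i\<in>UNIV. v $ i *\<^sub>R partial i cutoff x)"
        using d by (simp add: sum scaleR has_derivative_partial)
      also have "norm \<dots> \<le> (\<Sum>i\<in>(UNIV::'n set). norm v * C)"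
        by (rule sum_norm_le) (auto intro!: mult_mono pb component_le_norm_cart)
      finally show "norm (frechet_derivative cutoff (at x) v) \<le> real CARD('n) * C * norm v"
        by (simp add: ac_simps)
    qed (use C in auto)
  qed auto
  define K where "K = real CARD('n) * C + C"
  have "dbound m (\<lambda>x. K * e * (1 + norm x)) (\<lambda>x :: real ^ 'n. cutoff (e *\<^sub>R x) + - 1)" if e: "0 \<le> e" "e \<le> 1" for e
  proof -
    have 1: "norm (cutoff (e *\<^sub>R x) + - 1) \<le> K * e * (1 + norm x)" for x :: "real ^ 'n"
    proof -
      have "norm (cutoff (e *\<^sub>R x) + - 1) \<le> real CARD('n) * C * (e * norm x)"
        using lip[of "e *\<^sub>R x"] e by (simp add: cutoff_0)
      also have "\<dots> \<le> K * (e * (1 + norm x))"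
        using e C by (intro mult_mono) (auto simp: K_def)
      finally show ?thesis by (simp add: ac_simps)
    qed
    have 2: "dbound m (\<lambda>x. K * e * (1 + norm x)) (partial i (\<lambda>x :: real ^ 'n. cutoff (e *\<^sub>R x) + - 1))" for i
    proof -
      have p: "partial i (\<lambda>x :: real ^ 'n. cutoff (e *\<^sub>R x) + - 1) = (\<lambda>x. e *\<^sub>R partial i cutoff (e *\<^sub>R x))"
        unfolding partial_add[OF differentiable_dilation[OF smooth_differentiable[OF smooth_cutoff]] differentiable_const]
          partial_dilation[OF smooth_differentiable[OF smooth_cutoff]] by simp
      have "dbound m (\<lambda>x. C) (\<lambda>x :: real ^ 'n. partial i cutoff (e *\<^sub>R x))"
        by (rule dbound_dilation) (use e C1 in \<open>auto intro: smooth_partial smooth_cutoff simp: dbound_Suc\<close>)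
      then have "dbound m (\<lambda>x. e * C) (\<lambda>x :: real ^ 'n. e *\<^sub>R partial i cutoff (e *\<^sub>R x))"
        using e by (intro dbound_linear[OF bounded_linear_scaleR_right])
          (auto intro!: smooth_dilation smooth_partial smooth_cutoff)
      moreover have "e * C \<le> K * e * (1 + norm x)" for x :: "real ^ 'n"
      proof -
        have "C * e * 1 \<le> K * e * (1 + norm x)" using e C by (intro mult_mono) (auto simp: K_def)
        then show ?thesis by (simp add: ac_simps)
      qed
      ultimately show ?thesis unfolding p by (rule dbound_weaken)
    qed
    have "dbound (Suc m) (\<lambda>x. K * e * (1 + norm x)) (\<lambda>x :: real ^ 'n. cutoff (e *\<^sub>R x) + - 1)"
      unfolding dbound_Suc using 1 2 by blast
    then show ?thesis by (rule dbound_mono) auto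
  qed
  then show ?thesis using C by (intro exI[of _ K]) (auto simp: K_def)
qed

section \<open>Lebesgue measure on Euclidean space\<close>

lemma lborel_affine_integral:
  fixes f :: "'a::euclidean_space \<Rightarrow> 'b::{banach, second_countable_topology}"
  assumes [measurable]: "f \<in> borel_measurable borel" and "c \<noteq> 0"
  shows "(\<integral>x. f x \<partial>lborel) = \<bar>c\<bar> ^ DIM('a) *\<^sub>R (\<integral>x. f (t + c *\<^sub>R x) \<partial>lborel)"
  using assms(2)
  by (subst lborel_affine[OF assms(2), of t], subst integral_density)
     (auto simp: integral_distr)

lemma lborel_affine_integrable:
  fixes f :: "'a::euclidean_space \<Rightarrow> 'b::{banach, second_countable_topology}"
  assumes "integrable lborel f" and "c \<noteq> 0"
  shows "integrable lborel (\<lambda>x. f (t + c *\<^sub>R x))"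
proof -
  have [measurable]: "f \<in> borel_measurable borel" using borel_measurable_integrable[OF assms(1)] by simp
  have "integrable (density (distr lborel borel (\<lambda>x. t + c *\<^sub>R x)) (\<lambda>_. \<bar>c\<bar> ^ DIM('a))) f"
    using assms(1) lborel_affine[OF assms(2), of t] by simp
  then have "integrable lborel (\<lambda>x. \<bar>c\<bar> ^ DIM('a) *\<^sub>R f (t + c *\<^sub>R x))"
    using assms(2) by (subst (asm) integrable_density) (auto simp: integrable_distr_eq)
  from integrable_scaleR_right[OF this, of "inverse (\<bar>c\<bar> ^ DIM('a))"] show ?thesis using assms(2) by simp
qed

lemma lborel_reflect_integral:
  fixes f :: "'a::euclidean_space \<Rightarrow> 'b::{banach, second_countable_topology}"
  assumes "f \<in> borel_measurable borel"
  shows "(\<integral>x. f (- x) \<partial>lborel) = (\<integral>x. f x \<partial>lborel)"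
  using lborel_affine_integral[OF assms, of "-1" 0] by simp

lemma lborel_translate_integral:
  fixes f :: "'a::euclidean_space \<Rightarrow> 'b::{banach, second_countable_topology}"
  assumes "f \<in> borel_measurable borel"
  shows "(\<integral>x. f (x + t) \<partial>lborel) = (\<integral>x. f x \<partial>lborel)"
  using lborel_affine_integral[OF assms, of 1 t] by (simp add: add.commute)

lemma lborel_prod_integral:
  fixes f :: "'a::euclidean_space \<Rightarrow> real \<Rightarrow> 'b::{real_normed_field, banach, second_countable_topology}"
  assumes int: "\<And>b. b \<in> Basis \<Longrightarrow> integrable lborel (f b)"
  shows "(\<integral>x. (\<Prod>b\<in>Basis. f b (x \<bullet> b)) \<partial>lborel) = (\<Prod>b\<in>Basis. \<integral>y. f b y \<partial>lborel)" (is ?I)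
    and "integrable lborel (\<lambda>x. \<Prod>b\<in>Basis. f b (x \<bullet> b))" (is ?J)
proof -
  interpret product_sigma_finite "\<lambda>_ :: 'a. lborel :: real measure" ..
  have [measurable]: "f b \<in> borel_measurable borel" if "b \<in> Basis" for b
    using borel_measurable_integrable[OF int[OF that]] by simp
  have co: "(\<Sum>b'\<in>Basis. g b' *\<^sub>R b') \<bullet> b = g b" if "b \<in> Basis" for g and b :: 'a
    using that by (simp add: inner_sum_left_Basis)
  have "(\<integral>x. (\<Prod>b\<in>Basis. f b (x \<bullet> b)) \<partial>lborel) =
      (\<integral>g. (\<Prod>b\<in>Basis. f b (g b)) \<partial>(\<Pi>\<^sub>M b\<in>Basis. lborel))"
    by (subst lborel_eq, subst integral_distr) (auto simp: co cong: prod.cong)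
  also have "\<dots> = (\<Prod>b\<in>Basis. \<integral>y. f b y \<partial>lborel)"
    by (rule product_integral_prod) (auto intro: int)
  finally show ?I .
  show ?J
    by (subst lborel_eq, subst integrable_distr_eq)
       (auto simp: co cong: prod.cong intro!: product_integrable_prod int)
qed

text \<open>
  The exponent leaves room for comparison with the product of the integrable functions
  \<open>1 / (1 + t\<^sup>2)\<close> of the single coordinates.
\<close>

definition wt :: "real ^ 'n \<Rightarrow> real"
  where "wt x = 1 / (1 + norm x) ^ (2 * CARD('n))"

lemma wt_pos: "0 < wt x" by (simp add: wt_def add_pos_nonneg)
lemma wt_nonneg [simp]: "0 \<le> wt x" using wt_pos less_imp_le by blast
lemma wt_le_1: "wt x \<le> 1"
  unfolding wt_def by (subst divide_le_eq_1_pos) (auto intro!: add_pos_nonneg one_le_power zero_less_power)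

lemma wt_measurable [measurable]: "wt \<in> borel_measurable borel"
  unfolding wt_def by measurable

lemma wt_integrable: "integrable lborel (wt :: real ^ 'n \<Rightarrow> real)"
proof (rule Bochner_Integration.integrable_bound)
  have "integrable lborel (\<lambda>x::real. inverse (1 + x\<^sup>2))"
    using integrable_inverse_1_plus_square by (simp add: set_integrable_def einterval_def)
  then show "integrable lborel (\<lambda>x::real^'n. \<Prod>b\<in>Basis. inverse (1 + (x \<bullet> b)\<^sup>2))"
    by (intro lborel_prod_integral(2)) simp
  show "AE x::real^'n in lborel. norm (wt x) \<le> norm (\<Prod>b\<in>Basis. inverse (1 + (x \<bullet> b)\<^sup>2))"
  proof (intro AE_I2)
    fix x :: "real ^ 'n"
    have 1: "1 + (x \<bullet> b)\<^sup>2 \<le> (1 + norm x) ^ 2" if "b \<in> Basis" for b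
    proof -
      have "(x \<bullet> b)\<^sup>2 \<le> (norm x)\<^sup>2" using Basis_le_norm[OF that, of x] by (rule power2_le_iff_abs_le[THEN iffD2, rotated]) simp
      moreover have "(1 + norm x) ^ 2 = 1 + 2 * norm x + (norm x)\<^sup>2" by (simp add: power2_sum)
      ultimately show ?thesis using norm_ge_zero[of x] by linarith
    qed
    have "wt x = (\<Prod>b\<in>(Basis :: (real ^ 'n) set). inverse ((1 + norm x) ^ 2))"
      by (simp add: wt_def power_mult inverse_eq_divide power_one_over)
    also have "\<dots> \<le> (\<Prod>b\<in>(Basis :: (real ^ 'n) set). inverse (1 + (x \<bullet> b)\<^sup>2))"
      by (intro prod_mono conjI le_imp_inverse_le 1) (auto intro: add_pos_nonneg)
    finally show "norm (wt x) \<le> norm (\<Prod>b\<in>Basis. inverse (1 + (x \<bullet> b)\<^sup>2))"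
      by (simp add: prod_nonneg)
  qed
qed simp

lemma wt_const_nonneg: "a \<le> C * wt x \<Longrightarrow> 0 \<le> a \<Longrightarrow> 0 \<le> C"
  using wt_pos[of x] by (metis leD order_trans zero_le_mult_iff)

lemma wt_translate:
  fixes x v :: "real ^ 'n"
  assumes "norm v \<le> 1"
  shows "wt (x + v) \<le> 2 ^ (2 * CARD('n)) * wt (x :: real ^ 'n)"
proof -
  have "norm x \<le> norm (x + v) + norm v" using norm_triangle_ineq4[of "x + v" v] by simp
  then have "1 + norm x \<le> 2 * (1 + norm (x + v))" using assms norm_ge_zero[of "x + v"] by (smt (verit))
  then have "(1 + norm x) ^ (2 * CARD('n)) \<le> (2 * (1 + norm (x + v))) ^ (2 * CARD('n))"
    by (intro power_mono) auto
  then have "(1 + norm x) ^ (2 * CARD('n)) \<le> 2 ^ (2 * CARD('n)) * (1 + norm (x + v)) ^ (2 * CARD('n))"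
    by (simp only: power_mult_distrib)
  then show ?thesis
    by (simp add: wt_def divide_le_eq le_divide_eq mult.commute add_pos_nonneg del: power_mono_iff)
qed

lemma has_vector_derivative_quotient:
  "(g has_vector_derivative D) (at x within S) \<longleftrightarrow>
   ((\<lambda>y. (g y - g x) /\<^sub>R (y - x)) \<longlongrightarrow> D) (at x within S)"
proof -
  have eq: "norm ((g y - g x - (y - x) *\<^sub>R D) /\<^sub>R norm (y - x)) = norm ((g y - g x) /\<^sub>R (y - x) - D)" if "y \<noteq> x" for y
  proof -
    have "(g y - g x) /\<^sub>R (y - x) - D = (g y - g x - (y - x) *\<^sub>R D) /\<^sub>R (y - x)"
      using that by (simp add: scaleR_diff_right)
    then show ?thesis by simp
  qed
  have "(g has_vector_derivative D) (at x within S) \<longleftrightarrow>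
      ((\<lambda>y. norm ((g y - g x - (y - x) *\<^sub>R D) /\<^sub>R norm (y - x))) \<longlongrightarrow> 0) (at x within S)"
    unfolding has_vector_derivative_def has_derivative_within tendsto_norm_zero_iff
    by (simp add: bounded_linear_scaleR_left inverse_eq_divide diff_diff_eq)
  also have "\<dots> \<longleftrightarrow> ((\<lambda>y. norm ((g y - g x) /\<^sub>R (y - x) - D)) \<longlongrightarrow> 0) (at x within S)"
    by (rule filterlim_cong[OF refl refl]) (auto simp: eventually_at_filter eq[simplified] intro!: always_eventually)
  finally show ?thesis by (simp only: tendsto_norm_zero_iff LIM_zero_iff)
qed

text \<open>
  The integral of a derivative vanishes, because the integrals of all difference quotients vanish
  by translation invariance.
\<close>

lemma integral_partial_0:
  fixes f :: "real ^ 'n \<Rightarrow> complex"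
  assumes d: "\<And>x. f differentiable (at x)"
    and f: "\<And>x. norm (f x) \<le> C * wt x" and f': "\<And>x. norm (partial i f x) \<le> C * wt x"
    and [measurable]: "partial i f \<in> borel_measurable borel"
  shows "(\<integral>x. partial i f x \<partial>lborel) = 0"
proof -
  define h where "h k = 1 / real (Suc k)" for k
  have h: "0 < h k" "h k \<le> 1" "h k \<noteq> 0" for k by (auto simp: h_def)
  have h0: "filterlim h (at 0) sequentially"
    unfolding filterlim_at using h LIMSEQ_inverse_real_of_nat
    by (simp add: h_def[abs_def] inverse_eq_divide)
  define q where "q k x = (f (x + h k *\<^sub>R axis i 1) - f x) /\<^sub>R h k" for k x
  have [measurable]: "f \<in> borel_measurable borel"
    by (intro borel_measurable_continuous_onI continuous_at_imp_continuous_on ballI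
        differentiable_imp_continuous_within d)
  have C: "0 \<le> C" by (rule wt_const_nonneg[OF f norm_ge_zero])
  have dv: "((\<lambda>t. f (x + t *\<^sub>R axis i 1)) has_vector_derivative partial i f (x + t *\<^sub>R axis i 1)) (at t)" for x t
  proof -
    obtain f' where f': "(f has_derivative f') (at (x + t *\<^sub>R axis i 1))" using d by (auto simp: differentiable_def)
    interpret bounded_linear f' using f' by (rule has_derivative_bounded_linear)
    have 1: "((\<lambda>t::real. x + t *\<^sub>R axis i 1) has_derivative (\<lambda>h. h *\<^sub>R axis i 1)) (at t)"
      by (auto intro!: derivative_eq_intros)
    from has_derivative_compose[OF 1 f'] show ?thesis
      unfolding has_vector_derivative_def has_derivative_partial[OF f'] by (simp add: scaleR)
  qed
  have int_f: "integrable lborel f"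
    by (rule Bochner_Integration.integrable_bound[OF integrable_mult_right[OF wt_integrable, of C]])
       (use f C in \<open>auto\<close>)
  have "(\<lambda>k. \<integral>x. q k x \<partial>lborel) \<longlonglongrightarrow> (\<integral>x. partial i f x \<partial>lborel)"
  proof (rule integral_dominated_convergence)
    show "integrable lborel (\<lambda>x :: real ^ 'n. C * 2 ^ (2 * CARD('n)) * wt x)"
      by (intro integrable_mult_right wt_integrable)
    show "AE x in lborel. (\<lambda>k. q k x) \<longlonglongrightarrow> partial i f x"
    proof (rule AE_I2)
      fix x
      have "((\<lambda>t. (f (x + t *\<^sub>R axis i 1) - f x) /\<^sub>R t) \<longlongrightarrow> partial i f x) (at 0)"
        using dv[of x 0] unfolding has_vector_derivative_quotient by simp
      from filterlim_compose[OF this h0] show "(\<lambda>k. q k x) \<longlonglongrightarrow> partial i f x" by (simp add: q_def)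
    qed
    show "AE x in lborel. norm (q k x) \<le> C * 2 ^ (2 * CARD('n)) * wt x" for k
    proof (rule AE_I2)
      fix x
      have "norm (f (x + h k *\<^sub>R axis i 1) - f (x + 0 *\<^sub>R axis i 1)) \<le> (C * 2 ^ (2 * CARD('n)) * wt x) * norm (h k - 0)"
      proof (rule differentiable_bound[where S="{0..1}" and f="\<lambda>t. f (x + t *\<^sub>R axis i 1)"
              and f'="\<lambda>t s. s *\<^sub>R partial i f (x + t *\<^sub>R axis i 1)"])
        fix t :: real assume t: "t \<in> {0..1}"
        show "((\<lambda>t. f (x + t *\<^sub>R axis i 1)) has_derivative (\<lambda>s. s *\<^sub>R partial i f (x + t *\<^sub>R axis i 1))) (at t within {0..1})"
          using dv unfolding has_vector_derivative_def by (rule has_derivative_at_withinI)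
        have "norm (partial i f (x + t *\<^sub>R axis i 1)) \<le> C * (2 ^ (2 * CARD('n)) * wt x)"
          using t C by (intro order_trans[OF f'] mult_left_mono wt_translate) auto
        from mult_left_mono[OF this abs_ge_zero]
        show "onorm (\<lambda>s. s *\<^sub>R partial i f (x + t *\<^sub>R axis i 1)) \<le> C * 2 ^ (2 * CARD('n)) * wt x"
          using C by (intro onorm_bound) (auto simp: ac_simps)
      qed (use h[of k] in auto)
      then show "norm (q k x) \<le> C * 2 ^ (2 * CARD('n)) * wt x"
        using h[of k] by (simp add: q_def divide_inverse_commute[symmetric] pos_divide_le_eq ac_simps)
    qed
  qed (simp_all add: q_def[abs_def])
  moreover have "(\<integral>x. q k x \<partial>lborel) = 0" for k
  proof -
    have "integrable lborel (\<lambda>x. f (x + h k *\<^sub>R axis i 1))"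
      using lborel_affine_integrable[OF int_f, of 1 "h k *\<^sub>R axis i 1"] by (simp add: add.commute)
    then show ?thesis unfolding q_def using int_f by (simp add: lborel_translate_integral)
  qed
  ultimately show ?thesis by (simp add: LIMSEQ_const_iff)
qed



section \<open>Elementary properties of the Fourier transform\<close>

lemma integrable_dominated:
  fixes f :: "'a::euclidean_space \<Rightarrow> 'b::{banach, second_countable_topology}" and g :: "'a \<Rightarrow> real"
  assumes "integrable lborel g" "f \<in> borel_measurable borel" "\<And>x. norm (f x) \<le> C * g x"
  shows "integrable lborel f"
proof (rule Bochner_Integration.integrable_bound)
  show "integrable lborel (\<lambda>x. C * g x)" using assms(1) by simp
  show "AE x in lborel. norm (f x) \<le> norm (C * g x)"
    by (intro AE_I2, unfold real_norm_def, rule order_trans[OF assms(3) abs_ge_self])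
qed (use assms(2) in simp)

lemmas integrable_wt_bound = integrable_dominated[OF wt_integrable]

lemma norm_phase [simp]: "norm (exp (\<i> * complex_of_real r) * z) = norm z"
  by (simp add: norm_mult)

lemma integrable_phase:
  fixes \<phi> :: "real ^ 'n \<Rightarrow> complex"
  assumes "integrable lborel \<phi>"
  shows "integrable lborel (\<lambda>x. exp (\<i> * complex_of_real (x \<bullet> \<xi>)) * \<phi> x)"
proof (rule Bochner_Integration.integrable_bound[OF assms])
  have [measurable]: "\<phi> \<in> borel_measurable borel" using borel_measurable_integrable[OF assms] by simp
  show "(\<lambda>x. exp (\<i> * complex_of_real (x \<bullet> \<xi>)) * \<phi> x) \<in> borel_measurable lborel"
    by simp
qed simp

text \<open>
  The dimension is that of the type argument, so that the constant can be named without a vector.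
\<close>

definition fconst :: "'n::finite itself \<Rightarrow> real"
  where "fconst _ = (2 * pi) powr (- real CARD('n) / 2)"

lemma fconst_pos: "0 < fconst T" by (simp add: fconst_def)

lemma fourier_alt:
  fixes \<phi> :: "real ^ 'n \<Rightarrow> complex"
  shows "fourier \<phi> \<xi> = complex_of_real (fconst TYPE('n)) *
    (\<integral>x. exp (\<i> * complex_of_real (x \<bullet> \<xi>)) * \<phi> x \<partial>lborel)"
  by (simp add: fourier_def fconst_def)

lemma inv_fourier_minus: "inv_fourier \<psi> x = fourier \<psi> (- x)"
  by (simp add: inv_fourier_def fourier_def inner_commute)

lemma inv_fourier_reflect:
  assumes [measurable]: "\<psi> \<in> borel_measurable borel"
  shows "inv_fourier \<psi> x = fourier (\<lambda>y. \<psi> (- y)) x"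
  unfolding inv_fourier_minus fourier_def
  by (subst lborel_reflect_integral[symmetric]) simp_all

lemma fourier_norm_le:
  fixes \<phi> :: "real ^ 'n \<Rightarrow> complex"
  shows "norm (fourier \<phi> \<xi>) \<le> fconst TYPE('n) * (\<integral>x. norm (\<phi> x) \<partial>lborel)"
  unfolding fourier_alt norm_mult
  using fconst_pos[of "TYPE('n)"] integral_norm_bound[of lborel "\<lambda>x. exp (\<i> * complex_of_real (x \<bullet> \<xi>)) * \<phi> x"]
  by (intro mult_mono) auto

lemma fourier_mult: "fourier (\<lambda>x. c * \<phi> x) \<xi> = c * fourier \<phi> \<xi>"
  unfolding fourier_def by (simp add: mult.left_commute[of _ c])

lemma fourier_add:
  assumes "integrable lborel \<phi>" "integrable lborel \<psi>"
  shows "fourier (\<lambda>x. \<phi> x + \<psi> x) \<xi> = fourier \<phi> \<xi> + fourier \<psi> \<xi>"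
  unfolding fourier_def
  using integrable_phase[OF assms(1)] integrable_phase[OF assms(2)]
  by (simp add: distrib_left)

lemma fourier_zero [simp]: "fourier (\<lambda>x. 0) \<xi> = 0"
  by (simp add: fourier_def)

lemma fourier_sum:
  assumes "finite I" "\<And>i. i \<in> I \<Longrightarrow> integrable lborel (\<phi> i)"
  shows "fourier (\<lambda>x. \<Sum>i\<in>I. \<phi> i x) \<xi> = (\<Sum>i\<in>I. fourier (\<phi> i) \<xi>)"
  using assms by (induction I rule: finite_induct) (auto simp: fourier_add)

lemma fourier_has_derivative:
  fixes \<phi> :: "real ^ 'n \<Rightarrow> complex"
  assumes [measurable]: "\<phi> \<in> borel_measurable borel"
    and int: "integrable lborel (\<lambda>x. (1 + norm x)\<^sup>2 * norm (\<phi> x))"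
  shows "(fourier \<phi> has_derivative
    (\<lambda>v. fourier (\<lambda>x. \<i> * complex_of_real (x \<bullet> v) * \<phi> x) \<xi>)) (at \<xi>)"
proof -
  note bd = integrable_dominated[OF int]
  have sq: "1 \<le> (1 + norm x)\<^sup>2" "norm x \<le> (1 + norm x)\<^sup>2" "(norm x)\<^sup>2 \<le> (1 + norm x)\<^sup>2" for x :: "real ^ 'n"
    using norm_ge_zero[of x] zero_le_power2[of "norm x"] by (simp_all add: power2_sum)
  have i0: "integrable lborel \<phi>"
  proof (rule bd[of _ 1])
    show "norm (\<phi> x) \<le> 1 * ((1 + norm x)\<^sup>2 * norm (\<phi> x))" for x
      using mult_right_mono[OF sq(1)[of x] norm_ge_zero[of "\<phi> x"]] by simp
  qed simp
  have i1: "integrable lborel (\<lambda>x. \<i> * complex_of_real (x \<bullet> v) * \<phi> x)" for v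
  proof (rule bd[of _ "norm v"])
    fix x
    have "norm (\<i> * complex_of_real (x \<bullet> v) * \<phi> x) \<le> (norm x * norm v) * norm (\<phi> x)"
      using Cauchy_Schwarz_ineq2[of x v] by (simp add: norm_mult mult_right_mono)
    also have "\<dots> \<le> ((1 + norm x)\<^sup>2 * norm v) * norm (\<phi> x)"
      by (intro mult_right_mono sq) auto
    finally show "norm (\<i> * complex_of_real (x \<bullet> v) * \<phi> x) \<le> norm v * ((1 + norm x)\<^sup>2 * norm (\<phi> x))"
      by (simp add: ac_simps)
  qed simp
  have i2: "integrable lborel (\<lambda>x. (norm x)\<^sup>2 * norm (\<phi> x))"
  proof (rule Bochner_Integration.integrable_bound[OF int])
    show "AE x in lborel. norm ((norm x)\<^sup>2 * norm (\<phi> x)) \<le> norm ((1 + norm x)\<^sup>2 * norm (\<phi> x))"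
      by (intro AE_I2) (simp add: mult_right_mono sq)
  qed simp
  let ?D = "\<lambda>v. fourier (\<lambda>x. \<i> * complex_of_real (x \<bullet> v) * \<phi> x) \<xi>"
  have lin: "bounded_linear ?D"
  proof (rule bounded_linear_intro)
    fix v w
    show "?D (v + w) = ?D v + ?D w"
      by (subst fourier_add[OF i1 i1, symmetric]) (simp add: inner_add_right algebra_simps)
    show "?D (r *\<^sub>R v) = r *\<^sub>R ?D v" for r
      using fourier_mult[of "complex_of_real r" "\<lambda>x. \<i> * complex_of_real (x \<bullet> v) * \<phi> x" \<xi>]
      by (simp add: scaleR_conv_of_real[where 'a=complex] ac_simps)
    have "norm (?D v) \<le> fconst TYPE('n) * (\<integral>x. norm v * ((1 + norm x)\<^sup>2 * norm (\<phi> x)) \<partial>lborel)"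
    proof (rule order_trans[OF fourier_norm_le], rule mult_left_mono, rule integral_mono)
      show "norm (\<i> * complex_of_real (x \<bullet> v) * \<phi> x) \<le> norm v * ((1 + norm x)\<^sup>2 * norm (\<phi> x))" for x
      proof -
        have "norm (\<i> * complex_of_real (x \<bullet> v) * \<phi> x) \<le> (norm x * norm v) * norm (\<phi> x)"
          using Cauchy_Schwarz_ineq2[of x v] by (simp add: norm_mult mult_right_mono)
        also have "\<dots> \<le> ((1 + norm x)\<^sup>2 * norm v) * norm (\<phi> x)"
          by (intro mult_right_mono sq) auto
        finally show ?thesis by (simp add: ac_simps)
      qed
    qed (use int i1 fconst_pos[of "TYPE('n)"] in \<open>auto intro: less_imp_le\<close>)
    then show "norm (?D v) \<le> norm v * (fconst TYPE('n) * (\<integral>x. (1 + norm x)\<^sup>2 * norm (\<phi> x) \<partial>lborel))"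
      by (simp add: ac_simps)
  qed
  define K where "K = fconst TYPE('n) * (\<integral>x. (norm x)\<^sup>2 * norm (\<phi> x) \<partial>lborel)"
  have est: "norm (fourier \<phi> (\<xi> + v) - fourier \<phi> \<xi> - ?D v) \<le> K * (norm v)\<^sup>2" for v
  proof -
    let ?r = "\<lambda>x. (exp (\<i> * complex_of_real (x \<bullet> v)) - 1 - \<i> * complex_of_real (x \<bullet> v)) * \<phi> x"
    have ii: "integrable lborel (\<lambda>x. exp (\<i> * complex_of_real (x \<bullet> \<xi>)) * (exp (\<i> * complex_of_real (x \<bullet> v)) * \<phi> x))"
      by (intro integrable_phase i0)
    have "fourier \<phi> (\<xi> + v) = complex_of_real (fconst TYPE('n)) *
       (\<integral>x. exp (\<i> * complex_of_real (x \<bullet> \<xi>)) * (exp (\<i> * complex_of_real (x \<bullet> v)) * \<phi> x) \<partial>lborel)"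
      unfolding fourier_alt by (simp add: inner_add_right distrib_left exp_add mult.assoc)
    then have "fourier \<phi> (\<xi> + v) - fourier \<phi> \<xi> - ?D v = fourier ?r \<xi>"
      unfolding fourier_alt right_diff_distrib[symmetric]
      using ii integrable_phase[OF i0, of \<xi>] integrable_phase[OF i1[of v], of \<xi>]
      by (simp add: left_diff_distrib right_diff_distrib mult.assoc)
    also have "norm \<dots> \<le> fconst TYPE('n) * (\<integral>x. norm (?r x) \<partial>lborel)" by (rule fourier_norm_le)
    also have "\<dots> \<le> fconst TYPE('n) * (\<integral>x. (norm v)\<^sup>2 * ((norm x)\<^sup>2 * norm (\<phi> x)) \<partial>lborel)"
    proof (intro mult_left_mono integral_mono')
      show "integrable lborel (\<lambda>x. (norm v)\<^sup>2 * ((norm x)\<^sup>2 * norm (\<phi> x)))" using i2 by simp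
      fix x
      have "norm (exp (\<i> * complex_of_real (x \<bullet> v)) - 1 - \<i> * complex_of_real (x \<bullet> v)) \<le> (x \<bullet> v)\<^sup>2 / 2"
        using iexp_approx1[of "x \<bullet> v" 1] by (simp add: algebra_simps numeral_2_eq_2)
      also have "\<dots> \<le> (norm x * norm v)\<^sup>2"
      proof -
        have "(x \<bullet> v)\<^sup>2 \<le> (norm x * norm v)\<^sup>2"
          using Cauchy_Schwarz_ineq2[of x v] by (intro power2_le_iff_abs_le[THEN iffD2]) auto
        then show ?thesis using zero_le_power2[of "x \<bullet> v"] by linarith
      qed
      finally show "norm (?r x) \<le> (norm v)\<^sup>2 * ((norm x)\<^sup>2 * norm (\<phi> x))"
        by (simp add: norm_mult power_mult_distrib mult_right_mono flip: mult.assoc mult.commute[of "(norm x)\<^sup>2"])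
    qed (use fconst_pos[of "TYPE('n)"] in auto)
    also have "\<dots> = K * (norm v)\<^sup>2" by (simp add: K_def)
    finally show ?thesis .
  qed
  have "((\<lambda>v. norm (fourier \<phi> (\<xi> + v) - fourier \<phi> \<xi> - ?D v) / norm v) \<longlongrightarrow> 0) (at 0)"
  proof (rule Lim_null_comparison)
    show "((\<lambda>v :: real ^ 'n. K * norm v) \<longlongrightarrow> 0) (at 0)" by (auto intro!: tendsto_eq_intros)
    show "\<forall>\<^sub>F v in at 0. norm (norm (fourier \<phi> (\<xi> + v) - fourier \<phi> \<xi> - ?D v) / norm v) \<le> K * norm v"
      unfolding eventually_at_filter
    proof (rule always_eventually, intro allI impI)
      fix v :: "real ^ 'n" assume "v \<noteq> 0"
      have "norm (norm (fourier \<phi> (\<xi> + v) - fourier \<phi> \<xi> - ?D v) / norm v) \<le> (K * (norm v)\<^sup>2) / norm v"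
        unfolding real_norm_def abs_divide abs_norm_cancel by (intro divide_right_mono est norm_ge_zero)
      then show "norm (norm (fourier \<phi> (\<xi> + v) - fourier \<phi> \<xi> - ?D v) / norm v) \<le> K * norm v"
        using \<open>v \<noteq> 0\<close> by (simp add: power2_eq_square)
    qed
  qed
  then show ?thesis using lin by (simp add: has_derivative_at)
qed

lemma partial_fourier:
  fixes \<phi> :: "real ^ 'n \<Rightarrow> complex"
  assumes "\<phi> \<in> borel_measurable borel" "integrable lborel (\<lambda>x. (1 + norm x)\<^sup>2 * norm (\<phi> x))"
  shows "partial i (fourier \<phi>) = fourier (\<lambda>x. \<i> * complex_of_real (x $ i) * \<phi> x)"
  by (rule ext, subst has_derivative_partial[OF fourier_has_derivative[OF assms]])
     (simp add: inner_axis)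

lemma iter_partial_append: "iter_partial (is @ js) f = iter_partial is (iter_partial js f)"
  by (simp add: iter_partial_def)

lemma dbound_iter_partial:
  "dbound m w f \<Longrightarrow> k + length js \<le> m \<Longrightarrow> dbound k w (iter_partial js f)"
  unfolding dbound_def iter_partial_append[symmetric] by auto

text \<open>Integration by parts: the integral of the derivative of the product with the phase vanishes.\<close>

lemma fourier_partial:
  fixes \<phi> :: "real ^ 'n \<Rightarrow> complex"
  assumes "smooth \<phi>" "dbound (Suc 0) (\<lambda>x. C * wt x) \<phi>"
  shows "fourier (partial i \<phi>) \<xi> = - \<i> * complex_of_real (\<xi> $ i) * fourier \<phi> \<xi>"
proof -
  have b: "norm (\<phi> x) \<le> C * wt x" "norm (partial i \<phi> x) \<le> C * wt x" for x
    using assms(2) by (auto simp: dbound_Suc dbound_0)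
  have C: "0 \<le> C" by (rule wt_const_nonneg[OF b(1) norm_ge_zero])
  have [measurable]: "\<phi> \<in> borel_measurable borel" "partial i \<phi> \<in> borel_measurable borel"
    by (rule smooth_measurable[OF assms(1)], rule smooth_measurable[OF smooth_partial[OF assms(1)]])
  let ?e = "\<lambda>x. exp (\<i> * complex_of_real (x \<bullet> \<xi>))"
  have de: "(?e has_derivative (\<lambda>v. \<i> * complex_of_real (v \<bullet> \<xi>) * ?e x)) (at x)" for x
  proof -
    have "((\<lambda>x. \<i> * complex_of_real (x \<bullet> \<xi>)) has_derivative (\<lambda>v. \<i> * complex_of_real (v \<bullet> \<xi>))) (at x)"
      by (auto intro!: derivative_eq_intros)
    from has_derivative_compose[OF this DERIV_exp[unfolded has_field_derivative_def]] show ?thesis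
      by (simp add: ac_simps)
  qed
  have pe: "partial i ?e = (\<lambda>x. \<i> * complex_of_real (\<xi> $ i) * ?e x)"
    by (rule ext, subst has_derivative_partial[OF de]) (simp add: inner_axis')
  let ?f = "\<lambda>x. ?e x * \<phi> x"
  have p: "partial i ?f = (\<lambda>x. ?e x * (\<i> * complex_of_real (\<xi> $ i) * \<phi> x) + ?e x * partial i \<phi> x)"
    by (subst partial_mult)
       (use de in \<open>auto simp: differentiable_def pe smooth_differentiable[OF assms(1), unfolded differentiable_def] ac_simps\<close>)
  have int: "integrable lborel \<phi>" "integrable lborel (partial i \<phi>)"
    by (rule integrable_wt_bound[OF _ b(1)], simp, rule integrable_wt_bound[OF _ b(2)], simp)
  have "(\<integral>x. partial i ?f x \<partial>lborel) = 0"
  proof (rule integral_partial_0[where C="(1 + \<bar>\<xi> $ i\<bar>) * C"])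
    show "?f differentiable (at x)" for x
      using de smooth_differentiable[OF assms(1)] by (intro differentiable_mult) (auto simp: differentiable_def)
    fix x
    have "norm (?f x) \<le> C * wt x" using b by simp
    also have "\<dots> \<le> (1 + \<bar>\<xi> $ i\<bar>) * C * wt x"
      using C by (intro mult_right_mono) (auto simp: mult_le_cancel_right1 not_less)
    finally show "norm (?f x) \<le> (1 + \<bar>\<xi> $ i\<bar>) * C * wt x" .
    have "norm (partial i ?f x) \<le> norm (\<i> * complex_of_real (\<xi> $ i) * \<phi> x) + norm (partial i \<phi> x)"
      unfolding p by (rule order_trans[OF norm_triangle_ineq]) simp
    also have "\<dots> \<le> \<bar>\<xi> $ i\<bar> * (C * wt x) + C * wt x"
      using b by (intro add_mono) (auto simp: norm_mult intro!: mult_left_mono)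
    finally show "norm (partial i ?f x) \<le> (1 + \<bar>\<xi> $ i\<bar>) * C * wt x" by (simp add: algebra_simps)
  qed (simp add: p)
  moreover have "integrable lborel (\<lambda>x. \<i> * complex_of_real (\<xi> $ i) * \<phi> x)" using int by simp
  note integrable_phase[OF this, of \<xi>] integrable_phase[OF int(2), of \<xi>]
  ultimately have "(\<integral>x. ?e x * (\<i> * complex_of_real (\<xi> $ i) * \<phi> x) \<partial>lborel) + (\<integral>x. ?e x * partial i \<phi> x \<partial>lborel) = 0"
    unfolding p by simp
  then have "fourier (\<lambda>x. \<i> * complex_of_real (\<xi> $ i) * \<phi> x) \<xi> + fourier (partial i \<phi>) \<xi> = 0"
    unfolding fourier_def by (simp flip: distrib_left)
  then show ?thesis by (simp add: fourier_mult add_eq_0_iff)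
qed

text \<open>
  Smoothness turns into decay with a constant that depends linearly on the derivative bounds and
  on nothing else about the function. This uniformity is what makes the iterates of the operator
  grow only geometrically later on.
\<close>

lemma fourier_decay:
  "\<exists>K\<ge>0. \<forall>(\<phi> :: real ^ 'n \<Rightarrow> complex) C \<xi>. smooth \<phi> \<longrightarrow> dbound m (\<lambda>x. C * wt x) \<phi> \<longrightarrow>
     norm (fourier \<phi> \<xi>) * (1 + norm \<xi>) ^ m \<le> K * C"
proof -
  define W where "W = fconst TYPE('n) * (\<integral>x. wt (x :: real ^ 'n) \<partial>lborel)"
  have W: "0 \<le> W" using fconst_pos[of "TYPE('n)"] by (simp add: W_def)
  have "norm (fourier \<phi> \<xi>) * (1 + norm \<xi>) ^ m \<le> (1 + real CARD('n)) ^ m * W * C"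
    if sm: "smooth \<phi>" and db: "dbound m (\<lambda>x. C * wt x) \<phi>" for \<phi> :: "real ^ 'n \<Rightarrow> complex" and C \<xi>
  proof -
    have bd: "norm (fourier (iter_partial is \<phi>) \<xi>) \<le> W * C" if "length is \<le> m" for "is"
    proof -
      have b: "norm (iter_partial is \<phi> x) \<le> C * wt x" for x using db that by (simp add: dbound_def)
      have "(\<integral>x. norm (iter_partial is \<phi> x) \<partial>lborel) \<le> (\<integral>x. C * wt (x :: real ^ 'n) \<partial>lborel)"
      proof (rule Bochner_Integration.integral_mono)
        show "integrable lborel (\<lambda>x. norm (iter_partial is \<phi> x))"
          by (intro integrable_norm integrable_wt_bound[OF _ b] smooth_measurable smooth_iter_partial sm)
      qed (use b wt_integrable in auto)
      then have "fconst TYPE('n) * (\<integral>x. norm (iter_partial is \<phi> x) \<partial>lborel) \<le> fconst TYPE('n) * (\<integral>x. C * wt (x :: real ^ 'n) \<partial>lborel)"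
        using fconst_pos[of "TYPE('n)"] by (intro mult_left_mono) auto
      then show ?thesis
        using fourier_norm_le[of "iter_partial is \<phi>" \<xi>] by (simp add: W_def ac_simps)
    qed
    have rep: "fourier (iter_partial (replicate k i) \<phi>) \<xi> = (- \<i> * complex_of_real (\<xi> $ i)) ^ k * fourier \<phi> \<xi>" if "k \<le> m" for k i
      using that
    proof (induction k)
      case (Suc k)
      have "dbound (Suc 0) (\<lambda>x. C * wt x) (iter_partial (replicate k i) \<phi>)"
        by (rule dbound_iter_partial[OF db]) (use Suc.prems in simp)
      from fourier_partial[OF smooth_iter_partial[OF sm] this] Suc show ?case
        by (simp add: iter_partial_Cons)
    qed simp
    have co: "\<bar>\<xi> $ i\<bar> ^ m * norm (fourier \<phi> \<xi>) \<le> W * C" for i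
      using bd[of "replicate m i"] unfolding rep[OF order_refl] by (simp add: norm_mult norm_power)
    have v0: "norm (fourier \<phi> \<xi>) \<le> W * C" using bd[of "[]"] by simp
    obtain i where i: "\<And>j. \<bar>\<xi> $ j\<bar> \<le> \<bar>\<xi> $ i\<bar>"
    proof -
      have "Max (range (\<lambda>j. \<bar>\<xi> $ j\<bar>)) \<in> range (\<lambda>j. \<bar>\<xi> $ j\<bar>)" by (rule Max_in) auto
      then obtain i where "Max (range (\<lambda>j. \<bar>\<xi> $ j\<bar>)) = \<bar>\<xi> $ i\<bar>" by (rule rangeE)
      then have "\<bar>\<xi> $ j\<bar> \<le> \<bar>\<xi> $ i\<bar>" for j by (metis Max_ge finite finite_imageI rangeI)
      then show ?thesis using that by blast
    qed
    define M where "M = max 1 \<bar>\<xi> $ i\<bar>"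
    have "norm \<xi> \<le> (\<Sum>j\<in>UNIV. \<bar>\<xi> $ j\<bar>)" by (rule norm_le_l1_cart)
    also have "\<dots> \<le> (\<Sum>j\<in>(UNIV::'n set). M)" using i by (intro sum_mono) (auto simp: M_def intro: le_max_iff_disj[THEN iffD2])
    finally have "1 + norm \<xi> \<le> (1 + real CARD('n)) * M" by (simp add: algebra_simps M_def)
    then have "(1 + norm \<xi>) ^ m \<le> ((1 + real CARD('n)) * M) ^ m" by (intro power_mono) auto
    then have "norm (fourier \<phi> \<xi>) * (1 + norm \<xi>) ^ m \<le> norm (fourier \<phi> \<xi>) * ((1 + real CARD('n)) * M) ^ m"
      by (intro mult_left_mono) auto
    also have "\<dots> = (1 + real CARD('n)) ^ m * (M ^ m * norm (fourier \<phi> \<xi>))"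
      by (simp add: power_mult_distrib ac_simps)
    also have "M ^ m * norm (fourier \<phi> \<xi>) \<le> W * C"
      using co[of i] v0 by (auto simp: M_def max_def)
    finally show ?thesis by (simp add: mult_left_mono ac_simps)
  qed
  then show ?thesis using W by (intro exI[of _ "(1 + real CARD('n)) ^ m * W"]) auto
qed

lemma fourier_measurable [measurable]:
  fixes \<phi> :: "real ^ 'n \<Rightarrow> complex"
  assumes [measurable]: "\<phi> \<in> borel_measurable borel"
  shows "fourier \<phi> \<in> borel_measurable borel"
proof -
  have "(\<lambda>\<xi>. \<integral>x. exp (\<i> * complex_of_real (x \<bullet> \<xi>)) * \<phi> x \<partial>(lborel :: (real ^ 'n) measure)) \<in> borel_measurable lborel"
    by (rule lborel.borel_measurable_lebesgue_integral) simp
  then show ?thesis unfolding fourier_alt[abs_def] by simp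
qed

lemma inv_fourier_measurable [measurable]:
  fixes \<phi> :: "real ^ 'n \<Rightarrow> complex"
  assumes [measurable]: "\<phi> \<in> borel_measurable borel"
  shows "inv_fourier \<phi> \<in> borel_measurable borel"
  unfolding inv_fourier_minus[abs_def] by simp

text \<open>Fubini's theorem, since the kernel is symmetric in the two variables.\<close>

lemma fourier_symmetric:
  fixes \<phi> \<psi> :: "real ^ 'n \<Rightarrow> complex"
  assumes \<phi>: "integrable lborel \<phi>" and \<psi>: "integrable lborel \<psi>"
  shows "(\<integral>x. fourier \<phi> x * \<psi> x \<partial>lborel) = (\<integral>x. \<phi> x * fourier \<psi> x \<partial>lborel)"
proof -
  have [measurable]: "\<phi> \<in> borel_measurable borel" "\<psi> \<in> borel_measurable borel"
    using \<phi> \<psi> by auto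
  let ?k = "\<lambda>y x. exp (\<i> * complex_of_real (y \<bullet> x)) * \<phi> y * \<psi> x"
  have "integrable (lborel \<Otimes>\<^sub>M lborel) (case_prod ?k)"
  proof (rule lborel_pair.Fubini_integrable)
    show "integrable lborel (\<lambda>y. \<integral>x. norm (case (y, x) of (y, x) \<Rightarrow> ?k y x) \<partial>lborel)"
      using \<phi> by (simp add: norm_mult)
    show "AE y in lborel. integrable lborel (\<lambda>x. case (y, x) of (y, x) \<Rightarrow> ?k y x)"
    proof (rule AE_I2)
      fix y
      have "integrable lborel (\<lambda>x. \<phi> y * (exp (\<i> * complex_of_real (x \<bullet> y)) * \<psi> x))"
        by (intro integrable_mult_right integrable_phase \<psi>)
      then show "integrable lborel (\<lambda>x. case (y, x) of (y, x) \<Rightarrow> ?k y x)"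
        by (simp add: inner_commute ac_simps)
    qed
  qed simp
  from lborel_pair.Fubini_integral[OF this]
  have F: "(\<integral>x. \<integral>y. ?k y x \<partial>lborel \<partial>lborel) = (\<integral>y. \<integral>x. ?k y x \<partial>lborel \<partial>lborel)" .
  have L: "fourier \<phi> x * \<psi> x = complex_of_real (fconst TYPE('n)) * (\<integral>y. ?k y x \<partial>lborel)" for x
    by (simp add: fourier_alt)
  have "(\<integral>x. ?k y x \<partial>lborel) = \<phi> y * (\<integral>x. exp (\<i> * complex_of_real (x \<bullet> y)) * \<psi> x \<partial>lborel)" for y
    by (subst integral_mult_right_zero[symmetric]) (simp add: inner_commute ac_simps)
  then have R: "\<phi> y * fourier \<psi> y = complex_of_real (fconst TYPE('n)) * (\<integral>x. ?k y x \<partial>lborel)" for y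
    by (simp only: fourier_alt ac_simps)
  show ?thesis unfolding L R using F by simp
qed

section \<open>Fourier inversion\<close>

definition gauss :: "real ^ 'n \<Rightarrow> complex"
  where "gauss x = complex_of_real (exp (- (x \<bullet> x) / 2))"

lemma gauss_measurable [measurable]: "gauss \<in> borel_measurable borel"
  unfolding gauss_def by measurable

text \<open>The value is that of the characteristic function of the standard normal distribution.\<close>

lemma gauss_1d:
  "(\<integral>y. exp (\<i> * complex_of_real (y * t)) * complex_of_real (exp (- y\<^sup>2 / 2)) \<partial>lborel)
     = complex_of_real (sqrt (2 * pi) * exp (- t\<^sup>2 / 2))" (is ?I)
  "integrable lborel (\<lambda>y. exp (\<i> * complex_of_real (y * t)) * complex_of_real (exp (- y\<^sup>2 / 2)))" (is ?J)
proof -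
  have d: "complex_of_real (exp (- y\<^sup>2 / 2)) = complex_of_real (sqrt (2 * pi)) * complex_of_real (std_normal_density y)" for y
  proof -
    have "exp (- y\<^sup>2 / 2) = sqrt (2 * pi) * std_normal_density y" unfolding std_normal_density_def by simp
    then show ?thesis by (metis of_real_mult)
  qed
  have i: "integrable lborel (\<lambda>y. complex_of_real (sqrt (2 * pi)) * complex_of_real (std_normal_density y))"
    by (intro integrable_mult_right integrable_of_real integrable_normal_density) simp
  show ?J
    unfolding d by (rule Bochner_Integration.integrable_bound[OF i]) (auto simp: norm_mult)
  have "complex_of_real (exp (- t\<^sup>2 / 2)) = char std_normal_distribution t"
    by (simp add: char_std_normal_distribution)
  also have "\<dots> = (\<integral>y. std_normal_density y *\<^sub>R exp (\<i> * complex_of_real (t * y)) \<partial>lborel)"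
    unfolding char_def by (subst integral_density) auto
  finally have E: "complex_of_real (exp (- t\<^sup>2 / 2)) =
      (\<integral>y. std_normal_density y *\<^sub>R exp (\<i> * complex_of_real (t * y)) \<partial>lborel)" .
  have "complex_of_real (sqrt (2 * pi)) * complex_of_real (exp (- t\<^sup>2 / 2)) =
      (\<integral>y. complex_of_real (sqrt (2 * pi)) * (std_normal_density y *\<^sub>R exp (\<i> * complex_of_real (t * y))) \<partial>lborel)"
    unfolding E by (rule integral_mult_right_zero[symmetric])
  moreover have "exp (\<i> * complex_of_real (y * t)) * complex_of_real (exp (- y\<^sup>2 / 2)) =
      complex_of_real (sqrt (2 * pi)) * (std_normal_density y *\<^sub>R exp (\<i> * complex_of_real (t * y)))" for y
    by (simp only: d) (simp add: scaleR_conv_of_real ac_simps)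
  ultimately show ?I by (simp only: of_real_mult)
qed

lemma gauss_prod:
  fixes x :: "real ^ 'n"
  shows "exp (\<i> * complex_of_real (x \<bullet> \<xi>)) * gauss x =
    (\<Prod>b\<in>Basis. exp (\<i> * complex_of_real ((x \<bullet> b) * (\<xi> \<bullet> b))) * complex_of_real (exp (- (x \<bullet> b)\<^sup>2 / 2)))"
proof -
  have "exp (\<i> * complex_of_real (x \<bullet> \<xi>)) = (\<Prod>b\<in>Basis. exp (\<i> * complex_of_real ((x \<bullet> b) * (\<xi> \<bullet> b))))"
    by (subst euclidean_inner) (simp add: sum_distrib_left exp_sum)
  moreover have "gauss x = (\<Prod>b\<in>Basis. complex_of_real (exp (- (x \<bullet> b)\<^sup>2 / 2)))"
    unfolding gauss_def
    by (subst euclidean_inner)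
       (simp add: exp_sum[symmetric] sum_negf sum_divide_distrib power2_eq_square flip: of_real_prod)
  ultimately show ?thesis by (simp add: prod.distrib)
qed

lemma gauss_integral:
  fixes \<xi> :: "real ^ 'n"
  shows "integrable lborel (gauss :: real ^ 'n \<Rightarrow> complex)" (is ?I)
    and "(\<integral>x. exp (\<i> * complex_of_real (x \<bullet> \<xi>)) * gauss x \<partial>lborel) = complex_of_real (sqrt (2 * pi) ^ CARD('n)) * gauss \<xi>" (is ?J)
proof -
  have "integrable lborel (\<lambda>x :: real ^ 'n. exp (\<i> * complex_of_real (x \<bullet> 0)) * gauss x)"
    unfolding gauss_prod by (rule lborel_prod_integral(2)) (rule gauss_1d(2))
  then show ?I by simp
  have "(\<integral>x. exp (\<i> * complex_of_real (x \<bullet> \<xi>)) * gauss x \<partial>lborel) =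
      (\<Prod>b\<in>(Basis :: (real ^ 'n) set). complex_of_real (sqrt (2 * pi) * exp (- (\<xi> \<bullet> b)\<^sup>2 / 2)))"
    unfolding gauss_prod by (subst lborel_prod_integral(1)[OF gauss_1d(2)]) (simp only: gauss_1d(1))
  also have "\<dots> = complex_of_real (sqrt (2 * pi) ^ CARD('n)) * gauss \<xi>"
    using gauss_prod[of 0 \<xi>] gauss_prod[of \<xi> 0] by (simp add: prod.distrib)
  finally show ?J .
qed

lemma fconst_sqrt: "fconst TYPE('n::finite) * sqrt (2 * pi) ^ CARD('n) = 1"
proof -
  have "sqrt (2 * pi) ^ CARD('n) = (2 * pi) powr (real CARD('n) / 2)"
    by (simp add: powr_half_sqrt[symmetric] powr_powr flip: powr_realpow)
  then show ?thesis unfolding fconst_def by (simp flip: powr_add)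
qed

lemma fourier_gauss: "fourier gauss \<xi> = gauss (\<xi> :: real ^ 'n)"
  unfolding fourier_alt gauss_integral(2) mult.assoc[symmetric] of_real_mult[symmetric] fconst_sqrt by simp

text \<open>From here on the rule would start a search for smoothness in every proof of measurability.\<close>

declare smooth_measurable [measurable del]

lemma inv_fourier_limit:
  fixes f :: "nat \<Rightarrow> real ^ 'n \<Rightarrow> complex"
  assumes "\<And>k. f k \<in> borel_measurable borel" "g \<in> borel_measurable borel" "integrable lborel w"
    and "\<And>k \<xi>. norm (f k \<xi>) \<le> w \<xi>" "\<And>\<xi>. (\<lambda>k. f k \<xi>) \<longlonglongrightarrow> g \<xi>"
  shows "(\<lambda>k. inv_fourier (f k) x) \<longlonglongrightarrow> inv_fourier g x"
  unfolding inv_fourier_minus fourier_alt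
proof (rule tendsto_mult[OF tendsto_const], rule integral_dominated_convergence[OF _ _ assms(3)])
  note [measurable] = assms(1,2)
  show "(\<lambda>y. exp (\<i> * complex_of_real (y \<bullet> (- x))) * g y) \<in> borel_measurable lborel" by measurable
  show "(\<lambda>y. exp (\<i> * complex_of_real (y \<bullet> (- x))) * f k y) \<in> borel_measurable lborel" for k by measurable
  show "AE y in lborel. (\<lambda>k. exp (\<i> * complex_of_real (y \<bullet> (- x))) * f k y) \<longlonglongrightarrow> exp (\<i> * complex_of_real (y \<bullet> (- x))) * g y"
    by (intro AE_I2 tendsto_mult tendsto_const assms(5))
  show "AE y in lborel. norm (exp (\<i> * complex_of_real (y \<bullet> (- x))) * f k y) \<le> w y" for k
    by (intro AE_I2) (simp only: norm_phase assms(4))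
qed

text \<open>
  Multiplying the transform of \<open>\<phi>\<close> by a dilated function \<open>\<psi>\<close> amounts to averaging \<open>\<phi>\<close> around \<open>x\<close>
  with the transform of \<open>\<psi>\<close> as density; for small \<open>e\<close> the average concentrates at \<open>x\<close>.
\<close>

lemma regularized_inverse:
  fixes \<phi> \<psi> :: "real ^ 'n \<Rightarrow> complex"
  assumes \<phi>: "integrable lborel \<phi>" and \<psi>: "integrable lborel \<psi>" and e: "0 < e"
  shows "inv_fourier (\<lambda>\<xi>. \<psi> (e *\<^sub>R \<xi>) * fourier \<phi> \<xi>) x =
    complex_of_real (fconst TYPE('n)) * (\<integral>y. \<phi> (x + e *\<^sub>R y) * fourier \<psi> y \<partial>lborel)"
proof -
  have [measurable]: "\<phi> \<in> borel_measurable borel" "\<psi> \<in> borel_measurable borel" using \<phi> \<psi> by auto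
  let ?p = "\<lambda>\<xi>. exp (\<i> * complex_of_real (\<xi> \<bullet> (- x)))"
  have \<psi>e: "integrable lborel (\<lambda>\<xi>. \<psi> (e *\<^sub>R \<xi>))"
    using lborel_affine_integrable[OF \<psi>, of e 0] e by simp
  have F: "fourier (\<lambda>\<xi>. ?p \<xi> * \<psi> (e *\<^sub>R \<xi>)) y = complex_of_real (1 / e ^ CARD('n)) * fourier \<psi> ((1 / e) *\<^sub>R (y - x))" for y
  proof -
    have "fourier \<psi> ((1 / e) *\<^sub>R (y - x)) = complex_of_real (fconst TYPE('n)) * (e ^ CARD('n) *\<^sub>R
        (\<integral>\<xi>. exp (\<i> * complex_of_real (\<xi> \<bullet> (y - x))) * \<psi> (e *\<^sub>R \<xi>) \<partial>lborel))"
      unfolding fourier_alt by (subst lborel_affine_integral[of _ e 0]) (use e in auto)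
    also have "(\<integral>\<xi>. exp (\<i> * complex_of_real (\<xi> \<bullet> (y - x))) * \<psi> (e *\<^sub>R \<xi>) \<partial>lborel) =
        (\<integral>\<xi>. exp (\<i> * complex_of_real (\<xi> \<bullet> y)) * (?p \<xi> * \<psi> (e *\<^sub>R \<xi>)) \<partial>lborel)"
      by (simp add: inner_diff_right exp_diff exp_minus field_simps)
    finally show ?thesis using e unfolding fourier_alt[of "\<lambda>\<xi>. ?p \<xi> * \<psi> (e *\<^sub>R \<xi>)"] by (simp add: scaleR_conv_of_real)
  qed
  have "inv_fourier (\<lambda>\<xi>. \<psi> (e *\<^sub>R \<xi>) * fourier \<phi> \<xi>) x =
      complex_of_real (fconst TYPE('n)) * (\<integral>\<xi>. fourier \<phi> \<xi> * (?p \<xi> * \<psi> (e *\<^sub>R \<xi>)) \<partial>lborel)"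
    unfolding inv_fourier_minus fourier_alt[of "\<lambda>\<xi>. \<psi> (e *\<^sub>R \<xi>) * fourier \<phi> \<xi>"] by (simp add: ac_simps)
  also have "(\<integral>\<xi>. fourier \<phi> \<xi> * (?p \<xi> * \<psi> (e *\<^sub>R \<xi>)) \<partial>lborel) = (\<integral>y. \<phi> y * fourier (\<lambda>\<xi>. ?p \<xi> * \<psi> (e *\<^sub>R \<xi>)) y \<partial>lborel)"
    by (intro fourier_symmetric \<phi> integrable_phase \<psi>e)
  also have "\<dots> = (\<integral>y. complex_of_real (1 / e ^ CARD('n)) * (\<phi> y * fourier \<psi> ((1 / e) *\<^sub>R (y - x))) \<partial>lborel)"
    unfolding F by (simp add: ac_simps)
  also have "\<dots> = e ^ CARD('n) *\<^sub>R (\<integral>y. complex_of_real (1 / e ^ CARD('n)) * (\<phi> (x + e *\<^sub>R y) * fourier \<psi> y) \<partial>lborel)"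
    by (subst lborel_affine_integral[of _ e x]) (use e in auto)
  also have "\<dots> = (\<integral>y. \<phi> (x + e *\<^sub>R y) * fourier \<psi> y \<partial>lborel)"
    using e by (simp add: scaleR_conv_of_real)
  finally show ?thesis .
qed

text \<open>
  Insert the Gaussian \<open>gauss (h \<xi>)\<close> into the inverse transform. As \<open>h\<close> tends to zero, the integrals
  converge to the inverse transform; on the other hand they are Gaussian averages of \<open>\<phi>\<close>, which
  concentrate at the given point.
\<close>

theorem fourier_inversion:
  fixes \<phi> :: "real ^ 'n \<Rightarrow> complex"
  assumes cont: "continuous_on UNIV \<phi>" and bd: "\<And>x. norm (\<phi> x) \<le> K"
    and int: "integrable lborel \<phi>" and intF: "integrable lborel (fourier \<phi>)"
  shows "inv_fourier (fourier \<phi>) z = \<phi> z"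
proof -
  have [measurable]: "\<phi> \<in> borel_measurable borel" using cont by (rule borel_measurable_continuous_onI)
  define h where "h k = 1 / real (Suc k)" for k
  have h: "0 < h k" for k by (simp add: h_def)
  have h0: "h \<longlonglongrightarrow> 0" using LIMSEQ_inverse_real_of_nat by (simp add: h_def[abs_def] inverse_eq_divide)
  let ?c = "complex_of_real (fconst TYPE('n))"
  have L: "(\<lambda>k. inv_fourier (\<lambda>\<xi>. gauss (h k *\<^sub>R \<xi>) * fourier \<phi> \<xi>) z) \<longlonglongrightarrow> inv_fourier (fourier \<phi>) z"
  proof (rule inv_fourier_limit[where w="\<lambda>\<xi>. norm (fourier \<phi> \<xi>)"])
    show "integrable lborel (\<lambda>\<xi>. norm (fourier \<phi> \<xi>))" using intF by simp
    show "norm (gauss (h k *\<^sub>R \<xi>) * fourier \<phi> \<xi>) \<le> norm (fourier \<phi> \<xi>)" for k \<xi>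
    proof -
      have "norm (gauss x) \<le> 1" for x :: "real ^ 'n" by (simp add: gauss_def)
      then show ?thesis unfolding norm_mult by (intro mult_left_le_one_le) auto
    qed
    show "(\<lambda>k. gauss (h k *\<^sub>R \<xi>) * fourier \<phi> \<xi>) \<longlonglongrightarrow> fourier \<phi> \<xi>" for \<xi>
    proof -
      have "(\<lambda>k. gauss (h k *\<^sub>R \<xi>)) \<longlonglongrightarrow> gauss (0 :: real ^ 'n)"
        unfolding gauss_def by (rule tendsto_eq_intros h0 | simp)+
      from tendsto_mult[OF this tendsto_const[of "fourier \<phi> \<xi>"]] show ?thesis by (simp add: gauss_def)
    qed
    show "fourier \<phi> \<in> borel_measurable borel" by measurable
    show "(\<lambda>\<xi>. gauss (h k *\<^sub>R \<xi>) * fourier \<phi> \<xi>) \<in> borel_measurable borel" for k by measurable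
  qed
  have R: "inv_fourier (\<lambda>\<xi>. gauss (h k *\<^sub>R \<xi>) * fourier \<phi> \<xi>) z = ?c * (\<integral>y. \<phi> (z + h k *\<^sub>R y) * gauss y \<partial>lborel)" for k
    using regularized_inverse[OF int gauss_integral(1) h, of k z] by (simp only: fourier_gauss)
  have "(\<lambda>k. \<integral>y. \<phi> (z + h k *\<^sub>R y) * gauss y \<partial>lborel) \<longlonglongrightarrow> (\<integral>y. \<phi> z * gauss (y :: real ^ 'n) \<partial>lborel)"
  proof (rule integral_dominated_convergence)
    show "integrable lborel (\<lambda>y :: real ^ 'n. K * norm (gauss y))"
      by (intro integrable_mult_right integrable_norm gauss_integral(1))
    show "AE y in lborel. (\<lambda>k. \<phi> (z + h k *\<^sub>R y) * gauss y) \<longlonglongrightarrow> \<phi> z * gauss y"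
    proof (rule AE_I2)
      fix y :: "real ^ 'n"
      have "(\<lambda>k. z + h k *\<^sub>R y) \<longlonglongrightarrow> z" using h0 by (auto intro!: tendsto_eq_intros)
      then have "(\<lambda>k. \<phi> (z + h k *\<^sub>R y)) \<longlonglongrightarrow> \<phi> z"
        using cont by (intro continuous_on_tendsto_compose[of UNIV \<phi>]) auto
      then show "(\<lambda>k. \<phi> (z + h k *\<^sub>R y) * gauss y) \<longlonglongrightarrow> \<phi> z * gauss y" by (intro tendsto_mult tendsto_const)
    qed
    show "AE y in lborel. norm (\<phi> (z + h k *\<^sub>R y) * gauss y) \<le> K * norm (gauss y)" for k
      using bd by (auto simp: norm_mult intro!: AE_I2 mult_right_mono)
  qed simp_all
  from tendsto_mult[OF tendsto_const[of ?c] this]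
  have "inv_fourier (fourier \<phi>) z = ?c * (\<integral>y. \<phi> z * gauss (y :: real ^ 'n) \<partial>lborel)"
    using L unfolding R by (rule LIMSEQ_unique[rotated])
  also have "\<dots> = \<phi> z * (?c * complex_of_real (sqrt (2 * pi) ^ CARD('n)))"
    using gauss_integral(2)[of "0 :: real ^ 'n"] by (simp add: gauss_def ac_simps)
  also have "?c * complex_of_real (sqrt (2 * pi) ^ CARD('n)) = 1"
    unfolding of_real_mult[symmetric] fconst_sqrt by simp
  finally show ?thesis by simp
qed

lemma inv_fourier_integrable_iff:
  fixes \<phi> :: "real ^ 'n \<Rightarrow> complex"
  shows "integrable lborel (inv_fourier \<phi>) \<longleftrightarrow> integrable lborel (fourier \<phi>)"
  using lborel_affine_integrable[of "inv_fourier \<phi>" "-1" 0] lborel_affine_integrable[of "fourier \<phi>" "-1" 0]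
  by (auto simp: inv_fourier_minus[abs_def])

theorem inv_fourier_inversion:
  fixes \<phi> :: "real ^ 'n \<Rightarrow> complex"
  assumes "continuous_on UNIV \<phi>" "\<And>x. norm (\<phi> x) \<le> K"
    and int: "integrable lborel \<phi>" and "integrable lborel (inv_fourier \<phi>)"
  shows "fourier (inv_fourier \<phi>) z = \<phi> z"
proof -
  have [measurable]: "\<phi> \<in> borel_measurable borel" using int by simp
  have "fourier (inv_fourier \<phi>) z = fourier (\<lambda>x. fourier \<phi> (- x)) z"
    by (simp add: inv_fourier_minus[abs_def])
  also have "\<dots> = inv_fourier (fourier \<phi>) z" by (rule inv_fourier_reflect[symmetric]) simp
  also have "\<dots> = \<phi> z" using assms by (intro fourier_inversion) (auto simp: inv_fourier_integrable_iff)
  finally show ?thesis .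
qed


section \<open>Schwartz functions\<close>

lemma schwartz_smooth: "\<phi> \<in> schwartz \<Longrightarrow> smooth \<phi>" by (simp add: schwartz_def)

lemma schwartz_measurable: "\<phi> \<in> schwartz \<Longrightarrow> \<phi> \<in> borel_measurable borel"
  by (rule smooth_measurable[OF schwartz_smooth])

lemma schwartz_dbound:
  fixes \<phi> :: "real ^ 'n \<Rightarrow> 'b::real_normed_vector"
  assumes "\<phi> \<in> schwartz"
  shows "\<exists>C\<ge>0. dbound m (\<lambda>x. C * (1 / (1 + norm x) ^ k)) \<phi>"
proof (rule dbound_exists)
  fix "is" :: "'n list"
  obtain C where C: "\<And>x. (1 + norm x) ^ k * norm (iter_partial is \<phi> x) \<le> C"
    using assms unfolding schwartz_def by blast
  have "norm (iter_partial is \<phi> x) \<le> C * (1 / (1 + norm x) ^ k)" for x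
  proof -
    have "0 < (1 + norm x) ^ k" by (intro zero_less_power add_pos_nonneg) auto
    then show ?thesis using C[of x] by (simp add: pos_le_divide_eq mult.commute)
  qed
  then show "\<exists>C. \<forall>x. norm (iter_partial is \<phi> x) \<le> C * (1 / (1 + norm x) ^ k)" by blast
qed (auto intro!: divide_nonneg_nonneg zero_le_power add_nonneg_nonneg)

lemma schwartzI:
  fixes \<phi> :: "real ^ 'n \<Rightarrow> 'b::real_normed_vector"
  assumes "smooth \<phi>" "\<And>m k. \<exists>C. dbound m (\<lambda>x. C * (1 / (1 + norm x) ^ k)) \<phi>"
  shows "\<phi> \<in> schwartz"
proof -
  have "\<exists>C. \<forall>x. (1 + norm x) ^ k * norm (iter_partial is \<phi> x) \<le> C" for "is" k
  proof -
    obtain C where "dbound (length is) (\<lambda>x. C * (1 / (1 + norm x) ^ k)) \<phi>" using assms(2) by blast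
    then have C: "norm (iter_partial is \<phi> x) \<le> C * (1 / (1 + norm x) ^ k)" for x by (auto simp: dbound_def)
    have "(1 + norm x) ^ k * norm (iter_partial is \<phi> x) \<le> C" for x
    proof -
      have "0 < (1 + norm x) ^ k" by (intro zero_less_power add_pos_nonneg) auto
      then show ?thesis using C[of x] by (simp add: pos_le_divide_eq mult.commute)
    qed
    then show ?thesis by blast
  qed
  then show ?thesis using assms(1) by (simp add: schwartz_def)
qed

lemma schwartz_wt:
  fixes \<phi> :: "real ^ 'n \<Rightarrow> 'b::real_normed_vector"
  assumes "\<phi> \<in> schwartz"
  shows "\<exists>C\<ge>0. dbound m (\<lambda>x. C * wt x) \<phi>"
  using schwartz_dbound[OF assms] unfolding wt_def by blast

text \<open>
  The smooth functions all of whose derivatives grow at most polynomially; multiplication by them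
  preserves the Schwartz functions.
\<close>

definition pgrow :: "(real ^ 'n \<Rightarrow> 'b::real_normed_vector) \<Rightarrow> bool"
  where "pgrow f \<longleftrightarrow> smooth f \<and> (\<forall>m. \<exists>C k. dbound m (\<lambda>x. C * (1 + norm x) ^ k) f)"

lemma schwartz_mult:
  fixes f \<phi> :: "real ^ 'n \<Rightarrow> complex"
  assumes "pgrow f" "\<phi> \<in> schwartz"
  shows "(\<lambda>x. f x * \<phi> x) \<in> schwartz"
proof (rule schwartzI)
  have sm: "smooth f" "smooth \<phi>" using assms by (auto simp: pgrow_def schwartz_smooth)
  then show "smooth (\<lambda>x. f x * \<phi> x)" by (rule smooth_mult)
  fix m k
  obtain C j where 1: "dbound m (\<lambda>x. C * (1 + norm x) ^ j) f" using assms(1) unfolding pgrow_def by blast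
  obtain D where 2: "dbound m (\<lambda>x. D * (1 / (1 + norm x) ^ (j + k))) \<phi>" using schwartz_dbound[OF assms(2)] by blast
  have "2 ^ m * (C * (1 + norm x) ^ j * (D * (1 / (1 + norm x) ^ (j + k)))) = (2 ^ m * C * D) * (1 / (1 + norm x) ^ k)" for x :: "real ^ 'n"
  proof -
    have "1 + norm x \<noteq> 0" using norm_ge_zero[of x] by linarith
    then show ?thesis by (simp add: power_add)
  qed
  with dbound_mult[OF sm 1 2] show "\<exists>C. dbound m (\<lambda>x. C * (1 / (1 + norm x) ^ k)) (\<lambda>x. f x * \<phi> x)" by auto
qed

lemma schwartz_add:
  fixes f g :: "real ^ 'n \<Rightarrow> 'b::real_normed_vector"
  assumes "f \<in> schwartz" "g \<in> schwartz"
  shows "(\<lambda>x. f x + g x) \<in> schwartz"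
proof (rule schwartzI)
  show "smooth (\<lambda>x. f x + g x)" using assms by (intro smooth_add schwartz_smooth)
  fix m k
  obtain C D where "dbound m (\<lambda>x. C * (1 / (1 + norm x) ^ k)) f" "dbound m (\<lambda>x. D * (1 / (1 + norm x) ^ k)) g"
    using schwartz_dbound assms by blast
  from dbound_add[OF schwartz_smooth[OF assms(1)] schwartz_smooth[OF assms(2)] this]
  show "\<exists>C. dbound m (\<lambda>x. C * (1 / (1 + norm x) ^ k)) (\<lambda>x. f x + g x)"
    unfolding distrib_right[symmetric] by blast
qed

lemma schwartz_linear:
  fixes f :: "real ^ 'n \<Rightarrow> 'b::real_normed_vector"
  assumes "bounded_linear L" "f \<in> schwartz"
  shows "(\<lambda>x. L (f x)) \<in> schwartz"
proof (rule schwartzI)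
  show "smooth (\<lambda>x. L (f x))" by (rule smooth_linear[OF assms(1) schwartz_smooth[OF assms(2)]])
  fix m k
  obtain C where "dbound m (\<lambda>x. C * (1 / (1 + norm x) ^ k)) f" using schwartz_dbound assms by blast
  moreover obtain K where "0 \<le> K" "\<And>y. norm (L y) \<le> K * norm y"
    using bounded_linear.nonneg_bounded[OF assms(1)] by (metis mult.commute)
  ultimately have "dbound m (\<lambda>x. K * (C * (1 / (1 + norm x) ^ k))) (\<lambda>x. L (f x))"
    by (intro dbound_linear[OF assms(1) schwartz_smooth[OF assms(2)]])
  then show "\<exists>C. dbound m (\<lambda>x. C * (1 / (1 + norm x) ^ k)) (\<lambda>x. L (f x))" by (intro exI[of _ "K * C"]) (simp add: mult.assoc)
qed

lemma dbound_const:
  assumes "norm c \<le> B" "\<And>x. B \<le> w x"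
  shows "dbound m w (\<lambda>x. c)"
  using assms(1)
proof (induction m arbitrary: c)
  case (Suc m)
  then have "norm 0 \<le> B" using norm_ge_zero order_trans by (metis norm_zero)
  then show ?case using Suc assms(2) by (auto simp: dbound_Suc intro: order_trans)
qed (use assms(2) in \<open>auto simp: dbound_0 intro: order_trans\<close>)

lemma schwartz_zero: "(\<lambda>x. 0) \<in> schwartz"
proof (rule schwartzI)
  fix m k
  show "\<exists>C. dbound m (\<lambda>x. C * (1 / (1 + norm x) ^ k)) (\<lambda>x. 0)"
    by (intro exI[of _ 0] dbound_const[where B=0]) auto
qed simp

lemma schwartz_sum:
  "finite I \<Longrightarrow> (\<And>i. i \<in> I \<Longrightarrow> f i \<in> schwartz) \<Longrightarrow> (\<lambda>x. \<Sum>i\<in>I. f i x) \<in> schwartz"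
  by (induction I rule: finite_induct) (auto intro: schwartz_add schwartz_zero)

lemma schwartz_vec_iff:
  fixes f :: "real ^ 'n \<Rightarrow> complex ^ 'N"
  shows "f \<in> schwartz \<longleftrightarrow> (\<forall>j. (\<lambda>x. f x $ j) \<in> schwartz)"
proof safe
  fix j assume "f \<in> schwartz"
  then show "(\<lambda>x. f x $ j) \<in> schwartz" by (rule schwartz_linear[OF bounded_linear_vec_nth])
next
  assume *: "\<forall>j. (\<lambda>x. f x $ j) \<in> schwartz"
  have bl: "bounded_linear (\<lambda>c :: complex. axis j c :: complex ^ 'N)" for j
    unfolding linear_conv_bounded_linear[symmetric]
    by (rule linearI) (auto simp: axis_def vec_eq_iff)
  have f: "f = (\<lambda>x. \<Sum>j\<in>UNIV. axis j (f x $ j))"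
    by (rule ext) (simp add: vec_eq_iff axis_def)
  have s: "(\<lambda>x. axis j (f x $ j) :: complex ^ 'N) \<in> schwartz" for j
    using schwartz_linear[OF bl, of "\<lambda>x. f x $ j" j] * by simp
  show "f \<in> schwartz"
    by (subst f, rule schwartz_sum[of UNIV "\<lambda>j x. axis j (f x $ j)"]) (simp_all add: s)
qed

lemma pgrow_coord: "pgrow (\<lambda>x :: real ^ 'n. \<i> * complex_of_real (x $ i))"
  unfolding pgrow_def
proof (intro conjI allI exI)
  have bl: "bounded_linear (\<lambda>r. \<i> * complex_of_real r)"
    by (rule bounded_linear_compose[OF bounded_linear_mult_right bounded_linear_of_real])
  show "smooth (\<lambda>x :: real ^ 'n. \<i> * complex_of_real (x $ i))" by (rule smooth_linear[OF bl smooth_coord])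
  fix m
  have "dbound m (\<lambda>x. (1 + norm x) ^ 1) (\<lambda>x :: real ^ 'n. x $ i)"
  proof (cases m)
    case 0
    have "\<bar>x $ i\<bar> \<le> 1 + norm x" for x :: "real ^ 'n" using component_le_norm_cart[of x i] by simp
    then show ?thesis by (simp add: 0 dbound_0)
  next
    case (Suc m')
    have 1: "\<bar>x $ i\<bar> \<le> 1 + norm x" for x :: "real ^ 'n" using component_le_norm_cart[of x i] by simp
    have "dbound m' (\<lambda>x. (1 + norm x) ^ 1) (\<lambda>x :: real ^ 'n. if j = i then 1 else 0 :: real)" for j
      by (rule dbound_const[where B=1]) auto
    then show ?thesis using 1 by (simp add: Suc dbound_Suc partial_coord)
  qed
  then show "dbound m (\<lambda>x. 1 * (1 + norm x) ^ 1) (\<lambda>x :: real ^ 'n. \<i> * complex_of_real (x $ i))"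
    by (intro dbound_linear[OF bl smooth_coord]) (auto simp: norm_mult)
qed

lemma schwartz_integrable:
  fixes \<phi> :: "real ^ 'n \<Rightarrow> complex"
  assumes "\<phi> \<in> schwartz"
  shows "integrable lborel \<phi>"
proof -
  obtain C where "dbound 0 (\<lambda>x. C * wt x) \<phi>" using schwartz_wt[OF assms] by blast
  then show ?thesis by (intro integrable_wt_bound[of _ C] schwartz_measurable assms) (simp add: dbound_0)
qed

lemma schwartz_integrable2:
  fixes \<phi> :: "real ^ 'n \<Rightarrow> complex"
  assumes "\<phi> \<in> schwartz"
  shows "integrable lborel (\<lambda>x. (1 + norm x)\<^sup>2 * norm (\<phi> x))"
proof -
  obtain C where C: "dbound 0 (\<lambda>x. C * (1 / (1 + norm x) ^ (2 + 2 * CARD('n)))) \<phi>" using schwartz_dbound[OF assms] by blast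
  have "norm ((1 + norm x)\<^sup>2 * norm (\<phi> x)) \<le> C * wt x" for x
  proof -
    have "1 + norm x \<noteq> 0" using norm_ge_zero[of x] by linarith
    then have "C * wt x = (1 + norm x)\<^sup>2 * (C * (1 / (1 + norm x) ^ (2 + 2 * CARD('n))))"
      by (simp add: wt_def power_add power2_eq_square)
    moreover have "(1 + norm x)\<^sup>2 * norm (\<phi> x) \<le> (1 + norm x)\<^sup>2 * (C * (1 / (1 + norm x) ^ (2 + 2 * CARD('n))))"
      using C unfolding dbound_0 by (intro mult_left_mono zero_le_power2) blast
    ultimately show ?thesis by (simp only: real_norm_def abs_mult abs_norm_cancel abs_power2)
  qed
  then show ?thesis
    by (intro integrable_wt_bound[of _ C]) (use schwartz_measurable[OF assms] in auto)
qed

lemma iter_partial_fourier: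
  fixes \<phi> :: "real ^ 'n \<Rightarrow> complex"
  assumes "\<phi> \<in> schwartz"
  shows "\<exists>\<psi>\<in>schwartz. iter_partial is (fourier \<phi>) = fourier \<psi>"
proof (induction "is")
  case Nil then show ?case using assms by auto
next
  case (Cons i "is")
  then obtain \<psi> where \<psi>: "\<psi> \<in> schwartz" "iter_partial is (fourier \<phi>) = fourier \<psi>" by auto
  have "partial i (fourier \<psi>) = fourier (\<lambda>x. \<i> * complex_of_real (x $ i) * \<psi> x)"
    by (intro partial_fourier schwartz_measurable schwartz_integrable2 \<psi>)
  then show ?case using schwartz_mult[OF pgrow_coord \<psi>(1)] by (auto simp: iter_partial_Cons \<psi>)
qed

lemma schwartz_fourier:
  fixes \<phi> :: "real ^ 'n \<Rightarrow> complex"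
  assumes "\<phi> \<in> schwartz"
  shows "fourier \<phi> \<in> schwartz"
  unfolding schwartz_def
proof (intro CollectI conjI allI)
  show "smooth (fourier \<phi>)"
    unfolding smooth_def
  proof (intro allI)
    fix "is" x
    obtain \<psi> where \<psi>: "\<psi> \<in> schwartz" "iter_partial is (fourier \<phi>) = fourier \<psi>"
      using iter_partial_fourier[OF assms] by blast
    show "iter_partial is (fourier \<phi>) differentiable (at x)"
      unfolding \<psi>(2) differentiable_def
      using fourier_has_derivative[OF schwartz_measurable[OF \<psi>(1)] schwartz_integrable2[OF \<psi>(1)]] by blast
  qed
  fix "is" k
  obtain \<psi> where \<psi>: "\<psi> \<in> schwartz" "iter_partial is (fourier \<phi>) = fourier \<psi>"
    using iter_partial_fourier[OF assms] by blast
  obtain K where K: "\<And>\<phi> C \<xi>. smooth (\<phi> :: real ^ 'n \<Rightarrow> complex) \<Longrightarrow> dbound k (\<lambda>x. C * wt x) \<phi> \<Longrightarrow>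
     norm (fourier \<phi> \<xi>) * (1 + norm \<xi>) ^ k \<le> K * C" using fourier_decay[of k] by blast
  obtain C where "dbound k (\<lambda>x. C * wt x) \<psi>" using schwartz_wt[OF \<psi>(1)] by blast
  from K[OF schwartz_smooth[OF \<psi>(1)] this]
  show "\<exists>C. \<forall>x. (1 + norm x) ^ k * norm (iter_partial is (fourier \<phi>) x) \<le> C"
    by (intro exI[of _ "K * C"]) (simp add: \<psi>(2) mult.commute)
qed

lemma schwartz_reflect:
  fixes \<phi> :: "real ^ 'n \<Rightarrow> complex"
  assumes "\<phi> \<in> schwartz"
  shows "(\<lambda>x. \<phi> (- x)) \<in> schwartz"
proof (rule schwartzI)
  show "smooth (\<lambda>x. \<phi> (- x))" using smooth_dilation[OF schwartz_smooth[OF assms], of "-1"] by simp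
  fix m k
  obtain C where C: "dbound m (\<lambda>x. C * (1 / (1 + norm x) ^ k)) \<phi>" using schwartz_dbound[OF assms] by blast
  have "iter_partial is (\<lambda>x. \<phi> (- x)) = (\<lambda>x. (- 1) ^ length is *\<^sub>R iter_partial is \<phi> (- x))" for "is"
    using iter_partial_dilation[OF schwartz_smooth[OF assms], of _ "-1"] by simp
  then have "dbound m (\<lambda>x. C * (1 / (1 + norm x) ^ k)) (\<lambda>x. \<phi> (- x))"
    using C by (auto simp: dbound_def) (metis norm_minus_cancel)
  then show "\<exists>C. dbound m (\<lambda>x. C * (1 / (1 + norm x) ^ k)) (\<lambda>x. \<phi> (- x))" by blast
qed

lemma schwartz_inv_fourier:
  fixes \<phi> :: "real ^ 'n \<Rightarrow> complex"
  assumes "\<phi> \<in> schwartz"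
  shows "inv_fourier \<phi> \<in> schwartz"
  using schwartz_reflect[OF schwartz_fourier[OF assms]] by (simp add: inv_fourier_minus[abs_def])

lemma schwartz_bounded:
  fixes \<phi> :: "real ^ 'n \<Rightarrow> complex"
  assumes "\<phi> \<in> schwartz"
  shows "\<exists>K. \<forall>x. norm (\<phi> x) \<le> K"
proof -
  obtain C where "0 \<le> C" "dbound 0 (\<lambda>x. C * wt x) \<phi>" using schwartz_wt[OF assms] by blast
  then show ?thesis using mult_left_mono[OF wt_le_1, of C] by (intro exI[of _ C]) (auto simp: dbound_0 intro: order_trans)
qed

lemma schwartz_fourier_inv:
  fixes \<phi> :: "real ^ 'n \<Rightarrow> complex"
  assumes "\<phi> \<in> schwartz"
  shows "fourier (inv_fourier \<phi>) = \<phi>" "inv_fourier (fourier \<phi>) = \<phi>"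
proof -
  obtain K where K: "\<And>x. norm (\<phi> x) \<le> K" using schwartz_bounded[OF assms] by blast
  have c: "continuous_on UNIV \<phi>" by (intro smooth_continuous schwartz_smooth assms)
  show "fourier (inv_fourier \<phi>) = \<phi>"
    by (rule ext, rule inv_fourier_inversion[OF c K]) (intro schwartz_integrable schwartz_inv_fourier assms)+
  show "inv_fourier (fourier \<phi>) = \<phi>"
    by (rule ext, rule fourier_inversion[OF c K]) (intro schwartz_integrable schwartz_fourier assms)+
qed

lemma testfun_schwartz:
  fixes \<psi> :: "real ^ 'n \<Rightarrow> complex"
  assumes "testfun \<psi>"
  shows "\<psi> \<in> schwartz"
proof (rule schwartzI)
  show "smooth \<psi>" using assms by (rule testfun_smooth)
  fix m k
  obtain R where R: "R \<ge> 0" "\<forall>m. \<exists>C\<ge>0. dbound m (\<lambda>x. C * indicator (cball 0 R) x) \<psi>" using testfun_dbound[OF assms] by blast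
  then obtain C where C: "C \<ge> 0" "dbound m (\<lambda>x. C * indicator (cball 0 R) x) \<psi>" by blast
  have "C * indicator (cball 0 R) x \<le> (C * (1 + R) ^ k) * (1 / (1 + norm x) ^ k)" for x :: "real ^ 'n"
  proof (cases "norm x \<le> R")
    case True
    have "C * (1 + norm x) ^ k \<le> C * (1 + R) ^ k" using True C by (intro mult_left_mono power_mono) auto
    moreover have "0 < (1 + norm x) ^ k" by (intro zero_less_power add_pos_nonneg) auto
    ultimately show ?thesis using C True by (simp add: pos_le_divide_eq indicator_def)
  qed (use C R in \<open>auto intro!: divide_nonneg_nonneg mult_nonneg_nonneg zero_le_power add_nonneg_nonneg\<close>)
  from dbound_weaken[OF C(2) this]
  show "\<exists>C. dbound m (\<lambda>x. C * (1 / (1 + norm x) ^ k)) \<psi>" by blast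
qed

section \<open>Lebesgue spaces of functions\<close>

text \<open>
  The analysis is carried out for functions; the classes modulo equality almost everywhere only
  enter at the end, through their representatives.
\<close>

definition lp :: "real \<Rightarrow> ('a::euclidean_space \<Rightarrow> 'b::euclidean_space) \<Rightarrow> bool"
  where "lp p f \<longleftrightarrow> f \<in> borel_measurable borel \<and> integrable lborel (\<lambda>x. norm (f x) powr p)"

definition lpn :: "real \<Rightarrow> ('a::euclidean_space \<Rightarrow> 'b::euclidean_space) \<Rightarrow> real"
  where "lpn p f = (\<integral>x. norm (f x) powr p \<partial>lborel) powr (1 / p)"

lemma lp_measurable: "lp p f \<Longrightarrow> f \<in> borel_measurable borel"
  by (simp add: lp_def)

lemma lpn_nonneg [simp]: "0 \<le> lpn p f" by (simp add: lpn_def)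

lemma lpn_powr: "0 < p \<Longrightarrow> lpn p f powr p = (\<integral>x. norm (f x) powr p \<partial>lborel)"
  by (simp add: lpn_def powr_powr)

lemma lpn_leI:
  assumes "0 < p" "0 \<le> c" "(\<integral>x. norm (f x) powr p \<partial>lborel) \<le> c powr p"
  shows "lpn p f \<le> c"
proof -
  have "lpn p f \<le> (c powr p) powr (1 / p)"
    unfolding lpn_def using assms by (intro powr_mono2) auto
  then show ?thesis using assms by (simp add: powr_powr)
qed

lemma lpn_leD:
  assumes "0 < p" "lpn p f \<le> c"
  shows "(\<integral>x. norm (f x) powr p \<partial>lborel) \<le> c powr p"
  unfolding lpn_powr[OF assms(1), symmetric] using assms by (intro powr_mono2) auto

lemma lp_dominated:
  fixes f :: "'a::euclidean_space \<Rightarrow> 'b::euclidean_space" and g :: "'a \<Rightarrow> 'c::euclidean_space"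
  assumes "0 < p" "lp p g" "f \<in> borel_measurable borel" "AE x in lborel. norm (f x) \<le> norm (g x)"
  shows "lp p f" and "lpn p f \<le> lpn p g"
proof -
  have [measurable]: "f \<in> borel_measurable borel" using assms by simp
  have ae: "AE x in lborel. norm (f x) powr p \<le> norm (g x) powr p"
    using assms(4) by eventually_elim (use assms(1) in \<open>auto intro: powr_mono2\<close>)
  have i: "integrable lborel (\<lambda>x. norm (f x) powr p)"
    by (rule Bochner_Integration.integrable_bound[of _ "\<lambda>x. norm (g x) powr p"])
       (use assms(2) ae in \<open>auto simp: lp_def\<close>)
  then show "lp p f" by (simp add: lp_def)
  have "(\<integral>x. norm (f x) powr p \<partial>lborel) \<le> (\<integral>x. norm (g x) powr p \<partial>lborel)"
    by (rule integral_mono_AE) (use i assms(2) ae in \<open>auto simp: lp_def\<close>)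
  then show "lpn p f \<le> lpn p g"
    by (intro lpn_leI) (use assms lpn_powr[OF assms(1), of g] in auto)
qed

lemma lp_cong_AE:
  assumes "0 < p" "lp p g" "f \<in> borel_measurable borel" "AE x in lborel. f x = g x"
  shows "lp p f" and "lpn p f = lpn p g"
proof -
  have a: "AE x in lborel. norm (f x) \<le> norm (g x)" "AE x in lborel. norm (g x) \<le> norm (f x)"
    using assms(4) by auto
  show lf: "lp p f" using lp_dominated(1)[OF assms(1-3) a(1)] .
  show "lpn p f = lpn p g"
    using lp_dominated(2)[OF assms(1-3) a(1)] lp_dominated(2)[OF assms(1) lf lp_measurable[OF assms(2)] a(2)] by simp
qed

lemma lp_scaleR:
  assumes "0 < p" "lp p f"
  shows "lp p (\<lambda>x. c *\<^sub>R f x)" and "lpn p (\<lambda>x. c *\<^sub>R f x) = \<bar>c\<bar> * lpn p f"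
proof -
  have e: "norm (c *\<^sub>R f x) powr p = \<bar>c\<bar> powr p * norm (f x) powr p" for x
    by (simp add: powr_mult)
  have [measurable]: "f \<in> borel_measurable borel" using assms by (simp add: lp_def)
  show "lp p (\<lambda>x. c *\<^sub>R f x)" using assms unfolding lp_def e by auto
  show "lpn p (\<lambda>x. c *\<^sub>R f x) = \<bar>c\<bar> * lpn p f"
    unfolding lpn_def e using assms by (simp add: powr_mult powr_powr)
qed

lemma powr_convex_nonneg:
  fixes x y :: real
  assumes "1 \<le> p" "0 \<le> s" "0 \<le> t" "s + t = 1" "0 \<le> x" "0 \<le> y"
  shows "(s * x + t * y) powr p \<le> s * x powr p + t * y powr p"
proof -
  have *: "(t * y) powr p \<le> t * y powr p" if "0 \<le> t" "t \<le> 1" "0 \<le> y" for t y :: real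
  proof -
    have "t powr p \<le> t" using powr_mono'[of 1 p t] that assms(1) by (cases "t = 0") auto
    then show ?thesis using that by (simp add: powr_mult mult_right_mono)
  qed
  show ?thesis
  proof (cases "x = 0 \<or> y = 0")
    case True
    then show ?thesis using *[of t y] *[of s x] assms by auto
  next
    case False
    then show ?thesis
      using powr_convex[OF assms(1)] assms by (auto simp: convex_on_def)
  qed
qed

lemma lp_add:
  fixes f g :: "'a::euclidean_space \<Rightarrow> 'b::euclidean_space"
  assumes p: "1 \<le> p" and f: "lp p f" and g: "lp p g"
  shows "lp p (\<lambda>x. f x + g x)" and "lpn p (\<lambda>x. f x + g x) \<le> lpn p f + lpn p g"
proof -
  have [measurable]: "f \<in> borel_measurable borel" "g \<in> borel_measurable borel"
    using f g by (auto simp: lp_def)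
  have int: "integrable lborel (\<lambda>x. norm (f x) powr p)" "integrable lborel (\<lambda>x. norm (g x) powr p)"
    using f g by (auto simp: lp_def)
  have pw: "norm (f x + g x) powr p \<le> (a + b) powr p * (a / (a + b) * (norm (f x) powr p / a powr p) + b / (a + b) * (norm (g x) powr p / b powr p))"
    if ab: "a > 0" "b > 0" for a b :: real and x
  proof -
    have "norm (f x + g x) powr p \<le> (norm (f x) + norm (g x)) powr p"
      using p by (intro powr_mono2 norm_triangle_ineq) auto
    also have "norm (f x) + norm (g x) = (a + b) * (a / (a + b) * (norm (f x) / a) + b / (a + b) * (norm (g x) / b))"
      using ab by (simp add: distrib_left)
    also have "\<dots> powr p = (a + b) powr p * (a / (a + b) * (norm (f x) / a) + b / (a + b) * (norm (g x) / b)) powr p"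
      by (rule powr_mult)
    also have "\<dots> \<le> (a + b) powr p * (a / (a + b) * (norm (f x) / a) powr p + b / (a + b) * (norm (g x) / b) powr p)"
      using ab p by (intro mult_left_mono powr_convex_nonneg) (auto simp: add_divide_distrib[symmetric])
    finally show ?thesis using ab by (simp add: powr_divide)
  qed
  have i2: "integrable lborel (\<lambda>x. (a + b) powr p * (a / (a + b) * (norm (f x) powr p / a powr p) + b / (a + b) * (norm (g x) powr p / b powr p)))" for a b
    using int by simp
  have i: "integrable lborel (\<lambda>x. norm (f x + g x) powr p)"
    by (rule Bochner_Integration.integrable_bound[OF i2[of 1 1]])
       (auto intro!: AE_I2 order_trans[OF pw[of 1 1]])
  then show "lp p (\<lambda>x. f x + g x)" by (simp add: lp_def)
  show "lpn p (\<lambda>x. f x + g x) \<le> lpn p f + lpn p g"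
  proof (rule field_le_epsilon)
    fix e :: real assume e: "e > 0"
    define a b where "a = lpn p f + e / 2" and "b = lpn p g + e / 2"
    have ab: "a > 0" "b > 0" using e by (auto simp: a_def b_def add_nonneg_pos)
    have fa: "(\<integral>x. norm (f x) powr p \<partial>lborel) \<le> a powr p" and gb: "(\<integral>x. norm (g x) powr p \<partial>lborel) \<le> b powr p"
      using p e by (auto intro!: lpn_leD simp: a_def b_def)
    have "(\<integral>x. norm (f x + g x) powr p \<partial>lborel) \<le>
       (\<integral>x. (a + b) powr p * (a / (a + b) * (norm (f x) powr p / a powr p) + b / (a + b) * (norm (g x) powr p / b powr p)) \<partial>lborel)"
      by (rule Bochner_Integration.integral_mono[OF i i2]) (rule pw[OF ab])
    also have "\<dots> = (a + b) powr p * (a / (a + b) * ((\<integral>x. norm (f x) powr p \<partial>lborel) / a powr p) + b / (a + b) * ((\<integral>x. norm (g x) powr p \<partial>lborel) / b powr p))"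
      using int by simp
    also have "\<dots> \<le> (a + b) powr p * (a / (a + b) * 1 + b / (a + b) * 1)"
      using ab fa gb by (intro mult_left_mono add_mono) (auto simp: divide_le_eq)
    also have "\<dots> = (a + b) powr p" using ab by (simp add: add_divide_distrib[symmetric])
    finally have "lpn p (\<lambda>x. f x + g x) \<le> a + b" using p ab by (intro lpn_leI) auto
    then show "lpn p (\<lambda>x. f x + g x) \<le> lpn p f + lpn p g + e" by (simp add: a_def b_def)
  qed
qed

lemma lp_zero [simp]: "lp p (\<lambda>x. 0)" by (simp add: lp_def)
lemma lpn_zero [simp]: "lpn p (\<lambda>x. 0) = 0" by (simp add: lpn_def)

lemma lp_sum:
  assumes "1 \<le> p" "finite I" "\<And>i. i \<in> I \<Longrightarrow> lp p (f i)"
  shows "lp p (\<lambda>x. \<Sum>i\<in>I. f i x)" "lpn p (\<lambda>x. \<Sum>i\<in>I. f i x) \<le> (\<Sum>i\<in>I. lpn p (f i))"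
proof -
  have "lp p (\<lambda>x. \<Sum>i\<in>I. f i x) \<and> lpn p (\<lambda>x. \<Sum>i\<in>I. f i x) \<le> (\<Sum>i\<in>I. lpn p (f i))"
    using assms(2,3)
  proof (induction I rule: finite_induct)
    case (insert i I)
    then have "lp p (f i)" "lp p (\<lambda>x. \<Sum>i\<in>I. f i x)" "lpn p (\<lambda>x. \<Sum>i\<in>I. f i x) \<le> (\<Sum>i\<in>I. lpn p (f i))" by auto
    with lp_add[OF assms(1) this(1,2)] insert.hyps show ?case by auto
  qed simp
  then show "lp p (\<lambda>x. \<Sum>i\<in>I. f i x)" "lpn p (\<lambda>x. \<Sum>i\<in>I. f i x) \<le> (\<Sum>i\<in>I. lpn p (f i))" by auto
qed

lemma lp_diff:
  fixes f g :: "'a::euclidean_space \<Rightarrow> 'b::euclidean_space"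
  assumes p: "1 \<le> p" and f: "lp p f" and g: "lp p g"
  shows "lp p (\<lambda>x. f x - g x)" and "lpn p (\<lambda>x. f x - g x) \<le> lpn p f + lpn p g"
  using lp_add[OF p f, of "\<lambda>x. (- 1) *\<^sub>R g x"] lp_scaleR[OF _ g, of "- 1"] p by auto

lemma lpn_eq_0:
  assumes "0 < p" "lp p f" "lpn p f = 0"
  shows "AE x in lborel. f x = 0"
proof -
  have "(\<integral>x. norm (f x) powr p \<partial>lborel) = 0" using lpn_powr[OF assms(1), of f] assms by simp
  then have "AE x in lborel. norm (f x) powr p = 0"
    by (subst (asm) integral_nonneg_eq_0_iff_AE) (use assms in \<open>auto simp: lp_def\<close>)
  then show ?thesis by eventually_elim simp
qed

text \<open>Young's inequality, applied after normalizing both factors.\<close>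

lemma hoelder:
  fixes f :: "'a::euclidean_space \<Rightarrow> 'b::euclidean_space" and g :: "'a \<Rightarrow> 'c::euclidean_space"
  assumes pq: "p > 1" "q > 1" "1 / p + 1 / q = 1" and f: "lp p f" and g: "lp q g"
  shows "integrable lborel (\<lambda>x. norm (f x) * norm (g x))"
    and "(\<integral>x. norm (f x) * norm (g x) \<partial>lborel) \<le> lpn p f * lpn q g"
proof -
  have [measurable]: "f \<in> borel_measurable borel" "g \<in> borel_measurable borel"
    using f g by (auto simp: lp_def)
  have int: "integrable lborel (\<lambda>x. norm (f x) powr p)" "integrable lborel (\<lambda>x. norm (g x) powr q)"
    using f g by (auto simp: lp_def)
  have pw: "norm (f x) * norm (g x) \<le> a * b * (norm (f x) powr p / a powr p / p + norm (g x) powr q / b powr q / q)"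
    if ab: "a > 0" "b > 0" for a b :: real and x
  proof -
    have "(norm (f x) / a) * (norm (g x) / b) \<le> (norm (f x) / a) powr p / p + (norm (g x) / b) powr q / q"
      using pq ab by (intro Youngs_inequality) auto
    also have "\<dots> = norm (f x) powr p / a powr p / p + norm (g x) powr q / b powr q / q"
      using ab by (simp add: powr_divide)
    finally have "a * b * ((norm (f x) / a) * (norm (g x) / b)) \<le> a * b * (norm (f x) powr p / a powr p / p + norm (g x) powr q / b powr q / q)"
      using ab by (intro mult_left_mono) auto
    then show ?thesis using ab by simp
  qed
  have i2: "integrable lborel (\<lambda>x. a * b * (norm (f x) powr p / a powr p / p + norm (g x) powr q / b powr q / q))" for a b
    using int by simp
  show i: "integrable lborel (\<lambda>x. norm (f x) * norm (g x))"
    by (rule Bochner_Integration.integrable_bound[OF i2[of 1 1]])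
       (auto intro!: AE_I2 order_trans[OF pw[of 1 1]])
  have *: "(\<integral>x. norm (f x) * norm (g x) \<partial>lborel) \<le> (lpn p f + e) * (lpn q g + e)" if e: "e > 0" for e
  proof -
    define a b where "a = lpn p f + e" and "b = lpn q g + e"
    have ab: "a > 0" "b > 0" using e by (auto simp: a_def b_def add_nonneg_pos)
    have fa: "(\<integral>x. norm (f x) powr p \<partial>lborel) \<le> a powr p" and gb: "(\<integral>x. norm (g x) powr q \<partial>lborel) \<le> b powr q"
      using pq e by (auto intro!: lpn_leD simp: a_def b_def)
    have "(\<integral>x. norm (f x) * norm (g x) \<partial>lborel) \<le>
       (\<integral>x. a * b * (norm (f x) powr p / a powr p / p + norm (g x) powr q / b powr q / q) \<partial>lborel)"
      by (rule Bochner_Integration.integral_mono[OF i i2]) (rule pw[OF ab])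
    also have "\<dots> = a * b * ((\<integral>x. norm (f x) powr p \<partial>lborel) / a powr p / p + (\<integral>x. norm (g x) powr q \<partial>lborel) / b powr q / q)"
      using int by simp
    also have "\<dots> \<le> a * b * (1 / p + 1 / q)"
      using ab fa gb pq by (intro mult_left_mono add_mono divide_right_mono) (auto simp: divide_le_eq)
    finally show ?thesis using pq by (simp add: a_def b_def)
  qed
  have "((\<lambda>e. (lpn p f + e) * (lpn q g + e)) \<longlongrightarrow> (lpn p f + 0) * (lpn q g + 0)) (at_right 0)"
    by (intro tendsto_intros)
  then have "(\<integral>x. norm (f x) * norm (g x) \<partial>lborel) \<le> (lpn p f + 0) * (lpn q g + 0)"
    by (rule tendsto_lowerbound) (use * in \<open>auto simp: eventually_at_filter\<close>)
  then show "(\<integral>x. norm (f x) * norm (g x) \<partial>lborel) \<le> lpn p f * lpn q g" by simp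
qed

text \<open>
  The form of Fatou's lemma used below: a norm bound survives almost sure limits, and the limit is
  in \<open>L\<^sup>p\<close> without any domination.
\<close>

lemma lp_fatou:
  fixes f :: "'a::euclidean_space \<Rightarrow> 'b::euclidean_space"
  assumes p: "0 < p" and F: "\<And>k::nat. lp p (F k)" "\<And>k. lpn p (F k) \<le> c"
    and f: "f \<in> borel_measurable borel" and lim: "AE x in lborel. (\<lambda>k. F k x) \<longlonglongrightarrow> f x"
  shows "lp p f" and "lpn p f \<le> c"
proof -
  have [measurable]: "f \<in> borel_measurable borel" "\<And>k. F k \<in> borel_measurable borel"
    using f F by (auto simp: lp_def)
  have c: "0 \<le> c" using order_trans[OF lpn_nonneg F(2)] .
  have "(\<integral>\<^sup>+x. ennreal (norm (f x) powr p) \<partial>lborel) = (\<integral>\<^sup>+x. liminf (\<lambda>k. ennreal (norm (F k x) powr p)) \<partial>lborel)"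
  proof (rule nn_integral_cong_AE, use lim in eventually_elim)
    fix x assume "(\<lambda>k. F k x) \<longlonglongrightarrow> f x"
    then have "(\<lambda>k. ennreal (norm (F k x) powr p)) \<longlonglongrightarrow> ennreal (norm (f x) powr p)"
      using p by (intro tendsto_ennrealI tendsto_powr' tendsto_norm tendsto_const) auto
    from lim_imp_Liminf[OF trivial_limit_sequentially this]
    show "ennreal (norm (f x) powr p) = liminf (\<lambda>k. ennreal (norm (F k x) powr p))" by (rule sym)
  qed
  also have "\<dots> \<le> liminf (\<lambda>k. \<integral>\<^sup>+x. ennreal (norm (F k x) powr p) \<partial>lborel)"
    by (rule nn_integral_liminf) simp
  also have "\<dots> \<le> ennreal (c powr p)"
  proof (rule Liminf_le)
    show "\<forall>\<^sub>F k in sequentially. (\<integral>\<^sup>+x. ennreal (norm (F k x) powr p) \<partial>lborel) \<le> ennreal (c powr p)"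
    proof (rule always_eventually, rule allI)
      fix k
      have "(\<integral>\<^sup>+x. ennreal (norm (F k x) powr p) \<partial>lborel) = ennreal (\<integral>x. norm (F k x) powr p \<partial>lborel)"
        by (rule nn_integral_eq_integral) (use F in \<open>auto simp: lp_def\<close>)
      then show "(\<integral>\<^sup>+x. ennreal (norm (F k x) powr p) \<partial>lborel) \<le> ennreal (c powr p)"
        using lpn_leD[OF p F(2)] by (simp add: ennreal_leI)
    qed
  qed simp
  finally have le: "(\<integral>\<^sup>+x. ennreal (norm (f x) powr p) \<partial>lborel) \<le> ennreal (c powr p)" .
  then have i: "integrable lborel (\<lambda>x. norm (f x) powr p)"
    by (intro integrableI_bounded) (auto intro: le_less_trans)
  then show "lp p f" by (simp add: lp_def)
  have "ennreal (\<integral>x. norm (f x) powr p \<partial>lborel) = (\<integral>\<^sup>+x. ennreal (norm (f x) powr p) \<partial>lborel)"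
    by (rule nn_integral_eq_integral[symmetric, OF i]) simp
  with le have "ennreal (\<integral>x. norm (f x) powr p \<partial>lborel) \<le> ennreal (c powr p)" by simp
  then have "(\<integral>x. norm (f x) powr p \<partial>lborel) \<le> c powr p" by (subst (asm) ennreal_le_iff) auto
  then show "lpn p f \<le> c" by (rule lpn_leI[OF p c])
qed

lemma lp_dominated_convergence:
  fixes f :: "'a::euclidean_space \<Rightarrow> 'b::euclidean_space" and w :: "'a \<Rightarrow> real"
  assumes p: "0 < p" and F: "\<And>k::nat. F k \<in> borel_measurable borel" and f: "f \<in> borel_measurable borel"
    and lim: "AE x in lborel. (\<lambda>k. F k x) \<longlonglongrightarrow> f x"
    and w: "lp p w" and bd: "\<And>k. AE x in lborel. norm (F k x - f x) \<le> w x"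
  shows "(\<lambda>k. lpn p (\<lambda>x. F k x - f x)) \<longlonglongrightarrow> 0"
proof -
  have [measurable]: "f \<in> borel_measurable borel" "\<And>k. F k \<in> borel_measurable borel" using f F by auto
  have "(\<lambda>k. \<integral>x. norm (F k x - f x) powr p \<partial>lborel) \<longlonglongrightarrow> (\<integral>x. 0 \<partial>(lborel :: 'a measure))"
  proof (rule integral_dominated_convergence)
    show "integrable lborel (\<lambda>x. norm (w x) powr p)" using w by (simp add: lp_def)
    show "AE x in lborel. (\<lambda>k. norm (F k x - f x) powr p) \<longlonglongrightarrow> 0"
      using lim
    proof eventually_elim
      case (elim x)
      then have "(\<lambda>k. norm (F k x - f x)) \<longlonglongrightarrow> 0" by (simp add: LIM_zero tendsto_norm_zero)
      then have "(\<lambda>k. norm (F k x - f x) powr p) \<longlonglongrightarrow> 0 powr p"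
        using p by (intro tendsto_powr' tendsto_const) auto
      then show ?case using p by simp
    qed
    show "AE x in lborel. norm (norm (F k x - f x) powr p) \<le> norm (w x) powr p" for k
      using bd[of k] by eventually_elim (use p in \<open>auto intro!: powr_mono2 simp: abs_if\<close>)
  qed simp_all
  then have "(\<lambda>k. (\<integral>x. norm (F k x - f x) powr p \<partial>lborel) powr (1 / p)) \<longlonglongrightarrow> 0 powr (1 / p)"
    using p by (intro tendsto_powr' tendsto_const) (auto intro!: always_eventually)
  then show ?thesis by (simp add: lpn_def)
qed

text \<open>
  Completeness: a subsequence with summable increments converges almost everywhere, because the
  sum of the absolute increments is in \<open>L\<^sup>p\<close>, hence finite; Fatou's lemma gives convergence in norm.
\<close>

lemma lp_complete:
  fixes F :: "nat \<Rightarrow> 'a::euclidean_space \<Rightarrow> 'b::euclidean_space"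
  assumes p: "1 \<le> p" and F: "\<And>k. lp p (F k)"
    and cauchy: "\<And>e. e > 0 \<Longrightarrow> \<exists>N. \<forall>k\<ge>N. \<forall>l\<ge>N. lpn p (\<lambda>x. F k x - F l x) \<le> e"
  shows "\<exists>f. lp p f \<and> (\<lambda>k. lpn p (\<lambda>x. F k x - f x)) \<longlonglongrightarrow> 0"
proof -
  have p0: "0 < p" using p by simp
  have [measurable]: "F k \<in> borel_measurable borel" for k using F by (simp add: lp_def)
  obtain N where N: "\<And>e k l. e > 0 \<Longrightarrow> N e \<le> k \<Longrightarrow> N e \<le> l \<Longrightarrow> lpn p (\<lambda>x. F k x - F l x) \<le> e"
    using cauchy by metis
  \<comment> \<open>Adding up the thresholds makes them monotone, and the summand \<open>j\<close> makes \<open>r\<close> unbounded.\<close>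
  define r where "r j = (\<Sum>i\<le>j. N ((1/2) ^ i)) + j" for j
  have rN: "N ((1/2) ^ j) \<le> r i" if "j \<le> i" for i j
  proof -
    have "N ((1/2) ^ j) \<le> (\<Sum>i\<le>i. N ((1/2) ^ i))" using that by (intro member_le_sum) auto
    then show ?thesis by (simp add: r_def)
  qed
  define d where "d j x = F (r (Suc j)) x - F (r j) x" for j x
  have d: "lp p (\<lambda>x. norm (d j x))" "lpn p (\<lambda>x. norm (d j x)) \<le> (1/2) ^ j" for j
  proof -
    have l: "lp p (d j)" unfolding d_def by (intro lp_diff p F)
    show "lp p (\<lambda>x. norm (d j x))" using l by (auto simp: lp_def)
    have "lpn p (\<lambda>x. norm (d j x)) = lpn p (d j)" by (simp add: lpn_def)
    also have "\<dots> \<le> (1/2) ^ j" unfolding d_def by (intro N rN) auto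
    finally show "lpn p (\<lambda>x. norm (d j x)) \<le> (1/2) ^ j" .
  qed
  have [measurable]: "d j \<in> borel_measurable borel" for j unfolding d_def by measurable
  define G where "G K x = (\<Sum>j<K. norm (d j x))" for K x
  have G: "lp p (G K)" "lpn p (G K) \<le> 2" for K
  proof -
    show "lp p (G K)" unfolding G_def by (intro lp_sum p d) auto
    have "lpn p (G K) \<le> (\<Sum>j<K. lpn p (\<lambda>x. norm (d j x)))" unfolding G_def by (intro lp_sum p d) auto
    also have "\<dots> \<le> (\<Sum>j<K. (1/2) ^ j)" by (intro sum_mono d)
    also have "\<dots> \<le> (\<Sum>j. (1/2) ^ j)" by (intro sum_le_suminf summable_geometric) auto
    also have "\<dots> = 2" by (subst suminf_geometric) auto
    finally show "lpn p (G K) \<le> 2" .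
  qed
  have [measurable]: "G K \<in> borel_measurable borel" for K using G(1)[of K] by (simp add: lp_def)
  have "(\<integral>\<^sup>+x. (SUP K. ennreal (norm (G K x) powr p)) \<partial>lborel) = (SUP K. \<integral>\<^sup>+x. ennreal (norm (G K x) powr p) \<partial>lborel)"
  proof (rule nn_integral_monotone_convergence_SUP)
    show "incseq (\<lambda>K x. ennreal (norm (G K x) powr p))"
      unfolding incseq_def le_fun_def
    proof (intro allI impI ennreal_leI powr_mono2)
      fix K L x assume "K \<le> (L::nat)"
      then have "G K x \<le> G L x" unfolding G_def by (intro sum_mono2) auto
      then show "norm (G K x) \<le> norm (G L x)" by (simp add: G_def sum_nonneg)
    qed (use p0 in auto)
    show "(\<lambda>x. ennreal (norm (G K x) powr p)) \<in> borel_measurable lborel" for K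
      by simp
  qed
  also have "\<dots> \<le> ennreal (2 powr p)"
  proof (rule SUP_least)
    fix K
    have "(\<integral>\<^sup>+x. ennreal (norm (G K x) powr p) \<partial>lborel) = ennreal (\<integral>x. norm (G K x) powr p \<partial>lborel)"
      by (rule nn_integral_eq_integral) (use G in \<open>auto simp: lp_def\<close>)
    then show "(\<integral>\<^sup>+x. ennreal (norm (G K x) powr p) \<partial>lborel) \<le> ennreal (2 powr p)"
      using lpn_leD[OF p0 G(2)] by (simp add: ennreal_leI)
  qed
  finally have fin: "(\<integral>\<^sup>+x. (SUP K. ennreal (norm (G K x) powr p)) \<partial>lborel) \<le> ennreal (2 powr p)" .
  have "AE x in lborel. (SUP K. ennreal (norm (G K x) powr p)) \<noteq> \<infinity>"
  proof (rule nn_integral_noteq_infinite)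
    show "(\<lambda>x. SUP K. ennreal (norm (G K x) powr p)) \<in> borel_measurable lborel" by simp
    show "(\<integral>\<^sup>+x. (SUP K. ennreal (norm (G K x) powr p)) \<partial>lborel) \<noteq> \<infinity>"
      using le_less_trans[OF fin ennreal_less_top] by (simp add: less_top)
  qed
  then have conv: "AE x in lborel. convergent (\<lambda>j. F (r j) x)"
  proof eventually_elim
    case (elim x)
    then obtain b where b: "(SUP K. ennreal (norm (G K x) powr p)) = ennreal b" "0 \<le> b"
      by (cases "SUP K. ennreal (norm (G K x) powr p)") auto
    have "G K x \<le> b powr (1 / p)" for K
    proof -
      have "ennreal (norm (G K x) powr p) \<le> ennreal b" unfolding b(1)[symmetric] by (rule SUP_upper) simp
      then have "norm (G K x) powr p \<le> b" using b by (simp add: ennreal_le_iff)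
      then have "(norm (G K x) powr p) powr (1 / p) \<le> b powr (1 / p)" using p0 by (intro powr_mono2) auto
      then show ?thesis using p0 by (simp add: powr_powr)
    qed
    then have "summable (\<lambda>j. norm (d j x))"
      by (intro summableI_nonneg_bounded[of _ "b powr (1 / p)"]) (auto simp: G_def)
    then have "summable (\<lambda>j. d j x)" by (rule summable_norm_cancel)
    then have "convergent (\<lambda>K. \<Sum>j<K. d j x)" by (simp add: summable_iff_convergent)
    moreover have "(\<Sum>j<K. d j x) = F (r K) x - F (r 0) x" for K
      unfolding d_def by (rule sum_lessThan_telescope)
    ultimately show ?case by (simp add: convergent_diff_const_right_iff)
  qed
  define f where "f x = lim (\<lambda>j. F (r j) x)" for x
  have fm [measurable]: "f \<in> borel_measurable borel" unfolding f_def by measurable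
  have lim: "AE x in lborel. (\<lambda>j. F (r j) x) \<longlonglongrightarrow> f x"
    using conv by eventually_elim (simp add: f_def convergent_LIMSEQ_iff)
  have est: "lp p (\<lambda>x. F k x - f x)" "lpn p (\<lambda>x. F k x - f x) \<le> (1/2) ^ i" if k: "N ((1/2) ^ i) \<le> k" for k i
  proof -
    have 1: "lp p (\<lambda>x. F k x - F (r (j + i)) x)" "lpn p (\<lambda>x. F k x - F (r (j + i)) x) \<le> (1/2) ^ i" for j
      by (intro lp_diff p F, intro N rN k) auto
    have 2: "AE x in lborel. (\<lambda>j. F k x - F (r (j + i)) x) \<longlonglongrightarrow> F k x - f x"
      using lim by eventually_elim (intro tendsto_diff tendsto_const, rule LIMSEQ_ignore_initial_segment)
    show "lp p (\<lambda>x. F k x - f x)" "lpn p (\<lambda>x. F k x - f x) \<le> (1/2) ^ i"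
      by (rule lp_fatou[OF p0 1 _ 2], simp)+
  qed
  have "lp p (\<lambda>x. F (N ((1/2) ^ 0)) x - f x)" by (rule est(1)) (rule order_refl)
  from lp_diff(1)[OF p F[of "N ((1/2) ^ 0)"] this] have "lp p f" by simp
  moreover have "(\<lambda>k. lpn p (\<lambda>x. F k x - f x)) \<longlonglongrightarrow> 0"
  proof (rule LIMSEQ_I)
    fix e :: real assume "e > 0"
    then obtain i where i: "(1/2) ^ i < e" using real_arch_pow_inv[of e "1/2"] by auto
    show "\<exists>M. \<forall>k\<ge>M. norm (lpn p (\<lambda>x. F k x - f x) - 0) < e"
      using est(2)[of i] i by (intro exI[of _ "N ((1/2) ^ i)"]) (auto intro: le_less_trans)
  qed
  ultimately show ?thesis by blast
qed

lemma lp_wt: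
  assumes "1 \<le> p" shows "lp p (wt :: real ^ 'n \<Rightarrow> real)"
proof -
  have "norm (norm (wt x) powr p) \<le> 1 * wt x" for x :: "real ^ 'n"
    using powr_mono'[OF assms, of "wt x"] wt_le_1[of x] wt_pos[of x] by simp
  then have "integrable lborel (\<lambda>x :: real ^ 'n. norm (wt x) powr p)"
    by (intro integrable_wt_bound[of _ 1]) simp_all
  then show ?thesis by (simp add: lp_def)
qed

lemma lp_wt_bound:
  fixes f :: "real ^ 'n \<Rightarrow> 'b::euclidean_space"
  assumes "1 \<le> p" "f \<in> borel_measurable borel" "\<And>x. norm (f x) \<le> C * wt x"
  shows "lp p f" "lpn p f \<le> C * lpn p (wt :: real ^ 'n \<Rightarrow> real)"
proof -
  have C: "0 \<le> C" using wt_const_nonneg[OF assms(3) norm_ge_zero] .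
  have l: "lp p (\<lambda>x :: real ^ 'n. C *\<^sub>R wt x)" "lpn p (\<lambda>x :: real ^ 'n. C *\<^sub>R wt x) = C * lpn p (wt :: real ^ 'n \<Rightarrow> real)"
    using lp_scaleR[OF _ lp_wt[OF assms(1)], of C] assms(1) C by auto
  have a: "AE x in lborel. norm (f x) \<le> norm (C *\<^sub>R wt x)"
    using assms(3) C by simp
  show "lp p f" "lpn p f \<le> C * lpn p (wt :: real ^ 'n \<Rightarrow> real)"
    using lp_dominated[OF _ l(1) assms(2) a] assms(1) l(2) by auto
qed

lemma schwartz_lp:
  fixes \<phi> :: "real ^ 'n \<Rightarrow> complex"
  assumes "1 \<le> p" "\<phi> \<in> schwartz"
  shows "lp p \<phi>"
proof -
  obtain C where "dbound 0 (\<lambda>x. C * wt x) \<phi>" using schwartz_wt[OF assms(2)] by blast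
  then show ?thesis using lp_wt_bound(1)[OF assms(1) schwartz_measurable[OF assms(2)], of C] by (simp add: dbound_0)
qed

section \<open>Density of the band-limited Schwartz functions\<close>

definition cpt :: "real \<Rightarrow> (real ^ 'n \<Rightarrow> complex) \<Rightarrow> bool"
  where "cpt R f \<longleftrightarrow> f \<in> borel_measurable borel \<and> (\<exists>C\<ge>0. \<forall>x. norm (f x) \<le> C * indicator (cball 0 R) x)"

lemma cpt_wt:
  assumes "cpt R f"
  shows "\<exists>C. \<forall>x. norm ((1 + norm x)\<^sup>2 * norm (f x)) \<le> C * wt (x :: real ^ 'n)"
proof -
  obtain C where C: "\<And>x. norm (f x) \<le> C * indicator (cball 0 R) x" using assms by (auto simp: cpt_def)
  define D where "D = (1 + \<bar>R\<bar>) ^ 2 * \<bar>C\<bar> * (1 + \<bar>R\<bar>) ^ (2 * CARD('n))"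
  have "norm ((1 + norm x)\<^sup>2 * norm (f x)) \<le> D * wt x" for x
  proof (cases "norm x \<le> R")
    case True
    then have r: "1 + norm x \<le> 1 + \<bar>R\<bar>" by simp
    have f: "norm (f x) \<le> \<bar>C\<bar>" using C[of x] True by (simp add: indicator_def)
    have "(1 + norm x)\<^sup>2 * norm (f x) * (1 + norm x) ^ (2 * CARD('n)) \<le> D"
      unfolding D_def by (intro mult_mono power_mono r f) (auto intro!: mult_nonneg_nonneg zero_le_power)
    moreover have "0 < (1 + norm x) ^ (2 * CARD('n))" by (intro zero_less_power add_pos_nonneg) auto
    ultimately show ?thesis unfolding wt_def by (simp add: pos_le_divide_eq abs_mult)
  next
    case False
    then have "f x = 0" using C[of x] by simp
    then show ?thesis by (simp add: D_def)
  qed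
  then show ?thesis by blast
qed

lemma cpt_integrable2:
  fixes f :: "real ^ 'n \<Rightarrow> complex"
  assumes "cpt R f" shows "integrable lborel (\<lambda>x. (1 + norm x)\<^sup>2 * norm (f x))"
proof -
  have [measurable]: "f \<in> borel_measurable borel" using assms by (simp add: cpt_def)
  obtain C where C: "\<And>x. norm ((1 + norm x)\<^sup>2 * norm (f x)) \<le> C * wt x" using cpt_wt[OF assms] by blast
  show ?thesis by (rule integrable_wt_bound[OF _ C]) simp
qed

lemma cpt_coord:
  fixes f :: "real ^ 'n \<Rightarrow> complex"
  assumes "cpt R f" shows "cpt R (\<lambda>x. \<i> * complex_of_real (x $ i) * f x)"
proof -
  obtain C where C: "\<And>x. norm (f x) \<le> C * indicator (cball 0 R) x" "0 \<le> C" and [measurable]: "f \<in> borel_measurable borel"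
    using assms by (auto simp: cpt_def)
  have "norm (\<i> * complex_of_real (x $ i) * f x) \<le> (\<bar>R\<bar> * C) * indicator (cball 0 R) x" for x
  proof (cases "norm x \<le> R")
    case True
    then have "\<bar>x $ i\<bar> \<le> \<bar>R\<bar>" using component_le_norm_cart[of x i] by simp
    moreover have "norm (f x) \<le> C" using C(1)[of x] True by simp
    ultimately show ?thesis using True by (auto simp: norm_mult intro!: mult_mono)
  qed (use C(1)[of x] in simp)
  then show ?thesis unfolding cpt_def using C(2) by (intro conjI exI[of _ "\<bar>R\<bar> * C"]) auto
qed

text \<open>
  Differentiation under the transform multiplies by coordinates, which preserves bounded functions
  of compact support; so the transform is smooth by coinduction.
\<close>

lemma smooth_fourier_cpt:
  fixes f :: "real ^ 'n \<Rightarrow> complex"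
  assumes "cpt R f" shows "smooth (fourier f)"
proof (rule smooth_coinduct[where P="\<lambda>h. \<exists>f. h = fourier f \<and> cpt R f"])
  fix h :: "real ^ 'n \<Rightarrow> complex" assume "\<exists>f. h = fourier f \<and> cpt R f"
  then obtain f where h: "h = fourier f" and f: "cpt R f" by blast
  have m: "f \<in> borel_measurable borel" using f by (simp add: cpt_def)
  have "h differentiable (at x)" for x
    unfolding h differentiable_def using fourier_has_derivative[OF m cpt_integrable2[OF f]] by blast
  moreover have "\<exists>f. partial i h = fourier f \<and> cpt R f" for i
    unfolding h partial_fourier[OF m cpt_integrable2[OF f]] using cpt_coord[OF f] by blast
  ultimately show "(\<forall>x. h differentiable (at x)) \<and> (\<forall>i. \<exists>f. partial i h = fourier f \<and> cpt R f)" by blast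
qed (use assms in blast)

text \<open>
  The functions in the closure of the band-limited ones, which turn out to be all of \<open>L\<^sup>p\<close>.
\<close>

definition apx :: "real \<Rightarrow> (real ^ 'n \<Rightarrow> complex) \<Rightarrow> bool"
  where "apx p f \<longleftrightarrow> lp p f \<and> (\<forall>e>0. \<exists>g. testfun g \<and> lpn p (\<lambda>x. f x - inv_fourier g x) < e)"

lemma testfun_dilation:
  assumes "testfun f" "0 < e" shows "testfun (\<lambda>x. f (e *\<^sub>R x))"
proof -
  obtain R where "\<And>x. norm x > R \<Longrightarrow> f x = 0" using assms(1) by (auto simp: testfun_def)
  then have "norm x > R / e \<Longrightarrow> f (e *\<^sub>R x) = 0" for x using assms(2) by (simp add: divide_less_eq mult.commute)
  then show ?thesis using assms smooth_dilation[of f e] by (auto simp: testfun_def)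
qed

lemma testfun_lp: "1 \<le> p \<Longrightarrow> testfun g \<Longrightarrow> lp p (inv_fourier g)"
  by (intro schwartz_lp schwartz_inv_fourier testfun_schwartz)

lemma testfun_fourier_integrable: "testfun g \<Longrightarrow> integrable lborel g"
  by (intro schwartz_integrable testfun_schwartz)

lemma inv_fourier_add:
  "integrable lborel f \<Longrightarrow> integrable lborel g \<Longrightarrow> inv_fourier (\<lambda>x. f x + g x) y = inv_fourier f y + inv_fourier g y"
  by (simp add: inv_fourier_minus fourier_add)

lemma inv_fourier_mult: "inv_fourier (\<lambda>x. c * f x) y = c * inv_fourier f y"
  by (simp add: inv_fourier_minus fourier_mult)

lemma inv_fourier_sum:
  "finite I \<Longrightarrow> (\<And>i. i \<in> I \<Longrightarrow> integrable lborel (f i)) \<Longrightarrow> inv_fourier (\<lambda>x. \<Sum>i\<in>I. f i x) y = (\<Sum>i\<in>I. inv_fourier (f i) y)"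
  by (simp add: inv_fourier_minus fourier_sum)

lemma apx_add:
  assumes p: "1 \<le> p" and f: "apx p f" and g: "apx p g"
  shows "apx p (\<lambda>x. f x + g x)"
  unfolding apx_def
proof (intro conjI allI impI)
  have l: "lp p f" "lp p g" using f g by (auto simp: apx_def)
  then show "lp p (\<lambda>x. f x + g x)" by (intro lp_add p)
  fix e :: real assume e: "e > 0"
  obtain f' where f': "testfun f'" "lpn p (\<lambda>x. f x - inv_fourier f' x) < e / 2"
    using f e unfolding apx_def by (meson half_gt_zero)
  obtain g' where g': "testfun g'" "lpn p (\<lambda>x. g x - inv_fourier g' x) < e / 2"
    using g e unfolding apx_def by (meson half_gt_zero)
  have "lpn p (\<lambda>x. (f x - inv_fourier f' x) + (g x - inv_fourier g' x)) \<le> lpn p (\<lambda>x. f x - inv_fourier f' x) + lpn p (\<lambda>x. g x - inv_fourier g' x)"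
    by (intro lp_add lp_diff p l testfun_lp f' g')
  also have "\<dots> < e" using f' g' by simp
  also have "(\<lambda>x. (f x - inv_fourier f' x) + (g x - inv_fourier g' x)) = (\<lambda>x. f x + g x - inv_fourier (\<lambda>x. f' x + g' x) x)"
    by (rule ext, subst inv_fourier_add) (auto intro: testfun_fourier_integrable f' g')
  finally show "\<exists>h. testfun h \<and> lpn p (\<lambda>x. f x + g x - inv_fourier h x) < e"
    using testfun_add[OF f'(1) g'(1)] by blast
qed

lemma lp_cmult:
  fixes f :: "'a::euclidean_space \<Rightarrow> complex"
  assumes "0 < p" "lp p f"
  shows "lp p (\<lambda>x. c * f x)" "lpn p (\<lambda>x. c * f x) = norm c * lpn p f"
proof -
  have [measurable]: "f \<in> borel_measurable borel" using assms by (simp add: lp_def)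
  have e: "norm (c * f x) powr p = norm c powr p * norm (f x) powr p" for x by (simp add: norm_mult powr_mult)
  show "lp p (\<lambda>x. c * f x)" using assms unfolding lp_def e by auto
  show "lpn p (\<lambda>x. c * f x) = norm c * lpn p f"
    unfolding lpn_def e using assms by (simp add: powr_mult powr_powr)
qed

lemma testfun_cmult: "testfun f \<Longrightarrow> testfun (\<lambda>x. c * f x)"
  using testfun_mult[of f "\<lambda>x. c"] by simp

lemma apx_cmult:
  assumes p: "1 \<le> p" and f: "apx p f"
  shows "apx p (\<lambda>x. c * f x)"
  unfolding apx_def
proof (intro conjI allI impI)
  have l: "lp p f" using f by (auto simp: apx_def)
  then show "lp p (\<lambda>x. c * f x)" using p by (intro lp_cmult) auto
  fix e :: real assume e: "e > 0"
  have e': "e / (norm c + 1) > 0" using e by (simp add: add_nonneg_pos)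
  obtain f' where f': "testfun f'" "lpn p (\<lambda>x. f x - inv_fourier f' x) < e / (norm c + 1)"
    using f e' unfolding apx_def by meson
  have "lpn p (\<lambda>x. c * (f x - inv_fourier f' x)) = norm c * lpn p (\<lambda>x. f x - inv_fourier f' x)"
    using p by (intro lp_cmult lp_diff l testfun_lp f') auto
  also have "\<dots> \<le> norm c * (e / (norm c + 1))" using f' by (intro mult_left_mono) auto
  also have "\<dots> < e"
    using e by (simp add: divide_less_eq add_nonneg_pos distrib_left mult.commute)
  also have "(\<lambda>x. c * (f x - inv_fourier f' x)) = (\<lambda>x. c * f x - inv_fourier (\<lambda>x. c * f' x) x)"
    by (rule ext) (simp add: inv_fourier_mult right_diff_distrib)
  finally show "\<exists>h. testfun h \<and> lpn p (\<lambda>x. c * f x - inv_fourier h x) < e"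
    using testfun_cmult[OF f'(1)] by blast
qed

lemma apx_limit:
  fixes F :: "nat \<Rightarrow> real ^ 'n \<Rightarrow> complex"
  assumes p: "1 \<le> p" and F: "\<And>k. apx p (F k)" and f: "lp p f"
    and lim: "(\<lambda>k. lpn p (\<lambda>x. F k x - f x)) \<longlonglongrightarrow> 0"
  shows "apx p f"
  unfolding apx_def
proof (intro conjI allI impI)
  fix e :: real assume e: "e > 0"
  have l: "lp p (F k)" for k using F by (auto simp: apx_def)
  obtain k where k: "lpn p (\<lambda>x. F k x - f x) < e / 2"
    using order_tendstoD(2)[OF lim, of "e / 2"] e by (auto simp: eventually_sequentially)
  obtain g where g: "testfun g" "lpn p (\<lambda>x. F k x - inv_fourier g x) < e / 2"
    using F[of k] e unfolding apx_def by (meson half_gt_zero)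
  have "lpn p (\<lambda>x. (F k x - inv_fourier g x) - (F k x - f x)) \<le> lpn p (\<lambda>x. F k x - inv_fourier g x) + lpn p (\<lambda>x. F k x - f x)"
    by (intro lp_diff p l f testfun_lp g)
  also have "\<dots> < e" using k g by simp
  finally have "lpn p (\<lambda>x. f x - inv_fourier g x) < e" by simp
  then show "\<exists>h. testfun h \<and> lpn p (\<lambda>x. f x - inv_fourier h x) < e" using g(1) by blast
qed (rule f)

text \<open>
  Multiplying the transform of \<open>f\<close> by a dilated cut-off amounts to convolving \<open>f\<close> with an
  approximate identity. For a bounded \<open>f\<close> of compact support all of these convolutions are
  dominated by one multiple of the weight, so they converge in \<open>L\<^sup>p\<close> as soon as they converge
  at almost every point.
\<close>

lemma apx_cpt:
  fixes f :: "real ^ 'n \<Rightarrow> complex"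
  assumes p: "1 \<le> p" and f: "cpt R f" and cont: "AE x in lborel. isCont f x"
  shows "apx p f"
proof -
  obtain C where C: "\<And>x. norm (f x) \<le> C * indicator (cball 0 R) x" and C0: "0 \<le> C"
    and [measurable]: "f \<in> borel_measurable borel"
    using f by (auto simp: cpt_def)
  define c where "c = complex_of_real (fconst TYPE('n))"
  have cutS: "(cutoff :: real ^ 'n \<Rightarrow> complex) \<in> schwartz" by (rule testfun_schwartz[OF testfun_cutoff])
  obtain D1 where D1: "\<And>x. norm ((1 + norm x)\<^sup>2 * norm (f x)) \<le> D1 * wt x" using cpt_wt[OF f] by blast
  have fw: "norm (f x) \<le> D1 * wt x" for x
  proof -
    have "1 * norm (f x) \<le> (1 + norm x)\<^sup>2 * norm (f x)" by (intro mult_right_mono) (auto simp: power2_sum)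
    also have "\<dots> \<le> D1 * wt x" using D1[of x] by (simp add: abs_mult)
    finally show ?thesis by simp
  qed
  have int_f: "integrable lborel f" by (rule integrable_wt_bound[OF _ fw]) simp
  define k where "k = fourier (cutoff :: real ^ 'n \<Rightarrow> complex)"
  have kS: "k \<in> schwartz" unfolding k_def by (rule schwartz_fourier[OF cutS])
  note [measurable] = schwartz_measurable[OF kS]
  have k1: "c * (\<integral>y. k y \<partial>lborel) = 1"
  proof -
    have "inv_fourier k 0 = cutoff (0 :: real ^ 'n)" unfolding k_def using schwartz_fourier_inv(2)[OF cutS] by simp
    then show ?thesis by (simp add: inv_fourier_minus fourier_alt c_def cutoff_0)
  qed
  obtain D where D: "0 \<le> D" "\<And>y. norm (k y) \<le> D * (1 / (1 + norm y) ^ (4 * CARD('n)))"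
    using schwartz_dbound[OF kS, of 0 "4 * CARD('n)"] by (auto simp: dbound_0)
  have D': "norm (k y) \<le> D * (wt y * wt y)" for y
    using D(2)[of y] by (simp add: wt_def power_add[symmetric])
  define M where "M = C * D * (1 + \<bar>R\<bar>) ^ (2 * CARD('n))"
  have M0: "0 \<le> M" using C0 D(1) by (simp add: M_def)
  have bd: "norm (f (x + e *\<^sub>R y) * k y) \<le> M * wt x * wt y" if e: "0 < e" "e \<le> 1" for x y e
  proof (cases "norm (x + e *\<^sub>R y) \<le> R")
    case True
    have "norm x \<le> norm (x + e *\<^sub>R y) + norm (e *\<^sub>R y)" using norm_triangle_ineq4[of "x + e *\<^sub>R y" "e *\<^sub>R y"] by simp
    also have "norm (e *\<^sub>R y) \<le> norm y" using e by (simp add: mult_left_le_one_le)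
    finally have "1 + norm x \<le> 1 + \<bar>R\<bar> + norm y" using True by simp
    also have "\<dots> \<le> (1 + \<bar>R\<bar>) * (1 + norm y)" by (simp add: algebra_simps)
    finally have "(1 + norm x) ^ (2 * CARD('n)) \<le> ((1 + \<bar>R\<bar>) * (1 + norm y)) ^ (2 * CARD('n))"
      by (intro power_mono) auto
    then have "(1 + norm x) ^ (2 * CARD('n)) \<le> (1 + \<bar>R\<bar>) ^ (2 * CARD('n)) * (1 + norm y) ^ (2 * CARD('n))"
      by (simp only: power_mult_distrib)
    then have w: "wt y \<le> (1 + \<bar>R\<bar>) ^ (2 * CARD('n)) * wt x"
      by (simp add: wt_def divide_le_eq le_divide_eq mult.commute add_pos_nonneg del: power_mono_iff)
    have "norm (f (x + e *\<^sub>R y) * k y) \<le> C * (D * (wt y * wt y))"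
      unfolding norm_mult using C[of "x + e *\<^sub>R y"] True C0 D' by (intro mult_mono) auto
    also have "\<dots> \<le> C * (D * (((1 + \<bar>R\<bar>) ^ (2 * CARD('n)) * wt x) * wt y))"
      using C0 D(1) w by (intro mult_left_mono mult_right_mono) auto
    finally show ?thesis by (simp add: M_def ac_simps)
  next
    case False
    then have "f (x + e *\<^sub>R y) = 0" using C[of "x + e *\<^sub>R y"] by simp
    then show ?thesis using M0 by simp
  qed
  define h where "h j = 1 / real (Suc j)" for j
  have h: "0 < h j" "h j \<le> 1" for j by (auto simp: h_def)
  have h0: "h \<longlonglongrightarrow> 0" using LIMSEQ_inverse_real_of_nat by (simp add: h_def[abs_def] inverse_eq_divide)
  define g where "g j \<xi> = cutoff (h j *\<^sub>R \<xi>) * fourier f \<xi>" for j \<xi>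
  have tg: "testfun (g j)" for j
    unfolding g_def using testfun_mult[OF testfun_dilation[OF testfun_cutoff h(1)] smooth_fourier_cpt[OF f]]
    by (simp add: mult.commute)
  have ig: "inv_fourier (g j) x = c * (\<integral>y. f (x + h j *\<^sub>R y) * k y \<partial>lborel)" for j x
    unfolding g_def k_def c_def
    by (rule regularized_inverse[OF int_f testfun_fourier_integrable[OF testfun_cutoff] h(1)])
  define M1 where "M1 = norm c * (M * (\<integral>y. wt (y :: real ^ 'n) \<partial>lborel))"
  have igb: "norm (inv_fourier (g j) x) \<le> M1 * wt x" for j x
  proof -
    have "norm (\<integral>y. f (x + h j *\<^sub>R y) * k y \<partial>lborel) \<le> (\<integral>y. norm (f (x + h j *\<^sub>R y) * k y) \<partial>lborel)"
      by (rule integral_norm_bound)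
    also have "\<dots> \<le> (\<integral>y. M * wt x * wt (y :: real ^ 'n) \<partial>lborel)"
      by (rule integral_mono') (use bd[OF h] wt_integrable M0 in auto)
    finally have "norm (\<integral>y. f (x + h j *\<^sub>R y) * k y \<partial>lborel) \<le> M * wt x * (\<integral>y. wt (y :: real ^ 'n) \<partial>lborel)"
      by simp
    from mult_left_mono[OF this norm_ge_zero[of c]]
    show ?thesis unfolding ig norm_mult M1_def by (simp add: ac_simps)
  qed
  have "(\<lambda>j. lpn p (\<lambda>x. inv_fourier (g j) x - f x)) \<longlonglongrightarrow> 0"
  proof (rule lp_dominated_convergence)
    show "0 < p" using p by simp
    show "inv_fourier (g j) \<in> borel_measurable borel" for j
      by (rule lp_measurable[OF testfun_lp[OF p tg]])
    show "lp p (\<lambda>x :: real ^ 'n. (M1 + D1) *\<^sub>R wt x)" using p by (intro lp_scaleR lp_wt) auto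
    show "AE x in lborel. norm (inv_fourier (g j) x - f x) \<le> (M1 + D1) *\<^sub>R wt x" for j
    proof (rule AE_I2)
      fix x
      have "norm (inv_fourier (g j) x - f x) \<le> norm (inv_fourier (g j) x) + norm (f x)" by (rule norm_triangle_ineq4)
      then show "norm (inv_fourier (g j) x - f x) \<le> (M1 + D1) *\<^sub>R wt x"
        using igb[of j x] fw[of x] by (simp add: distrib_right)
    qed
    show "AE x in lborel. (\<lambda>j. inv_fourier (g j) x) \<longlonglongrightarrow> f x"
      using cont
    proof eventually_elim
      case (elim x)
      have "(\<lambda>j. \<integral>y. f (x + h j *\<^sub>R y) * k y \<partial>lborel) \<longlonglongrightarrow> (\<integral>y. f x * k y \<partial>lborel)"
      proof (rule integral_dominated_convergence)
        show "integrable lborel (\<lambda>y :: real ^ 'n. M * wt x * wt y)" by (intro integrable_mult_right wt_integrable)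
        show "AE y in lborel. (\<lambda>j. f (x + h j *\<^sub>R y) * k y) \<longlonglongrightarrow> f x * k y"
        proof (rule AE_I2)
          fix y
          have "(\<lambda>j. x + h j *\<^sub>R y) \<longlonglongrightarrow> x + 0 *\<^sub>R y" by (intro tendsto_intros h0)
          then have "(\<lambda>j. x + h j *\<^sub>R y) \<longlonglongrightarrow> x" by simp
          from isCont_tendsto_compose[OF elim this]
          show "(\<lambda>j. f (x + h j *\<^sub>R y) * k y) \<longlonglongrightarrow> f x * k y" by (intro tendsto_mult tendsto_const)
        qed
        show "AE y in lborel. norm (f (x + h j *\<^sub>R y) * k y) \<le> M * wt x * wt y" for j
          by (intro AE_I2 bd h)
      qed simp_all
      then have "(\<lambda>j. c * (\<integral>y. f (x + h j *\<^sub>R y) * k y \<partial>lborel)) \<longlonglongrightarrow> c * (\<integral>y. f x * k y \<partial>lborel)"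
        by (intro tendsto_mult tendsto_const)
      moreover have "c * (\<integral>y. f x * k y \<partial>lborel) = f x" using k1 by (simp add: mult.left_commute[of c])
      ultimately show ?case unfolding ig by (simp only:)
    qed
  qed simp
  moreover have "lp p f" by (rule lp_wt_bound(1)[OF p _ fw]) simp
  moreover have "apx p (inv_fourier (g j))" for j
    unfolding apx_def using testfun_lp[OF p tg[of j]] tg[of j] by (auto intro!: exI[of _ "g j"])
  ultimately show ?thesis by (intro apx_limit[OF p, of "\<lambda>j. inv_fourier (g j)" f])
qed

lemma apx_box:
  assumes p: "1 \<le> p"
  shows "apx p (indicator (box a b) :: real ^ 'n \<Rightarrow> complex)"
proof -
  obtain R where R: "\<And>x. x \<in> box a b \<Longrightarrow> norm x \<le> R" using bounded_box[of a b] unfolding bounded_iff by blast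
  have "norm (indicator (box a b) x :: complex) \<le> 1 * indicator (cball 0 R) x" for x
    using R[of x] by (cases "x \<in> box a b") (simp_all del: mem_box)
  then have cp: "cpt R (indicator (box a b) :: real ^ 'n \<Rightarrow> complex)"
    unfolding cpt_def by (intro conjI exI[of _ 1]) simp_all
  have "(cbox a b - box a b) \<in> null_sets (lebesgue :: (real ^ 'n) measure)"
    using negligible_frontier_interval[of a b] by (simp add: negligible_iff_null_sets)
  then have "(cbox a b - box a b) \<in> null_sets (lborel :: (real ^ 'n) measure)"
    by (subst (asm) null_sets_completion_iff) auto
  then have "AE x in lborel. x \<notin> (cbox a b - box a b)" by (rule AE_not_in)
  then have cont: "AE x in lborel. isCont (indicator (box a b) :: real ^ 'n \<Rightarrow> complex) x"
  proof eventually_elim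
    case (elim x)
    show ?case
    proof (cases "x \<in> box a b")
      case True
      have "\<forall>\<^sub>F y in nhds x. indicator (box a b) y = (1 :: complex)"
        using eventually_nhds_in_open[OF open_box True] by eventually_elim simp
      then show ?thesis by (subst isCont_cong) auto
    next
      case False
      then have x: "x \<in> - cbox a b" using elim by blast
      have "\<forall>\<^sub>F y in nhds x. y \<in> - cbox a b" using x by (intro eventually_nhds_in_open) auto
      then have "\<forall>\<^sub>F y in nhds x. indicator (box a b) y = (0 :: complex)"
        by eventually_elim (use box_subset_cbox in \<open>auto simp: indicator_def simp del: mem_box\<close>)
      then show ?thesis by (subst isCont_cong) auto
    qed
  qed
  show ?thesis by (rule apx_cpt[OF p cp cont])
qed

text \<open>
  The sets \<open>A\<close> with this property form a Dynkin system, and the boxes are a generator of the Borel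
  sets that is closed under intersections.
\<close>

lemma apx_indicator_box:
  assumes p: "1 \<le> p" and A: "A \<in> sets borel"
  shows "apx p (indicator (A \<inter> box a b) :: real ^ 'n \<Rightarrow> complex)"
proof -
  let ?G = "range (\<lambda>(a, b). box a b :: (real ^ 'n) set)"
  have lpb: "lp p (indicator (B \<inter> box a b) :: real ^ 'n \<Rightarrow> complex)" if "B \<in> sets borel" for B
  proof (rule lp_dominated(1))
    show "lp p (indicator (box a b) :: real ^ 'n \<Rightarrow> complex)" using apx_box[OF p] by (auto simp: apx_def)
  qed (use p that in \<open>auto simp: indicator_def\<close>)
  have S: "A \<in> sigma_sets UNIV ?G" using A by (simp add: borel_eq_box)
  have I: "Int_stable ?G"
    unfolding Int_stable_def by (auto simp: box_Int_box)
  have P: "?G \<subseteq> Pow UNIV" by simp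
  from I P S show ?thesis
  proof (induction rule: sigma_sets_induct_disjoint)
    case (basic B)
    then obtain c d where "B = box c d" by auto
    then have "\<exists>c d. B \<inter> box a b = box c d" by (auto simp: box_Int_box)
    then show ?case using apx_box[OF p] by auto
  next
    case empty
    have "apx p (\<lambda>x :: real ^ 'n. 0 * indicator (box a b) x)" by (intro apx_cmult apx_box p)
    then show ?case by (simp add: indicator_def[abs_def])
  next
    case (compl B)
    have "apx p (\<lambda>x. indicator (box a b) x + (- 1) * (indicator (B \<inter> box a b) x :: complex))"
      by (intro apx_add apx_cmult apx_box p compl)
    moreover have "(\<lambda>x. indicator (box a b) x + (- 1) * (indicator (B \<inter> box a b) x :: complex)) = indicator ((UNIV - B) \<inter> box a b)"
      by (auto simp: indicator_def)
    ultimately show ?case by simp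
  next
    case (union B)
    have Bm: "B i \<in> sets borel" for i using union.hyps(2) by (auto simp: borel_eq_box)
    have disj: "disjoint_family (\<lambda>i. B i \<inter> box a b)" using union.hyps(1) by (auto simp: disjoint_family_on_def)
    show ?case
    proof (rule apx_limit[OF p])
      fix K :: nat
      show "apx p (\<lambda>x. \<Sum>i<K. indicator (B i \<inter> box a b) x)"
      proof (induction K)
        case 0
        have "apx p (\<lambda>x :: real ^ 'n. 0 * indicator (box a b) x)" by (intro apx_cmult apx_box p)
        then show ?case by simp
      next
        case (Suc K)
        then show ?case by (simp add: apx_add[OF p] union.IH)
      qed
    next
      show "lp p (indicator ((\<Union>i. B i) \<inter> box a b) :: real ^ 'n \<Rightarrow> complex)" by (rule lpb) (use Bm in auto)
      have ind: "(\<Sum>i<K. indicator (B i \<inter> box a b) x) = (indicator (\<Union>i<K. B i \<inter> box a b) x :: complex)" for K x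
        by (rule indicator_UN_disjoint[symmetric]) (use disj in \<open>auto simp: disjoint_family_on_def\<close>)
      show "(\<lambda>K. lpn p (\<lambda>x. (\<Sum>i<K. indicator (B i \<inter> box a b) x) - (indicator ((\<Union>i. B i) \<inter> box a b) x :: complex))) \<longlonglongrightarrow> 0"
        unfolding ind
      proof (rule lp_dominated_convergence)
        show "lp p (\<lambda>x. norm (indicator (box a b) x :: complex))" using apx_box[OF p, of a b] by (auto simp: apx_def lp_def)
        show "AE x in lborel. (\<lambda>K. indicator (\<Union>i<K. B i \<inter> box a b) x) \<longlonglongrightarrow> (indicator ((\<Union>i. B i) \<inter> box a b) x :: complex)"
        proof (rule AE_I2)
          fix x
          have "(\<lambda>K. indicator (\<Union>i<K. B i \<inter> box a b) x) \<longlonglongrightarrow> (indicator (\<Union>i. B i \<inter> box a b) x :: complex)"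
            by (rule LIMSEQ_indicator_UN)
          then show "(\<lambda>K. indicator (\<Union>i<K. B i \<inter> box a b) x) \<longlonglongrightarrow> (indicator ((\<Union>i. B i) \<inter> box a b) x :: complex)" by simp
        qed
        show "AE x in lborel. norm (indicator (\<Union>i<K. B i \<inter> box a b) x - (indicator ((\<Union>i. B i) \<inter> box a b) x :: complex)) \<le> norm (indicator (box a b) x :: complex)" for K
          by (rule AE_I2) (auto simp: indicator_def)
      qed (use p Bm in auto)
    qed
  qed
qed

lemma apx_dominated_limit:
  fixes F :: "nat \<Rightarrow> real ^ 'n \<Rightarrow> complex"
  assumes p: "1 \<le> p" and F: "\<And>k. apx p (F k)" and f: "lp p f"
    and lim: "\<And>x. (\<lambda>k. F k x) \<longlonglongrightarrow> f x" and bd: "\<And>k x. norm (F k x - f x) \<le> norm (f x)"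
  shows "apx p f"
proof (rule apx_limit[OF p F f])
  show "(\<lambda>k. lpn p (\<lambda>x. F k x - f x)) \<longlonglongrightarrow> 0"
  proof (rule lp_dominated_convergence)
    show "lp p (\<lambda>x. norm (f x))" using f by (auto simp: lp_def)
    show "F k \<in> borel_measurable borel" for k using F[of k] by (auto simp: apx_def lp_def)
  qed (use p f lim bd in \<open>auto simp: lp_def\<close>)
qed

lemma apx_indicator:
  assumes p: "1 \<le> p" and A: "A \<in> sets borel" and l: "lp p (indicator A :: real ^ 'n \<Rightarrow> complex)"
  shows "apx p (indicator A :: real ^ 'n \<Rightarrow> complex)"
proof (rule apx_dominated_limit[OF p _ l])
  let ?B = "\<lambda>k :: nat. box (- (\<chi> i. real k)) (\<chi> i. real k) :: (real ^ 'n) set"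
  show "apx p (indicator (A \<inter> ?B k) :: real ^ 'n \<Rightarrow> complex)" for k by (rule apx_indicator_box[OF p A])
  show "(\<lambda>k. indicator (A \<inter> ?B k) x) \<longlonglongrightarrow> (indicator A x :: complex)" for x
  proof (rule tendsto_eventually)
    obtain K where K: "norm x < real K" using reals_Archimedean2 by blast
    have "x \<in> ?B k" if "K \<le> k" for k
    proof -
      have "\<bar>x $ i\<bar> < real k" for i using component_le_norm_cart[of x i] K that by simp
      then show ?thesis by (simp add: mem_box_cart abs_less_iff minus_less_iff)
    qed
    then show "\<forall>\<^sub>F k in sequentially. indicator (A \<inter> ?B k) x = (indicator A x :: complex)"
      unfolding eventually_sequentially by (intro exI[of _ K]) (auto simp: indicator_def)
  qed
qed (auto simp: indicator_def)

text \<open>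
  Nonnegative functions are increasing limits of simple functions, that is, of sums of indicators.
\<close>

lemma apx_nonneg:
  fixes u :: "real ^ 'n \<Rightarrow> real"
  assumes p: "1 \<le> p" and u: "u \<in> borel_measurable borel" "\<And>x. 0 \<le> u x"
  shows "lp p (\<lambda>x. complex_of_real (u x)) \<Longrightarrow> apx p (\<lambda>x. complex_of_real (u x))"
proof -
  have "u \<in> borel_measurable lborel" using u(1) by simp
  then show "lp p (\<lambda>x. complex_of_real (u x)) \<Longrightarrow> apx p (\<lambda>x. complex_of_real (u x))"
    using u(2)
  proof (induction u rule: borel_measurable_induct_real)
    case (set A)
    then show ?case using apx_indicator[OF p, of A] by (simp add: of_real_indicator[abs_def])
  next
    case (mult u c)
    show ?case
    proof (cases "c = 0")
      case True
      then show ?thesis using apx_cmult[OF p apx_box[OF p], of 0 0 0] by simp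
    next
      case False
      have "lp p (\<lambda>x. complex_of_real (1 / c) * complex_of_real (c * u x))" using p mult.prems by (intro lp_cmult) auto
      then have "apx p (\<lambda>x. complex_of_real (u x))" using False by (intro mult.IH) simp
      from apx_cmult[OF p this, of "complex_of_real c"] show ?thesis by simp
    qed
  next
    case (add u v)
    have le: "norm (complex_of_real (u x)) \<le> norm (complex_of_real (v x + u x))"
        "norm (complex_of_real (v x)) \<le> norm (complex_of_real (v x + u x))" for x
      using add.hyps(2)[of x] add.hyps(4)[of x] by (auto simp del: of_real_add)
    have m: "(\<lambda>x. complex_of_real (u x)) \<in> borel_measurable borel" "(\<lambda>x. complex_of_real (v x)) \<in> borel_measurable borel"
      using add.hyps by auto
    have "apx p (\<lambda>x. complex_of_real (u x))" "apx p (\<lambda>x. complex_of_real (v x))"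
      using p by (auto intro!: add.IH lp_dominated(1)[OF _ add.prems] m AE_I2 le simp del: of_real_add)
    from apx_add[OF p this(2,1)] show ?case by simp
  next
    case (seq U)
    have le: "U k x \<le> u x" for k x
      using seq by (intro incseq_le[of "\<lambda>i. U i x"]) (auto simp: incseq_def le_fun_def)
    have nn: "0 \<le> U k x" for k x using seq by auto
    show ?case
    proof (rule apx_dominated_limit[OF p _ seq.prems])
      show "apx p (\<lambda>x. complex_of_real (U k x))" for k
        by (rule seq.IH, rule lp_dominated(1)[OF _ seq.prems])
           (use p seq.hyps le order_trans[OF nn le] nn in auto)
      show "(\<lambda>k. complex_of_real (U k x)) \<longlonglongrightarrow> complex_of_real (u x)" for x
        using seq by (intro tendsto_of_real) auto
      show "norm (complex_of_real (U k x) - complex_of_real (u x)) \<le> norm (complex_of_real (u x))" for k x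
        using le[of k x] nn[of k x] by (simp flip: of_real_diff)
    qed
  qed
qed

theorem lp_dense:
  fixes f :: "real ^ 'n \<Rightarrow> complex"
  assumes p: "1 \<le> p" and f: "lp p f"
  shows "apx p f"
proof -
  have [measurable]: "f \<in> borel_measurable borel" using f by (simp add: lp_def)
  have *: "apx p (\<lambda>x. complex_of_real (max 0 (g x)))" if [measurable]: "g \<in> borel_measurable borel" and "\<And>x. \<bar>g x\<bar> \<le> norm (f x)" for g
  proof (rule apx_nonneg[OF p])
    show "lp p (\<lambda>x. complex_of_real (max 0 (g x)))"
    proof (rule lp_dominated(1)[OF _ f])
      have "\<bar>max 0 (g x)\<bar> \<le> norm (f x)" for x using that(2)[of x] by auto
      then show "AE x in lborel. norm (complex_of_real (max 0 (g x))) \<le> norm (f x)" by simp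
    qed (use p in auto)
  qed auto
  have "apx p (\<lambda>x. (complex_of_real (max 0 (Re (f x))) + (- 1) * complex_of_real (max 0 (- Re (f x)))) +
      \<i> * (complex_of_real (max 0 (Im (f x))) + (- 1) * complex_of_real (max 0 (- Im (f x)))))"
    by (intro apx_add apx_cmult p *) (auto simp: abs_Re_le_cmod abs_Im_le_cmod)
  also have "(\<lambda>x. (complex_of_real (max 0 (Re (f x))) + (- 1) * complex_of_real (max 0 (- Re (f x)))) +
      \<i> * (complex_of_real (max 0 (Im (f x))) + (- 1) * complex_of_real (max 0 (- Im (f x))))) = f"
    by (rule ext) (auto simp: complex_eq_iff max_def)
  finally show ?thesis .
qed

text \<open>
  The converse of Hoelder's inequality. The usual extremal function is \<open>\<bar>u\<bar> ^ (p - 1)\<close> times the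
  conjugate sign of \<open>u\<close>; it lies in \<open>L\<^sup>q\<close> and is approximated there by band-limited functions.
\<close>

theorem lpn_dual:
  fixes u :: "real ^ 'n \<Rightarrow> complex"
  assumes pq: "p > 1" "q > 1" "1 / p + 1 / q = 1" and u: "lp p u" and K: "0 \<le> K"
    and bd: "\<And>g. testfun g \<Longrightarrow> norm (\<integral>x. inv_fourier g x * u x \<partial>lborel) \<le> K * lpn q (inv_fourier g)"
  shows "lpn p u \<le> K"
proof -
  have [measurable]: "u \<in> borel_measurable borel" using u by (simp add: lp_def)
  have pq': "(p - 1) * q = p"
  proof -
    have "q + p = p * q" using pq by (simp add: field_simps)
    then show ?thesis by (simp add: left_diff_distrib)
  qed
  have ih: "integrable lborel (\<lambda>x. w x * u x)" "norm (\<integral>x. w x * u x \<partial>lborel) \<le> lpn q w * lpn p u" if "lp q w" for w :: "real ^ 'n \<Rightarrow> complex"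
  proof -
    have [measurable]: "w \<in> borel_measurable borel" using that by (simp add: lp_def)
    have h: "integrable lborel (\<lambda>x. norm (w x) * norm (u x))" "(\<integral>x. norm (w x) * norm (u x) \<partial>lborel) \<le> lpn q w * lpn p u"
      using hoelder[of q p w u] pq that u by (auto simp: add.commute)
    show "integrable lborel (\<lambda>x. w x * u x)"
      by (rule Bochner_Integration.integrable_bound[OF h(1)]) (auto simp: norm_mult)
    have "norm (\<integral>x. w x * u x \<partial>lborel) \<le> (\<integral>x. norm (w x * u x) \<partial>lborel)" by (rule integral_norm_bound)
    with h(2) show "norm (\<integral>x. w x * u x \<partial>lborel) \<le> lpn q w * lpn p u" by (simp add: norm_mult)
  qed
  have all: "norm (\<integral>x. w x * u x \<partial>lborel) \<le> K * lpn q w" if w: "lp q w" for w :: "real ^ 'n \<Rightarrow> complex"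
  proof (rule field_le_epsilon)
    fix e :: real assume "e > 0"
    then have "e / (K + lpn p u + 1) > 0" using K by (simp add: add_nonneg_pos)
    then obtain g where g: "testfun g" "lpn q (\<lambda>x. w x - inv_fourier g x) < e / (K + lpn p u + 1)"
      using lp_dense[OF _ w] pq unfolding apx_def by (meson less_imp_le)
    let ?g = "inv_fourier g" let ?d = "lpn q (\<lambda>x. w x - inv_fourier g x)"
    have lg: "lp q ?g" "lp q (\<lambda>x. w x - ?g x)" using pq g w by (auto intro!: testfun_lp lp_diff)
    have "(\<integral>x. w x * u x \<partial>lborel) = (\<integral>x. ?g x * u x \<partial>lborel) + (\<integral>x. (w x - ?g x) * u x \<partial>lborel)"
      using ih(1)[OF lg(1)] ih(1)[OF lg(2)] ih(1)[OF w] by (simp add: left_diff_distrib)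
    then have "norm (\<integral>x. w x * u x \<partial>lborel) \<le> K * lpn q ?g + ?d * lpn p u"
      using bd[OF g(1)] ih(2)[OF lg(2)] by (smt (verit) norm_triangle_ineq)
    also have "lpn q ?g \<le> lpn q w + ?d"
      using lp_diff(2)[OF _ w lg(2)] pq by simp
    then have "K * lpn q ?g \<le> K * (lpn q w + ?d)" using K by (rule mult_left_mono)
    finally have "norm (\<integral>x. w x * u x \<partial>lborel) \<le> K * lpn q w + ?d * (K + lpn p u)" by (simp add: algebra_simps)
    also have "?d * (K + lpn p u) \<le> (e / (K + lpn p u + 1)) * (K + lpn p u + 1)"
      using g(2) K \<open>e > 0\<close> by (intro mult_mono) (auto intro!: divide_nonneg_nonneg add_nonneg_nonneg)
    also have "(e / (K + lpn p u + 1)) * (K + lpn p u + 1) = e"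
      using K lpn_nonneg[of p u] by (simp add: add_nonneg_eq_0_iff)
    finally show "norm (\<integral>x. w x * u x \<partial>lborel) \<le> K * lpn q w + e" by simp
  qed
  \<comment> \<open>The extremal function in Hoelder's inequality; at zeros of \<open>u\<close> the factor \<open>cnj (u x)\<close> vanishes.\<close>
  define w where "w x = cnj (u x) * complex_of_real (norm (u x) powr (p - 2))" for x
  define I where "I = (\<integral>x. norm (u x) powr p \<partial>lborel)"
  have nw: "norm (w x) powr q = norm (u x) powr p" for x
  proof -
    have "norm (w x) = norm (u x) powr (p - 1)"
    proof (cases "u x = 0")
      case False
      then have "norm (u x) powr 1 * norm (u x) powr (p - 2) = norm (u x) powr (p - 1)"
        by (simp only: powr_add[symmetric]) simp
      then show ?thesis using False by (simp add: w_def norm_mult)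
    qed (simp add: w_def)
    then show ?thesis using pq' by (simp add: powr_powr)
  qed
  have wu: "w x * u x = complex_of_real (norm (u x) powr p)" for x
  proof (cases "u x = 0")
    case False
    have "w x * u x = complex_of_real ((norm (u x))\<^sup>2 * norm (u x) powr (p - 2))"
      using complex_norm_square[of "u x"] unfolding w_def by (simp add: ac_simps)
    also have "(norm (u x))\<^sup>2 * norm (u x) powr (p - 2) = norm (u x) powr p"
      using False by (simp flip: powr_numeral powr_add)
    finally show ?thesis .
  qed (simp add: w_def)
  have [measurable]: "cnj \<in> borel_measurable borel" by (intro borel_measurable_continuous_onI continuous_intros)
  have "w \<in> borel_measurable borel" unfolding w_def by measurable
  then have lw: "lp q w" using u unfolding lp_def nw by simp
  have "norm (\<integral>x. w x * u x \<partial>lborel) = I" unfolding wu I_def by simp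
  with all[OF lw] have le: "I \<le> K * I powr (1 / q)" by (simp add: lpn_def nw I_def)
  show ?thesis
  proof (cases "I = 0")
    case True then show ?thesis using K by (simp add: lpn_def I_def)
  next
    case False
    then have I: "I > 0" unfolding I_def by (simp add: less_le)
    have "I powr (1 / p) * I powr (1 / q) = I" using pq I by (simp flip: powr_add)
    then have "I powr (1 / p) * I powr (1 / q) \<le> K * I powr (1 / q)" using le by simp
    then have "I powr (1 / p) \<le> K" using I by (simp add: mult_le_cancel_right)
    then show ?thesis by (simp add: lpn_def I_def)
  qed
qed

section \<open>Normed carriers and semigroups\<close>

text \<open>
  Outside of the carrier, \<open>nrm\<close> is only known to be nonnegative.
\<close>

locale banach_carrier =
  fixes X :: "'v::real_vector set" and nrm :: "'v \<Rightarrow> real"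
  assumes subspace: "subspace X"
    and nrm_nonneg: "0 \<le> nrm x"
    and nrm_triangle: "x \<in> X \<Longrightarrow> y \<in> X \<Longrightarrow> nrm (x + y) \<le> nrm x + nrm y"
    and nrm_scaleR: "x \<in> X \<Longrightarrow> nrm (c *\<^sub>R x) = \<bar>c\<bar> * nrm x"
    and nrm_eq_0: "x \<in> X \<Longrightarrow> nrm x = 0 \<Longrightarrow> x = 0"
    and complete: "(\<And>k::nat. s k \<in> X) \<Longrightarrow> (\<And>e. e > 0 \<Longrightarrow> \<exists>N. \<forall>k\<ge>N. \<forall>l\<ge>N. nrm (s k - s l) \<le> e) \<Longrightarrow>
      \<exists>x\<in>X. (\<lambda>k. nrm (s k - x)) \<longlonglongrightarrow> 0"
begin

lemma add_in: "x \<in> X \<Longrightarrow> y \<in> X \<Longrightarrow> x + y \<in> X" using subspace by (rule subspace_add)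
lemma diff_in: "x \<in> X \<Longrightarrow> y \<in> X \<Longrightarrow> x - y \<in> X" using subspace by (rule subspace_diff)
lemma scaleR_in: "x \<in> X \<Longrightarrow> c *\<^sub>R x \<in> X" using subspace by (rule subspace_scale)
lemma zero_in: "0 \<in> X" using subspace by (rule subspace_0)

lemma nrm_0: "nrm 0 = 0" using nrm_scaleR[OF zero_in, of 0] by simp

lemma nrm_minus: "x \<in> X \<Longrightarrow> nrm (- x) = nrm x" using nrm_scaleR[of x "- 1"] by simp

lemma nrm_minus_commute: "x \<in> X \<Longrightarrow> y \<in> X \<Longrightarrow> nrm (x - y) = nrm (y - x)"
  using nrm_minus[OF diff_in, of x y] by simp

lemma nrm_triangle_diff: "x \<in> X \<Longrightarrow> y \<in> X \<Longrightarrow> z \<in> X \<Longrightarrow> nrm (x - z) \<le> nrm (x - y) + nrm (y - z)"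
  using nrm_triangle[OF diff_in diff_in, of x y y z] by simp

lemma nrm_le_diff: "x \<in> X \<Longrightarrow> y \<in> X \<Longrightarrow> nrm x \<le> nrm y + nrm (x - y)"
  using nrm_triangle[OF _ diff_in, of y x y] by simp

lemma nrm_reverse_triangle: "x \<in> X \<Longrightarrow> y \<in> X \<Longrightarrow> \<bar>nrm x - nrm y\<bar> \<le> nrm (x - y)"
  using nrm_le_diff[of x y] nrm_le_diff[of y x] nrm_minus_commute[of x y] by linarith

lemma eq_if_diff_0: "x \<in> X \<Longrightarrow> y \<in> X \<Longrightarrow> nrm (x - y) = 0 \<Longrightarrow> x = y"
  using nrm_eq_0[OF diff_in] by auto

lemma converges_unique:
  assumes "converges_in nrm f x F" "converges_in nrm f y F" "F \<noteq> bot" "\<forall>\<^sub>F s in F. f s \<in> X" "x \<in> X" "y \<in> X"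
  shows "x = y"
proof -
  have "((\<lambda>s. nrm (f s - x) + nrm (f s - y)) \<longlongrightarrow> 0 + 0) F"
    using assms(1,2) unfolding converges_in_def by (rule tendsto_add)
  moreover have "\<forall>\<^sub>F s in F. nrm (x - y) \<le> nrm (f s - x) + nrm (f s - y)"
    using assms(4) by eventually_elim (use nrm_triangle_diff nrm_minus_commute assms(5,6) in metis)
  ultimately have "nrm (x - y) \<le> 0 + 0"
    using assms(3) by (intro tendsto_lowerbound)
  then show ?thesis using nrm_nonneg[of "x - y"] eq_if_diff_0 assms(5,6) by force
qed

lemma bounded_operator_in: "bounded_operator X nrm B \<Longrightarrow> x \<in> X \<Longrightarrow> B x \<in> X"
  by (auto simp: bounded_operator_def linear_operator_def)

lemma bounded_operator_add: "bounded_operator X nrm B \<Longrightarrow> x \<in> X \<Longrightarrow> y \<in> X \<Longrightarrow> B (x + y) = B x + B y"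
  by (auto simp: bounded_operator_def linear_operator_def)

lemma bounded_operator_scaleR: "bounded_operator X nrm B \<Longrightarrow> x \<in> X \<Longrightarrow> B (c *\<^sub>R x) = c *\<^sub>R B x"
  by (auto simp: bounded_operator_def linear_operator_def)

lemma bounded_operator_diff:
  assumes "bounded_operator X nrm B" "x \<in> X" "y \<in> X" shows "B (x - y) = B x - B y"
  using bounded_operator_add[OF assms(1,2), of "(- 1) *\<^sub>R y"] bounded_operator_scaleR[OF assms(1,3), of "- 1"]
    scaleR_in[OF assms(3), of "- 1"] by simp

lemma operator_norm_le:
  assumes "\<And>x. x \<in> X \<Longrightarrow> nrm (B x) \<le> C * nrm x" "0 \<le> C"
  shows "operator_norm X nrm B \<le> C"
  unfolding operator_norm_def
proof (rule cSUP_least)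
  show "X \<noteq> {}" using zero_in by blast
  fix x assume x: "x \<in> X"
  show "nrm (B x) / nrm x \<le> C"
  proof (cases "nrm x = 0")
    case False
    then have "0 < nrm x" using nrm_nonneg[of x] by simp
    then show ?thesis using assms(1)[OF x] by (simp add: divide_le_eq)
  qed (use assms in simp)
qed

lemma operator_norm_bound:
  assumes "bounded_operator X nrm B" "x \<in> X"
  shows "nrm (B x) \<le> operator_norm X nrm B * nrm x"
proof -
  obtain K where K: "\<And>x. x \<in> X \<Longrightarrow> nrm (B x) \<le> K * nrm x" using assms(1) by (auto simp: bounded_operator_def)
  show ?thesis
  proof (cases "nrm x = 0")
    case True
    then show ?thesis using K[OF assms(2)] by simp
  next
    case False
    then have p: "0 < nrm x" using nrm_nonneg[of x] by simp
    have "nrm (B x) / nrm x \<le> operator_norm X nrm B"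
      unfolding operator_norm_def
    proof (rule cSUP_upper)
      show "bdd_above ((\<lambda>x. nrm (B x) / nrm x) ` X)"
      proof (rule bdd_aboveI2)
        fix y assume y: "y \<in> X"
        show "nrm (B y) / nrm y \<le> \<bar>K\<bar>"
        proof (cases "nrm y = 0")
          case False
          then have "0 < nrm y" using nrm_nonneg[of y] by simp
          then show ?thesis using K[OF y] by (simp add: divide_le_eq) (meson abs_ge_self mult_right_mono order_trans less_imp_le)
        qed simp
      qed
    qed (rule assms)
    then show ?thesis using p by (simp add: divide_le_eq)
  qed
qed

lemma converges_in_bound:
  assumes "converges_in nrm f x F" "\<And>s. nrm (h s - z) \<le> K * nrm (f s - x)"
  shows "converges_in nrm h z F"
  unfolding converges_in_def
proof (rule Lim_null_comparison)
  show "((\<lambda>s. K * nrm (f s - x)) \<longlongrightarrow> 0) F"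
    using tendsto_mult[OF tendsto_const[of K] assms(1)[unfolded converges_in_def]] by simp
  show "\<forall>\<^sub>F s in F. norm (nrm (h s - z)) \<le> K * nrm (f s - x)" using assms(2) nrm_nonneg by simp
qed

lemma converges_in_add:
  assumes "converges_in nrm f x F" "converges_in nrm g y F" "\<And>s. f s \<in> X" "\<And>s. g s \<in> X" "x \<in> X" "y \<in> X"
  shows "converges_in nrm (\<lambda>s. f s + g s) (x + y) F"
  unfolding converges_in_def
proof (rule Lim_null_comparison)
  show "((\<lambda>s. nrm (f s - x) + nrm (g s - y)) \<longlongrightarrow> 0) F"
    using tendsto_add[OF assms(1,2)[unfolded converges_in_def]] by simp
  have "nrm (f s + g s - (x + y)) \<le> nrm (f s - x) + nrm (g s - y)" for s
    using nrm_triangle[OF diff_in[OF assms(3,5)] diff_in[OF assms(4,6)], of s s] by (simp add: algebra_simps)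
  then show "\<forall>\<^sub>F s in F. norm (nrm (f s + g s - (x + y))) \<le> nrm (f s - x) + nrm (g s - y)" using nrm_nonneg by simp
qed

lemma dense_sequence:
  assumes dense: "\<And>x e. x \<in> X \<Longrightarrow> e > 0 \<Longrightarrow> \<exists>v\<in>V. nrm (v - x) < e" and x: "x \<in> X"
  obtains s where "\<And>k :: nat. s k \<in> V" "converges_in nrm s x sequentially"
proof -
  have "\<forall>k. \<exists>v. v \<in> V \<and> nrm (v - x) < 1 / real (Suc k)"
    using dense[OF x, of "1 / real (Suc k)" for k] by (simp del: of_nat_Suc add: Bex_def)
  from choice[OF this] obtain s where s: "\<And>k. s k \<in> V" "\<And>k. nrm (s k - x) < 1 / real (Suc k)" by blast
  have "converges_in nrm s x sequentially"
    unfolding converges_in_def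
  proof (rule Lim_null_comparison)
    show "(\<lambda>k. 1 / real (Suc k)) \<longlonglongrightarrow> 0" using LIMSEQ_inverse_real_of_nat by (simp add: inverse_eq_divide)
    show "\<forall>\<^sub>F k in sequentially. norm (nrm (s k - x)) \<le> 1 / real (Suc k)"
      using less_imp_le[OF s(2)] by (intro always_eventually allI) (simp add: nrm_nonneg del: of_nat_Suc)
  qed
  with s(1) show ?thesis by (rule that)
qed

lemma bounded_operator_converges:
  assumes B: "bounded_operator X nrm B" and s: "\<And>k. s k \<in> X" "x \<in> X" "converges_in nrm s x F"
  shows "converges_in nrm (\<lambda>k. B (s k)) (B x) F"
proof -
  obtain K where K: "\<And>x. x \<in> X \<Longrightarrow> nrm (B x) \<le> K * nrm x" using B by (auto simp: bounded_operator_def)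
  show ?thesis
    using K[OF diff_in[OF s(1,2)]] by (intro converges_in_bound[OF s(3)]) (simp add: bounded_operator_diff[OF B s(1,2)])
qed

text \<open>
  The value at \<open>x\<close> is the common limit of \<open>B0 (s k)\<close> over all sequences \<open>s\<close> in the subspace that
  converge to \<open>x\<close>; linearity and the bound then follow from the limit laws.
\<close>

lemma bounded_extension:
  assumes V: "subspace V" "V \<subseteq> X" and dense: "\<And>x e. x \<in> X \<Longrightarrow> e > 0 \<Longrightarrow> \<exists>v\<in>V. nrm (v - x) < e"
    and B0: "\<And>v. v \<in> V \<Longrightarrow> B0 v \<in> X" "\<And>v w. v \<in> V \<Longrightarrow> w \<in> V \<Longrightarrow> B0 (v + w) = B0 v + B0 w"
      "\<And>c v. v \<in> V \<Longrightarrow> B0 (c *\<^sub>R v) = c *\<^sub>R B0 v"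
    and K: "0 \<le> K" "\<And>v. v \<in> V \<Longrightarrow> nrm (B0 v) \<le> K * nrm v"
  shows "\<exists>B. bounded_operator X nrm B \<and> (\<forall>v\<in>V. B v = B0 v)"
proof -
  let ?c = "\<lambda>s x. converges_in nrm s x sequentially"
  define R where "R x y \<longleftrightarrow> y \<in> X \<and> (\<forall>s. (\<forall>k. s k \<in> V) \<longrightarrow> ?c s x \<longrightarrow> ?c (\<lambda>k. B0 (s k)) y)" for x y
  have VX: "v \<in> V \<Longrightarrow> v \<in> X" for v using V by auto
  have Vs: "v \<in> V \<Longrightarrow> c *\<^sub>R v \<in> V" for v c using V(1) by (rule subspace_scale)
  have Va: "v \<in> V \<Longrightarrow> w \<in> V \<Longrightarrow> v + w \<in> V" for v w using V(1) by (rule subspace_add)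
  have B0d: "nrm (B0 v - B0 w) \<le> K * (nrm (v - x) + nrm (w - x))" if "v \<in> V" "w \<in> V" "x \<in> X" for v w x
  proof -
    have "B0 v - B0 w = B0 (v - w)"
      using B0(2)[OF that(1) Vs[OF that(2), of "- 1"]] B0(3)[OF that(2), of "- 1"] by simp
    then have "nrm (B0 v - B0 w) \<le> K * nrm (v - w)" using K(2)[OF subspace_diff[OF V(1) that(1,2)]] by simp
    also have "nrm (v - w) \<le> nrm (v - x) + nrm (w - x)"
      using nrm_triangle_diff[OF VX[OF that(1)] that(3) VX[OF that(2)]] nrm_minus_commute[OF VX[OF that(2)] that(3)] by simp
    finally show ?thesis using K(1) by (simp add: mult_left_mono)
  qed
  have ex: "\<exists>y. R x y" if x: "x \<in> X" for x
  proof -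
    obtain s where s: "\<And>k. s k \<in> V" "?c s x" using dense_sequence[OF dense x] by blast
    have "\<exists>y\<in>X. (\<lambda>k. nrm (B0 (s k) - y)) \<longlonglongrightarrow> 0"
    proof (rule complete)
      fix e :: real assume e: "e > 0"
      have "(\<lambda>k. K * nrm (s k - x)) \<longlonglongrightarrow> K * 0" using s(2) unfolding converges_in_def by (intro tendsto_mult tendsto_const)
      then have "\<forall>\<^sub>F k in sequentially. K * nrm (s k - x) < e / 2" using e by (intro order_tendstoD(2)[where y=0]) auto
      then obtain N where N: "\<And>k. N \<le> k \<Longrightarrow> K * nrm (s k - x) < e / 2" by (auto simp: eventually_sequentially)
      have "nrm (B0 (s k) - B0 (s l)) \<le> e" if "N \<le> k" "N \<le> l" for k l
        using B0d[OF s(1)[of k] s(1)[of l] x] N[OF that(1)] N[OF that(2)] by (simp add: distrib_left)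
      then show "\<exists>N. \<forall>k\<ge>N. \<forall>l\<ge>N. nrm (B0 (s k) - B0 (s l)) \<le> e" by blast
    qed (use B0 s in auto)
    then obtain y where y: "y \<in> X" "(\<lambda>k. nrm (B0 (s k) - y)) \<longlonglongrightarrow> 0" by blast
    have "?c (\<lambda>k. B0 (r k)) y" if r: "\<forall>k. r k \<in> V" "?c r x" for r
      unfolding converges_in_def
    proof (rule Lim_null_comparison)
      have "(\<lambda>k. K * (nrm (r k - x) + nrm (s k - x)) + nrm (B0 (s k) - y)) \<longlonglongrightarrow> K * (0 + 0) + 0"
        using r(2) s(2) y(2) unfolding converges_in_def by (intro tendsto_intros)
      then show "(\<lambda>k. K * (nrm (r k - x) + nrm (s k - x)) + nrm (B0 (s k) - y)) \<longlonglongrightarrow> 0" by simp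
      have "nrm (B0 (r k) - y) \<le> K * (nrm (r k - x) + nrm (s k - x)) + nrm (B0 (s k) - y)" for k
        using nrm_triangle_diff[OF B0(1) B0(1) y(1), of "r k" "s k"] B0d[OF _ s(1)[of k] x, of "r k"] r(1) s(1)[of k] by simp
      then show "\<forall>\<^sub>F k in sequentially. norm (nrm (B0 (r k) - y)) \<le> K * (nrm (r k - x) + nrm (s k - x)) + nrm (B0 (s k) - y)"
        using nrm_nonneg by simp
    qed
    then show ?thesis using y(1) unfolding R_def by blast
  qed
  define B where "B x = (SOME y. R x y)" for x
  have R: "R x (B x)" if "x \<in> X" for x unfolding B_def using ex[OF that] by (rule someI_ex)
  have BX: "B x \<in> X" if "x \<in> X" for x using R[OF that] by (simp add: R_def)
  have Bs: "?c (\<lambda>k. B0 (s k)) (B x)" if "x \<in> X" "\<And>k. s k \<in> V" "?c s x" for s x using R[OF that(1)] that(2,3) by (simp add: R_def)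
  have add: "B (x + y) = B x + B y" if x: "x \<in> X" and y: "y \<in> X" for x y
  proof -
    obtain s where s: "\<And>k. s k \<in> V" "?c s x" using dense_sequence[OF dense x] by blast
    obtain r where r: "\<And>k. r k \<in> V" "?c r y" using dense_sequence[OF dense y] by blast
    have "?c (\<lambda>k. B0 (s k + r k)) (B (x + y))"
      by (intro Bs add_in x y Va s(1) r(1) converges_in_add[OF s(2) r(2)] VX)
    moreover have "?c (\<lambda>k. B0 (s k + r k)) (B x + B y)"
      unfolding B0(2)[OF s(1) r(1)] by (intro converges_in_add Bs x y s r BX B0(1))
    ultimately show ?thesis
      by (rule converges_unique) (use add_in BX x y B0(1) Va s r in auto)
  qed
  have scl: "B (c *\<^sub>R x) = c *\<^sub>R B x" if x: "x \<in> X" for c x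
  proof -
    have sc: "converges_in nrm (\<lambda>k. c *\<^sub>R f k) (c *\<^sub>R z) sequentially" if f: "\<And>k. f k \<in> X" "z \<in> X" "?c f z" for f z
      using nrm_scaleR[OF diff_in[OF f(1,2)], of c]
      by (intro converges_in_bound[OF f(3), where K="\<bar>c\<bar>"]) (simp add: scaleR_diff_right)
    obtain s where s: "\<And>k. s k \<in> V" "?c s x" using dense_sequence[OF dense x] by blast
    have "?c (\<lambda>k. B0 (c *\<^sub>R s k)) (B (c *\<^sub>R x))" by (intro Bs scaleR_in x Vs s(1) sc s(2) VX)
    moreover have "?c (\<lambda>k. B0 (c *\<^sub>R s k)) (c *\<^sub>R B x)"
      unfolding B0(3)[OF s(1)] by (intro sc Bs x s BX B0(1))
    ultimately show ?thesis
      by (rule converges_unique) (use scaleR_in BX x B0(1) Vs s in auto)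
  qed
  have ext: "B v = B0 v" if v: "v \<in> V" for v
  proof -
    have "?c (\<lambda>k. B0 v) (B v)" by (rule Bs[OF VX[OF v] v]) (simp add: converges_in_def nrm_0)
    moreover have "?c (\<lambda>k. B0 v) (B0 v)" by (simp add: converges_in_def nrm_0)
    ultimately show ?thesis by (rule converges_unique) (use BX VX B0(1) v in auto)
  qed
  have bnd: "nrm (B x) \<le> K * nrm x" if x: "x \<in> X" for x
  proof -
    obtain s where s: "\<And>k. s k \<in> V" "?c s x" using dense_sequence[OF dense x] by blast
    have "(\<lambda>k. K * (nrm x + nrm (s k - x)) + nrm (B0 (s k) - B x)) \<longlonglongrightarrow> K * (nrm x + 0) + 0"
      using s(2) Bs[OF x s] unfolding converges_in_def by (intro tendsto_intros)
    moreover have "nrm (B x) \<le> K * (nrm x + nrm (s k - x)) + nrm (B0 (s k) - B x)" for k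
    proof -
      have "K * nrm (s k) \<le> K * (nrm x + nrm (s k - x))" by (intro mult_left_mono nrm_le_diff VX s x K)
      then show ?thesis
        using nrm_le_diff[OF BX[OF x] B0(1)[OF s(1)], of k] K(2)[OF s(1)[of k]] nrm_minus_commute[OF BX[OF x] B0(1)[OF s(1)], of k] by linarith
    qed
    ultimately have "nrm (B x) \<le> K * (nrm x + 0) + 0" by (intro LIMSEQ_le_const) auto
    then show ?thesis by simp
  qed
  have "bounded_operator X nrm B"
    unfolding bounded_operator_def linear_operator_def
    using subspace BX add scl bnd by blast
  then show ?thesis using ext by blast
qed

lemma bounded_operator_eq_dense:
  assumes B: "bounded_operator X nrm B" and C: "bounded_operator X nrm C" and VX: "V \<subseteq> X"
    and dense: "\<And>x e. x \<in> X \<Longrightarrow> e > 0 \<Longrightarrow> \<exists>v\<in>V. nrm (v - x) < e"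
    and eq: "\<And>v. v \<in> V \<Longrightarrow> B v = C v" and x: "x \<in> X"
  shows "B x = C x"
proof -
  obtain s where s: "\<And>k :: nat. s k \<in> V" "converges_in nrm s x sequentially" using dense_sequence[OF dense x] by blast
  have sX: "s k \<in> X" for k using s(1) VX by blast
  have "converges_in nrm (\<lambda>k. B (s k)) (B x) sequentially" by (rule bounded_operator_converges[OF B sX x s(2)])
  moreover have "converges_in nrm (\<lambda>k. B (s k)) (C x) sequentially"
    unfolding eq[OF s(1)] by (rule bounded_operator_converges[OF C sX x s(2)])
  ultimately show ?thesis
    by (rule converges_unique) (use bounded_operator_in[OF B] bounded_operator_in[OF C] sX x in auto)
qed

lemma bound_on_dense:
  assumes B: "bounded_operator X nrm B" and VX: "V \<subseteq> X"
    and dense: "\<And>x e. x \<in> X \<Longrightarrow> e > 0 \<Longrightarrow> \<exists>v\<in>V. nrm (v - x) < e"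
    and bd: "\<And>v. v \<in> V \<Longrightarrow> nrm (B v) \<le> C * nrm v" and C: "0 \<le> C" and x: "x \<in> X"
  shows "nrm (B x) \<le> C * nrm x"
proof -
  obtain s where s: "\<And>k :: nat. s k \<in> V" "converges_in nrm s x sequentially" using dense_sequence[OF dense x] by blast
  have sX: "s k \<in> X" for k using s(1) VX by blast
  note b = bounded_operator_in[OF B]
  have "(\<lambda>k. C * (nrm x + nrm (s k - x)) + nrm (B (s k) - B x)) \<longlonglongrightarrow> C * (nrm x + 0) + 0"
    using s(2) bounded_operator_converges[OF B sX x s(2)] unfolding converges_in_def by (intro tendsto_intros)
  moreover have "nrm (B x) \<le> C * (nrm x + nrm (s k - x)) + nrm (B (s k) - B x)" for k
  proof -
    have "C * nrm (s k) \<le> C * (nrm x + nrm (s k - x))" by (intro mult_left_mono nrm_le_diff sX x C)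
    then show ?thesis
      using nrm_le_diff[OF b[OF x] b[OF sX], of k] bd[OF s(1)[of k]] nrm_minus_commute[OF b[OF x] b[OF sX], of k] by linarith
  qed
  ultimately have "nrm (B x) \<le> C * (nrm x + 0) + 0" by (intro LIMSEQ_le_const) auto
  then show ?thesis by simp
qed

end

locale bounded_semigroup = banach_carrier X nrm for X :: "'v::real_vector set" and nrm +
  fixes D :: "'v set" and A :: "'v \<Rightarrow> 'v" and S :: "real \<Rightarrow> 'v \<Rightarrow> 'v"
  assumes gen: "generates_semigroup X nrm D A S"
    and locally_bounded: "\<And>T. T > 0 \<Longrightarrow> \<exists>C>0. \<forall>t\<in>{0..T}. \<forall>x\<in>X. nrm (S t x) \<le> C * nrm x"
begin

lemma S_bounded: "0 \<le> t \<Longrightarrow> bounded_operator X nrm (S t)"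
  and S_0: "x \<in> X \<Longrightarrow> S 0 x = x"
  and S_add: "0 \<le> s \<Longrightarrow> 0 \<le> t \<Longrightarrow> x \<in> X \<Longrightarrow> S (s + t) x = S s (S t x)"
  and S_right: "x \<in> X \<Longrightarrow> ((\<lambda>t. nrm (S t x - x)) \<longlongrightarrow> 0) (at_right 0)"
  using gen by (auto simp: generates_semigroup_def C0_semigroup_def converges_in_def)

lemmas S_in = bounded_operator_in[OF S_bounded] and S_diff = bounded_operator_diff[OF S_bounded]
  and S_scaleR = bounded_operator_scaleR[OF S_bounded]

lemma D_in: "x \<in> D \<Longrightarrow> x \<in> X" and A_in: "x \<in> D \<Longrightarrow> A x \<in> X"
  and A_right: "x \<in> D \<Longrightarrow> ((\<lambda>h. nrm ((1 / h) *\<^sub>R (S h x - x) - A x)) \<longlongrightarrow> 0) (at_right 0)"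
  and D_I: "x \<in> X \<Longrightarrow> y \<in> X \<Longrightarrow> ((\<lambda>h. nrm ((1 / h) *\<^sub>R (S h x - x) - y)) \<longlongrightarrow> 0) (at_right 0) \<Longrightarrow> x \<in> D"
  using gen by (auto simp: generates_semigroup_def converges_in_def)

lemma bound_near:
  assumes "0 \<le> t"
  obtains C where "C > 0" "\<And>s x. 0 \<le> s \<Longrightarrow> s \<le> t + 1 \<Longrightarrow> x \<in> X \<Longrightarrow> nrm (S s x) \<le> C * nrm x"
  using locally_bounded[of "t + 1"] assms by force

lemma abs_diff_at_right:
  assumes "(g \<longlongrightarrow> 0) (at_right (0::real))"
  shows "((\<lambda>s. g \<bar>s - t\<bar>) \<longlongrightarrow> 0) (at t within U)"
proof (rule filterlim_compose[OF assms])
  show "filterlim (\<lambda>s. \<bar>s - t\<bar>) (at_right 0) (at t within U)"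
    unfolding filterlim_at
  proof
    show "\<forall>\<^sub>F s in at t within U. \<bar>s - t\<bar> \<in> {0<..} \<and> \<bar>s - t\<bar> \<noteq> 0"
      by (auto simp: eventually_at_filter)
    have "((\<lambda>s. \<bar>s - t\<bar>) \<longlongrightarrow> \<bar>t - t\<bar>) (at t within U)" by (intro tendsto_intros)
    then show "((\<lambda>s. \<bar>s - t\<bar>) \<longlongrightarrow> 0) (at t within U)" by simp
  qed
qed

lemma S_continuous:
  assumes t: "0 \<le> t" and x: "x \<in> X"
  shows "((\<lambda>s. nrm (S s x - S t x)) \<longlongrightarrow> 0) (at t within {0..})"
proof -
  obtain C where C: "C > 0" "\<And>s x. 0 \<le> s \<Longrightarrow> s \<le> t + 1 \<Longrightarrow> x \<in> X \<Longrightarrow> nrm (S s x) \<le> C * nrm x"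
    using bound_near[OF t] by blast
  have l: "((\<lambda>s. C * nrm (S \<bar>s - t\<bar> x - x)) \<longlongrightarrow> C * 0) (at t within {0..})"
    by (intro tendsto_mult tendsto_const abs_diff_at_right[OF S_right[OF x]])
  have "\<forall>\<^sub>F s in at t within {0..}. s \<in> {t - 1<..<t + 1}"
    by (intro eventually_at_topological[THEN iffD2] exI[of _ "{t - 1<..<t + 1}"]) auto
  moreover have "\<forall>\<^sub>F s in at t within {0..}. s \<in> {0..}" by (simp add: eventually_at_filter)
  ultimately have "\<forall>\<^sub>F s in at t within {0..}. norm (nrm (S s x - S t x)) \<le> C * nrm (S \<bar>s - t\<bar> x - x)"
  proof eventually_elim
    case (elim s)
    show ?case
    proof (cases "t \<le> s")
      case True
      have "S s x - S t x = S t (S \<bar>s - t\<bar> x - x)"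
        using S_add[OF t, of "s - t" x] S_diff[OF t S_in x, of "s - t"] True x by simp
      then show ?thesis using C(2)[of t "S \<bar>s - t\<bar> x - x"] t x True nrm_nonneg diff_in S_in by simp
    next
      case False
      have "S s x - S t x = - S s (S \<bar>s - t\<bar> x - x)"
        using S_add[of s "t - s" x] S_diff[OF _ S_in x, of s "t - s"] False elim x by simp
      then show ?thesis using C(2)[of s "S \<bar>s - t\<bar> x - x"] t x False elim nrm_nonneg diff_in S_in nrm_minus by simp
    qed
  qed
  from Lim_null_comparison[OF this] l show ?thesis by simp
qed

lemma S_D:
  assumes t: "0 \<le> t" and x: "x \<in> D"
  shows "S t x \<in> D" "A (S t x) = S t (A x)"
proof -
  note xX = D_in[OF x] and aX = A_in[OF x]
  obtain C where C: "C > 0" "\<And>s x. 0 \<le> s \<Longrightarrow> s \<le> t + 1 \<Longrightarrow> x \<in> X \<Longrightarrow> nrm (S s x) \<le> C * nrm x"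
    using bound_near[OF t] by blast
  have l: "((\<lambda>h. C * nrm ((1 / h) *\<^sub>R (S h x - x) - A x)) \<longlongrightarrow> C * 0) (at_right 0)"
    by (intro tendsto_mult tendsto_const A_right x)
  have "\<forall>\<^sub>F h in at_right 0. norm (nrm ((1 / h) *\<^sub>R (S h (S t x) - S t x) - S t (A x))) \<le> C * nrm ((1 / h) *\<^sub>R (S h x - x) - A x)"
    unfolding eventually_at_filter
  proof (rule always_eventually, intro allI impI)
    fix h :: real assume "h \<in> {0<..}"
    then have h: "0 \<le> h" by simp
    have i: "S h x - x \<in> X" "(1 / h) *\<^sub>R (S h x - x) \<in> X" "(1 / h) *\<^sub>R (S h x - x) - A x \<in> X"
      using S_in[OF h xX] xX aX diff_in scaleR_in by auto
    have "S h (S t x) = S t (S h x)" using S_add[OF h t xX] S_add[OF t h xX] by (simp add: add.commute)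
    then have "(1 / h) *\<^sub>R (S h (S t x) - S t x) - S t (A x) = S t ((1 / h) *\<^sub>R (S h x - x) - A x)"
      using S_diff[OF t i(2) aX] S_scaleR[OF t i(1)] S_diff[OF t S_in[OF h xX] xX] by simp
    then show "norm (nrm ((1 / h) *\<^sub>R (S h (S t x) - S t x) - S t (A x))) \<le> C * nrm ((1 / h) *\<^sub>R (S h x - x) - A x)"
      using C(2)[OF t _ i(3)] nrm_nonneg by simp
  qed
  from Lim_null_comparison[OF this] l
  have L: "((\<lambda>h. nrm ((1 / h) *\<^sub>R (S h (S t x) - S t x) - S t (A x))) \<longlongrightarrow> 0) (at_right 0)" by simp
  show D: "S t x \<in> D" by (rule D_I[OF S_in[OF t xX] S_in[OF t aX] L])
  show "A (S t x) = S t (A x)"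
  proof (rule converges_unique)
    show "\<forall>\<^sub>F h in at_right 0. (1 / h) *\<^sub>R (S h (S t x) - S t x) \<in> X"
      unfolding eventually_at_filter
      by (rule always_eventually) (auto intro!: scaleR_in diff_in S_in t xX)
  qed (use A_right[OF D] L A_in[OF D] S_in[OF t aX] in \<open>auto simp: converges_in_def\<close>)
qed

lemma S_derivative:
  assumes t: "0 \<le> t" and x: "x \<in> D"
  shows "((\<lambda>s. nrm ((1 / (s - t)) *\<^sub>R (S s x - S t x) - S t (A x))) \<longlongrightarrow> 0) (at t within {0..})"
proof -
  note xX = D_in[OF x] and aX = A_in[OF x]
  obtain C where C: "C > 0" "\<And>s x. 0 \<le> s \<Longrightarrow> s \<le> t + 1 \<Longrightarrow> x \<in> X \<Longrightarrow> nrm (S s x) \<le> C * nrm x"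
    using bound_near[OF t] by blast
  let ?q = "\<lambda>h. (1 / h) *\<^sub>R (S h x - x) - A x"
  have l: "((\<lambda>s. C * nrm (?q \<bar>s - t\<bar>) + nrm (S s (A x) - S t (A x))) \<longlongrightarrow> C * 0 + 0) (at t within {0..})"
    by (intro tendsto_add tendsto_mult tendsto_const abs_diff_at_right[OF A_right[OF x]] S_continuous t aX)
  have "\<forall>\<^sub>F s in at t within {0..}. s \<in> {t - 1<..<t + 1}"
    by (intro eventually_at_topological[THEN iffD2] exI[of _ "{t - 1<..<t + 1}"]) auto
  moreover have "\<forall>\<^sub>F s in at t within {0..}. s \<in> {0..} \<and> s \<noteq> t" by (simp add: eventually_at_filter)
  ultimately have "\<forall>\<^sub>F s in at t within {0..}. norm (nrm ((1 / (s - t)) *\<^sub>R (S s x - S t x) - S t (A x)))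
      \<le> C * nrm (?q \<bar>s - t\<bar>) + nrm (S s (A x) - S t (A x))"
  proof eventually_elim
    case (elim s)
    define h where "h = \<bar>s - t\<bar>"
    have h: "0 \<le> h" by (simp add: h_def)
    have i: "S h x - x \<in> X" "(1 / h) *\<^sub>R (S h x - x) \<in> X" "?q h \<in> X"
      using S_in[OF h xX] xX aX diff_in scaleR_in by auto
    have Sq: "S r (?q h) = (1 / h) *\<^sub>R (S r (S h x) - S r x) - S r (A x)" if r: "0 \<le> r" for r
      using S_diff[OF r i(2) aX] S_scaleR[OF r i(1)] S_diff[OF r S_in[OF h xX] xX] by simp
    show ?case
    proof (cases "t \<le> s")
      case True
      have "(1 / (s - t)) *\<^sub>R (S s x - S t x) - S t (A x) = S t (?q h)"
        using S_add[OF t h xX] True unfolding Sq[OF t] by (simp add: h_def)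
      then have "nrm ((1 / (s - t)) *\<^sub>R (S s x - S t x) - S t (A x)) \<le> C * nrm (?q h)"
        using C(2)[OF t _ i(3)] by simp
      then show ?thesis using nrm_nonneg unfolding h_def by (simp add: add_increasing2)
    next
      case False
      then have s: "0 \<le> s" "s \<le> t + 1" using elim by auto
      have "S t x = S s (S h x)" using S_add[OF s(1) h xX] False by (simp add: h_def)
      moreover have "1 / (s - t) = - (1 / h)" using False by (simp add: h_def) (metis minus_diff_eq minus_divide_right)
      ultimately have e: "(1 / (s - t)) *\<^sub>R (S s x - S t x) - S t (A x) = S s (?q h) + (S s (A x) - S t (A x))"
        unfolding Sq[OF s(1)] by (simp add: algebra_simps)
      have "nrm ((1 / (s - t)) *\<^sub>R (S s x - S t x) - S t (A x)) \<le> nrm (S s (?q h)) + nrm (S s (A x) - S t (A x))"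
        unfolding e by (intro nrm_triangle S_in diff_in s t aX i)
      also have "nrm (S s (?q h)) \<le> C * nrm (?q h)" by (intro C(2) s i)
      finally show ?thesis using nrm_nonneg unfolding h_def by simp
    qed
  qed
  from Lim_null_comparison[OF this] l show ?thesis by simp
qed

lemma S_solution:
  assumes "x \<in> D" shows "classical_solution X nrm D A x (\<lambda>t. S t x)"
  unfolding classical_solution_def converges_in_def
  using S_0[OF D_in[OF assms]] S_in[OF _ D_in[OF assms]] S_in[OF _ A_in[OF assms]]
    S_derivative[OF _ assms] S_continuous[OF _ A_in[OF assms]] S_D[OF _ assms]
  by (intro conjI exI[of _ "\<lambda>t. S t (A x)"]) auto

text \<open>
  For a solution \<open>v\<close> the function \<open>r \<mapsto> S (t - r) (v r)\<close> is constant: its distance from the initial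
  value is a real function with derivative zero.
\<close>

lemma solution_unique:
  assumes v: "classical_solution X nrm D A x v" and t: "0 < t"
  shows "v t = S t x"
proof -
  obtain v' where v0: "v 0 = x" and vX: "\<And>t. 0 \<le> t \<Longrightarrow> v t \<in> X" and v'X: "\<And>t. 0 \<le> t \<Longrightarrow> v' t \<in> X"
    and dv: "\<And>t. 0 \<le> t \<Longrightarrow> ((\<lambda>s. nrm ((1 / (s - t)) *\<^sub>R (v s - v t) - v' t)) \<longlongrightarrow> 0) (at t within {0..})"
    and vD: "\<And>t. 0 < t \<Longrightarrow> v t \<in> D" and v'A: "\<And>t. 0 < t \<Longrightarrow> v' t = A (v t)"
    using v unfolding classical_solution_def converges_in_def by blast
  have t0: "0 \<le> t" using t by simp
  obtain C where C: "C > 0" "\<And>s x. 0 \<le> s \<Longrightarrow> s \<le> t + 1 \<Longrightarrow> x \<in> X \<Longrightarrow> nrm (S s x) \<le> C * nrm x"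
    using bound_near[OF t0] by blast
  define F where "F r = S (t - r) (v r)" for r
  have FX: "F r \<in> X" if "r \<in> {0..t}" for r using that by (auto simp: F_def intro!: S_in vX)
  have sub: "filterlim (\<lambda>r'. t - r') (at (t - r) within {0..}) (at r within {0..t})" for r
    unfolding filterlim_at
  proof
    show "\<forall>\<^sub>F r' in at r within {0..t}. t - r' \<in> {0..} \<and> t - r' \<noteq> t - r" by (auto simp: eventually_at_filter)
    show "((\<lambda>r'. t - r') \<longlongrightarrow> t - r) (at r within {0..t})" by (intro tendsto_intros)
  qed
  have vc: "((\<lambda>s. nrm (v s - v r)) \<longlongrightarrow> 0) (at r within {0..t})" if r: "0 \<le> r" for r
  proof -
    have "((\<lambda>s. \<bar>s - r\<bar> * (nrm ((1 / (s - r)) *\<^sub>R (v s - v r) - v' r) + nrm (v' r))) \<longlongrightarrow> \<bar>r - r\<bar> * (0 + nrm (v' r))) (at r within {0..t})"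
      by (intro tendsto_intros tendsto_within_subset[OF dv[OF r]]) auto
    then have l: "((\<lambda>s. \<bar>s - r\<bar> * (nrm ((1 / (s - r)) *\<^sub>R (v s - v r) - v' r) + nrm (v' r))) \<longlongrightarrow> 0) (at r within {0..t})" by simp
    show ?thesis
    proof (rule Lim_null_comparison[OF _ l])
      show "\<forall>\<^sub>F s in at r within {0..t}. norm (nrm (v s - v r)) \<le> \<bar>s - r\<bar> * (nrm ((1 / (s - r)) *\<^sub>R (v s - v r) - v' r) + nrm (v' r))"
        unfolding eventually_at_filter
      proof (rule always_eventually, intro allI impI)
        fix s assume s: "s \<noteq> r" "s \<in> {0..t}"
        have i: "v s - v r \<in> X" using vX r s diff_in by auto
        have "nrm (v s - v r) = \<bar>s - r\<bar> * nrm ((1 / (s - r)) *\<^sub>R (v s - v r))"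
          unfolding nrm_scaleR[OF i] using s by simp
        also have "nrm ((1 / (s - r)) *\<^sub>R (v s - v r)) \<le> nrm (v' r) + nrm ((1 / (s - r)) *\<^sub>R (v s - v r) - v' r)"
          by (intro nrm_le_diff scaleR_in i v'X r)
        finally show "norm (nrm (v s - v r)) \<le> \<bar>s - r\<bar> * (nrm ((1 / (s - r)) *\<^sub>R (v s - v r) - v' r) + nrm (v' r))"
          using nrm_nonneg by (simp add: add.commute mult_left_mono)
      qed
    qed
  qed
  have Fc: "((\<lambda>r'. nrm (F r' - F r)) \<longlongrightarrow> 0) (at r within {0..t})" if r: "r \<in> {0..t}" for r
  proof -
    have "((\<lambda>r'. nrm (S (t - r') (v r) - S (t - r) (v r))) \<longlongrightarrow> 0) (at r within {0..t})"
      by (rule filterlim_compose[OF S_continuous sub]) (use r vX in auto)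
    then have l: "((\<lambda>r'. C * nrm (v r' - v r) + nrm (S (t - r') (v r) - S (t - r) (v r))) \<longlongrightarrow> C * 0 + 0) (at r within {0..t})"
      using r by (intro tendsto_add tendsto_mult tendsto_const vc) auto
    have "\<forall>\<^sub>F r' in at r within {0..t}. norm (nrm (F r' - F r)) \<le> C * nrm (v r' - v r) + nrm (S (t - r') (v r) - S (t - r) (v r))"
      unfolding eventually_at_filter
    proof (rule always_eventually, intro allI impI)
      fix r' assume r': "r' \<in> {0..t}"
      have n: "0 \<le> t - r'" "0 \<le> t - r" "v r' \<in> X" "v r \<in> X" using r r' vX by auto
      have "F r' - F r = S (t - r') (v r' - v r) + (S (t - r') (v r) - S (t - r) (v r))"
        unfolding F_def using S_diff[OF n(1,3,4)] by simp
      also have "nrm \<dots> \<le> nrm (S (t - r') (v r' - v r)) + nrm (S (t - r') (v r) - S (t - r) (v r))"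
        by (intro nrm_triangle S_in diff_in n)
      also have "nrm (S (t - r') (v r' - v r)) \<le> C * nrm (v r' - v r)"
        using r' by (intro C(2) diff_in n) auto
      finally show "norm (nrm (F r' - F r)) \<le> C * nrm (v r' - v r) + nrm (S (t - r') (v r) - S (t - r) (v r))"
        using nrm_nonneg by simp
    qed
    from Lim_null_comparison[OF this] l show ?thesis by simp
  qed
  have Fd: "((\<lambda>r'. nrm ((1 / (r' - r)) *\<^sub>R (F r' - F r))) \<longlongrightarrow> 0) (at r within {0..t})" if r: "r \<in> {0<..<t}" for r
  proof -
    have rr: "0 \<le> r" "0 < r" "0 \<le> t - r" using r by auto
    note vr = vD[OF rr(2)]
    let ?a = "\<lambda>r'. nrm ((1 / (r' - r)) *\<^sub>R (v r' - v r) - v' r)"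
    let ?b = "\<lambda>\<sigma>. nrm (S \<sigma> (v' r) - S (t - r) (v' r))"
    let ?c = "\<lambda>\<sigma>. nrm ((1 / (\<sigma> - (t - r))) *\<^sub>R (S \<sigma> (v r) - S (t - r) (v r)) - S (t - r) (A (v r)))"
    have la: "(?a \<longlongrightarrow> 0) (at r within {0..t})" by (rule tendsto_within_subset[OF dv[OF rr(1)]]) auto
    have lb: "((\<lambda>r'. ?b (t - r')) \<longlongrightarrow> 0) (at r within {0..t})"
      by (rule filterlim_compose[OF S_continuous[OF rr(3) v'X[OF rr(1)]] sub])
    have lc: "((\<lambda>r'. ?c (t - r')) \<longlongrightarrow> 0) (at r within {0..t})"
      by (rule filterlim_compose[OF S_derivative[OF rr(3) vr] sub])
    have l: "((\<lambda>r'. C * ?a r' + (?b (t - r') + ?c (t - r'))) \<longlongrightarrow> C * 0 + (0 + 0)) (at r within {0..t})"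
      by (intro tendsto_add tendsto_mult tendsto_const la lb lc)
    have "\<forall>\<^sub>F r' in at r within {0..t}. norm (nrm ((1 / (r' - r)) *\<^sub>R (F r' - F r))) \<le> C * ?a r' + (?b (t - r') + ?c (t - r'))"
      unfolding eventually_at_filter
    proof (rule always_eventually, intro allI impI)
      fix r' assume r': "r' \<noteq> r" "r' \<in> {0..t}"
      define \<sigma> where "\<sigma> = t - r'"
      define d where "d = r' - r"
      have d: "d \<noteq> 0" "\<sigma> - (t - r) = - d" using r' by (auto simp: d_def \<sigma>_def)
      have \<sigma>: "0 \<le> \<sigma>" "\<sigma> \<le> t + 1" using r' by (auto simp: \<sigma>_def)
      have n: "v r' \<in> X" "v r \<in> X" "v' r \<in> X" "v r' - v r \<in> X" "(1 / d) *\<^sub>R (v r' - v r) \<in> X" "A (v r) \<in> X"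
        using r' vX rr v'X diff_in scaleR_in A_in[OF vr] by auto
      have e: "(1 / d) *\<^sub>R (F r' - F r) = S \<sigma> ((1 / d) *\<^sub>R (v r' - v r) - v' r) +
          ((S \<sigma> (v' r) - S (t - r) (v' r)) -
           ((1 / (\<sigma> - (t - r))) *\<^sub>R (S \<sigma> (v r) - S (t - r) (v r)) - S (t - r) (A (v r))))"
        unfolding F_def \<sigma>_def[symmetric] S_diff[OF \<sigma>(1) n(5,3)] S_scaleR[OF \<sigma>(1) n(4)] S_diff[OF \<sigma>(1) n(1,2)] d(2)
        using v'A[OF rr(2)] by (simp add: algebra_simps)
      have i: "S \<sigma> ((1 / d) *\<^sub>R (v r' - v r) - v' r) \<in> X" "S \<sigma> (v' r) - S (t - r) (v' r) \<in> X"
        "(1 / (\<sigma> - (t - r))) *\<^sub>R (S \<sigma> (v r) - S (t - r) (v r)) - S (t - r) (A (v r)) \<in> X"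
        by (intro S_in diff_in scaleR_in \<sigma> rr n)+
      have "nrm ((1 / d) *\<^sub>R (F r' - F r)) \<le> nrm (S \<sigma> ((1 / d) *\<^sub>R (v r' - v r) - v' r)) + (?b \<sigma> + ?c \<sigma>)"
        unfolding e
        using nrm_triangle[OF i(1) diff_in[OF i(2,3)]] nrm_triangle_diff[OF i(2) zero_in i(3)] nrm_minus[OF i(3)] by simp
      also have "nrm (S \<sigma> ((1 / d) *\<^sub>R (v r' - v r) - v' r)) \<le> C * nrm ((1 / d) *\<^sub>R (v r' - v r) - v' r)"
        by (intro C(2) \<sigma> diff_in n)
      finally show "norm (nrm ((1 / (r' - r)) *\<^sub>R (F r' - F r))) \<le> C * ?a r' + (?b (t - r') + ?c (t - r'))"
        using nrm_nonneg unfolding d_def \<sigma>_def by simp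
    qed
    from Lim_null_comparison[OF this] l show ?thesis by simp
  qed
  define g where "g r = nrm (F r - F 0)" for r
  have F0: "F 0 \<in> X" using t by (intro FX) auto
  have gd: "\<bar>g r' - g r\<bar> \<le> nrm (F r' - F r)" if "r' \<in> {0..t}" "r \<in> {0..t}" for r r'
    using nrm_reverse_triangle[OF diff_in[OF FX[OF that(1)] F0] diff_in[OF FX[OF that(2)] F0]] by (simp add: g_def)
  have "g t = g 0"
  proof (rule DERIV_isconst_end[OF t])
    show "continuous_on {0..t} g"
      unfolding continuous_on_def
    proof
      fix r assume r: "r \<in> {0..t}"
      have "((\<lambda>r'. g r' - g r) \<longlongrightarrow> 0) (at r within {0..t})"
        by (rule Lim_null_comparison[OF _ Fc[OF r]]) (use gd r in \<open>auto simp: eventually_at_filter\<close>)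
      then show "(g \<longlongrightarrow> g r) (at r within {0..t})" by (rule LIM_zero_cancel)
    qed
    fix r assume r: "0 < r" "r < t"
    have "((\<lambda>r'. (g r' - g r) / (r' - r)) \<longlongrightarrow> 0) (at r within {0..t})"
    proof (rule Lim_null_comparison[OF _ Fd])
      show "\<forall>\<^sub>F r' in at r within {0..t}. norm ((g r' - g r) / (r' - r)) \<le> nrm ((1 / (r' - r)) *\<^sub>R (F r' - F r))"
        unfolding eventually_at_filter
      proof (rule always_eventually, intro allI impI)
        fix r' assume r': "r' \<in> {0..t}"
        have "F r' - F r \<in> X" using r r' by (intro diff_in FX) auto
        then show "norm ((g r' - g r) / (r' - r)) \<le> nrm ((1 / (r' - r)) *\<^sub>R (F r' - F r))"
          using gd[OF r', of r] r by (simp add: nrm_scaleR abs_divide divide_right_mono)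
      qed
    qed (use r in auto)
    moreover have "at r within {0..t} = at r" using r by (intro at_within_interior) auto
    ultimately show "(g has_real_derivative 0) (at r)" by (simp add: has_field_derivative_iff)
  qed
  then have "nrm (F t - F 0) = 0" by (simp add: g_def nrm_0)
  then have "F t = F 0" using FX[of t] F0 t by (intro eq_if_diff_0) auto
  then show ?thesis using S_0[OF vX[OF t0]] v0 by (simp add: F_def)
qed

text \<open>
  Orbits starting in the domain are classical solutions; they are the only ones, and the bound on
  the operators bounds them.
\<close>

theorem generator_well_posed:
  assumes "linear_operator X D A" "closed_operator X nrm D A" "densely_defined X nrm D"
  shows "well_posed X nrm D A"
  unfolding well_posed_def
proof (intro conjI ballI allI impI assms)
  have all: "v t = S t x" if "classical_solution X nrm D A x v" "x \<in> D" "0 \<le> t" for v x t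
    using solution_unique[OF that(1)] that S_0[OF D_in[OF that(2)]]
    by (cases "t = 0") (auto simp: classical_solution_def)
  fix x assume x: "x \<in> D"
  show "\<exists>u. classical_solution X nrm D A x u \<and> (\<forall>v. classical_solution X nrm D A x v \<longrightarrow> (\<forall>t\<ge>0. v t = u t))"
    using S_solution[OF x] all[OF _ x] by blast
next
  have all: "v t = S t x" if "classical_solution X nrm D A x v" "x \<in> D" "0 \<le> t" for v x t
    using solution_unique[OF that(1)] that S_0[OF D_in[OF that(2)]]
    by (cases "t = 0") (auto simp: classical_solution_def)
  fix T :: real assume "0 < T"
  then obtain C where C: "C > 0" "\<forall>t\<in>{0..T}. \<forall>x\<in>X. nrm (S t x) \<le> C * nrm x" using locally_bounded by blast
  show "\<exists>C>0. \<forall>u0\<in>D. \<forall>u. classical_solution X nrm D A u0 u \<longrightarrow> (\<forall>t\<in>{0..T}. nrm (u t) \<le> C * nrm u0)"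
  proof (intro exI[of _ C] conjI ballI allI impI C(1))
    fix x u t assume "x \<in> D" "classical_solution X nrm D A x u" "t \<in> {0..T}"
    then show "nrm (u t) \<le> C * nrm x" using C(2) all[of x u t] D_in[of x] by simp
  qed
qed

end

section \<open>Lebesgue spaces of classes\<close>

lemma ae_eq_refl: "f \<in> borel_measurable borel \<Longrightarrow> ae_eq f f"
  by (simp add: ae_eq_def)

lemma rep_measurable [measurable]: "rep_ae_class u \<in> borel_measurable borel"
  using rep_ae_class_measurable[of u] by simp

lemma class_of_add: "f \<in> borel_measurable borel \<Longrightarrow> g \<in> borel_measurable borel \<Longrightarrow>
    class_of f + class_of g = class_of (\<lambda>x. f x + g x)"
  by (rule plus_ae_class.abs_eq) (rule ae_eq_refl, assumption)+

lemma class_of_diff: "f \<in> borel_measurable borel \<Longrightarrow> g \<in> borel_measurable borel \<Longrightarrow>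
    class_of f - class_of g = class_of (\<lambda>x. f x - g x)"
  by (rule minus_ae_class.abs_eq) (rule ae_eq_refl, assumption)+

lemma class_of_scaleR: "f \<in> borel_measurable borel \<Longrightarrow> c *\<^sub>R class_of f = class_of (\<lambda>x. c *\<^sub>R f x)"
  by (rule scaleR_ae_class.abs_eq) (rule ae_eq_refl, assumption)

lemma class_of_zero: "class_of (\<lambda>x. 0) = 0"
  by (rule zero_ae_class.abs_eq[symmetric])

lemma Lp_iff_lp: "u \<in> Lp p \<longleftrightarrow> lp p (rep_ae_class u)"
  by (simp add: Lp_def lp_def)

lemma Lp_norm_lpn: "Lp_norm p u = lpn p (rep_ae_class u)"
  by (simp add: Lp_norm_def lpn_def)

lemma rep_class_of: "f \<in> borel_measurable borel \<Longrightarrow> AE x in lborel. rep_ae_class (class_of f) x = f x"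
  by (rule rep_class_of_AE) simp

lemma class_of_Lp:
  assumes "0 < p" "f \<in> borel_measurable borel"
  shows "class_of f \<in> Lp p \<longleftrightarrow> lp p f"
proof
  assume "class_of f \<in> Lp p"
  then have "lp p (rep_ae_class (class_of f))" by (simp add: Lp_iff_lp)
  moreover have "AE x in lborel. f x = rep_ae_class (class_of f) x" using rep_class_of[OF assms(2)] by (simp add: eq_commute)
  ultimately show "lp p f" by (rule lp_cong_AE(1)[OF assms(1) _ assms(2)])
next
  assume "lp p f"
  then have "lp p (rep_ae_class (class_of f))"
    by (rule lp_cong_AE(1)[OF assms(1) _ rep_measurable rep_class_of[OF assms(2)]])
  then show "class_of f \<in> Lp p" by (simp add: Lp_iff_lp)
qed

lemma Lp_norm_class_of:
  assumes "0 < p" "lp p f"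
  shows "Lp_norm p (class_of f) = lpn p f"
  unfolding Lp_norm_lpn
  by (rule lp_cong_AE(2)[OF assms rep_measurable rep_class_of[OF lp_measurable[OF assms(2)]]])

lemma Lp_norm_diff: "Lp_norm p (class_of f - u) = Lp_norm p (class_of (\<lambda>x. f x - rep_ae_class u x))"
  if "f \<in> borel_measurable borel"
  using class_of_diff[OF that rep_measurable[of u]] by (simp add: class_of_rep_ae_class)

lemma Lp_banach_carrier:
  assumes p: "1 \<le> p"
  shows "banach_carrier (Lp p :: ('a::euclidean_space, 'b::euclidean_space) ae_class set) (Lp_norm p)"
proof
  have p0: "0 < p" using p by simp
  have add: "x + y \<in> Lp p \<and> Lp_norm p (x + y) \<le> Lp_norm p x + Lp_norm p y" if "x \<in> Lp p" "y \<in> Lp p"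
    for x y :: "('a, 'b) ae_class"
  proof -
    have l: "lp p (rep_ae_class x)" "lp p (rep_ae_class y)" using that by (auto simp: Lp_iff_lp)
    have e: "x + y = class_of (\<lambda>z. rep_ae_class x z + rep_ae_class y z)"
      using class_of_add[OF rep_measurable[of x] rep_measurable[of y]] by (simp add: class_of_rep_ae_class)
    show ?thesis
      unfolding e using lp_add[OF p l] p0
      by (simp add: class_of_Lp lp_measurable Lp_norm_class_of) (simp add: Lp_norm_lpn)
  qed
  have scale: "c *\<^sub>R x \<in> Lp p \<and> Lp_norm p (c *\<^sub>R x) = \<bar>c\<bar> * Lp_norm p x" if "x \<in> Lp p" for c and x :: "('a, 'b) ae_class"
  proof -
    have l: "lp p (rep_ae_class x)" using that by (auto simp: Lp_iff_lp)
    have e: "c *\<^sub>R x = class_of (\<lambda>z. c *\<^sub>R rep_ae_class x z)"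
      using class_of_scaleR[OF rep_measurable[of x]] by (simp add: class_of_rep_ae_class)
    show ?thesis
      unfolding e using lp_scaleR[OF p0 l, of c] p0
      by (simp add: class_of_Lp lp_measurable Lp_norm_class_of) (simp add: Lp_norm_lpn)
  qed
  have zero: "(0 :: ('a, 'b) ae_class) \<in> Lp p"
    using class_of_Lp[OF p0, of "\<lambda>x. 0"] by (simp add: class_of_zero[symmetric])
  show "subspace (Lp p :: ('a, 'b) ae_class set)"
    using add scale zero by (auto simp: subspace_def)
  fix x y :: "('a, 'b) ae_class" and c :: real
  show "0 \<le> Lp_norm p x" by (simp add: Lp_norm_lpn)
  show "x \<in> Lp p \<Longrightarrow> y \<in> Lp p \<Longrightarrow> Lp_norm p (x + y) \<le> Lp_norm p x + Lp_norm p y" using add by blast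
  show "x \<in> Lp p \<Longrightarrow> Lp_norm p (c *\<^sub>R x) = \<bar>c\<bar> * Lp_norm p x" using scale by blast
  show "x = 0" if "x \<in> Lp p" "Lp_norm p x = 0"
  proof -
    have "AE z in lborel. rep_ae_class x z = 0"
      using that p0 by (intro lpn_eq_0[of p]) (auto simp: Lp_iff_lp Lp_norm_lpn)
    then have "class_of (rep_ae_class x) = class_of (\<lambda>z. 0)"
      by (subst class_of_eq_iff) auto
    then show "x = 0" by (simp add: class_of_rep_ae_class class_of_zero)
  qed
next
  fix s :: "nat \<Rightarrow> ('a, 'b) ae_class"
  assume s: "\<And>k. s k \<in> Lp p" and c: "\<And>e. e > 0 \<Longrightarrow> \<exists>N. \<forall>k\<ge>N. \<forall>l\<ge>N. Lp_norm p (s k - s l) \<le> e"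
  have p0: "0 < p" using p by simp
  let ?F = "\<lambda>k. rep_ae_class (s k)"
  have F: "lp p (?F k)" for k using s by (simp add: Lp_iff_lp)
  have n: "Lp_norm p (s k - class_of f) = lpn p (\<lambda>x. ?F k x - f x)" if "lp p f" for k f
  proof -
    have "s k - class_of f = class_of (\<lambda>x. ?F k x - f x)"
      using class_of_diff[OF rep_measurable[of "s k"] lp_measurable[OF that]] by (simp add: class_of_rep_ae_class)
    then show ?thesis using Lp_norm_class_of[OF p0 lp_diff(1)[OF p F that]] by simp
  qed
  have "\<exists>f. lp p f \<and> (\<lambda>k. lpn p (\<lambda>x. ?F k x - f x)) \<longlonglongrightarrow> 0"
  proof (rule lp_complete[OF p F])
    fix e :: real assume "e > 0"
    then show "\<exists>N. \<forall>k\<ge>N. \<forall>l\<ge>N. lpn p (\<lambda>x. ?F k x - ?F l x) \<le> e"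
      using c[of e] n[OF F] by (simp add: class_of_rep_ae_class)
  qed
  then obtain f where f: "lp p f" "(\<lambda>k. lpn p (\<lambda>x. ?F k x - f x)) \<longlonglongrightarrow> 0" by blast
  then show "\<exists>x\<in>Lp p. (\<lambda>k. Lp_norm p (s k - x)) \<longlonglongrightarrow> 0"
    using n[OF f(1)] class_of_Lp[OF p0 lp_measurable[OF f(1)]] by (intro bexI[of _ "class_of f"]) auto
qed

lemma vec_norm_le_sum: "norm (v :: complex ^ 'N) \<le> (\<Sum>j\<in>UNIV. norm (v $ j))"
  by (simp add: norm_vec_def L2_set_le_sum)

lemma measurable_vec_nth [measurable]:
  fixes f :: "'a \<Rightarrow> complex ^ 'N"
  assumes [measurable]: "f \<in> borel_measurable M" shows "(\<lambda>x. f x $ j) \<in> borel_measurable M"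
proof -
  have "(\<lambda>v :: complex ^ 'N. v $ j) \<in> borel_measurable borel"
    by (intro borel_measurable_continuous_onI linear_continuous_on bounded_linear_vec_nth)
  from measurable_compose[OF assms this] show ?thesis .
qed

lemma measurable_vecI:
  fixes f :: "'a::euclidean_space \<Rightarrow> complex ^ 'N"
  assumes "\<And>j. (\<lambda>x. f x $ j) \<in> borel_measurable borel"
  shows "f \<in> borel_measurable borel"
proof -
  have ax: "(\<lambda>c :: complex. axis j c :: complex ^ 'N) \<in> borel_measurable borel" for j
  proof (intro borel_measurable_continuous_onI linear_continuous_on)
    show "bounded_linear (\<lambda>c :: complex. axis j c :: complex ^ 'N)"
      unfolding linear_conv_bounded_linear[symmetric]
      by (rule linearI) (auto simp: axis_def vec_eq_iff)
  qed
  have f: "f = (\<lambda>x. \<Sum>j\<in>UNIV. axis j (f x $ j))"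
    by (rule ext) (simp add: vec_eq_iff axis_def)
  have "(\<lambda>x. axis j (f x $ j) :: complex ^ 'N) \<in> borel_measurable borel" for j
    by (rule measurable_compose[OF assms ax])
  then have "(\<lambda>x. \<Sum>j\<in>UNIV. axis j (f x $ j)) \<in> borel_measurable borel"
    by (intro borel_measurable_sum) auto
  then show ?thesis using f by simp
qed

lemma lp_vec:
  fixes f :: "'a::euclidean_space \<Rightarrow> complex ^ 'N"
  assumes p: "1 \<le> p"
  shows "lp p f \<longleftrightarrow> (\<forall>j. lp p (\<lambda>x. f x $ j))"
    and "(\<And>j. lp p (\<lambda>x. f x $ j)) \<Longrightarrow> lpn p f \<le> (\<Sum>j\<in>UNIV. lpn p (\<lambda>x. f x $ j))"
    and "lp p f \<Longrightarrow> lpn p (\<lambda>x. f x $ j) \<le> lpn p f"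
proof -
  have p0: "0 < p" using p by simp
  have 1: "lp p (\<lambda>x. f x $ j) \<and> lpn p (\<lambda>x. f x $ j) \<le> lpn p f" if "lp p f" for j
    using lp_dominated[OF p0 that measurable_vec_nth[OF lp_measurable[OF that]], of j] Finite_Cartesian_Product.norm_nth_le by auto
  have 2: "lp p f \<and> lpn p f \<le> (\<Sum>j\<in>UNIV. lpn p (\<lambda>x. f x $ j))" if j: "\<And>j. lp p (\<lambda>x. f x $ j)"
  proof -
    have m: "f \<in> borel_measurable borel" by (rule measurable_vecI[OF lp_measurable[OF j]])
    have n: "lp p (\<lambda>x. norm (f x $ j))" "lpn p (\<lambda>x. norm (f x $ j)) = lpn p (\<lambda>x. f x $ j)" for j
      using j[of j] by (auto simp: lp_def lpn_def)
    have s: "lp p (\<lambda>x. \<Sum>j\<in>UNIV. norm (f x $ j))" "lpn p (\<lambda>x. \<Sum>j\<in>UNIV. norm (f x $ j)) \<le> (\<Sum>j\<in>UNIV. lpn p (\<lambda>x. f x $ j))"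
      using lp_sum[OF p, of "UNIV :: 'N set" "\<lambda>j x. norm (f x $ j)"] n by auto
    have "norm (f x) \<le> norm (\<Sum>j\<in>UNIV. norm (f x $ j))" for x
      using vec_norm_le_sum[of "f x"] by (simp add: sum_nonneg)
    then show ?thesis using lp_dominated[OF p0 s(1) m] s(2) by auto
  qed
  show "lp p f \<longleftrightarrow> (\<forall>j. lp p (\<lambda>x. f x $ j))"
    "(\<And>j. lp p (\<lambda>x. f x $ j)) \<Longrightarrow> lpn p f \<le> (\<Sum>j\<in>UNIV. lpn p (\<lambda>x. f x $ j))"
    "lp p f \<Longrightarrow> lpn p (\<lambda>x. f x $ j) \<le> lpn p f" using 1 2 by blast+
qed

section \<open>Pairing with Schwartz functions\<close>

locale conjugate =
  fixes p q :: real
  assumes pq: "1 < p" "1 < q" "1 / p + 1 / q = 1"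
begin

lemma p_ge: "1 \<le> p" "0 < p" "1 \<le> q" "0 < q" using pq by auto

lemma pair_integrable:
  fixes f \<phi> :: "real ^ 'n \<Rightarrow> complex"
  assumes "lp p f" "lp q \<phi>"
  shows "integrable lborel (\<lambda>x. \<phi> x * f x)" "norm (\<integral>x. \<phi> x * f x \<partial>lborel) \<le> lpn q \<phi> * lpn p f"
proof -
  have [measurable]: "f \<in> borel_measurable borel" "\<phi> \<in> borel_measurable borel" using assms by (auto simp: lp_def)
  have h: "integrable lborel (\<lambda>x. norm (\<phi> x) * norm (f x))" "(\<integral>x. norm (\<phi> x) * norm (f x) \<partial>lborel) \<le> lpn q \<phi> * lpn p f"
    using hoelder[of q p \<phi> f] pq assms by (auto simp: add.commute)
  show "integrable lborel (\<lambda>x. \<phi> x * f x)"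
    by (rule Bochner_Integration.integrable_bound[OF h(1)]) (auto simp: norm_mult)
  have "norm (\<integral>x. \<phi> x * f x \<partial>lborel) \<le> (\<integral>x. norm (\<phi> x * f x) \<partial>lborel)" by (rule integral_norm_bound)
  with h(2) show "norm (\<integral>x. \<phi> x * f x \<partial>lborel) \<le> lpn q \<phi> * lpn p f" by (simp add: norm_mult)
qed

lemma dist_of_nth:
  fixes u :: "(real ^ 'n, complex ^ 'N) ae_class"
  assumes "u \<in> Lp p" "lp q \<phi>"
  shows "dist_of u \<phi> $ j = (\<integral>x. \<phi> x * rep_ae_class u x $ j \<partial>lborel)"
proof -
  have l: "lp p (\<lambda>x. rep_ae_class u x $ j)" for j using assms lp_vec(1)[OF p_ge(1)] by (auto simp: Lp_iff_lp)
  have [measurable]: "\<phi> \<in> borel_measurable borel" using assms(2) by (rule lp_measurable)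
  have "integrable lborel (\<lambda>x. \<phi> x *s rep_ae_class u x)"
  proof (rule Bochner_Integration.integrable_bound)
    show "integrable lborel (\<lambda>x. \<Sum>j\<in>UNIV. norm (\<phi> x * rep_ae_class u x $ j))"
      by (intro Bochner_Integration.integrable_sum integrable_norm pair_integrable(1)[OF l assms(2)])
    show "AE x in lborel. norm (\<phi> x *s rep_ae_class u x) \<le> norm (\<Sum>j\<in>UNIV. norm (\<phi> x * rep_ae_class u x $ j))"
      using vec_norm_le_sum[of "\<phi> _ *s rep_ae_class u _"] by (auto simp: sum_nonneg intro!: AE_I2)
    have "(\<lambda>x. \<phi> x *s rep_ae_class u x) \<in> borel_measurable borel" by (rule measurable_vecI) simp
    then show "(\<lambda>x. \<phi> x *s rep_ae_class u x) \<in> borel_measurable lborel" by simp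
  qed
  from integral_bounded_linear[OF bounded_linear_vec_nth this, of j]
  show ?thesis by (simp add: dist_of_def)
qed

lemma dist_of_class:
  fixes f :: "real ^ 'n \<Rightarrow> complex ^ 'N"
  assumes "lp p f" "lp q \<phi>"
  shows "dist_of (class_of f) \<phi> $ j = (\<integral>x. \<phi> x * f x $ j \<partial>lborel)"
proof -
  have [measurable]: "\<phi> \<in> borel_measurable borel" "f \<in> borel_measurable borel" using assms by (auto intro: lp_measurable)
  have "class_of f \<in> Lp p" using class_of_Lp[OF p_ge(2) lp_measurable[OF assms(1)]] assms(1) by simp
  then have "dist_of (class_of f) \<phi> $ j = (\<integral>x. \<phi> x * rep_ae_class (class_of f) x $ j \<partial>lborel)"
    by (rule dist_of_nth[OF _ assms(2)])
  also have "\<dots> = (\<integral>x. \<phi> x * f x $ j \<partial>lborel)"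
    by (rule integral_cong_AE) (use rep_class_of[OF lp_measurable[OF assms(1)]] in auto)
  finally show ?thesis .
qed

lemma dist_of_bound:
  fixes u :: "(real ^ 'n, complex ^ 'N) ae_class"
  assumes "u \<in> Lp p" "lp q \<phi>"
  shows "norm (dist_of u \<phi> $ j) \<le> lpn q \<phi> * Lp_norm p u"
proof -
  have l: "lp p (rep_ae_class u)" using assms by (simp add: Lp_iff_lp)
  then have lj: "lp p (\<lambda>x. rep_ae_class u x $ j)" using lp_vec(1)[OF p_ge(1)] by auto
  have "norm (dist_of u \<phi> $ j) \<le> lpn q \<phi> * lpn p (\<lambda>x. rep_ae_class u x $ j)"
    unfolding dist_of_nth[OF assms] by (rule pair_integrable(2)[OF lj assms(2)])
  also have "\<dots> \<le> lpn q \<phi> * lpn p (rep_ae_class u)" by (intro mult_left_mono lp_vec(3)[OF p_ge(1) l]) simp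
  finally show ?thesis by (simp add: Lp_norm_lpn)
qed

lemma rep_nth_lp:
  fixes u :: "(real ^ 'n, complex ^ 'N) ae_class"
  shows "u \<in> Lp p \<Longrightarrow> lp p (\<lambda>x. rep_ae_class u x $ j)"
  using lp_vec(1)[OF p_ge(1)] by (auto simp: Lp_iff_lp)

lemma dist_of_add:
  fixes u v :: "(real ^ 'n, complex ^ 'N) ae_class"
  assumes u: "u \<in> Lp p" and v: "v \<in> Lp p" and \<phi>: "lp q \<phi>"
  shows "dist_of (u + v) \<phi> = dist_of u \<phi> + dist_of v \<phi>"
proof -
  have l: "lp p (rep_ae_class u)" "lp p (rep_ae_class v)" using u v by (auto simp: Lp_iff_lp)
  have "u + v = class_of (\<lambda>x. rep_ae_class u x + rep_ae_class v x)"
    using class_of_add[OF rep_measurable[of u] rep_measurable[of v]] by (simp add: class_of_rep_ae_class)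
  then have "dist_of (u + v) \<phi> $ j = (\<integral>x. \<phi> x * (rep_ae_class u x + rep_ae_class v x) $ j \<partial>lborel)" for j
    using dist_of_class[OF lp_add(1)[OF p_ge(1) l] \<phi>] by simp
  then show ?thesis
    using pair_integrable(1)[OF rep_nth_lp[OF u] \<phi>] pair_integrable(1)[OF rep_nth_lp[OF v] \<phi>]
    by (simp add: vec_eq_iff dist_of_nth[OF u \<phi>] dist_of_nth[OF v \<phi>] distrib_left)
qed

lemma dist_of_scaleR:
  fixes u :: "(real ^ 'n, complex ^ 'N) ae_class"
  assumes u: "u \<in> Lp p" and \<phi>: "lp q \<phi>"
  shows "dist_of (c *\<^sub>R u) \<phi> = c *\<^sub>R dist_of u \<phi>"
proof -
  have l: "lp p (rep_ae_class u)" using u by (auto simp: Lp_iff_lp)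
  have "c *\<^sub>R u = class_of (\<lambda>x. c *\<^sub>R rep_ae_class u x)"
    using class_of_scaleR[OF rep_measurable[of u]] by (simp add: class_of_rep_ae_class)
  then have "dist_of (c *\<^sub>R u) \<phi> $ j = (\<integral>x. \<phi> x * (c *\<^sub>R rep_ae_class u x) $ j \<partial>lborel)" for j
    using dist_of_class[OF lp_scaleR(1)[OF p_ge(2) l] \<phi>] by simp
  then show ?thesis
    by (simp add: vec_eq_iff dist_of_nth[OF u \<phi>])
qed

lemma dist_of_diff:
  fixes u v :: "(real ^ 'n, complex ^ 'N) ae_class"
  assumes u: "u \<in> Lp p" and v: "v \<in> Lp p" and \<phi>: "lp q \<phi>"
  shows "dist_of (u - v) \<phi> = dist_of u \<phi> - dist_of v \<phi>"
proof -
  interpret banach_carrier "Lp p :: (real ^ 'n, complex ^ 'N) ae_class set" "Lp_norm p"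
    by (rule Lp_banach_carrier[OF p_ge(1)])
  show ?thesis
    using dist_of_add[OF u scaleR_in[OF v, of "- 1"] \<phi>] dist_of_scaleR[OF v \<phi>, of "- 1"] by simp
qed

lemma dist_of_diff_bound:
  fixes u v :: "(real ^ 'n, complex ^ 'N) ae_class"
  assumes u: "u \<in> Lp p" and v: "v \<in> Lp p" and \<phi>: "lp q \<phi>"
  shows "norm (dist_of u \<phi> $ j - dist_of v \<phi> $ j) \<le> lpn q \<phi> * Lp_norm p (u - v)"
proof -
  interpret X: banach_carrier "Lp p :: (real ^ 'n, complex ^ 'N) ae_class set" "Lp_norm p"
    by (rule Lp_banach_carrier[OF p_ge(1)])
  show ?thesis using dist_of_bound[OF X.diff_in[OF u v] \<phi>, of j] dist_of_diff[OF u v \<phi>] by simp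
qed

text \<open>
  The components are estimated separately and added up, whence the factor \<open>CARD('N)\<close>.
\<close>

lemma Lp_norm_dual:
  fixes u :: "(real ^ 'n, complex ^ 'N) ae_class"
  assumes u: "u \<in> Lp p" and K: "0 \<le> K"
    and bd: "\<And>g j. testfun g \<Longrightarrow> norm (dist_of u (inv_fourier g) $ j) \<le> K * lpn q (inv_fourier g)"
  shows "Lp_norm p u \<le> real CARD('N) * K"
proof -
  have "lpn p (\<lambda>x. rep_ae_class u x $ j) \<le> K" for j
  proof (rule lpn_dual[OF pq rep_nth_lp[OF u] K])
    fix g :: "real ^ 'n \<Rightarrow> complex" assume g: "testfun g"
    show "norm (\<integral>x. inv_fourier g x * rep_ae_class u x $ j \<partial>lborel) \<le> K * lpn q (inv_fourier g)"
      using bd[OF g, of j] dist_of_nth[OF u testfun_lp[OF p_ge(3) g]] by simp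
  qed
  then have "(\<Sum>j\<in>UNIV. lpn p (\<lambda>x. rep_ae_class u x $ j)) \<le> (\<Sum>j\<in>(UNIV :: 'N set). K)" by (intro sum_mono)
  moreover have "Lp_norm p u \<le> (\<Sum>j\<in>UNIV. lpn p (\<lambda>x. rep_ae_class u x $ j))"
    unfolding Lp_norm_lpn by (rule lp_vec(2)[OF p_ge(1) rep_nth_lp[OF u]])
  ultimately show ?thesis by simp
qed

text \<open>
  Band-limited test functions separate the classes, since the norm of the difference is controlled.
\<close>

lemma Lp_eqI:
  fixes u v :: "(real ^ 'n, complex ^ 'N) ae_class"
  assumes u: "u \<in> Lp p" and v: "v \<in> Lp p"
    and eq: "\<And>g j. testfun g \<Longrightarrow> dist_of u (inv_fourier g) $ j = dist_of v (inv_fourier g) $ j"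
  shows "u = v"
proof -
  interpret banach_carrier "Lp p :: (real ^ 'n, complex ^ 'N) ae_class set" "Lp_norm p"
    by (rule Lp_banach_carrier[OF p_ge(1)])
  have "Lp_norm p (u - v) \<le> real CARD('N) * 0"
    by (rule Lp_norm_dual[OF diff_in[OF u v]])
       (use eq in \<open>auto simp: dist_of_diff[OF u v testfun_lp[OF p_ge(3)]]\<close>)
  then show ?thesis using nrm_nonneg[of "u - v"] eq_if_diff_0[OF u v] by simp
qed

definition testvec :: "(real ^ 'n \<Rightarrow> complex ^ 'N) \<Rightarrow> bool"
  where "testvec g \<longleftrightarrow> (\<forall>j. testfun (\<lambda>\<xi>. g \<xi> $ j))"

lemma testvec_schwartz:
  fixes g :: "real ^ 'n \<Rightarrow> complex ^ 'N"
  shows "testvec g \<Longrightarrow> inv_fourier_vec g \<in> schwartz"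
  unfolding schwartz_vec_iff testvec_def inv_fourier_vec_def
  by (auto intro: schwartz_inv_fourier testfun_schwartz)

lemma schwartz_vec_lp:
  fixes u :: "real ^ 'n \<Rightarrow> complex ^ 'N"
  shows "u \<in> schwartz \<Longrightarrow> lp p u"
  unfolding lp_vec(1)[OF p_ge(1)] schwartz_vec_iff by (auto intro: schwartz_lp p_ge)

lemma testvec_dense:
  fixes u :: "(real ^ 'n, complex ^ 'N) ae_class"
  assumes u: "u \<in> Lp p" and e: "e > 0"
  shows "\<exists>g. testvec g \<and> Lp_norm p (class_of (inv_fourier_vec g) - u) < e"
proof -
  have "\<exists>g. testfun g \<and> lpn p (\<lambda>x. rep_ae_class u x $ j - inv_fourier g x) < e / real (CARD('N))" for j
    using lp_dense[OF p_ge(1) rep_nth_lp[OF u, of j]] e by (auto simp: apx_def)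
  then obtain g where g: "\<And>j. testfun (g j)" "\<And>j. lpn p (\<lambda>x. rep_ae_class u x $ j - inv_fourier (g j) x) < e / real (CARD('N))"
    by metis
  define G where "G \<xi> = (\<chi> j. g j \<xi>)" for \<xi>
  have G: "testvec G" using g by (simp add: testvec_def G_def)
  have lG: "lp p (inv_fourier_vec G)" by (intro schwartz_vec_lp testvec_schwartz G)
  let ?d = "\<lambda>x. inv_fourier_vec G x - rep_ae_class u x"
  have ld: "lp p ?d" by (intro lp_diff p_ge lG) (use u in \<open>simp add: Lp_iff_lp\<close>)
  have "Lp_norm p (class_of (inv_fourier_vec G) - u) = lpn p ?d"
    unfolding Lp_norm_diff[OF lp_measurable[OF lG]] by (rule Lp_norm_class_of[OF p_ge(2) ld])
  also have "\<dots> \<le> (\<Sum>j\<in>UNIV. lpn p (\<lambda>x. ?d x $ j))"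
  proof (rule lp_vec(2)[OF p_ge(1)])
    show "lp p (\<lambda>x. ?d x $ j)" for j using ld unfolding lp_vec(1)[OF p_ge(1), of ?d] by blast
  qed
  also have "\<dots> = (\<Sum>j\<in>UNIV. lpn p (\<lambda>x. rep_ae_class u x $ j - inv_fourier (g j) x))"
    by (simp add: inv_fourier_vec_def G_def lpn_def norm_minus_commute)
  also have "\<dots> < (\<Sum>j\<in>(UNIV :: 'N set). e / real (CARD('N)))"
    by (intro sum_strict_mono g) auto
  also have "\<dots> = e" by simp
  finally show ?thesis using G by blast
qed

end

section \<open>Power series with geometrically bounded Taylor coefficients\<close>

text \<open>
  The exponential generating function of \<open>c\<close>. Shifting \<open>c\<close> differentiates it; all estimates come
  from a geometric bound \<open>C B ^ k\<close> of the coefficients.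
\<close>

definition eseries :: "(nat \<Rightarrow> complex) \<Rightarrow> real \<Rightarrow> complex"
  where "eseries c t = (\<Sum>k. complex_of_real (t ^ k / fact k) * c k)"

lemma eseries_at_0: "eseries c 0 = c 0"
  unfolding eseries_def by (subst suminf_finite[of "{0}"]) auto

lemma eseries_bound_sums: "(\<lambda>k. \<bar>t ^ k / fact k\<bar> * (C * B ^ k)) sums (C * exp (\<bar>t\<bar> * B))" for t :: real
proof -
  have "(\<lambda>k. C * ((\<bar>t\<bar> * B) ^ k /\<^sub>R fact k)) sums (C * exp (\<bar>t\<bar> * B))"
    by (intro sums_mult exp_converges)
  then show ?thesis by (simp add: power_mult_distrib power_abs divide_inverse ac_simps abs_mult)
qed

context
  fixes c :: "nat \<Rightarrow> complex" and C B :: real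
  assumes c: "\<And>k. norm (c k) \<le> C * B ^ k"
begin

lemma eseries_summable_norm: "summable (\<lambda>k. norm (complex_of_real (t ^ k / fact k) * c k))"
proof (rule summable_comparison_test'[OF sums_summable[OF eseries_bound_sums[of t C B]]])
  fix k
  show "norm (norm (complex_of_real (t ^ k / fact k) * c k)) \<le> \<bar>t ^ k / fact k\<bar> * (C * B ^ k)"
    unfolding real_norm_def abs_norm_cancel unfolding norm_mult norm_of_real by (intro mult_left_mono c abs_ge_zero)
qed

lemma eseries_sums: "(\<lambda>k. complex_of_real (t ^ k / fact k) * c k) sums eseries c t"
  unfolding eseries_def using summable_norm_cancel[OF eseries_summable_norm] by (rule summable_sums)

lemma eseries_norm: "norm (eseries c t) \<le> C * exp (\<bar>t\<bar> * B)"
proof -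
  have "norm (eseries c t) \<le> (\<Sum>k. norm (complex_of_real (t ^ k / fact k) * c k))"
    unfolding eseries_def by (rule summable_norm[OF eseries_summable_norm])
  also have "\<dots> \<le> (\<Sum>k. \<bar>t ^ k / fact k\<bar> * (C * B ^ k))"
  proof (rule suminf_le[OF _ eseries_summable_norm sums_summable[OF eseries_bound_sums]])
    fix k
    show "norm (complex_of_real (t ^ k / fact k) * c k) \<le> \<bar>t ^ k / fact k\<bar> * (C * B ^ k)"
      unfolding norm_mult norm_of_real by (intro mult_left_mono c abs_ge_zero)
  qed
  also have "\<dots> = C * exp (\<bar>t\<bar> * B)" by (rule sums_unique[OF eseries_bound_sums, symmetric])
  finally show ?thesis .
qed

lemma eseries_derivative: "(eseries c has_vector_derivative eseries (\<lambda>k. c (Suc k)) t) (at t within U)"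
proof -
  let ?d = "\<lambda>k. c k / fact k"
  have s: "summable (\<lambda>k. ?d k * z ^ k)" for z :: complex
  proof (rule summable_norm_cancel, rule summable_comparison_test'[OF sums_summable[OF eseries_bound_sums[of "norm z" C B]]])
    fix k
    have "norm (norm (?d k * z ^ k)) = \<bar>norm z ^ k / fact k\<bar> * norm (c k)" by (simp add: norm_mult norm_divide norm_power)
    also have "\<dots> \<le> \<bar>norm z ^ k / fact k\<bar> * (C * B ^ k)" by (intro mult_left_mono c abs_ge_zero)
    finally show "norm (norm (?d k * z ^ k)) \<le> \<bar>norm z ^ k / fact k\<bar> * (C * B ^ k)" .
  qed
  have "diffs ?d k = c (Suc k) / fact k" for k
    by (simp add: diffs_def field_simps del: of_nat_Suc)
  then have "((\<lambda>z. \<Sum>k. ?d k * z ^ k) has_field_derivative (\<Sum>k. c (Suc k) / fact k * complex_of_real t ^ k)) (at (complex_of_real t))"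
    using termdiffs_strong_converges_everywhere[OF s, of "complex_of_real t"] by simp
  from has_vector_derivative_real_field[OF this]
  show ?thesis by (simp add: eseries_def[abs_def] mult.commute)
qed

end

lemma eseries_shift_bound:
  assumes "\<And>k. norm (c k) \<le> C * B ^ k" shows "norm (c (Suc k)) \<le> (C * B) * B ^ k"
  using assms[of "Suc k"] by (simp add: ac_simps)

lemma eseries_lipschitz:
  assumes c: "\<And>k. norm (c k) \<le> C * B ^ k" and B: "0 \<le> B" and C: "0 \<le> C" and s: "\<bar>s\<bar> \<le> T" and t: "\<bar>t\<bar> \<le> T"
  shows "norm (eseries c s - eseries c t) \<le> (C * B * exp (T * B)) * \<bar>s - t\<bar>"
proof -
  have "norm (eseries c s - eseries c t) \<le> (C * B * exp (T * B)) * norm (s - t)"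
  proof (rule differentiable_bound[of "{- T..T}" "eseries c" "\<lambda>t h. h *\<^sub>R eseries (\<lambda>k. c (Suc k)) t"])
    fix r assume r: "r \<in> {- T..T}"
    show "(eseries c has_derivative (\<lambda>h. h *\<^sub>R eseries (\<lambda>k. c (Suc k)) r)) (at r within {- T..T})"
      using eseries_derivative[OF c] unfolding has_vector_derivative_def .
    have "norm (eseries (\<lambda>k. c (Suc k)) r) \<le> (C * B) * exp (\<bar>r\<bar> * B)"
      by (rule eseries_norm[OF eseries_shift_bound[OF c]])
    also have "\<dots> \<le> (C * B) * exp (T * B)" using r B C by (intro mult_left_mono) (auto intro!: mult_right_mono)
    finally have n: "norm (eseries (\<lambda>k. c (Suc k)) r) \<le> (C * B) * exp (T * B)" .
    show "onorm (\<lambda>h. h *\<^sub>R eseries (\<lambda>k. c (Suc k)) r) \<le> C * B * exp (T * B)"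
      using mult_left_mono[OF n abs_ge_zero] B C by (intro onorm_bound) (auto simp: mult.commute)
  qed (use s t in auto)
  then show ?thesis by simp
qed

lemma eseries_mean_value:
  assumes c: "\<And>k. norm (c k) \<le> C * B ^ k"
    and d: "\<And>r. r \<in> closed_segment s t \<Longrightarrow> norm (eseries (\<lambda>k. c (Suc k)) r - eseries (\<lambda>k. c (Suc k)) t) \<le> d"
  shows "norm (eseries c s - eseries c t - (s - t) *\<^sub>R eseries (\<lambda>k. c (Suc k)) t) \<le> d * \<bar>s - t\<bar>"
proof -
  let ?E = "eseries (\<lambda>k. c (Suc k))"
  let ?f = "\<lambda>r. eseries c r - r *\<^sub>R ?E t"
  have d0: "0 \<le> d" using d[of t] norm_ge_zero by (meson ends_in_segment(2) order_trans)
  have "norm (?f s - ?f t) \<le> d * norm (s - t)"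
  proof (rule differentiable_bound[of "closed_segment s t" ?f "\<lambda>r h. h *\<^sub>R ?E r - h *\<^sub>R ?E t"])
    fix r assume r: "r \<in> closed_segment s t"
    show "(?f has_derivative (\<lambda>h. h *\<^sub>R ?E r - h *\<^sub>R ?E t)) (at r within closed_segment s t)"
      using eseries_derivative[OF c] unfolding has_vector_derivative_def
      by (intro has_derivative_diff) (auto intro!: derivative_eq_intros)
    show "onorm (\<lambda>h. h *\<^sub>R ?E r - h *\<^sub>R ?E t) \<le> d"
      unfolding scaleR_diff_right[symmetric]
      using mult_left_mono[OF d[OF r] abs_ge_zero] d0 by (intro onorm_bound) (auto simp: mult.commute)
  qed auto
  moreover have "?f s - ?f t = eseries c s - eseries c t - (s - t) *\<^sub>R ?E t" by (simp add: algebra_simps)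
  ultimately show ?thesis by simp
qed

lemma eseries_taylor:
  assumes c: "\<And>k. norm (c k) \<le> C * B ^ k" and B: "0 \<le> B" and C: "0 \<le> C" and s: "\<bar>s\<bar> \<le> T" and t: "\<bar>t\<bar> \<le> T"
  shows "norm (eseries c s - eseries c t - (s - t) *\<^sub>R eseries (\<lambda>k. c (Suc k)) t) \<le> (C * B\<^sup>2 * exp (T * B)) * (s - t)\<^sup>2"
proof -
  let ?E = "eseries (\<lambda>k. c (Suc k))"
  have "norm (?E r - ?E t) \<le> C * B\<^sup>2 * exp (T * B) * \<bar>s - t\<bar>" if r: "r \<in> closed_segment s t" for r
  proof -
    have rT: "\<bar>r\<bar> \<le> T" and rs: "\<bar>r - t\<bar> \<le> \<bar>s - t\<bar>" using r s t by (auto simp: closed_segment_eq_real_ivl split: if_splits)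
    have "norm (?E r - ?E t) \<le> ((C * B) * B * exp (T * B)) * \<bar>r - t\<bar>"
      by (rule eseries_lipschitz[OF eseries_shift_bound[OF c] B _ rT t]) (use B C in auto)
    also have "\<dots> \<le> ((C * B) * B * exp (T * B)) * \<bar>s - t\<bar>" using rs B C by (intro mult_left_mono) auto
    finally show ?thesis by (simp add: power2_eq_square ac_simps)
  qed
  from eseries_mean_value[of c C B s t, OF c this] show ?thesis by (simp add: power2_eq_square mult.assoc)
qed

lemma eseries_mult_right:
  assumes "\<And>k. norm (c k) \<le> C * B ^ k" shows "eseries (\<lambda>k. c k * z) t = eseries c t * z"
  using sums_unique[OF sums_mult2[OF eseries_sums[OF assms, of t], of z]]
  by (simp add: eseries_def[of "\<lambda>k. c k * z"] mult.assoc)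

text \<open>
  Integration commutes with the series, since the absolute values have a summable integral.
\<close>

lemma eseries_integral:
  fixes P :: "nat \<Rightarrow> 'a::euclidean_space \<Rightarrow> complex" and f :: "'a \<Rightarrow> complex"
  assumes i: "\<And>k. integrable lborel (\<lambda>y. P k y * f y)" and w: "integrable lborel (\<lambda>y. w y * norm (f y))"
    and b: "\<And>k y. norm (P k y) \<le> (C * w y) * B ^ k"
  shows "(\<integral>y. eseries (\<lambda>k. P k y) t * f y \<partial>lborel) = eseries (\<lambda>k. \<integral>y. P k y * f y \<partial>lborel) t"
proof -
  let ?f = "\<lambda>k y. complex_of_real (t ^ k / fact k) * (P k y * f y)"
  let ?W = "\<integral>y. w y * norm (f y) \<partial>lborel"
  have n: "norm (?f k y) \<le> \<bar>t ^ k / fact k\<bar> * ((C * (w y * norm (f y))) * B ^ k)" for k y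
  proof -
    have "norm (P k y * f y) \<le> ((C * w y) * B ^ k) * norm (f y)"
      unfolding norm_mult by (rule mult_right_mono[OF b norm_ge_zero])
    then have "norm (?f k y) \<le> \<bar>t ^ k / fact k\<bar> * (((C * w y) * B ^ k) * norm (f y))"
      unfolding norm_mult[of "complex_of_real _"] norm_of_real by (rule mult_left_mono) simp
    then show ?thesis by (simp only: ac_simps)
  qed
  have fi: "integrable lborel (?f k)" for k by (intro integrable_mult_right i)
  have "(\<lambda>k. \<integral>y. ?f k y \<partial>lborel) sums (\<integral>y. (\<Sum>k. ?f k y) \<partial>lborel)"
  proof (rule sums_integral[OF fi])
    show "AE y in lborel. summable (\<lambda>k. norm (?f k y))"
    proof (rule AE_I2)
      fix y
      show "summable (\<lambda>k. norm (?f k y))"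
        by (rule summable_comparison_test'[OF sums_summable[OF eseries_bound_sums[of t "C * (w y * norm (f y))" B]]])
           (use n in simp)
    qed
    show "summable (\<lambda>k. \<integral>y. norm (?f k y) \<partial>lborel)"
    proof (rule summable_comparison_test'[OF sums_summable[OF eseries_bound_sums[of t "C * ?W" B]]])
      fix k
      have "(\<integral>y. norm (?f k y) \<partial>lborel) \<le> (\<integral>y. \<bar>t ^ k / fact k\<bar> * ((C * (w y * norm (f y))) * B ^ k) \<partial>lborel)"
        by (rule Bochner_Integration.integral_mono[OF integrable_norm[OF fi] _ n])
           (intro integrable_mult_right integrable_mult_left w)
      also have "\<dots> = \<bar>t ^ k / fact k\<bar> * ((C * ?W) * B ^ k)" by simp
      finally show "norm (\<integral>y. norm (?f k y) \<partial>lborel) \<le> \<bar>t ^ k / fact k\<bar> * ((C * ?W) * B ^ k)" by simp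
    qed
  qed
  moreover have "(\<Sum>k. ?f k y) = eseries (\<lambda>k. P k y) t * f y" for y
  proof -
    have "(\<lambda>k. (complex_of_real (t ^ k / fact k) * P k y) * f y) sums (eseries (\<lambda>k. P k y) t * f y)"
      by (rule sums_mult2[OF eseries_sums[OF b]])
    from sums_unique[OF this] show ?thesis by (simp only: mult.assoc)
  qed
  moreover have "(\<integral>y. ?f k y \<partial>lborel) = complex_of_real (t ^ k / fact k) * (\<integral>y. P k y * f y \<partial>lborel)" for k
    by (rule integral_mult_right_zero)
  ultimately have "(\<lambda>k. complex_of_real (t ^ k / fact k) * (\<integral>y. P k y * f y \<partial>lborel)) sums (\<integral>y. eseries (\<lambda>k. P k y) t * f y \<partial>lborel)"
    by simp
  then show ?thesis unfolding eseries_def[of "\<lambda>k. \<integral>y. P k y * f y \<partial>lborel"] by (rule sums_unique)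
qed

section \<open>Powers of the symbol on test functions\<close>

text \<open>Powers for the matrix product; the type class power on vectors is componentwise.\<close>

definition mpow :: "complex ^ 'N ^ 'N \<Rightarrow> nat \<Rightarrow> complex ^ 'N ^ 'N"
  where "mpow M k = ((**) M ^^ k) (mat 1)"

lemma mpow_0: "mpow M 0 = mat 1" by (simp add: mpow_def)
lemma mpow_Suc: "mpow M (Suc k) = M ** mpow M k" by (simp add: mpow_def)

lemma mpow_Suc': "mpow M (Suc k) = mpow M k ** M"
  by (induction k) (simp_all add: mpow_0 mpow_Suc matrix_mul_assoc)

lemma mpow_add: "mpow M (k + l) = mpow M k ** mpow M l"
  by (induction k) (simp_all add: mpow_0 mpow_Suc matrix_mul_assoc)

lemma mpow_Suc_nth: "mpow M (Suc k) $ i $ j = (\<Sum>l\<in>UNIV. M $ i $ l * mpow M k $ l $ j)"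
  by (simp add: mpow_Suc matrix_matrix_mult_def)

definition msum :: "complex ^ 'N ^ 'N \<Rightarrow> real"
  where "msum M = (\<Sum>i\<in>UNIV. \<Sum>l\<in>UNIV. norm (M $ i $ l))"

lemma msum_nonneg: "0 \<le> msum M" by (simp add: msum_def sum_nonneg)

lemma mpow_norm: "norm (mpow M k $ i $ j) \<le> 1 * msum M ^ k"
proof (induction k arbitrary: i)
  case 0 then show ?case by (simp add: mpow_0 mat_def)
next
  case (Suc k)
  have "norm (mpow M (Suc k) $ i $ j) \<le> (\<Sum>l\<in>UNIV. norm (M $ i $ l) * (1 * msum M ^ k))"
    unfolding mpow_Suc_nth by (rule sum_norm_le) (auto simp: norm_mult intro!: mult_left_mono Suc[simplified])
  also have "\<dots> = (\<Sum>l\<in>UNIV. norm (M $ i $ l)) * msum M ^ k" by (simp add: sum_distrib_right)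
  also have "(\<Sum>l\<in>UNIV. norm (M $ i $ l)) \<le> msum M"
    unfolding msum_def by (rule member_le_sum[where f="\<lambda>i. \<Sum>l\<in>UNIV. norm (M $ i $ l)"]) (auto intro: sum_nonneg)
  then have "(\<Sum>l\<in>UNIV. norm (M $ i $ l)) * msum M ^ k \<le> msum M * msum M ^ k"
    by (intro mult_right_mono) (auto simp: msum_nonneg)
  finally show ?case by simp
qed

lemma matrix_mult_scaleR: "(s *\<^sub>R M) ** (t *\<^sub>R N) = (s * t) *\<^sub>R (M ** N)" for M N :: "complex ^ 'N ^ 'N"
  by (simp add: matrix_matrix_mult_def vec_eq_iff scaleR_sum_right mult.commute)

lemma mpow_scaleR: "((**) (t *\<^sub>R M) ^^ k) (mat 1) = t ^ k *\<^sub>R mpow M k"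
  by (induction k) (simp_all add: mpow_0 mpow_Suc matrix_mult_scaleR)

text \<open>All questions of convergence and differentiation in \<open>t\<close> are reduced to scalar power series.\<close>

lemma mat_exp_nth: "mat_exp (t *\<^sub>R M) $ i $ j = eseries (\<lambda>k. mpow M k $ i $ j) t"
proof -
  let ?X = "\<lambda>k. (1 / fact k) *\<^sub>R (((**) (t *\<^sub>R M) ^^ k) (mat 1))"
  have e: "(\<Sum>k<n. ?X k) $ i $ j = (\<Sum>k<n. complex_of_real (t ^ k / fact k) * mpow M k $ i $ j)" for n i j
    by (simp add: mpow_scaleR scaleR_conv_of_real[where 'a=complex])
  have "?X sums (\<chi> i j. eseries (\<lambda>k. mpow M k $ i $ j) t)"
    unfolding sums_def
  proof (intro vec_tendstoI)
    fix i j
    show "(\<lambda>n. (\<Sum>k<n. ?X k) $ i $ j) \<longlonglongrightarrow> (\<chi> i j. eseries (\<lambda>k. mpow M k $ i $ j) t) $ i $ j"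
      unfolding e using eseries_sums[OF mpow_norm] by (simp add: sums_def)
  qed
  then have "mat_exp (t *\<^sub>R M) = (\<chi> i j. eseries (\<lambda>k. mpow M k $ i $ j) t)"
    unfolding mat_exp_def by (rule sums_unique[symmetric])
  then show ?thesis by simp
qed

text \<open>The functional equation follows from the Cauchy product of the entrywise series.\<close>

lemma mat_exp_add: "mat_exp ((s + t) *\<^sub>R M) = mat_exp (s *\<^sub>R M) ** mat_exp (t *\<^sub>R M)"
proof -
  have "mat_exp ((s + t) *\<^sub>R M) $ i $ j = (\<Sum>l\<in>UNIV. mat_exp (s *\<^sub>R M) $ i $ l * mat_exp (t *\<^sub>R M) $ l $ j)" for i j
  proof -
    let ?a = "\<lambda>l k. complex_of_real (s ^ k / fact k) * mpow M k $ i $ l"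
    let ?b = "\<lambda>l k. complex_of_real (t ^ k / fact k) * mpow M k $ l $ j"
    have "(\<lambda>n. \<Sum>k\<le>n. ?a l k * ?b l (n - k)) sums (mat_exp (s *\<^sub>R M) $ i $ l * mat_exp (t *\<^sub>R M) $ l $ j)" for l
      unfolding mat_exp_nth
      using Cauchy_product_sums[OF eseries_summable_norm[OF mpow_norm[of M _ i l], of s] eseries_summable_norm[OF mpow_norm[of M _ l j], of t]]
      by (simp add: eseries_def)
    then have "(\<lambda>n. \<Sum>l\<in>UNIV. \<Sum>k\<le>n. ?a l k * ?b l (n - k)) sums (\<Sum>l\<in>UNIV. mat_exp (s *\<^sub>R M) $ i $ l * mat_exp (t *\<^sub>R M) $ l $ j)"
      by (rule sums_sum)
    moreover have "(\<Sum>l\<in>UNIV. \<Sum>k\<le>n. ?a l k * ?b l (n - k)) = complex_of_real ((s + t) ^ n / fact n) * mpow M n $ i $ j" for n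
    proof -
      have "(\<Sum>l\<in>UNIV. \<Sum>k\<le>n. ?a l k * ?b l (n - k)) = (\<Sum>k\<le>n. \<Sum>l\<in>UNIV. ?a l k * ?b l (n - k))" by (rule sum.swap)
      also have "\<dots> = (\<Sum>k\<le>n. complex_of_real ((s ^ k / fact k) * (t ^ (n - k) / fact (n - k))) * mpow M n $ i $ j)"
      proof (rule sum.cong[OF refl])
        fix k assume "k \<in> {..n}"
        then have "mpow M n = mpow M k ** mpow M (n - k)" by (simp flip: mpow_add)
        then have "mpow M n $ i $ j = (\<Sum>l\<in>UNIV. mpow M k $ i $ l * mpow M (n - k) $ l $ j)" by (simp add: matrix_matrix_mult_def)
        then show "(\<Sum>l\<in>UNIV. ?a l k * ?b l (n - k)) = complex_of_real ((s ^ k / fact k) * (t ^ (n - k) / fact (n - k))) * mpow M n $ i $ j"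
          by (simp add: sum_distrib_left ac_simps)
      qed
      also have "\<dots> = complex_of_real (\<Sum>k\<le>n. (s ^ k / fact k) * (t ^ (n - k) / fact (n - k))) * mpow M n $ i $ j"
        by (simp add: sum_distrib_right)
      also have "(\<Sum>k\<le>n. (s ^ k / fact k) * (t ^ (n - k) / fact (n - k))) = (s + t) ^ n / fact n"
      proof -
        have "(s ^ k / fact k) * (t ^ (n - k) / fact (n - k)) = (of_nat (n choose k) * s ^ k * t ^ (n - k)) / fact n" if "k \<le> n" for k
          using binomial_fact[OF that, where 'a=real] by (simp add: field_simps)
        then show ?thesis by (simp add: binomial_ring sum_divide_distrib)
      qed
      finally show ?thesis .
    qed
    ultimately have "(\<lambda>n. complex_of_real ((s + t) ^ n / fact n) * mpow M n $ i $ j) sums (\<Sum>l\<in>UNIV. mat_exp (s *\<^sub>R M) $ i $ l * mat_exp (t *\<^sub>R M) $ l $ j)"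
      by simp
    then show ?thesis unfolding mat_exp_nth[of "s + t"] eseries_def by (rule sums_unique[symmetric])
  qed
  then show ?thesis by (simp add: vec_eq_iff matrix_matrix_mult_def)
qed

lemma mat_exp_0: "mat_exp (0 *\<^sub>R M) = mat 1"
proof -
  have "eseries (\<lambda>k. mpow M k $ i $ j) 0 = mpow M 0 $ i $ j" for i j
    by (rule eseries_at_0)
  then show ?thesis using mat_exp_nth[of 0 M] by (simp add: vec_eq_iff mpow_0)
qed

lemma wt_minus: "wt (- x) = wt x" by (simp add: wt_def)

text \<open>
  A function that can be moved back and forth by the Fourier transform: this is all that is known
  of \<open>exp (t a) \<psi>\<close> without differentiating the exponential.
\<close>

definition nice :: "(real ^ 'n \<Rightarrow> complex) \<Rightarrow> bool"
  where "nice h \<longleftrightarrow> continuous_on UNIV h \<and> (\<exists>C. \<forall>x. norm (h x) \<le> C * wt x) \<and> (\<exists>C. \<forall>x. norm (inv_fourier h x) \<le> C * wt x)"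

lemma nice_measurable: "nice h \<Longrightarrow> h \<in> borel_measurable borel"
  unfolding nice_def by (intro borel_measurable_continuous_onI) blast

lemma nice_integrable: "nice h \<Longrightarrow> integrable lborel h"
  using integrable_wt_bound[OF nice_measurable] unfolding nice_def by blast

lemma nice_inv_integrable: "nice h \<Longrightarrow> integrable lborel (inv_fourier h)"
  using integrable_wt_bound[OF inv_fourier_measurable[OF nice_measurable]] unfolding nice_def by blast

lemma nice_inversion: assumes "nice h" shows "fourier (inv_fourier h) x = h x"
proof -
  obtain C where C: "\<And>x. norm (h x) \<le> C * wt x" and c: "continuous_on UNIV h" using assms by (auto simp: nice_def)
  have C0: "0 \<le> C" by (rule wt_const_nonneg[OF C norm_ge_zero])
  have b: "norm (h x) \<le> C" for x using C[of x] mult_left_mono[OF wt_le_1 C0, of x] by simp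
  show ?thesis by (rule inv_fourier_inversion[OF c b nice_integrable[OF assms] nice_inv_integrable[OF assms]])
qed

lemma nice_lp: "1 \<le> p \<Longrightarrow> nice h \<Longrightarrow> lp p (inv_fourier h)"
  using lp_wt_bound(1)[OF _ inv_fourier_measurable[OF nice_measurable]] unfolding nice_def by blast

lemma nice_pairing:
  fixes h \<theta> :: "real ^ 'n \<Rightarrow> complex"
  assumes "nice h" "integrable lborel \<theta>"
  shows "(\<integral>x. fourier \<theta> x * inv_fourier h x \<partial>lborel) = (\<integral>x. \<theta> x * h x \<partial>lborel)"
  using fourier_symmetric[OF assms(2) nice_inv_integrable[OF assms(1)]] by (simp add: nice_inversion[OF assms(1)])

locale lp_symbol = conjugate p q for p q :: real +
  fixes a :: "real ^ 'n \<Rightarrow> complex ^ 'N ^ 'N"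
  assumes pgrow_a: "\<And>i j. pgrow (\<lambda>\<xi>. a \<xi> $ i $ j)"
begin

abbreviation apow :: "nat \<Rightarrow> 'N \<Rightarrow> 'N \<Rightarrow> real ^ 'n \<Rightarrow> complex"
  where "apow k i j \<xi> \<equiv> mpow (a \<xi>) k $ i $ j"

abbreviation aexp :: "real \<Rightarrow> real ^ 'n \<Rightarrow> complex ^ 'N ^ 'N"
  where "aexp t \<xi> \<equiv> mat_exp (t *\<^sub>R a \<xi>)"

abbreviation fourier_apow :: "nat \<Rightarrow> 'N \<Rightarrow> 'N \<Rightarrow> (real ^ 'n \<Rightarrow> complex) \<Rightarrow> real ^ 'n \<Rightarrow> complex"
  where "fourier_apow k i j \<psi> \<equiv> fourier (\<lambda>\<xi>. apow k i j \<xi> * \<psi> \<xi>)"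

abbreviation fourier_aexp :: "real \<Rightarrow> 'N \<Rightarrow> 'N \<Rightarrow> (real ^ 'n \<Rightarrow> complex) \<Rightarrow> real ^ 'n \<Rightarrow> complex"
  where "fourier_aexp t i j \<psi> \<equiv> fourier (\<lambda>\<xi>. aexp t \<xi> $ i $ j * \<psi> \<xi>)"

lemma smooth_a: "smooth (\<lambda>\<xi>. a \<xi> $ i $ j)" using pgrow_a by (simp add: pgrow_def)

text \<open>
  Each further factor \<open>a\<close> costs a fixed constant on the support of \<open>\<psi>\<close>, so the derivative bounds of
  \<open>a ^ k \<psi>\<close> grow geometrically in \<open>k\<close>.
\<close>

lemma apow_testfun:
  assumes \<psi>: "testfun \<psi>"
  shows "\<exists>C\<ge>0. \<exists>B\<ge>0. \<forall>k i j. testfun (\<lambda>\<xi>. apow k i j \<xi> * \<psi> \<xi>) \<and>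
    dbound m (\<lambda>\<xi>. C * B ^ k * wt \<xi>) (\<lambda>\<xi>. apow k i j \<xi> * \<psi> \<xi>)"
proof -
  obtain R where R: "R \<ge> 0" "\<forall>m. \<exists>C\<ge>0. dbound m (\<lambda>x. C * indicator (cball 0 R) x) \<psi>"
    using testfun_dbound[OF \<psi>] by blast
  then obtain C where C: "C \<ge> 0" "dbound m (\<lambda>x. C * indicator (cball 0 R) x) \<psi>" by blast
  have "\<forall>i j. \<exists>A L. dbound m (\<lambda>x. A * (1 + norm x) ^ L) (\<lambda>\<xi>. a \<xi> $ i $ j)"
    using pgrow_a unfolding pgrow_def by blast
  then obtain A L where AL: "\<And>i j. dbound m (\<lambda>x. A i j * (1 + norm x) ^ L i j) (\<lambda>\<xi>. a \<xi> $ i $ j)" by metis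
  \<comment> \<open>A common bound on the support of \<open>\<psi>\<close> for all derivatives of all entries up to order \<open>m\<close>.\<close>
  define W where "W = (\<Sum>i\<in>UNIV. \<Sum>j\<in>UNIV. \<bar>A i j\<bar> * (1 + R) ^ L i j)"
  have W: "A i j * (1 + norm x) ^ L i j \<le> W" if "norm x \<le> R" for i j and x :: "real ^ 'n"
  proof -
    have "A i j * (1 + norm x) ^ L i j \<le> \<bar>A i j\<bar> * (1 + R) ^ L i j"
      using that by (intro mult_mono power_mono) auto
    also have "\<dots> \<le> (\<Sum>j\<in>UNIV. \<bar>A i j\<bar> * (1 + R) ^ L i j)"
      by (rule member_le_sum) (use R in auto)
    also have "\<dots> \<le> W" unfolding W_def
      by (rule member_le_sum[where f="\<lambda>i. \<Sum>j\<in>UNIV. \<bar>A i j\<bar> * (1 + R) ^ L i j"]) (use R in \<open>auto intro!: sum_nonneg\<close>)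
    finally show ?thesis .
  qed
  have W0: "0 \<le> W" unfolding W_def using R by (auto intro!: sum_nonneg)
  define B where "B = real CARD('N) * (2 ^ m * W)"
  have B0: "0 \<le> B" using W0 by (simp add: B_def)
  have main: "testfun (\<lambda>\<xi>. apow k i j \<xi> * \<psi> \<xi>) \<and>
      dbound m (\<lambda>\<xi>. C * B ^ k * indicator (cball 0 R) \<xi>) (\<lambda>\<xi>. apow k i j \<xi> * \<psi> \<xi>)" for k i j
  proof (induction k arbitrary: i)
    case 0
    show ?case
    proof (cases "i = j")
      case True then show ?thesis using \<psi> C by (simp add: mpow_0 mat_def)
    next
      case False
      have "dbound m (\<lambda>\<xi>. C * indicator (cball 0 R) \<xi>) (\<lambda>\<xi>. 0 :: complex)"
        by (rule dbound_const[where B=0]) (use C in auto)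
      then show ?thesis using False by (simp add: mpow_0 mat_def testfun_const0)
    qed
  next
    case (Suc k)
    have e: "(\<lambda>\<xi>. apow (Suc k) i j \<xi> * \<psi> \<xi>) = (\<lambda>\<xi>. \<Sum>l\<in>UNIV. a \<xi> $ i $ l * (apow k l j \<xi> * \<psi> \<xi>))"
      by (simp add: mpow_Suc_nth sum_distrib_right mult.assoc)
    have t: "testfun (\<lambda>\<xi>. a \<xi> $ i $ l * (apow k l j \<xi> * \<psi> \<xi>))" for l
      using testfun_mult[OF _ smooth_a] Suc by blast
    have "dbound m (\<lambda>x. 2 ^ m * ((A i l * (1 + norm x) ^ L i l) * (C * B ^ k * indicator (cball 0 R) x))) (\<lambda>\<xi>. a \<xi> $ i $ l * (apow k l j \<xi> * \<psi> \<xi>))" for l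
      using Suc by (intro dbound_mult smooth_a AL testfun_smooth) auto
    then have d: "dbound m (\<lambda>x. 2 ^ m * (W * (C * B ^ k * indicator (cball 0 R) x))) (\<lambda>\<xi>. a \<xi> $ i $ l * (apow k l j \<xi> * \<psi> \<xi>))" for l
    proof (rule dbound_weaken)
      fix x :: "real ^ 'n"
      show "2 ^ m * ((A i l * (1 + norm x) ^ L i l) * (C * B ^ k * indicator (cball 0 R) x)) \<le> 2 ^ m * (W * (C * B ^ k * indicator (cball 0 R) x))"
      proof (cases "norm x \<le> R")
        case True
        show ?thesis by (rule mult_left_mono[OF mult_right_mono[OF W[OF True]]]) (use C B0 in auto)
      qed simp
    qed
    have "dbound m (\<lambda>x. \<Sum>l\<in>(UNIV :: 'N set). 2 ^ m * (W * (C * B ^ k * indicator (cball 0 R) x))) (\<lambda>\<xi>. apow (Suc k) i j \<xi> * \<psi> \<xi>)"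
      unfolding e by (intro dbound_sum finite d testfun_smooth t)
    then have "dbound m (\<lambda>\<xi>. C * B ^ Suc k * indicator (cball 0 R) \<xi>) (\<lambda>\<xi>. apow (Suc k) i j \<xi> * \<psi> \<xi>)"
      by (simp add: B_def ac_simps)
    moreover have "testfun (\<lambda>\<xi>. apow (Suc k) i j \<xi> * \<psi> \<xi>)" unfolding e by (intro testfun_sum finite t)
    ultimately show ?case by blast
  qed
  have le: "C * B ^ k * indicator (cball 0 R) x \<le> (C * (1 + R) ^ (2 * CARD('n))) * B ^ k * wt x" for k and x :: "real ^ 'n"
  proof (cases "norm x \<le> R")
    case True
    have "(1 + norm x) ^ (2 * CARD('n)) \<le> (1 + R) ^ (2 * CARD('n))" using True by (intro power_mono) auto
    then have "1 \<le> (1 + R) ^ (2 * CARD('n)) * wt x"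
      by (simp add: wt_def le_divide_eq add_pos_nonneg)
    from mult_left_mono[OF this, of "C * B ^ k"] show ?thesis using True C B0 by (simp add: ac_simps)
  qed (use C B0 R in auto)
  have "testfun (\<lambda>\<xi>. apow k i j \<xi> * \<psi> \<xi>) \<and>
      dbound m (\<lambda>\<xi>. (C * (1 + R) ^ (2 * CARD('n))) * B ^ k * wt \<xi>) (\<lambda>\<xi>. apow k i j \<xi> * \<psi> \<xi>)" for k i j
    using dbound_weaken[OF main[of k i j, THEN conjunct2] le] main[of k i j] by blast
  then show ?thesis using C B0 R by (intro exI[of _ "C * (1 + R) ^ (2 * CARD('n))"] conjI exI[of _ B]) auto
qed

text \<open>
  The derivative bounds of the preceding lemma become decay, uniformly in \<open>k\<close> up to the factor \<open>B ^ k\<close>.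
\<close>

lemma apow_fourier_bound:
  assumes \<psi>: "testfun \<psi>"
  shows "\<exists>C\<ge>0. \<exists>B\<ge>0. \<forall>k i j x. norm (apow k i j x * \<psi> x) \<le> C * B ^ k * wt x \<and>
    norm (fourier_apow k i j \<psi> x) \<le> C * B ^ k * wt x \<and>
    norm (inv_fourier (\<lambda>\<xi>. apow k i j \<xi> * \<psi> \<xi>) x) \<le> C * B ^ k * wt x"
proof -
  let ?m = "2 * CARD('n)"
  obtain C B where CB: "C \<ge> 0" "B \<ge> 0" "\<And>k i j. testfun (\<lambda>\<xi>. apow k i j \<xi> * \<psi> \<xi>)"
    "\<And>k i j. dbound ?m (\<lambda>\<xi>. C * B ^ k * wt \<xi>) (\<lambda>\<xi>. apow k i j \<xi> * \<psi> \<xi>)"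
    using apow_testfun[OF \<psi>, of ?m] by blast
  obtain K where K: "K \<ge> 0" "\<And>(\<phi> :: real ^ 'n \<Rightarrow> complex) C \<xi>. smooth \<phi> \<Longrightarrow> dbound ?m (\<lambda>x. C * wt x) \<phi> \<Longrightarrow>
     norm (fourier \<phi> \<xi>) * (1 + norm \<xi>) ^ ?m \<le> K * C" using fourier_decay[of ?m] by blast
  have F: "norm (fourier_apow k i j \<psi> x) \<le> (K * C) * B ^ k * wt x" for k i j x
  proof -
    have "norm (fourier_apow k i j \<psi> x) * (1 + norm x) ^ ?m \<le> K * (C * B ^ k)"
      by (rule K(2)[OF testfun_smooth[OF CB(3)] CB(4)])
    moreover have "0 < (1 + norm x) ^ ?m" by (intro zero_less_power add_pos_nonneg) auto
    ultimately show ?thesis by (simp add: wt_def pos_le_divide_eq mult.assoc)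
  qed
  have "norm (apow k i j x * \<psi> x) \<le> C * B ^ k * wt x" for k i j x using dbound_value[OF CB(4)] .
  moreover have le: "C * B ^ k * wt x \<le> (C + K * C) * B ^ k * wt x" "(K * C) * B ^ k * wt x \<le> (C + K * C) * B ^ k * wt x" for k and x :: "real ^ 'n"
    using CB K by (auto intro!: mult_right_mono)
  ultimately have E: "norm (apow k i j x * \<psi> x) \<le> (C + K * C) * B ^ k * wt x" for k i j x using order_trans by blast
  have G: "norm (fourier_apow k i j \<psi> x) \<le> (C + K * C) * B ^ k * wt x" for k i j x
    using order_trans[OF F le(2)] .
  have H: "norm (inv_fourier (\<lambda>\<xi>. apow k i j \<xi> * \<psi> \<xi>) x) \<le> (C + K * C) * B ^ k * wt x" for k i j x
    using G[where k=k and i=i and j=j and x="- x"] unfolding inv_fourier_minus wt_minus .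
  have "0 \<le> C + K * C" using CB K by simp
  with CB(2) E G H show ?thesis by blast
qed

lemma apow_fourier_sums:
  assumes \<psi>: "testfun \<psi>"
  shows "fourier_aexp t i j \<psi> x = eseries (\<lambda>k. fourier_apow k i j \<psi> x) t"
proof -
  obtain C B where CB: "C \<ge> 0" "B \<ge> 0" "\<And>k i j x. norm (apow k i j x * \<psi> x) \<le> C * B ^ k * wt x"
    using apow_fourier_bound[OF \<psi>] by blast
  have CB': "norm (apow k i j \<xi> * \<psi> \<xi>) \<le> (C * wt \<xi>) * B ^ k" for k \<xi>
    using CB(3)[where k=k and i=i and j=j and x=\<xi>] by (simp only: ac_simps)
  let ?e = "\<lambda>\<xi>. complex_of_real (fconst TYPE('n)) * exp (\<i> * complex_of_real (\<xi> \<bullet> x))"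
  have F: "fourier \<phi> x = (\<integral>\<xi>. \<phi> \<xi> * ?e \<xi> \<partial>lborel)" for \<phi>
    unfolding fourier_alt integral_mult_right_zero[symmetric] by (simp only: ac_simps)
  have i: "integrable lborel (\<lambda>\<xi>. (apow k i j \<xi> * \<psi> \<xi>) * ?e \<xi>)" for k
  proof -
    have "testfun (\<lambda>\<xi>. apow k i j \<xi> * \<psi> \<xi>)" using apow_testfun[OF \<psi>, of 0] by blast
    from integrable_mult_right[OF integrable_phase[OF testfun_fourier_integrable[OF this]], of "complex_of_real (fconst TYPE('n))" x]
    show ?thesis by (simp only: ac_simps)
  qed
  have "fourier_aexp t i j \<psi> x = (\<integral>\<xi>. eseries (\<lambda>k. apow k i j \<xi> * \<psi> \<xi>) t * ?e \<xi> \<partial>lborel)"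
    unfolding F mat_exp_nth eseries_mult_right[OF mpow_norm] ..
  also have "\<dots> = eseries (\<lambda>k. \<integral>\<xi>. (apow k i j \<xi> * \<psi> \<xi>) * ?e \<xi> \<partial>lborel) t"
    by (rule eseries_integral[OF i _ CB']) (simp add: norm_mult wt_integrable)
  finally show ?thesis unfolding F .
qed

lemma apow_inv_fourier_sums:
  "testfun \<psi> \<Longrightarrow> inv_fourier (\<lambda>\<xi>. aexp t \<xi> $ i $ j * \<psi> \<xi>) x = eseries (\<lambda>k. inv_fourier (\<lambda>\<xi>. apow k i j \<xi> * \<psi> \<xi>) x) t"
  unfolding inv_fourier_minus by (rule apow_fourier_sums)

lemma aexp_continuous: "continuous_on UNIV (\<lambda>\<xi>. aexp t \<xi> $ i $ j)"
proof (rule continuous_at_imp_continuous_on, rule ballI)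
  fix \<xi>0 :: "real ^ 'n"
  let ?K = "cball \<xi>0 1"
  have ca: "continuous_on ?K (\<lambda>\<xi>. a \<xi> $ i $ j)" for i j by (rule smooth_continuous[OF smooth_a])
  have "continuous_on ?K (\<lambda>\<xi>. msum (a \<xi>))" unfolding msum_def by (intro continuous_intros ca)
  then have "bounded ((\<lambda>\<xi>. msum (a \<xi>)) ` ?K)" by (intro compact_imp_bounded compact_continuous_image compact_cball)
  then obtain M where "\<forall>y\<in>(\<lambda>\<xi>. msum (a \<xi>)) ` ?K. norm y \<le> M" unfolding bounded_iff by blast
  then have M: "msum (a \<xi>) \<le> M" if "\<xi> \<in> ?K" for \<xi> using that by (auto simp: abs_le_iff)
  have M0: "0 \<le> M" using M[of \<xi>0] msum_nonneg[of "a \<xi>0"] by simp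
  have cp: "continuous_on ?K (\<lambda>\<xi>. apow k i j \<xi>)" for k i j
  proof (induction k arbitrary: i)
    case 0 then show ?case by (simp add: mpow_0)
  next
    case (Suc k) then show ?case
      unfolding mpow_Suc_nth by (intro continuous_on_sum continuous_on_mult ca)
  qed
  have "uniform_limit ?K (\<lambda>n \<xi>. \<Sum>k<n. complex_of_real (t ^ k / fact k) * apow k i j \<xi>) (\<lambda>\<xi>. \<Sum>k. complex_of_real (t ^ k / fact k) * apow k i j \<xi>) sequentially"
  proof (rule Weierstrass_m_test)
    show "summable (\<lambda>k. \<bar>t ^ k / fact k\<bar> * (1 * M ^ k))" by (rule sums_summable[OF eseries_bound_sums])
    fix k \<xi> assume \<xi>: "\<xi> \<in> ?K"
    have "norm (apow k i j \<xi>) \<le> 1 * M ^ k"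
      by (rule order_trans[OF mpow_norm]) (use M[OF \<xi>] msum_nonneg in \<open>auto intro: power_mono\<close>)
    then show "norm (complex_of_real (t ^ k / fact k) * apow k i j \<xi>) \<le> \<bar>t ^ k / fact k\<bar> * (1 * M ^ k)"
      unfolding norm_mult norm_of_real by (rule mult_left_mono) simp
  qed
  then have "continuous_on ?K (\<lambda>\<xi>. \<Sum>k. complex_of_real (t ^ k / fact k) * apow k i j \<xi>)"
    by (rule uniform_limit_theorem[rotated])
       (simp, intro always_eventually allI continuous_on_sum continuous_on_mult continuous_on_const cp)
  then have "continuous_on ?K (\<lambda>\<xi>. aexp t \<xi> $ i $ j)" by (simp add: mat_exp_nth eseries_def)
  then show "isCont (\<lambda>\<xi>. aexp t \<xi> $ i $ j) \<xi>0" by (rule continuous_on_interior) (simp add: interior_cball)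
qed

lemma aexp_nice:
  assumes \<psi>: "testfun \<psi>"
  shows "nice (\<lambda>\<xi>. aexp t \<xi> $ i $ j * \<psi> \<xi>)"
proof -
  obtain C B where CB: "C \<ge> 0" "B \<ge> 0" "\<And>k i j x. norm (apow k i j x * \<psi> x) \<le> C * B ^ k * wt x"
    "\<And>k i j x. norm (inv_fourier (\<lambda>\<xi>. apow k i j \<xi> * \<psi> \<xi>) x) \<le> C * B ^ k * wt x"
    using apow_fourier_bound[OF \<psi>] by blast
  have "norm (inv_fourier (\<lambda>\<xi>. aexp t \<xi> $ i $ j * \<psi> \<xi>) x) \<le> (C * exp (\<bar>t\<bar> * B)) * wt x" for x
  proof -
    have "norm (eseries (\<lambda>k. inv_fourier (\<lambda>\<xi>. apow k i j \<xi> * \<psi> \<xi>) x) t) \<le> (C * wt x) * exp (\<bar>t\<bar> * B)"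
      by (rule eseries_norm) (use CB(4) in \<open>simp add: ac_simps\<close>)
    then show ?thesis unfolding apow_inv_fourier_sums[OF \<psi>] by (simp add: ac_simps)
  qed
  moreover have "norm (aexp t x $ i $ j * \<psi> x) \<le> (C * exp (\<bar>t\<bar> * B)) * wt x" for x
  proof -
    have "(\<lambda>k. complex_of_real (t ^ k / fact k) * apow k i j x * \<psi> x) sums (aexp t x $ i $ j * \<psi> x)"
      unfolding mat_exp_nth by (intro sums_mult2 eseries_sums[OF mpow_norm])
    then have e: "aexp t x $ i $ j * \<psi> x = eseries (\<lambda>k. apow k i j x * \<psi> x) t" unfolding eseries_def by (simp add: sums_unique mult.assoc)
    have "norm (eseries (\<lambda>k. apow k i j x * \<psi> x) t) \<le> (C * wt x) * exp (\<bar>t\<bar> * B)"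
      by (rule eseries_norm) (use CB(3) in \<open>simp add: ac_simps\<close>)
    then show ?thesis unfolding e by (simp add: ac_simps)
  qed
  moreover have "continuous_on UNIV (\<lambda>\<xi>. aexp t \<xi> $ i $ j * \<psi> \<xi>)"
    by (intro continuous_on_mult aexp_continuous smooth_continuous testfun_smooth \<psi>)
  ultimately show ?thesis unfolding nice_def by blast
qed

end

section \<open>The realization of the symbol\<close>

lemma nice_add:
  fixes f g :: "real ^ 'n \<Rightarrow> complex"
  assumes "nice f" "nice g" shows "nice (\<lambda>x. f x + g x)"
proof -
  obtain A B A' B' where AB: "\<And>x. norm (f x) \<le> A * wt x" "\<And>x. norm (g x) \<le> B * wt x"
    "\<And>x. norm (inv_fourier f x) \<le> A' * wt x" "\<And>x. norm (inv_fourier g x) \<le> B' * wt x"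
    using assms unfolding nice_def by blast
  have 1: "norm (f x + g x) \<le> (A + B) * wt x" for x
    unfolding distrib_right by (rule order_trans[OF norm_triangle_ineq add_mono[OF AB(1,2)]])
  have 2: "norm (inv_fourier (\<lambda>x. f x + g x) x) \<le> (A' + B') * wt x" for x
    unfolding distrib_right inv_fourier_add[OF nice_integrable[OF assms(1)] nice_integrable[OF assms(2)]]
    by (rule order_trans[OF norm_triangle_ineq add_mono[OF AB(3,4)]])
  show ?thesis using assms 1 2 unfolding nice_def by (blast intro: continuous_on_add)
qed

lemma nice_zero: "nice (\<lambda>x :: real ^ 'n. 0)"
  unfolding nice_def by (auto intro!: exI[of _ 0] simp: inv_fourier_minus)

lemma nice_sum:
  "finite I \<Longrightarrow> (\<And>i. i \<in> I \<Longrightarrow> nice (f i)) \<Longrightarrow> nice (\<lambda>x :: real ^ 'n. \<Sum>i\<in>I. f i x)"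
  by (induction I rule: finite_induct) (auto intro: nice_add nice_zero)

lemma eseries_sum:
  assumes "finite I" "\<And>i. i \<in> I \<Longrightarrow> \<exists>C B. \<forall>k. norm (c i k) \<le> C * B ^ k"
  shows "(\<Sum>i\<in>I. eseries (c i) t) = eseries (\<lambda>k. \<Sum>i\<in>I. c i k) t"
proof -
  have "(\<lambda>k. \<Sum>i\<in>I. complex_of_real (t ^ k / fact k) * c i k) sums (\<Sum>i\<in>I. eseries (c i) t)"
  proof (rule sums_sum)
    fix i assume "i \<in> I"
    then obtain C B where "\<And>k. norm (c i k) \<le> C * B ^ k" using assms(2) by blast
    then show "(\<lambda>k. complex_of_real (t ^ k / fact k) * c i k) sums eseries (c i) t" by (rule eseries_sums)
  qed
  then show ?thesis unfolding eseries_def[of "\<lambda>k. \<Sum>i\<in>I. c i k"] by (simp add: sum_distrib_left sums_unique)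
qed

lemma norm_le_entries: "norm (M :: complex ^ 'N ^ 'N) \<le> msum M"
proof -
  have "norm M \<le> (\<Sum>i\<in>UNIV. norm (M $ i))" by (simp add: norm_vec_def L2_set_le_sum)
  also have "\<dots> \<le> msum M" unfolding msum_def by (intro sum_mono vec_norm_le_sum)
  finally show ?thesis .
qed

lemma (in conjugate) testvec_inversion:
  fixes g :: "real ^ 'n \<Rightarrow> complex ^ 'N"
  assumes "testvec g" shows "fourier_vec (inv_fourier_vec g) = g"
proof
  fix \<xi>
  have "fourier (inv_fourier (\<lambda>\<xi>. g \<xi> $ j)) \<xi> = g \<xi> $ j" for j
    using schwartz_fourier_inv(1)[OF testfun_schwartz, of "\<lambda>\<xi>. g \<xi> $ j"] assms by (simp add: testvec_def)
  then show "fourier_vec (inv_fourier_vec g) \<xi> = g \<xi>" by (simp add: fourier_vec_def inv_fourier_vec_def vec_eq_iff)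
qed

lemma (in conjugate) Lp_wt_bound:
  fixes f :: "real ^ 'n \<Rightarrow> complex ^ 'N"
  assumes "f \<in> borel_measurable borel" "\<And>x i. norm (f x $ i) \<le> M * wt x"
  shows "lp p f" "class_of f \<in> Lp p"
    "Lp_norm p (class_of f) \<le> (real CARD('N) * lpn p (wt :: real ^ 'n \<Rightarrow> real)) * M"
proof -
  have c: "lp p (\<lambda>x. f x $ i)" "lpn p (\<lambda>x. f x $ i) \<le> M * lpn p (wt :: real ^ 'n \<Rightarrow> real)" for i
    using lp_wt_bound[OF p_ge(1) measurable_vec_nth[OF assms(1)], of i M] assms(2) by auto
  show l: "lp p f" unfolding lp_vec(1)[OF p_ge(1)] using c by blast
  then show "class_of f \<in> Lp p" using class_of_Lp[OF p_ge(2) assms(1)] by simp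
  have "Lp_norm p (class_of f) = lpn p f" by (rule Lp_norm_class_of[OF p_ge(2) l])
  also have "\<dots> \<le> (\<Sum>i\<in>UNIV. lpn p (\<lambda>x. f x $ i))" by (rule lp_vec(2)[OF p_ge(1) c(1)])
  also have "\<dots> \<le> (\<Sum>i\<in>(UNIV :: 'N set). M * lpn p (wt :: real ^ 'n \<Rightarrow> real))" by (intro sum_mono c)
  finally show "Lp_norm p (class_of f) \<le> (real CARD('N) * lpn p (wt :: real ^ 'n \<Rightarrow> real)) * M" by (simp add: ac_simps)
qed

context lp_symbol
begin

sublocale X: banach_carrier "Lp p :: (real ^ 'n, complex ^ 'N) ae_class set" "Lp_norm p"
  by (rule Lp_banach_carrier[OF p_ge(1)])

text \<open>
  The candidate solution and its time derivative for the initial value \<open>inv_fourier_vec g\<close>, and the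
  Taylor coefficients of its components at a fixed point of space.
\<close>

definition sol :: "real \<Rightarrow> (real ^ 'n \<Rightarrow> complex ^ 'N) \<Rightarrow> real ^ 'n \<Rightarrow> complex ^ 'N"
  where "sol t g = inv_fourier_vec (\<lambda>\<xi>. aexp t \<xi> *v g \<xi>)"

definition dsol :: "real \<Rightarrow> (real ^ 'n \<Rightarrow> complex ^ 'N) \<Rightarrow> real ^ 'n \<Rightarrow> complex ^ 'N"
  where "dsol t g = inv_fourier_vec (\<lambda>\<xi>. a \<xi> *v (aexp t \<xi> *v g \<xi>))"

definition coef :: "(real ^ 'n \<Rightarrow> complex ^ 'N) \<Rightarrow> real ^ 'n \<Rightarrow> 'N \<Rightarrow> nat \<Rightarrow> complex"
  where "coef g x i k = (\<Sum>j\<in>UNIV. inv_fourier (\<lambda>\<xi>. apow k i j \<xi> * g \<xi> $ j) x)"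

lemma op_fun_aexp: "testvec g \<Longrightarrow> op_fun (aexp t) (inv_fourier_vec g) = sol t g"
  by (simp add: op_fun_def sol_def testvec_inversion)

lemma coef_bound:
  assumes "testvec g"
  shows "\<exists>C\<ge>0. \<exists>B\<ge>0. \<forall>x i k. norm (coef g x i k) \<le> (C * wt x) * B ^ k"
proof -
  have "\<forall>l. \<exists>CB. 0 \<le> fst CB \<and> 0 \<le> snd CB \<and> (\<forall>k i j x. norm (inv_fourier (\<lambda>\<xi>. apow k i j \<xi> * g \<xi> $ l) x) \<le> fst CB * snd CB ^ k * wt x)"
  proof
    fix l
    obtain C B where "0 \<le> C" "0 \<le> B" "\<And>k i j x. norm (inv_fourier (\<lambda>\<xi>. apow k i j \<xi> * g \<xi> $ l) x) \<le> C * B ^ k * wt x"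
      using apow_fourier_bound[of "\<lambda>\<xi>. g \<xi> $ l"] assms unfolding testvec_def by blast
    then show "\<exists>CB. 0 \<le> fst CB \<and> 0 \<le> snd CB \<and> (\<forall>k i j x. norm (inv_fourier (\<lambda>\<xi>. apow k i j \<xi> * g \<xi> $ l) x) \<le> fst CB * snd CB ^ k * wt x)"
      by (intro exI[of _ "(C, B)"]) simp
  qed
  from choice[OF this] obtain F where F: "\<forall>l. 0 \<le> fst (F l) \<and> 0 \<le> snd (F l) \<and>
    (\<forall>k i j x. norm (inv_fourier (\<lambda>\<xi>. apow k i j \<xi> * g \<xi> $ l) x) \<le> fst (F l) * snd (F l) ^ k * wt x)" by blast
  define C where "C l = fst (F l)" for l
  define B where "B l = snd (F l)" for l
  have CB: "0 \<le> C l" "0 \<le> B l" "norm (inv_fourier (\<lambda>\<xi>. apow k i j \<xi> * g \<xi> $ l) x) \<le> C l * B l ^ k * wt x" for l k i j x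
    using F unfolding C_def B_def by blast+
  have "norm (coef g x i k) \<le> ((\<Sum>l\<in>UNIV. C l) * wt x) * (\<Sum>l\<in>UNIV. B l) ^ k" for x i k
  proof -
    have "norm (coef g x i k) \<le> (\<Sum>l\<in>UNIV. C l * (\<Sum>l\<in>UNIV. B l) ^ k * wt x)"
      unfolding coef_def
    proof (rule sum_norm_le)
      fix l
      have "B l \<le> (\<Sum>l\<in>UNIV. B l)" by (rule member_le_sum) (use CB in auto)
      then have "C l * B l ^ k * wt x \<le> C l * (\<Sum>l\<in>UNIV. B l) ^ k * wt x"
        using CB by (intro mult_right_mono mult_left_mono power_mono) auto
      then show "norm (inv_fourier (\<lambda>\<xi>. apow k i l \<xi> * g \<xi> $ l) x) \<le> C l * (\<Sum>l\<in>UNIV. B l) ^ k * wt x"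
        using order_trans[OF CB(3)] by blast
    qed
    then show ?thesis unfolding sum_distrib_right[symmetric] by (simp only: ac_simps)
  qed
  moreover have "0 \<le> (\<Sum>l\<in>UNIV. C l)" "0 \<le> (\<Sum>l\<in>UNIV. B l)" using CB by (auto intro: sum_nonneg)
  ultimately show ?thesis by blast
qed

lemma aexp_vec_nice: assumes "testvec g" shows "nice (\<lambda>\<xi>. (aexp t \<xi> *v g \<xi>) $ i)"
  unfolding matrix_vector_mult_def
  using assms by (simp, intro nice_sum aexp_nice) (auto simp: testvec_def)

lemma a_testfun: "testfun \<psi> \<Longrightarrow> testfun (\<lambda>\<xi>. a \<xi> $ i $ j * \<psi> \<xi>)"
  by (rule testfun_mult[OF _ smooth_a])

lemma a_aexp_vec: "(a \<xi> *v (aexp t \<xi> *v v)) $ i = (\<Sum>j\<in>UNIV. \<Sum>l\<in>UNIV. aexp t \<xi> $ j $ l * (a \<xi> $ i $ j * v $ l))"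
  by (simp add: matrix_vector_mult_def sum_distrib_left ac_simps)

lemma a_aexp_vec_nice: assumes "testvec g" shows "nice (\<lambda>\<xi>. (a \<xi> *v (aexp t \<xi> *v g \<xi>)) $ i)"
  unfolding a_aexp_vec using assms by (intro nice_sum aexp_nice a_testfun) (auto simp: testvec_def)

lemma sol_nth:
  assumes g: "testvec g"
  shows "sol t g x $ i = eseries (coef g x i) t"
proof -
  have tg: "testfun (\<lambda>\<xi>. g \<xi> $ j)" for j using g by (simp add: testvec_def)
  have CB: "\<exists>C B. \<forall>k. norm (inv_fourier (\<lambda>\<xi>. apow k i j \<xi> * g \<xi> $ j) x) \<le> C * B ^ k" for j
  proof -
    obtain C B where "\<And>k i j' x. norm (inv_fourier (\<lambda>\<xi>. apow k i j' \<xi> * g \<xi> $ j) x) \<le> C * B ^ k * wt x"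
      using apow_fourier_bound[OF tg[of j]] by blast
    then have "norm (inv_fourier (\<lambda>\<xi>. apow k i j \<xi> * g \<xi> $ j) x) \<le> (C * wt x) * B ^ k" for k
      by (simp only: ac_simps)
    then show ?thesis by blast
  qed
  have "sol t g x $ i = inv_fourier (\<lambda>\<xi>. \<Sum>j\<in>UNIV. aexp t \<xi> $ i $ j * g \<xi> $ j) x"
    by (simp add: sol_def inv_fourier_vec_def matrix_vector_mult_def)
  also have "\<dots> = (\<Sum>j\<in>UNIV. inv_fourier (\<lambda>\<xi>. aexp t \<xi> $ i $ j * g \<xi> $ j) x)"
    by (rule inv_fourier_sum) (auto intro!: nice_integrable aexp_nice tg)
  also have "\<dots> = (\<Sum>j\<in>UNIV. eseries (\<lambda>k. inv_fourier (\<lambda>\<xi>. apow k i j \<xi> * g \<xi> $ j) x) t)"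
    by (simp add: apow_inv_fourier_sums[OF tg])
  also have "\<dots> = eseries (\<lambda>k. \<Sum>j\<in>UNIV. inv_fourier (\<lambda>\<xi>. apow k i j \<xi> * g \<xi> $ j) x) t"
    by (rule eseries_sum[OF _ CB]) simp
  finally show ?thesis by (simp add: coef_def[abs_def])
qed

text \<open>
  Differentiating in time shifts the coefficients, since one more factor \<open>a\<close> can be put either in
  front of the exponential or behind it.
\<close>

lemma dsol_nth:
  assumes g: "testvec g"
  shows "dsol t g x $ i = eseries (\<lambda>k. coef g x i (Suc k)) t"
proof -
  define G where "G j \<xi> = (\<chi> l. a \<xi> $ i $ j * g \<xi> $ l)" for j \<xi>
  have tG: "testvec (G j)" for j using g unfolding testvec_def G_def by (auto intro: a_testfun)
  have "dsol t g x $ i = inv_fourier (\<lambda>\<xi>. \<Sum>j\<in>UNIV. (aexp t \<xi> *v G j \<xi>) $ j) x"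
    by (simp add: dsol_def inv_fourier_vec_def a_aexp_vec) (simp add: matrix_vector_mult_def G_def)
  also have "\<dots> = (\<Sum>j\<in>UNIV. sol t (G j) x $ j)"
    by (subst inv_fourier_sum) (auto intro!: nice_integrable aexp_vec_nice tG simp: sol_def inv_fourier_vec_def)
  also have "\<dots> = (\<Sum>j\<in>UNIV. eseries (coef (G j) x j) t)" by (simp add: sol_nth[OF tG])
  also have "\<dots> = eseries (\<lambda>k. \<Sum>j\<in>UNIV. coef (G j) x j k) t"
  proof -
    have "\<exists>C B. \<forall>k. norm (coef (G j) x j k) \<le> C * B ^ k" for j using coef_bound[OF tG[of j]] by blast
    then show ?thesis by (intro eseries_sum finite)
  qed
  also have "(\<lambda>k. \<Sum>j\<in>UNIV. coef (G j) x j k) = (\<lambda>k. coef g x i (Suc k))"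
  proof
    fix k
    have int: "integrable lborel (\<lambda>\<xi>. apow k j l \<xi> * (a \<xi> $ i $ j * g \<xi> $ l))" for j l
    proof -
      have "testfun (\<lambda>\<xi>. a \<xi> $ i $ j * g \<xi> $ l)" using g by (auto simp: testvec_def intro: a_testfun)
      then show ?thesis using apow_testfun[of _ 0] testfun_fourier_integrable by blast
    qed
    have "(\<Sum>j\<in>UNIV. coef (G j) x j k) = (\<Sum>l\<in>UNIV. \<Sum>j\<in>UNIV. inv_fourier (\<lambda>\<xi>. apow k j l \<xi> * (a \<xi> $ i $ j * g \<xi> $ l)) x)"
      unfolding coef_def G_def by (simp, rule sum.swap)
    also have "\<dots> = (\<Sum>l\<in>UNIV. inv_fourier (\<lambda>\<xi>. apow (Suc k) i l \<xi> * g \<xi> $ l) x)"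
    proof (rule sum.cong[OF refl])
      fix l
      have "(\<Sum>j\<in>UNIV. inv_fourier (\<lambda>\<xi>. apow k j l \<xi> * (a \<xi> $ i $ j * g \<xi> $ l)) x) = inv_fourier (\<lambda>\<xi>. \<Sum>j\<in>UNIV. apow k j l \<xi> * (a \<xi> $ i $ j * g \<xi> $ l)) x"
        by (rule inv_fourier_sum[symmetric]) (auto intro: int)
      also have "(\<lambda>\<xi>. \<Sum>j\<in>UNIV. apow k j l \<xi> * (a \<xi> $ i $ j * g \<xi> $ l)) = (\<lambda>\<xi>. apow (Suc k) i l \<xi> * g \<xi> $ l)"
        by (simp add: mpow_Suc_nth sum_distrib_left ac_simps)
      finally show "(\<Sum>j\<in>UNIV. inv_fourier (\<lambda>\<xi>. apow k j l \<xi> * (a \<xi> $ i $ j * g \<xi> $ l)) x) = inv_fourier (\<lambda>\<xi>. apow (Suc k) i l \<xi> * g \<xi> $ l) x" .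
    qed
    finally show "(\<Sum>j\<in>UNIV. coef (G j) x j k) = coef g x i (Suc k)" by (simp add: coef_def)
  qed
  finally show ?thesis .
qed

lemma nice_vec_measurable:
  fixes h :: "real ^ 'n \<Rightarrow> complex ^ 'N"
  assumes "\<And>j. nice (\<lambda>\<xi>. h \<xi> $ j)" shows "inv_fourier_vec h \<in> borel_measurable borel"
  by (rule measurable_vecI) (simp add: inv_fourier_vec_def inv_fourier_measurable[OF nice_measurable[OF assms]])

lemma nice_vec_lp:
  fixes h :: "real ^ 'n \<Rightarrow> complex ^ 'N"
  assumes "\<And>j. nice (\<lambda>\<xi>. h \<xi> $ j)" shows "lp p (inv_fourier_vec h)"
  unfolding lp_vec(1)[OF p_ge(1)] by (simp add: inv_fourier_vec_def nice_lp[OF p_ge(1) assms])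

lemma nice_vec_pairing:
  fixes h :: "real ^ 'n \<Rightarrow> complex ^ 'N"
  assumes h: "\<And>j. nice (\<lambda>\<xi>. h \<xi> $ j)" and \<theta>: "integrable lborel \<theta>" "lp q (fourier \<theta>)"
  shows "dist_of (class_of (inv_fourier_vec h)) (fourier \<theta>) $ i = (\<integral>\<xi>. \<theta> \<xi> * h \<xi> $ i \<partial>lborel)"
  using dist_of_class[OF nice_vec_lp[OF h] \<theta>(2), of i] nice_pairing[OF h[of i] \<theta>(1)]
  by (simp add: inv_fourier_vec_def)

lemma represents_op_iff:
  "represents_op a u v \<longleftrightarrow> (\<forall>\<phi>\<in>schwartz. \<forall>i.
     (\<Sum>j\<in>UNIV. dist_of u (fourier (\<lambda>\<xi>. a \<xi> $ i $ j * inv_fourier \<phi> \<xi>)) $ j) = dist_of v \<phi> $ i)"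
  by (simp add: represents_op_def op_dist_def dist_inv_fourier_def dist_mult_def dist_fourier_def vec_eq_iff)

lemma a_schwartz: "\<phi> \<in> schwartz \<Longrightarrow> (\<lambda>\<xi>. a \<xi> $ i $ j * \<phi> \<xi>) \<in> schwartz"
  by (rule schwartz_mult[OF pgrow_a])

text \<open>
  For functions whose transform \<open>h\<close> is a decaying function, the distribution \<open>op[a]\<close> is the inverse
  transform of the product \<open>a h\<close>.
\<close>

lemma represents_nice:
  assumes h: "\<And>j. nice (\<lambda>\<xi>. h \<xi> $ j)" and ah: "\<And>i. nice (\<lambda>\<xi>. (a \<xi> *v h \<xi>) $ i)"
  shows "represents_op a (class_of (inv_fourier_vec h)) (class_of (inv_fourier_vec (\<lambda>\<xi>. a \<xi> *v h \<xi>)))"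
  unfolding represents_op_iff
proof (intro ballI allI)
  fix \<phi> :: "real ^ 'n \<Rightarrow> complex" and i assume \<phi>: "\<phi> \<in> schwartz"
  note i\<phi> = schwartz_inv_fourier[OF \<phi>]
  have S: "(\<lambda>\<xi>. a \<xi> $ i $ j * inv_fourier \<phi> \<xi>) \<in> schwartz" for j by (rule a_schwartz[OF i\<phi>])
  have int: "integrable lborel (\<lambda>\<xi>. (a \<xi> $ i $ j * inv_fourier \<phi> \<xi>) * h \<xi> $ j)" for j
  proof -
    obtain C where C: "\<And>x. norm (h x $ j) \<le> C * wt x" using h[of j] by (auto simp: nice_def)
    have C0: "0 \<le> C" by (rule wt_const_nonneg[OF C norm_ge_zero])
    show ?thesis
    proof (rule integrable_dominated[OF integrable_norm[OF schwartz_integrable[OF S]]])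
      show "(\<lambda>\<xi>. (a \<xi> $ i $ j * inv_fourier \<phi> \<xi>) * h \<xi> $ j) \<in> borel_measurable borel"
        by (intro borel_measurable_times schwartz_measurable[OF S] nice_measurable[OF h])
      fix x
      have "norm (h x $ j) \<le> C" using C[of x] mult_left_mono[OF wt_le_1 C0, of x] by simp
      then show "norm ((a x $ i $ j * inv_fourier \<phi> x) * h x $ j) \<le> C * norm (a x $ i $ j * inv_fourier \<phi> x)"
        unfolding norm_mult[of "_ * _" "h x $ j"] by (simp add: mult.commute mult_right_mono)
    qed
  qed
  have "(\<Sum>j\<in>UNIV. dist_of (class_of (inv_fourier_vec h)) (fourier (\<lambda>\<xi>. a \<xi> $ i $ j * inv_fourier \<phi> \<xi>)) $ j) =
      (\<Sum>j\<in>UNIV. \<integral>\<xi>. (a \<xi> $ i $ j * inv_fourier \<phi> \<xi>) * h \<xi> $ j \<partial>lborel)"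
    by (rule sum.cong[OF refl], rule nice_vec_pairing[OF h])
       (intro schwartz_integrable S, intro schwartz_lp schwartz_fourier S p_ge)
  also have "\<dots> = (\<integral>\<xi>. (\<Sum>j\<in>UNIV. (a \<xi> $ i $ j * inv_fourier \<phi> \<xi>) * h \<xi> $ j) \<partial>lborel)"
    by (rule Bochner_Integration.integral_sum[symmetric]) (rule int)
  also have "\<dots> = (\<integral>\<xi>. inv_fourier \<phi> \<xi> * (a \<xi> *v h \<xi>) $ i \<partial>lborel)"
    by (simp add: matrix_vector_mult_def sum_distrib_left ac_simps)
  also have "\<dots> = (\<integral>x. fourier (inv_fourier \<phi>) x * inv_fourier (\<lambda>\<xi>. (a \<xi> *v h \<xi>) $ i) x \<partial>lborel)"
    by (rule nice_pairing[OF ah schwartz_integrable[OF i\<phi>], symmetric])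
  also have "\<dots> = dist_of (class_of (inv_fourier_vec (\<lambda>\<xi>. a \<xi> *v h \<xi>))) \<phi> $ i"
    using dist_of_class[OF nice_vec_lp[OF ah] schwartz_lp[OF p_ge(3) \<phi>], of i]
    by (simp add: schwartz_fourier_inv(1)[OF \<phi>] inv_fourier_vec_def)
  finally show "(\<Sum>j\<in>UNIV. dist_of (class_of (inv_fourier_vec h)) (fourier (\<lambda>\<xi>. a \<xi> $ i $ j * inv_fourier \<phi> \<xi>)) $ j) =
    dist_of (class_of (inv_fourier_vec (\<lambda>\<xi>. a \<xi> *v h \<xi>))) \<phi> $ i" .
qed

lemma realization_eqI:
  assumes u: "u \<in> Lp p" and v: "v \<in> Lp p" and r: "represents_op a u v"
  shows "u \<in> Lp_domain p a" "Lp_realization p a u = v"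
proof -
  show "u \<in> Lp_domain p a" using assms by (auto simp: Lp_domain_def)
  show "Lp_realization p a u = v"
    unfolding Lp_realization_def
  proof (rule the_equality)
    fix w assume w: "w \<in> Lp p \<and> represents_op a u w"
    then have w': "w \<in> Lp p" and rw: "represents_op a u w" by auto
    have "dist_of w (inv_fourier g) $ j = dist_of v (inv_fourier g) $ j" if "testfun g" for g j
    proof -
      have S: "inv_fourier g \<in> schwartz" by (intro schwartz_inv_fourier testfun_schwartz that)
      show ?thesis
        using rw[unfolded represents_op_iff, rule_format, OF S, of j] r[unfolded represents_op_iff, rule_format, OF S, of j] by simp
    qed
    then show "w = v" by (rule Lp_eqI[OF w' v])
  qed (simp add: v r)
qed

lemma domainD:
  assumes "u \<in> Lp_domain p a"
  shows "u \<in> Lp p" "Lp_realization p a u \<in> Lp p" "represents_op a u (Lp_realization p a u)"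
proof -
  obtain v where "u \<in> Lp p" "v \<in> Lp p" "represents_op a u v" using assms by (auto simp: Lp_domain_def)
  with realization_eqI(2)[OF this]
  show "u \<in> Lp p" "Lp_realization p a u \<in> Lp p" "represents_op a u (Lp_realization p a u)" by auto
qed

lemma a_fourier_lp: "\<phi> \<in> schwartz \<Longrightarrow> lp q (fourier (\<lambda>\<xi>. a \<xi> $ i $ j * inv_fourier \<phi> \<xi>))"
  by (intro schwartz_lp p_ge schwartz_fourier a_schwartz schwartz_inv_fourier)

lemma sol_domain:
  assumes g: "testvec g"
  shows "class_of (sol t g) \<in> Lp_domain p a" "Lp_realization p a (class_of (sol t g)) = class_of (dsol t g)"
proof -
  note h = aexp_vec_nice[OF g] and ah = a_aexp_vec_nice[OF g]
  have "class_of (sol t g) \<in> Lp p"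
    unfolding sol_def using class_of_Lp[OF p_ge(2) lp_measurable[OF nice_vec_lp[OF h]]] nice_vec_lp[OF h] by simp
  moreover have "class_of (dsol t g) \<in> Lp p"
    unfolding dsol_def using class_of_Lp[OF p_ge(2) lp_measurable[OF nice_vec_lp[OF ah]]] nice_vec_lp[OF ah] by simp
  moreover note represents_nice[OF h ah]
  ultimately
  show "class_of (sol t g) \<in> Lp_domain p a" "Lp_realization p a (class_of (sol t g)) = class_of (dsol t g)"
    using realization_eqI unfolding sol_def dsol_def by blast+
qed

lemma sol_0: "sol 0 g = inv_fourier_vec g"
proof -
  have "aexp 0 \<xi> = mat 1" for \<xi> using mat_exp_0[of "a \<xi>"] by simp
  then show ?thesis by (simp add: sol_def)
qed

lemma realization_linear: "linear_operator (Lp p) (Lp_domain p a) (Lp_realization p a)"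
proof -
  have add: "x + y \<in> Lp_domain p a \<and> Lp_realization p a (x + y) = Lp_realization p a x + Lp_realization p a y"
    if x: "x \<in> Lp_domain p a" and y: "y \<in> Lp_domain p a" for x y
  proof -
    note X = domainD[OF x] and Y = domainD[OF y]
    have "represents_op a (x + y) (Lp_realization p a x + Lp_realization p a y)"
      using X(3) Y(3) unfolding represents_op_iff
      by (simp add: dist_of_add[OF X(1) Y(1) a_fourier_lp] dist_of_add[OF X(2) Y(2) schwartz_lp[OF p_ge(3)]] sum.distrib)
    from realization_eqI[OF X.add_in[OF X(1) Y(1)] X.add_in[OF X(2) Y(2)] this] show ?thesis by blast
  qed
  have scl: "c *\<^sub>R x \<in> Lp_domain p a \<and> Lp_realization p a (c *\<^sub>R x) = c *\<^sub>R Lp_realization p a x"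
    if x: "x \<in> Lp_domain p a" for c x
  proof -
    note X = domainD[OF x]
    have "represents_op a (c *\<^sub>R x) (c *\<^sub>R Lp_realization p a x)"
      using X(3) unfolding represents_op_iff
      by (simp add: dist_of_scaleR[OF X(1) a_fourier_lp] dist_of_scaleR[OF X(2) schwartz_lp[OF p_ge(3)]] flip: scaleR_sum_right)
    from realization_eqI[OF X.scaleR_in[OF X(1)] X.scaleR_in[OF X(2)] this] show ?thesis by blast
  qed
  have "testvec (\<lambda>\<xi>. 0 :: complex ^ 'N)" by (simp add: testvec_def testfun_const0)
  from sol_domain(1)[OF this, of 0] obtain x where x: "x \<in> Lp_domain p a" by blast
  have "0 \<in> Lp_domain p a" using scl[OF x, of 0] by simp
  then show ?thesis
    unfolding linear_operator_def subspace_def using add scl domainD by blast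
qed

text \<open>
  Both sides of the defining identity are continuous in the norm for each fixed test function.
\<close>

lemma realization_closed: "closed_operator (Lp p) (Lp_norm p) (Lp_domain p a) (Lp_realization p a)"
  unfolding closed_operator_def
proof (intro allI impI, elim conjE)
  fix s x y
  assume s: "\<forall>k::nat. s k \<in> Lp_domain p a" and x: "x \<in> Lp p" and y: "y \<in> Lp p"
    and sx: "converges_in (Lp_norm p) s x sequentially"
    and sy: "converges_in (Lp_norm p) (\<lambda>k. Lp_realization p a (s k)) y sequentially"
  have s1: "s k \<in> Lp p" and s2: "Lp_realization p a (s k) \<in> Lp p" and s3: "represents_op a (s k) (Lp_realization p a (s k))" for k
    using domainD s by auto
  have lim: "(\<lambda>k. dist_of (r k) \<phi> $ j) \<longlonglongrightarrow> dist_of z \<phi> $ j"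
    if "\<And>k. r k \<in> Lp p" "z \<in> Lp p" "converges_in (Lp_norm p) r z sequentially" "lp q \<phi>" for r and z :: "(real ^ 'n, complex ^ 'N) ae_class" and \<phi> j
  proof -
    have l: "(\<lambda>k. lpn q \<phi> * Lp_norm p (r k - z)) \<longlonglongrightarrow> 0"
      using tendsto_mult[OF tendsto_const[of "lpn q \<phi>"] that(3)[unfolded converges_in_def]] by simp
    have "\<forall>\<^sub>F k in sequentially. norm (dist_of (r k) \<phi> $ j - dist_of z \<phi> $ j) \<le> lpn q \<phi> * Lp_norm p (r k - z)"
      by (rule always_eventually, rule allI, rule dist_of_diff_bound[OF that(1,2,4)])
    from LIM_zero_cancel[OF Lim_null_comparison[OF this l]] show ?thesis .
  qed
  have "represents_op a x y"
    unfolding represents_op_iff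
  proof (intro ballI allI)
    fix \<phi> :: "real ^ 'n \<Rightarrow> complex" and i assume \<phi>: "\<phi> \<in> schwartz"
    have "(\<lambda>k. \<Sum>j\<in>UNIV. dist_of (s k) (fourier (\<lambda>\<xi>. a \<xi> $ i $ j * inv_fourier \<phi> \<xi>)) $ j) \<longlonglongrightarrow>
        (\<Sum>j\<in>UNIV. dist_of x (fourier (\<lambda>\<xi>. a \<xi> $ i $ j * inv_fourier \<phi> \<xi>)) $ j)"
      by (intro tendsto_sum lim s1 x sx a_fourier_lp \<phi>)
    moreover have "(\<lambda>k. dist_of (Lp_realization p a (s k)) \<phi> $ i) \<longlonglongrightarrow> dist_of y \<phi> $ i"
      by (intro lim s2 y sy schwartz_lp p_ge \<phi>)
    moreover have "(\<Sum>j\<in>UNIV. dist_of (s k) (fourier (\<lambda>\<xi>. a \<xi> $ i $ j * inv_fourier \<phi> \<xi>)) $ j) = dist_of (Lp_realization p a (s k)) \<phi> $ i" for k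
      using s3[of k] \<phi> unfolding represents_op_iff by blast
    ultimately show "(\<Sum>j\<in>UNIV. dist_of x (fourier (\<lambda>\<xi>. a \<xi> $ i $ j * inv_fourier \<phi> \<xi>)) $ j) = dist_of y \<phi> $ i"
      using LIMSEQ_unique by simp
  qed
  then show "x \<in> Lp_domain p a \<and> Lp_realization p a x = y" using realization_eqI[OF x y] by blast
qed

lemma realization_dense: "densely_defined (Lp p) (Lp_norm p) (Lp_domain p a)"
  unfolding densely_defined_def
proof (intro ballI allI impI)
  fix x :: "(real ^ 'n, complex ^ 'N) ae_class" and e :: real assume "x \<in> Lp p" "0 < e"
  then obtain g where g: "testvec g" "Lp_norm p (class_of (inv_fourier_vec g) - x) < e" using testvec_dense by blast
  then show "\<exists>y\<in>Lp_domain p a. Lp_norm p (y - x) < e"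
    using sol_domain(1)[OF g(1), of 0] by (auto simp: sol_0)
qed

lemma sol_measurable:
  "testvec g \<Longrightarrow> sol t g \<in> borel_measurable borel" "testvec g \<Longrightarrow> dsol t g \<in> borel_measurable borel"
  unfolding sol_def dsol_def by (intro nice_vec_measurable aexp_vec_nice, assumption) (intro nice_vec_measurable a_aexp_vec_nice)

lemma sol_Lp: "testvec g \<Longrightarrow> class_of (sol t g) \<in> Lp p" "testvec g \<Longrightarrow> class_of (dsol t g) \<in> Lp p"
  using domainD(1)[OF sol_domain(1)] domainD(2)[OF sol_domain(1)] sol_domain(2) by metis+

text \<open>Quantitative differentiability in \<open>t\<close>, from the Taylor estimate for the series at each point.\<close>

lemma sol_estimates:
  assumes g: "testvec g"
  shows "\<exists>K\<ge>0. \<forall>s t. \<bar>s\<bar> \<le> T \<longrightarrow> \<bar>t\<bar> \<le> T \<longrightarrow>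
    Lp_norm p (class_of (sol s g) - class_of (sol t g)) \<le> K * \<bar>s - t\<bar> \<and>
    Lp_norm p (class_of (dsol s g) - class_of (dsol t g)) \<le> K * \<bar>s - t\<bar> \<and>
    Lp_norm p (class_of (sol s g) - class_of (sol t g) - (s - t) *\<^sub>R class_of (dsol t g)) \<le> K * (s - t)\<^sup>2"
proof -
  obtain C B where CB: "0 \<le> C" "0 \<le> B" "\<And>x i k. norm (coef g x i k) \<le> (C * wt x) * B ^ k"
    using coef_bound[OF g] by blast
  have CBs: "norm (coef g x i (Suc k)) \<le> (C * B * wt x) * B ^ k" for x i k
    using CB(3)[of x i "Suc k"] by (simp add: ac_simps)
  define w where "w = real CARD('N) * lpn p (wt :: real ^ 'n \<Rightarrow> real)"
  define E where "E = exp (T * B)"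
  define K where "K = w * (C * B * E + C * B\<^sup>2 * E)"
  have w: "0 \<le> w" "0 \<le> E" by (auto simp: w_def E_def)
  note m = sol_measurable[OF g]
  have "Lp_norm p (class_of (sol s g) - class_of (sol t g)) \<le> K * \<bar>s - t\<bar> \<and>
    Lp_norm p (class_of (dsol s g) - class_of (dsol t g)) \<le> K * \<bar>s - t\<bar> \<and>
    Lp_norm p (class_of (sol s g) - class_of (sol t g) - (s - t) *\<^sub>R class_of (dsol t g)) \<le> K * (s - t)\<^sup>2"
    if st: "\<bar>s\<bar> \<le> T" "\<bar>t\<bar> \<le> T" for s t
  proof (intro conjI)
    have "Lp_norm p (class_of (\<lambda>x. sol s g x - sol t g x)) \<le> w * (C * B * E * \<bar>s - t\<bar>)"
      unfolding w_def
    proof (rule Lp_wt_bound(3))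
      show "norm ((sol s g x - sol t g x) $ i) \<le> C * B * E * \<bar>s - t\<bar> * wt x" for x i
        using eseries_lipschitz[of "coef g x i" "C * wt x" B s T t, OF CB(3) CB(2) _ st] CB(1)
        by (simp add: sol_nth[OF g] E_def ac_simps)
    qed (use m in measurable)
    also have "\<dots> = (w * (C * B * E)) * \<bar>s - t\<bar>" by (simp only: ac_simps)
    also have "\<dots> \<le> K * \<bar>s - t\<bar>"
      using w CB unfolding K_def by (intro mult_right_mono mult_left_mono) auto
    finally show "Lp_norm p (class_of (sol s g) - class_of (sol t g)) \<le> K * \<bar>s - t\<bar>"
      by (simp add: class_of_diff[OF m(1) m(1)])
    have "Lp_norm p (class_of (\<lambda>x. dsol s g x - dsol t g x)) \<le> w * (C * B\<^sup>2 * E * \<bar>s - t\<bar>)"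
      unfolding w_def
    proof (rule Lp_wt_bound(3))
      show "norm ((dsol s g x - dsol t g x) $ i) \<le> C * B\<^sup>2 * E * \<bar>s - t\<bar> * wt x" for x i
        using eseries_lipschitz[of "\<lambda>k. coef g x i (Suc k)" "C * B * wt x" B s T t, OF CBs CB(2) _ st] CB
        by (simp add: dsol_nth[OF g] E_def ac_simps power2_eq_square)
    qed (use m in measurable)
    also have "\<dots> = (w * (C * B\<^sup>2 * E)) * \<bar>s - t\<bar>" by (simp only: ac_simps)
    also have "\<dots> \<le> K * \<bar>s - t\<bar>"
      using w CB unfolding K_def by (intro mult_right_mono mult_left_mono) auto
    finally show "Lp_norm p (class_of (dsol s g) - class_of (dsol t g)) \<le> K * \<bar>s - t\<bar>"
      by (simp add: class_of_diff[OF m(2) m(2)])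
    have m3: "(\<lambda>x. sol s g x - sol t g x) \<in> borel_measurable borel" "(\<lambda>x. (s - t) *\<^sub>R dsol t g x) \<in> borel_measurable borel"
      using m by measurable
    have "Lp_norm p (class_of (\<lambda>x. sol s g x - sol t g x - (s - t) *\<^sub>R dsol t g x)) \<le> w * (C * B\<^sup>2 * E * (s - t)\<^sup>2)"
      unfolding w_def
    proof (rule Lp_wt_bound(3))
      show "norm ((sol s g x - sol t g x - (s - t) *\<^sub>R dsol t g x) $ i) \<le> C * B\<^sup>2 * E * (s - t)\<^sup>2 * wt x" for x i
        using eseries_taylor[of "coef g x i" "C * wt x" B s T t, OF CB(3) CB(2) _ st] CB(1)
        by (simp add: sol_nth[OF g] dsol_nth[OF g] E_def ac_simps)
    qed (use m3 in measurable)
    also have "\<dots> = (w * (C * B\<^sup>2 * E)) * (s - t)\<^sup>2" by (simp only: ac_simps)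
    also have "\<dots> \<le> K * (s - t)\<^sup>2"
      using w CB unfolding K_def by (intro mult_right_mono mult_left_mono) auto
    finally show "Lp_norm p (class_of (sol s g) - class_of (sol t g) - (s - t) *\<^sub>R class_of (dsol t g)) \<le> K * (s - t)\<^sup>2"
      by (simp add: class_of_diff[OF m(1) m(1)] class_of_scaleR[OF m(2)] class_of_diff[OF m3])
  qed
  moreover have "0 \<le> K" using w CB by (simp add: K_def)
  ultimately show ?thesis by blast
qed

lemma sol_classical:
  assumes g: "testvec g"
  shows "classical_solution (Lp p) (Lp_norm p) (Lp_domain p a) (Lp_realization p a)
    (class_of (inv_fourier_vec g)) (\<lambda>t. class_of (sol t g))"
proof -
  have "((\<lambda>s. Lp_norm p ((1 / (s - t)) *\<^sub>R (class_of (sol s g) - class_of (sol t g)) - class_of (dsol t g))) \<longlongrightarrow> 0) (at t within {0..}) \<and>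
      ((\<lambda>s. Lp_norm p (class_of (dsol s g) - class_of (dsol t g))) \<longlongrightarrow> 0) (at t within {0..})" if t: "0 \<le> t" for t
  proof -
    obtain K where K: "0 \<le> K" "\<And>s r. \<bar>s\<bar> \<le> t + 1 \<Longrightarrow> \<bar>r\<bar> \<le> t + 1 \<Longrightarrow>
      Lp_norm p (class_of (dsol s g) - class_of (dsol r g)) \<le> K * \<bar>s - r\<bar> \<and>
      Lp_norm p (class_of (sol s g) - class_of (sol r g) - (s - r) *\<^sub>R class_of (dsol r g)) \<le> K * (s - r)\<^sup>2"
      using sol_estimates[OF g, of "t + 1"] by blast
    have l: "((\<lambda>s. K * \<bar>s - t\<bar>) \<longlongrightarrow> 0) (at t within {0..})"
    proof -
      have "((\<lambda>s. K * \<bar>s - t\<bar>) \<longlongrightarrow> K * \<bar>t - t\<bar>) (at t within {0..})" by (intro tendsto_intros)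
      then show ?thesis by simp
    qed
    have "\<forall>\<^sub>F s in at t within {0..}. s \<in> {t - 1<..<t + 1}"
      by (intro eventually_at_topological[THEN iffD2] exI[of _ "{t - 1<..<t + 1}"]) auto
    moreover have "\<forall>\<^sub>F s in at t within {0..}. s \<in> {0..} \<and> s \<noteq> t" by (simp add: eventually_at_filter)
    ultimately have ev: "\<forall>\<^sub>F s in at t within {0..}. \<bar>s\<bar> \<le> t + 1 \<and> s \<noteq> t" by eventually_elim auto
    have 1: "\<forall>\<^sub>F s in at t within {0..}. norm (Lp_norm p ((1 / (s - t)) *\<^sub>R (class_of (sol s g) - class_of (sol t g)) - class_of (dsol t g))) \<le> K * \<bar>s - t\<bar>"
      using ev
    proof eventually_elim
      case (elim s)
      have i: "class_of (sol s g) - class_of (sol t g) - (s - t) *\<^sub>R class_of (dsol t g) \<in> Lp p"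
        by (intro X.diff_in X.scaleR_in sol_Lp g)
      have "(1 / (s - t)) *\<^sub>R (class_of (sol s g) - class_of (sol t g)) - class_of (dsol t g) =
          (1 / (s - t)) *\<^sub>R (class_of (sol s g) - class_of (sol t g) - (s - t) *\<^sub>R class_of (dsol t g))"
        using elim by (simp add: scaleR_diff_right)
      then have "Lp_norm p ((1 / (s - t)) *\<^sub>R (class_of (sol s g) - class_of (sol t g)) - class_of (dsol t g)) =
          \<bar>1 / (s - t)\<bar> * Lp_norm p (class_of (sol s g) - class_of (sol t g) - (s - t) *\<^sub>R class_of (dsol t g))"
        using X.nrm_scaleR[OF i] by simp
      also have "\<dots> \<le> \<bar>1 / (s - t)\<bar> * (K * (s - t)\<^sup>2)" using K(2)[of s t] elim t by (intro mult_left_mono) auto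
      also have "\<dots> = (\<bar>1 / (s - t)\<bar> * \<bar>s - t\<bar>) * (K * \<bar>s - t\<bar>)"
        unfolding power2_abs[of "s - t", symmetric] power2_eq_square by (simp only: ac_simps)
      also have "\<bar>1 / (s - t)\<bar> * \<bar>s - t\<bar> = 1" using elim by simp
      also have "1 * (K * \<bar>s - t\<bar>) = K * \<bar>s - t\<bar>" by simp
      finally show ?case using X.nrm_nonneg by simp
    qed
    have 2: "\<forall>\<^sub>F s in at t within {0..}. norm (Lp_norm p (class_of (dsol s g) - class_of (dsol t g))) \<le> K * \<bar>s - t\<bar>"
      using ev by eventually_elim (use K(2)[of _ t] t X.nrm_nonneg in auto)
    show ?thesis using Lim_null_comparison[OF 1 l] Lim_null_comparison[OF 2 l] by blast
  qed
  then show ?thesis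
    unfolding classical_solution_def converges_in_def
    using sol_Lp[OF g] sol_domain[OF g]
    by (intro conjI exI[of _ "\<lambda>t. class_of (dsol t g)"]) (auto simp: sol_0)
qed

end

section \<open>Well-posedness bounds the multipliers\<close>

lemma lpn_dilation:
  fixes f :: "'a::euclidean_space \<Rightarrow> 'b::euclidean_space"
  assumes p: "0 < p" and f: "lp p f" and e: "0 < e"
  shows "lp p (\<lambda>x. f (e *\<^sub>R x))"
    and "lpn p (\<lambda>x. f (e *\<^sub>R x)) = (1 / e ^ DIM('a)) powr (1 / p) * lpn p f"
proof -
  let ?F = "\<lambda>x. norm (f x) powr p"
  have m: "f \<in> borel_measurable borel" and i: "integrable lborel ?F" using f by (auto simp: lp_def)
  have m': "(\<lambda>x. f (e *\<^sub>R x)) \<in> borel_measurable borel" by (rule measurable_compose[OF _ m]) simp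
  have mF: "?F \<in> borel_measurable borel" using m by measurable
  show "lp p (\<lambda>x. f (e *\<^sub>R x))"
    using lborel_affine_integrable[OF i, of e 0] e m' by (simp add: lp_def)
  have "(\<integral>x. ?F x \<partial>lborel) = e ^ DIM('a) * (\<integral>x. ?F (e *\<^sub>R x) \<partial>lborel)"
    using lborel_affine_integral[OF mF, of e 0] e by simp
  then have "(\<integral>x. ?F (e *\<^sub>R x) \<partial>lborel) = (1 / e ^ DIM('a)) * (\<integral>x. ?F x \<partial>lborel)" using e by simp
  then show "lpn p (\<lambda>x. f (e *\<^sub>R x)) = (1 / e ^ DIM('a)) powr (1 / p) * lpn p f"
    unfolding lpn_def using e by (simp only: powr_mult)
qed

lemma inv_fourier_affine:
  fixes f :: "real ^ 'n \<Rightarrow> complex"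
  assumes f: "f \<in> borel_measurable borel" and e: "0 < e"
  shows "inv_fourier (\<lambda>\<eta>. f (\<xi> + e *\<^sub>R \<eta>)) y = complex_of_real (1 / e ^ CARD('n)) *
    (exp (\<i> * complex_of_real (((1 / e) *\<^sub>R y) \<bullet> \<xi>)) * inv_fourier f ((1 / e) *\<^sub>R y))"
proof -
  let ?z = "(1 / e) *\<^sub>R y"
  let ?g = "\<lambda>x. exp (\<i> * complex_of_real (x \<bullet> (- ?z))) * f x"
  have gm: "?g \<in> borel_measurable borel" using f by measurable
  have g: "?g (\<xi> + e *\<^sub>R \<eta>) = exp (- (\<i> * complex_of_real (?z \<bullet> \<xi>))) * (exp (\<i> * complex_of_real (\<eta> \<bullet> (- y))) * f (\<xi> + e *\<^sub>R \<eta>))" for \<eta>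
  proof -
    have "(\<xi> + e *\<^sub>R \<eta>) \<bullet> (- ?z) = - (?z \<bullet> \<xi>) + \<eta> \<bullet> (- y)"
      unfolding inner_add_left using e by (simp add: inner_commute)
    then have "exp (\<i> * complex_of_real ((\<xi> + e *\<^sub>R \<eta>) \<bullet> (- ?z))) = exp (- (\<i> * complex_of_real (?z \<bullet> \<xi>)) + \<i> * complex_of_real (\<eta> \<bullet> (- y)))"
      by (simp only: of_real_add of_real_minus distrib_left mult_minus_right)
    then show ?thesis by (simp only: exp_add mult.assoc)
  qed
  have "(\<integral>x. ?g x \<partial>lborel) = complex_of_real (e ^ CARD('n)) * (\<integral>\<eta>. ?g (\<xi> + e *\<^sub>R \<eta>) \<partial>lborel)"
    using lborel_affine_integral[OF gm, of e \<xi>] e unfolding scaleR_conv_of_real[where 'a=complex] by simp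
  also have "(\<integral>\<eta>. ?g (\<xi> + e *\<^sub>R \<eta>) \<partial>lborel) = exp (- (\<i> * complex_of_real (?z \<bullet> \<xi>))) *
      (\<integral>\<eta>. exp (\<i> * complex_of_real (\<eta> \<bullet> (- y))) * f (\<xi> + e *\<^sub>R \<eta>) \<partial>lborel)"
    unfolding g by (rule integral_mult_right_zero)
  finally have "inv_fourier f ?z = complex_of_real (e ^ CARD('n)) * (exp (- (\<i> * complex_of_real (?z \<bullet> \<xi>))) * inv_fourier (\<lambda>\<eta>. f (\<xi> + e *\<^sub>R \<eta>)) y)"
    unfolding inv_fourier_minus fourier_alt by (simp only: ac_simps)
  then have "exp (\<i> * complex_of_real (?z \<bullet> \<xi>)) * inv_fourier f ?z =
      (exp (\<i> * complex_of_real (?z \<bullet> \<xi>)) * exp (- (\<i> * complex_of_real (?z \<bullet> \<xi>)))) * (complex_of_real (e ^ CARD('n)) * inv_fourier (\<lambda>\<eta>. f (\<xi> + e *\<^sub>R \<eta>)) y)"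
    by (simp only: ac_simps)
  also have "exp (\<i> * complex_of_real (?z \<bullet> \<xi>)) * exp (- (\<i> * complex_of_real (?z \<bullet> \<xi>))) = 1"
    unfolding exp_add[symmetric] by simp
  finally show ?thesis using e by simp
qed

text \<open>
  Zooming in at a frequency multiplies all \<open>L\<^sup>p\<close> norms by the same factor, so inequalities between
  them are scale invariant. The value of the factor cancels later.
\<close>

lemma inv_fourier_affine_lpn:
  fixes f :: "real ^ 'n \<Rightarrow> complex"
  assumes p: "1 \<le> p" and e: "0 < e"
  shows "\<exists>\<kappa>>0. \<forall>f :: real ^ 'n \<Rightarrow> complex. f \<in> borel_measurable borel \<longrightarrow> lp p (inv_fourier f) \<longrightarrow>
    lp p (inv_fourier (\<lambda>\<eta>. f (\<xi> + e *\<^sub>R \<eta>))) \<and> lpn p (inv_fourier (\<lambda>\<eta>. f (\<xi> + e *\<^sub>R \<eta>))) = \<kappa> * lpn p (inv_fourier f)"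
proof (intro exI conjI allI impI)
  let ?\<kappa> = "(1 / e ^ CARD('n)) * (1 / (1 / e) ^ CARD('n)) powr (1 / p)"
  show "0 < ?\<kappa>" using e by simp
  fix f :: "real ^ 'n \<Rightarrow> complex"
  assume f: "f \<in> borel_measurable borel" and l: "lp p (inv_fourier f)"
  let ?H = "\<lambda>y. (1 / e ^ CARD('n)) *\<^sub>R inv_fourier f ((1 / e) *\<^sub>R y)"
  have p0: "0 < p" and e': "0 < 1 / e" using p e by auto
  note d = lpn_dilation[OF p0 l e']
  note H = lp_scaleR[OF p0 d(1), of "1 / e ^ CARD('n)"]
  have n: "norm (inv_fourier (\<lambda>\<eta>. f (\<xi> + e *\<^sub>R \<eta>)) y) = norm (?H y)" for y
    unfolding inv_fourier_affine[OF f e] norm_mult norm_of_real norm_scaleR by simp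
  have m: "inv_fourier (\<lambda>\<eta>. f (\<xi> + e *\<^sub>R \<eta>)) \<in> borel_measurable borel"
    by (rule inv_fourier_measurable, rule measurable_compose[OF _ f]) simp
  show "lp p (inv_fourier (\<lambda>\<eta>. f (\<xi> + e *\<^sub>R \<eta>)))"
    using H(1) m unfolding lp_def n by blast
  have "lpn p (inv_fourier (\<lambda>\<eta>. f (\<xi> + e *\<^sub>R \<eta>))) = lpn p ?H" unfolding lpn_def n ..
  also have "\<dots> = ?\<kappa> * lpn p (inv_fourier f)" unfolding H(2) d(2) using e by simp
  finally show "lpn p (inv_fourier (\<lambda>\<eta>. f (\<xi> + e *\<^sub>R \<eta>))) = ?\<kappa> * lpn p (inv_fourier f)" .
qed

text \<open>By inversion, a vanishing norm would force the cutoff to vanish.\<close>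

lemma lpn_inv_fourier_cutoff_pos: assumes p: "1 \<le> p" shows "0 < lpn p (inv_fourier (cutoff :: real ^ 'n \<Rightarrow> complex))"
proof (rule ccontr)
  let ?c = "cutoff :: real ^ 'n \<Rightarrow> complex"
  assume "\<not> ?thesis"
  then have "lpn p (inv_fourier ?c) = 0" by (simp add: not_less antisym)
  then have "AE x in lborel. inv_fourier ?c x = 0" using lpn_eq_0[OF _ testfun_lp[OF p testfun_cutoff]] p by simp
  then have "(\<integral>x. inv_fourier ?c x \<partial>lborel) = 0" by (rule integral_eq_zero_AE)
  then have "fourier (inv_fourier ?c) 0 = 0" by (simp add: fourier_alt)
  then have "?c 0 = 0" by (simp only: schwartz_fourier_inv(1)[OF testfun_schwartz[OF testfun_cutoff]])
  then show False by (simp add: cutoff_0)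
qed

text \<open>
  A multiplier is bounded by its norm on \<open>L\<^sup>p\<close>: tested on functions whose Fourier transform is
  concentrated near \<open>\<xi>\<close>, the operator is close to the multiplication by \<open>m \<xi>\<close>. Rescaling changes both
  sides by the same factor.
\<close>

lemma multiplier_pointwise_bound:
  fixes m :: "real ^ 'n \<Rightarrow> complex"
  assumes p: "1 \<le> p" and cont: "continuous_on UNIV m"
    and l: "\<And>\<psi>. testfun \<psi> \<Longrightarrow> lp p (inv_fourier (\<lambda>\<xi>. m \<xi> * \<psi> \<xi>))"
    and bd: "\<And>\<psi>. testfun \<psi> \<Longrightarrow> lpn p (inv_fourier (\<lambda>\<xi>. m \<xi> * \<psi> \<xi>)) \<le> C * lpn p (inv_fourier \<psi>)"
  shows "norm (m \<xi>) \<le> C"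
proof -
  let ?c = "cutoff :: real ^ 'n \<Rightarrow> complex"
  define e where "e k = 1 / real (Suc k)" for k
  have e: "0 < e k" "e k \<le> 1" for k by (auto simp: e_def)
  have e0: "e \<longlonglongrightarrow> 0" unfolding e_def using LIMSEQ_inverse_real_of_nat by (simp add: inverse_eq_divide)
  have p0: "0 < p" using p by simp
  have tc: "testfun ?c" by (rule testfun_cutoff)
  have mm: "m \<in> borel_measurable borel" by (rule borel_measurable_continuous_onI[OF cont])
  have mc: "?c \<in> borel_measurable borel" by (rule schwartz_measurable[OF testfun_schwartz[OF tc]])
  define F where "F k = inv_fourier (\<lambda>\<eta>. m (\<xi> + e k *\<^sub>R \<eta>) * ?c \<eta>)" for k
  have F: "lp p (F k) \<and> lpn p (F k) \<le> C * lpn p (inv_fourier ?c)" for k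
  proof -
    \<comment> \<open>A bump at \<open>\<xi>\<close> of width \<open>e k\<close>, which the affine substitution turns into the fixed bump \<open>?c\<close>.\<close>
    define \<psi> where "\<psi> x = ?c ((1 / e k) *\<^sub>R (x - \<xi>))" for x
    have sub: "\<psi> (\<xi> + e k *\<^sub>R \<eta>) = ?c \<eta>" for \<eta> using e(1)[of k] by (simp add: \<psi>_def)
    have t: "testfun \<psi>"
    proof -
      have s: "smooth (\<lambda>x. ?c ((1 / e k) *\<^sub>R x))" by (rule smooth_dilation[OF smooth_cutoff])
      have "smooth \<psi>" unfolding \<psi>_def using smooth_translation[OF s, of "- \<xi>"] by simp
      moreover have "\<psi> x = 0" if "norm x > norm \<xi> + e k" for x
      proof -
        have "e k \<le> norm (x - \<xi>)" using that norm_triangle_ineq2[of x \<xi>] by linarith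
        then have "1 \<le> norm ((1 / e k) *\<^sub>R (x - \<xi>))" unfolding norm_scaleR using e(1)[of k] by simp
        then show ?thesis unfolding \<psi>_def by (rule cutoff_eq_0)
      qed
      ultimately show ?thesis unfolding testfun_def by blast
    qed
    obtain \<kappa> where \<kappa>: "0 < \<kappa>" "\<And>f :: real ^ 'n \<Rightarrow> complex. f \<in> borel_measurable borel \<Longrightarrow> lp p (inv_fourier f) \<Longrightarrow>
       lp p (inv_fourier (\<lambda>\<eta>. f (\<xi> + e k *\<^sub>R \<eta>))) \<and> lpn p (inv_fourier (\<lambda>\<eta>. f (\<xi> + e k *\<^sub>R \<eta>))) = \<kappa> * lpn p (inv_fourier f)"
      using inv_fourier_affine_lpn[OF p e(1)[of k], of \<xi>] by blast
    have m\<psi>: "\<psi> \<in> borel_measurable borel" by (rule schwartz_measurable[OF testfun_schwartz[OF t]])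
    have 1: "lp p (F k) \<and> lpn p (F k) = \<kappa> * lpn p (inv_fourier (\<lambda>\<xi>. m \<xi> * \<psi> \<xi>))"
      using \<kappa>(2)[OF borel_measurable_times[OF mm m\<psi>] l[OF t]] by (simp add: sub F_def)
    have 2: "lpn p (inv_fourier ?c) = \<kappa> * lpn p (inv_fourier \<psi>)"
      using \<kappa>(2)[OF m\<psi> testfun_lp[OF p t]] by (simp add: sub)
    have "\<kappa> * lpn p (inv_fourier (\<lambda>\<xi>. m \<xi> * \<psi> \<xi>)) \<le> \<kappa> * (C * lpn p (inv_fourier \<psi>))"
      using \<kappa>(1) bd[OF t] by simp
    then show ?thesis using 1 2 by (simp add: ac_simps)
  qed
  obtain M where M: "\<And>y. norm (y - \<xi>) \<le> 1 \<Longrightarrow> norm (m y) \<le> M"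
  proof -
    have "compact (m ` cball \<xi> 1)" by (rule compact_continuous_image[OF continuous_on_subset[OF cont]]) auto
    then have "bounded (m ` cball \<xi> 1)" by (rule compact_imp_bounded)
    then obtain M where M: "\<forall>z\<in>m ` cball \<xi> 1. norm z \<le> M" unfolding bounded_iff by blast
    have "norm (m y) \<le> M" if "norm (y - \<xi>) \<le> 1" for y
      using that by (intro M[rule_format] imageI) (simp add: dist_norm norm_minus_commute)
    then show ?thesis using that[of M] by blast
  qed
  have lim: "(\<lambda>k. F k x) \<longlonglongrightarrow> inv_fourier (\<lambda>\<eta>. m \<xi> * ?c \<eta>) x" for x
    unfolding F_def
  proof (rule inv_fourier_limit[where w="\<lambda>\<eta>. M * norm (?c \<eta>)"])
    show "(\<lambda>\<eta>. m (\<xi> + e k *\<^sub>R \<eta>) * ?c \<eta>) \<in> borel_measurable borel" for k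
      by (rule borel_measurable_times[OF measurable_compose[OF _ mm] mc]) simp
    show "(\<lambda>\<eta>. m \<xi> * ?c \<eta>) \<in> borel_measurable borel" using mc by simp
    show "integrable lborel (\<lambda>\<eta>. M * norm (?c \<eta>))"
      using integrable_norm[OF testfun_fourier_integrable[OF tc]] by simp
    show "norm (m (\<xi> + e k *\<^sub>R \<eta>) * ?c \<eta>) \<le> M * norm (?c \<eta>)" for k \<eta>
    proof (cases "norm \<eta> \<ge> 1")
      case False
      have "norm (e k *\<^sub>R \<eta>) \<le> 1 * 1" unfolding norm_scaleR using e[of k] False by (intro mult_mono) auto
      then have "norm (m (\<xi> + e k *\<^sub>R \<eta>)) \<le> M" by (intro M) simp
      then show ?thesis by (simp add: norm_mult mult_right_mono)
    qed (simp add: cutoff_eq_0)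
    show "(\<lambda>k. m (\<xi> + e k *\<^sub>R \<eta>) * ?c \<eta>) \<longlonglongrightarrow> m \<xi> * ?c \<eta>" for \<eta>
    proof (rule tendsto_mult[OF _ tendsto_const])
      have "(\<lambda>k. \<xi> + e k *\<^sub>R \<eta>) \<longlonglongrightarrow> \<xi> + 0 *\<^sub>R \<eta>" by (intro tendsto_intros e0)
      moreover have "isCont m \<xi>" using cont by (simp add: continuous_on_eq_continuous_at)
      ultimately show "(\<lambda>k. m (\<xi> + e k *\<^sub>R \<eta>)) \<longlonglongrightarrow> m \<xi>" using isCont_tendsto_compose[of \<xi> m "\<lambda>k. \<xi> + e k *\<^sub>R \<eta>" sequentially] by simp
    qed
  qed
  have mI: "inv_fourier (\<lambda>\<eta>. m \<xi> * ?c \<eta>) \<in> borel_measurable borel"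
    by (rule inv_fourier_measurable) (use mc in simp)
  have "lpn p (inv_fourier (\<lambda>\<eta>. m \<xi> * ?c \<eta>)) \<le> C * lpn p (inv_fourier ?c)"
    using lp_fatou(2)[OF p0 F[THEN conjunct1] F[THEN conjunct2] mI AE_I2[OF lim]] .
  moreover have "lpn p (inv_fourier (\<lambda>\<eta>. m \<xi> * ?c \<eta>)) = norm (m \<xi>) * lpn p (inv_fourier ?c)"
  proof -
    have "lpn p (inv_fourier (\<lambda>\<eta>. m \<xi> * ?c \<eta>)) = lpn p (\<lambda>x. norm (m \<xi>) *\<^sub>R inv_fourier ?c x)"
      unfolding lpn_def by (simp add: inv_fourier_mult[abs_def] norm_mult)
    then show ?thesis using lp_scaleR(2)[OF p0 testfun_lp[OF p tc], of "norm (m \<xi>)"] by simp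
  qed
  ultimately show ?thesis using lpn_inv_fourier_cutoff_pos[OF p, where 'n='n] by simp
qed

text \<open>
  The factor \<open>cutoff (e \<xi>) - 1\<close> costs one power of \<open>\<xi>\<close> and gains \<open>e\<close>, with all derivatives; the Schwartz
  function pays for the power, and smoothness gives the decay in \<open>x\<close>.
\<close>

lemma fourier_cutoff_approx:
  fixes \<phi> :: "real ^ 'n \<Rightarrow> complex"
  assumes \<phi>: "\<phi> \<in> schwartz"
  shows "\<exists>K\<ge>0. \<forall>e x. 0 \<le> e \<longrightarrow> e \<le> 1 \<longrightarrow>
    norm (fourier (\<lambda>\<xi>. \<phi> \<xi> * cutoff (e *\<^sub>R \<xi>)) x - fourier \<phi> x) \<le> K * e * wt x"
proof -
  let ?m = "2 * CARD('n)"
  obtain A where A: "0 \<le> A" "\<And>e. 0 \<le> e \<Longrightarrow> e \<le> 1 \<Longrightarrow> dbound ?m (\<lambda>x. A * e * (1 + norm x)) (\<lambda>x :: real ^ 'n. cutoff (e *\<^sub>R x) + - 1)"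
    using cutoff_dbound[of ?m] by blast
  obtain B where B: "0 \<le> B" "dbound ?m (\<lambda>x. B * (1 / (1 + norm x) ^ Suc ?m)) \<phi>" using schwartz_dbound[OF \<phi>] by blast
  obtain K where K: "K \<ge> 0" "\<And>(\<phi> :: real ^ 'n \<Rightarrow> complex) C \<xi>. smooth \<phi> \<Longrightarrow> dbound ?m (\<lambda>x. C * wt x) \<phi> \<Longrightarrow>
     norm (fourier \<phi> \<xi>) * (1 + norm \<xi>) ^ ?m \<le> K * C" using fourier_decay[of ?m] by blast
  have "norm (fourier (\<lambda>\<xi>. \<phi> \<xi> * cutoff (e *\<^sub>R \<xi>)) x - fourier \<phi> x) \<le> (K * (2 ^ ?m * A * B)) * e * wt x"
    if e: "0 \<le> e" "e \<le> 1" for e and x :: "real ^ 'n"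
  proof -
    let ?D = "\<lambda>\<xi> :: real ^ 'n. (cutoff (e *\<^sub>R \<xi>) + - 1) * \<phi> \<xi>"
    have s: "smooth (\<lambda>\<xi> :: real ^ 'n. cutoff (e *\<^sub>R \<xi>) + - 1)"
      by (rule smooth_add[OF smooth_dilation[OF smooth_cutoff] smooth_const])
    have "dbound ?m (\<lambda>x. 2 ^ ?m * ((A * e * (1 + norm x)) * (B * (1 / (1 + norm x) ^ Suc ?m)))) ?D"
      by (rule dbound_mult[OF s schwartz_smooth[OF \<phi>] A(2)[OF e] B(2)])
    then have db: "dbound ?m (\<lambda>x. (2 ^ ?m * A * B * e) * wt x) ?D"
    proof (rule dbound_weaken)
      fix x :: "real ^ 'n"
      have "(1 + norm x) * (1 / (1 + norm x) ^ Suc ?m) = wt x"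
        using add_pos_nonneg[OF zero_less_one norm_ge_zero[of x]] unfolding wt_def power_Suc by (simp add: divide_simps)
      moreover have "2 ^ ?m * ((A * e * (1 + norm x)) * (B * (1 / (1 + norm x) ^ Suc ?m))) =
          (2 ^ ?m * A * B * e) * ((1 + norm x) * (1 / (1 + norm x) ^ Suc ?m))" by (simp only: ac_simps)
      ultimately have "2 ^ ?m * ((A * e * (1 + norm x)) * (B * (1 / (1 + norm x) ^ Suc ?m))) = (2 ^ ?m * A * B * e) * wt x"
        by simp
      then show "2 ^ ?m * ((A * e * (1 + norm x)) * (B * (1 / (1 + norm x) ^ Suc ?m))) \<le> (2 ^ ?m * A * B * e) * wt x" by simp
    qed
    have sD: "smooth ?D" by (rule smooth_mult[OF s schwartz_smooth[OF \<phi>]])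
    have iD: "integrable lborel ?D"
      by (rule integrable_wt_bound[OF smooth_measurable[OF sD] dbound_value[OF db]])
    have "(\<lambda>\<xi>. \<phi> \<xi> * cutoff (e *\<^sub>R \<xi>)) = (\<lambda>\<xi>. ?D \<xi> + \<phi> \<xi>)" by (simp add: algebra_simps)
    then have "fourier (\<lambda>\<xi>. \<phi> \<xi> * cutoff (e *\<^sub>R \<xi>)) x - fourier \<phi> x = fourier ?D x"
      by (simp only: fourier_add[OF iD schwartz_integrable[OF \<phi>]] add_diff_cancel_right')
    moreover have "norm (fourier ?D x) * (1 + norm x) ^ ?m \<le> K * (2 ^ ?m * A * B * e)" by (rule K(2)[OF sD db])
    then have "norm (fourier ?D x) \<le> (K * (2 ^ ?m * A * B * e)) * wt x"
      using add_pos_nonneg[OF zero_less_one norm_ge_zero[of x]] unfolding wt_def by (simp add: pos_le_divide_eq)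
    ultimately show ?thesis by (simp only: ac_simps)
  qed
  moreover have "0 \<le> K * (2 ^ ?m * A * B)" using K A B by simp
  ultimately show ?thesis by blast
qed

lemma fourier_cong_AE:
  fixes f g :: "real ^ 'n \<Rightarrow> complex"
  assumes "f \<in> borel_measurable borel" "g \<in> borel_measurable borel" "AE x in lborel. f x = g x"
  shows "fourier f \<xi> = fourier g \<xi>"
proof -
  note [measurable] = assms(1,2)
  show ?thesis
    unfolding fourier_alt by (intro arg_cong[where f="\<lambda>z. _ * z"] integral_cong_AE) (use assms(3) in auto)
qed

section \<open>Multipliers as bounded operators\<close>

context conjugate
begin

lemma class_of_schwartz:
  fixes u :: "real ^ 'n \<Rightarrow> complex ^ 'N"
  assumes "u \<in> schwartz" shows "class_of u \<in> Lp p"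
  using class_of_Lp[OF p_ge(2) schwartz_measurable[OF assms]] schwartz_vec_lp[OF assms] by simp

lemma op_fun_entry_integrable:
  fixes m :: "real ^ 'n \<Rightarrow> complex ^ 'N ^ 'N" and u :: "real ^ 'n \<Rightarrow> complex ^ 'N"
  assumes m: "m \<in> borel_measurable borel" "AE \<xi> in lborel. norm (m \<xi>) \<le> K" and u: "u \<in> schwartz"
  shows "integrable lborel (\<lambda>\<xi>. (m \<xi> *v fourier_vec u \<xi>) $ i)"
  unfolding matrix_vector_mult_def fourier_vec_def vec_lambda_beta
proof (rule Bochner_Integration.integrable_sum)
  fix j
  have uj: "(\<lambda>x. u x $ j) \<in> schwartz" using u schwartz_vec_iff by blast
  note F = schwartz_fourier[OF uj]
  have mij: "(\<lambda>\<xi>. m \<xi> $ i $ j) \<in> borel_measurable borel"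
  proof -
    have "(\<lambda>A :: complex ^ 'N ^ 'N. A $ i $ j) \<in> borel_measurable borel"
      by (intro borel_measurable_continuous_onI continuous_intros)
    from measurable_compose[OF m(1) this] show ?thesis .
  qed
  show "integrable lborel (\<lambda>\<xi>. m \<xi> $ i $ j * fourier (\<lambda>x. u x $ j) \<xi>)"
  proof (rule Bochner_Integration.integrable_bound)
    show "integrable lborel (\<lambda>\<xi>. K * norm (fourier (\<lambda>x. u x $ j) \<xi>))"
      using integrable_norm[OF schwartz_integrable[OF F]] by simp
    show "(\<lambda>\<xi>. m \<xi> $ i $ j * fourier (\<lambda>x. u x $ j) \<xi>) \<in> borel_measurable lborel"
      using borel_measurable_times[OF mij schwartz_measurable[OF F]] by simp
    show "AE \<xi> in lborel. norm (m \<xi> $ i $ j * fourier (\<lambda>x. u x $ j) \<xi>) \<le> norm (K * norm (fourier (\<lambda>x. u x $ j) \<xi>))"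
      using m(2)
    proof eventually_elim
      case (elim \<xi>)
      have "norm (m \<xi> $ i $ j) \<le> \<bar>K\<bar>"
        using Finite_Cartesian_Product.norm_nth_le[of "m \<xi> $ i" j] Finite_Cartesian_Product.norm_nth_le[of "m \<xi>" i] elim by linarith
      then show ?case by (simp add: norm_mult abs_mult mult_right_mono)
    qed
  qed
qed

lemma op_fun_measurable:
  fixes m :: "real ^ 'n \<Rightarrow> complex ^ 'N ^ 'N" and u :: "real ^ 'n \<Rightarrow> complex ^ 'N"
  assumes m: "m \<in> borel_measurable borel" "AE \<xi> in lborel. norm (m \<xi>) \<le> K" and u: "u \<in> schwartz"
  shows "op_fun m u \<in> borel_measurable borel"
proof (rule measurable_vecI)
  fix i
  have "(\<lambda>\<xi>. (m \<xi> *v fourier_vec u \<xi>) $ i) \<in> borel_measurable borel"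
    using borel_measurable_integrable[OF op_fun_entry_integrable[OF assms]] by simp
  then show "(\<lambda>x. op_fun m u x $ i) \<in> borel_measurable borel"
    unfolding op_fun_def inv_fourier_vec_def vec_lambda_beta by (rule inv_fourier_measurable)
qed

lemma op_fun_add:
  fixes m :: "real ^ 'n \<Rightarrow> complex ^ 'N ^ 'N" and u v :: "real ^ 'n \<Rightarrow> complex ^ 'N"
  assumes m: "m \<in> borel_measurable borel" "AE \<xi> in lborel. norm (m \<xi>) \<le> K" and u: "u \<in> schwartz" and v: "v \<in> schwartz"
  shows "op_fun m (\<lambda>x. u x + v x) x = op_fun m u x + op_fun m v x"
proof -
  have i: "integrable lborel (\<lambda>x. w x $ j)" if "w \<in> schwartz" for w :: "real ^ 'n \<Rightarrow> complex ^ 'N" and j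
    using that schwartz_vec_iff schwartz_integrable by blast
  have "fourier_vec (\<lambda>x. u x + v x) = (\<lambda>\<xi>. fourier_vec u \<xi> + fourier_vec v \<xi>)"
    by (simp add: fun_eq_iff vec_eq_iff fourier_vec_def fourier_add[OF i[OF u] i[OF v]])
  then show ?thesis
    using inv_fourier_add[OF op_fun_entry_integrable[OF m u] op_fun_entry_integrable[OF m v]]
    by (simp add: op_fun_def inv_fourier_vec_def vec_eq_iff matrix_vector_right_distrib)
qed

lemma op_fun_scaleR: "op_fun m (\<lambda>x. c *\<^sub>R u x) x = c *\<^sub>R op_fun m u x"
  for m :: "real ^ 'n \<Rightarrow> complex ^ 'N ^ 'N"
proof -
  have "fourier_vec (\<lambda>x. c *\<^sub>R u x) \<xi> $ j = complex_of_real c * fourier_vec u \<xi> $ j" for \<xi> j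
    by (simp add: fourier_vec_def scaleR_conv_of_real[where 'a=complex] fourier_mult)
  then have "(m \<xi> *v fourier_vec (\<lambda>x. c *\<^sub>R u x) \<xi>) $ i = complex_of_real c * (m \<xi> *v fourier_vec u \<xi>) $ i" for \<xi> i
    by (simp add: matrix_vector_mult_def sum_distrib_left ac_simps)
  then show ?thesis
    by (simp add: op_fun_def inv_fourier_vec_def vec_eq_iff inv_fourier_mult scaleR_conv_of_real[where 'a=complex])
qed

text \<open>
  The Schwartz functions are dense, so the operator on their classes has a bounded extension, and
  the choice in the definition of \<open>multiplier_op\<close> is one of them.
\<close>

lemma multiplier_op_extends:
  fixes m :: "real ^ 'n \<Rightarrow> complex ^ 'N ^ 'N"
  assumes "m \<in> multipliers p"
  shows "bounded_operator (Lp p) (Lp_norm p) (multiplier_op p m)"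
    and "u \<in> schwartz \<Longrightarrow> multiplier_op p m (class_of u) = class_of (op_fun m u)"
proof -
  interpret X: banach_carrier "Lp p :: (real ^ 'n, complex ^ 'N) ae_class set" "Lp_norm p"
    by (rule Lp_banach_carrier[OF p_ge(1)])
  obtain K c where m: "m \<in> borel_measurable borel" "AE \<xi> in lborel. norm (m \<xi>) \<le> K" and c: "0 < c"
    "\<And>u. u \<in> schwartz \<Longrightarrow> class_of (op_fun m u) \<in> Lp p \<and> Lp_norm p (class_of (op_fun m u)) \<le> c * Lp_norm p (class_of u)"
    using assms unfolding multipliers_def by auto
  let ?V = "class_of ` (schwartz :: (real ^ 'n \<Rightarrow> complex ^ 'N) set)"
  \<comment> \<open>\<open>op_fun\<close> only depends on the class of its argument, so any representative will do.\<close>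
  define B0 :: "(real ^ 'n, complex ^ 'N) ae_class \<Rightarrow> (real ^ 'n, complex ^ 'N) ae_class"
    where "B0 v = class_of (op_fun m (rep_ae_class v))" for v
  have B0: "B0 (class_of u) = class_of (op_fun m u)" if u: "u \<in> schwartz" for u
  proof -
    note mu = schwartz_measurable[OF u]
    have "fourier (\<lambda>x. rep_ae_class (class_of u) x $ j) \<xi> = fourier (\<lambda>x. u x $ j) \<xi>" for j \<xi>
      by (rule fourier_cong_AE[OF measurable_vec_nth[OF rep_measurable] measurable_vec_nth[OF mu]])
         (use rep_class_of[OF mu] in auto)
    then have "fourier_vec (rep_ae_class (class_of u)) = fourier_vec u" by (simp add: fourier_vec_def fun_eq_iff)
    then show ?thesis by (simp add: B0_def op_fun_def)
  qed
  have sV: "subspace ?V"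
    unfolding subspace_def
  proof (intro conjI ballI allI)
    show "0 \<in> ?V" using schwartz_zero class_of_zero by (metis imageI)
    fix x assume "x \<in> ?V"
    then obtain u where u: "u \<in> schwartz" "x = class_of u" by blast
    fix c :: real
    have "(\<lambda>x. c *\<^sub>R u x) \<in> schwartz" by (rule schwartz_linear[OF bounded_linear_scaleR_right u(1)])
    then show "c *\<^sub>R x \<in> ?V" unfolding u(2) class_of_scaleR[OF schwartz_measurable[OF u(1)]] by blast
  next
    fix x y assume "x \<in> ?V" "y \<in> ?V"
    then obtain u v where u: "u \<in> schwartz" "x = class_of u" and v: "v \<in> schwartz" "y = class_of v" by blast
    show "x + y \<in> ?V"
      unfolding u(2) v(2) class_of_add[OF schwartz_measurable[OF u(1)] schwartz_measurable[OF v(1)]]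
      using schwartz_add[OF u(1) v(1)] by blast
  qed
  have VX: "?V \<subseteq> Lp p" using class_of_schwartz by blast
  have "\<exists>B. bounded_operator (Lp p) (Lp_norm p) B \<and> (\<forall>v\<in>?V. B v = B0 v)"
  proof (rule X.bounded_extension[OF sV VX, where K=c])
    show "\<exists>v\<in>?V. Lp_norm p (v - x) < e" if "x \<in> Lp p" "0 < e" for x e
      using testvec_dense[OF that] testvec_schwartz by blast
    show "0 \<le> c" using c(1) by simp
    show "B0 v \<in> Lp p" "Lp_norm p (B0 v) \<le> c * Lp_norm p v" if "v \<in> ?V" for v
      using that c(2) by (auto simp: B0)
    show "B0 (v + w) = B0 v + B0 w" if vw: "v \<in> ?V" "w \<in> ?V" for v w
    proof -
      obtain u u' where u: "u \<in> schwartz" "v = class_of u" and u': "u' \<in> schwartz" "w = class_of u'" using vw by blast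
      have "B0 (v + w) = class_of (op_fun m (\<lambda>x. u x + u' x))"
        unfolding u(2) u'(2) class_of_add[OF schwartz_measurable[OF u(1)] schwartz_measurable[OF u'(1)]]
        by (rule B0[OF schwartz_add[OF u(1) u'(1)]])
      also have "\<dots> = class_of (\<lambda>x. op_fun m u x + op_fun m u' x)"
        using op_fun_add[OF m u(1) u'(1)] by presburger
      also have "\<dots> = B0 v + B0 w"
        unfolding u(2) u'(2) B0[OF u(1)] B0[OF u'(1)]
        by (rule class_of_add[OF op_fun_measurable[OF m u(1)] op_fun_measurable[OF m u'(1)], symmetric])
      finally show ?thesis .
    qed
    show "B0 (r *\<^sub>R v) = r *\<^sub>R B0 v" if v: "v \<in> ?V" for r v
    proof -
      obtain u where u: "u \<in> schwartz" "v = class_of u" using v by blast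
      have "B0 (r *\<^sub>R v) = class_of (op_fun m (\<lambda>x. r *\<^sub>R u x))"
        unfolding u(2) class_of_scaleR[OF schwartz_measurable[OF u(1)]]
        by (rule B0[OF schwartz_linear[OF bounded_linear_scaleR_right u(1)]])
      also have "\<dots> = class_of (\<lambda>x. r *\<^sub>R op_fun m u x)" unfolding op_fun_scaleR ..
      also have "\<dots> = r *\<^sub>R B0 v"
        unfolding u(2) B0[OF u(1)] by (rule class_of_scaleR[OF op_fun_measurable[OF m u(1)], symmetric])
      finally show ?thesis .
    qed
  qed
  then have "\<exists>B. bounded_operator (Lp p) (Lp_norm p) B \<and> (\<forall>u\<in>schwartz. B (class_of u) = class_of (op_fun m u))"
    using B0 by auto
  from someI_ex[OF this]
  show "bounded_operator (Lp p) (Lp_norm p) (multiplier_op p m)"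
    and "u \<in> schwartz \<Longrightarrow> multiplier_op p m (class_of u) = class_of (op_fun m u)"
    unfolding multiplier_op_def by blast+
qed

end

context lp_symbol
begin

lemma sol_lp: "testvec g \<Longrightarrow> lp p (sol t g)"
  unfolding sol_def by (intro nice_vec_lp aexp_vec_nice)

context
  fixes t C :: real
  assumes C: "0 < C" and bd: "\<And>g. testvec g \<Longrightarrow> lpn p (sol t g) \<le> C * lpn p (inv_fourier_vec g)"
begin

text \<open>
  The entry \<open>(i, j)\<close> is seen by testing with vectors whose only nonzero component is the \<open>j\<close>-th.
\<close>

lemma aexp_entry_bound: "norm (aexp t \<xi> $ i $ j) \<le> C"
proof (rule multiplier_pointwise_bound[OF p_ge(1) aexp_continuous])
  fix \<psi> :: "real ^ 'n \<Rightarrow> complex" assume \<psi>: "testfun \<psi>"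
  show l: "lp p (inv_fourier (\<lambda>\<xi>. aexp t \<xi> $ i $ j * \<psi> \<xi>))" by (rule nice_lp[OF p_ge(1) aexp_nice[OF \<psi>]])
  define g :: "real ^ 'n \<Rightarrow> complex ^ 'N" where "g \<xi> = (\<chi> l. if l = j then \<psi> \<xi> else 0)" for \<xi>
  have "testfun (\<lambda>\<xi>. g \<xi> $ l)" for l by (cases "l = j") (simp_all add: g_def \<psi> testfun_const0)
  then have g: "testvec g" by (simp add: testvec_def)
  have s: "sol t g x $ i = inv_fourier (\<lambda>\<xi>. aexp t \<xi> $ i $ j * \<psi> \<xi>) x" for x
    by (simp add: sol_def inv_fourier_vec_def matrix_vector_mult_def g_def if_distrib[of "\<lambda>z. _ * z"] cong: if_cong)
  have z: "inv_fourier_vec g x = (\<chi> l. if l = j then inv_fourier \<psi> x else 0)" for x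
    using inv_fourier_mult[of 0 "\<lambda>\<xi>. 0" x] by (simp add: inv_fourier_vec_def g_def vec_eq_iff)
  have lg: "lp p (inv_fourier_vec g)" by (rule schwartz_vec_lp[OF testvec_schwartz[OF g]])
  have "lpn p (inv_fourier (\<lambda>\<xi>. aexp t \<xi> $ i $ j * \<psi> \<xi>)) \<le> lpn p (sol t g)"
    using lp_vec(3)[OF p_ge(1) sol_lp[OF g], of t i] by (simp add: s)
  also have "\<dots> \<le> C * lpn p (inv_fourier_vec g)" by (rule bd[OF g])
  also have "lpn p (inv_fourier_vec g) \<le> (\<Sum>l\<in>UNIV. lpn p (\<lambda>x. inv_fourier_vec g x $ l))"
    using lg lp_vec(1)[OF p_ge(1)] by (intro lp_vec(2)[OF p_ge(1)]) blast
  also have "\<dots> = (\<Sum>l\<in>UNIV. if l = j then lpn p (inv_fourier \<psi>) else 0)"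
    by (intro sum.cong refl) (simp add: z)
  also have "\<dots> = lpn p (inv_fourier \<psi>)" by simp
  finally show "lpn p (inv_fourier (\<lambda>\<xi>. aexp t \<xi> $ i $ j * \<psi> \<xi>)) \<le> C * lpn p (inv_fourier \<psi>)"
    using C by simp
qed

lemma aexp_bounded: "norm (aexp t \<xi>) \<le> real CARD('N) * (real CARD('N) * C)"
proof -
  have "norm (aexp t \<xi>) \<le> msum (aexp t \<xi>)" by (rule norm_le_entries)
  also have "\<dots> \<le> (\<Sum>i\<in>(UNIV :: 'N set). \<Sum>j\<in>(UNIV :: 'N set). C)" unfolding msum_def by (intro sum_mono aexp_entry_bound)
  finally show ?thesis by simp
qed

lemma aexp_measurable: "aexp t \<in> borel_measurable borel"
proof (rule borel_measurable_continuous_onI)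
  have "continuous_on UNIV (\<lambda>\<xi>. \<chi> i j. aexp t \<xi> $ i $ j)" by (intro continuous_on_vec_lambda aexp_continuous)
  then show "continuous_on UNIV (aexp t)" by simp
qed

text \<open>
  From band-limited to Schwartz functions: cutting off the frequencies converges in \<open>L\<^sup>p\<close>, while the
  images converge pointwise, so that Fatou's lemma applies.
\<close>

lemma op_fun_aexp_bound:
  assumes u: "u \<in> schwartz"
  shows "lp p (op_fun (aexp t) u)" "lpn p (op_fun (aexp t) u) \<le> C * lpn p u"
proof -
  define e where "e k = 1 / real (Suc k)" for k
  have e: "0 < e k" "e k \<le> 1" for k by (auto simp: e_def)
  have e0: "e \<longlonglongrightarrow> 0" unfolding e_def using LIMSEQ_inverse_real_of_nat by (simp add: inverse_eq_divide)
  have uj: "(\<lambda>x. u x $ j) \<in> schwartz" for j using u schwartz_vec_iff by blast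
  define h where "h j = fourier (\<lambda>x. u x $ j)" for j
  have h: "h j \<in> schwartz" for j unfolding h_def by (rule schwartz_fourier[OF uj])
  have hu: "inv_fourier (h j) x = u x $ j" for j x unfolding h_def using schwartz_fourier_inv(2)[OF uj] by metis
  define g where "g k \<xi> = (\<chi> j. h j \<xi> * cutoff (e k *\<^sub>R \<xi>))" for k \<xi>
  have g: "testvec (g k)" for k
    unfolding testvec_def g_def
    using testfun_mult[OF testfun_dilation[OF testfun_cutoff e(1)] schwartz_smooth[OF h]] by simp
  have "\<forall>j. \<exists>K\<ge>0. \<forall>e x. 0 \<le> e \<longrightarrow> e \<le> 1 \<longrightarrow> norm (fourier (\<lambda>\<xi>. h j \<xi> * cutoff (e *\<^sub>R \<xi>)) x - fourier (h j) x) \<le> K * e * wt x"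
    using fourier_cutoff_approx[OF h] by blast
  from choice[OF this] obtain K where K: "\<And>j. 0 \<le> K j" "\<And>j e x. 0 \<le> e \<Longrightarrow> e \<le> 1 \<Longrightarrow>
    norm (fourier (\<lambda>\<xi>. h j \<xi> * cutoff (e *\<^sub>R \<xi>)) x - fourier (h j) x) \<le> K j * e * wt x" by blast
  define M where "M = (\<Sum>j\<in>UNIV. K j)"
  have "K j \<le> M" for j unfolding M_def by (rule member_le_sum) (use K in auto)
  then have M: "norm (inv_fourier_vec (g k) x $ j - u x $ j) \<le> (M * e k) * wt x" for j k x
  proof -
    have "norm (inv_fourier_vec (g k) x $ j - u x $ j) = norm (fourier (\<lambda>\<xi>. h j \<xi> * cutoff (e k *\<^sub>R \<xi>)) (- x) - fourier (h j) (- x))"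
      unfolding hu[symmetric] inv_fourier_vec_def g_def inv_fourier_minus by simp
    also have "\<dots> \<le> K j * e k * wt (- x)" using e[of k] by (intro K(2)) auto
    also have "\<dots> \<le> (M * e k) * wt x" unfolding wt_minus
      using \<open>K j \<le> M\<close> e[of k] by (intro mult_right_mono) auto
    finally show ?thesis .
  qed
  note lg = schwartz_vec_lp[OF testvec_schwartz[OF g]] and lu = schwartz_vec_lp[OF u]
  define W where "W = real CARD('N) * lpn p (wt :: real ^ 'n \<Rightarrow> real) * M"
  have W: "lpn p (inv_fourier_vec (g k)) \<le> lpn p u + W * e k" for k
  proof -
    note d = lp_diff[OF p_ge(1) lg[of k] lu]
    have "lpn p (\<lambda>x. inv_fourier_vec (g k) x - u x) = Lp_norm p (class_of (\<lambda>x. inv_fourier_vec (g k) x - u x))"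
      by (rule Lp_norm_class_of[OF p_ge(2) d(1), symmetric])
    also have "\<dots> \<le> (real CARD('N) * lpn p (wt :: real ^ 'n \<Rightarrow> real)) * (M * e k)"
      by (rule Lp_wt_bound(3)[OF lp_measurable[OF d(1)]]) (simp add: M)
    also have "\<dots> = W * e k" by (simp add: W_def)
    finally have "lpn p (\<lambda>x. inv_fourier_vec (g k) x - u x) \<le> W * e k" .
    moreover have "lpn p (inv_fourier_vec (g k)) \<le> lpn p u + lpn p (\<lambda>x. inv_fourier_vec (g k) x - u x)"
      using lp_add(2)[OF p_ge(1) lu d(1)] by simp
    ultimately show ?thesis by linarith
  qed
  obtain Q where Q: "\<And>x :: real ^ 'n. norm (cutoff x) \<le> Q" using schwartz_bounded[OF testfun_schwartz[OF testfun_cutoff]] by blast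
  have lim: "(\<lambda>k. sol t (g k) x) \<longlonglongrightarrow> op_fun (aexp t) u x" for x
  proof (rule vec_tendstoI)
    fix i
    let ?w = "\<lambda>\<xi>. \<Sum>j\<in>UNIV. C * (norm (h j \<xi>) * Q)"
    have "(\<lambda>k. inv_fourier (\<lambda>\<xi>. (aexp t \<xi> *v g k \<xi>) $ i) x) \<longlonglongrightarrow> inv_fourier (\<lambda>\<xi>. \<Sum>j\<in>UNIV. aexp t \<xi> $ i $ j * h j \<xi>) x"
    proof (rule inv_fourier_limit[where w="?w"])
      show "(\<lambda>\<xi>. (aexp t \<xi> *v g k \<xi>) $ i) \<in> borel_measurable borel" for k by (rule nice_measurable[OF aexp_vec_nice[OF g]])
      show "(\<lambda>\<xi>. \<Sum>j\<in>UNIV. aexp t \<xi> $ i $ j * h j \<xi>) \<in> borel_measurable borel"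
        by (intro borel_measurable_sum borel_measurable_times borel_measurable_continuous_onI[OF aexp_continuous] schwartz_measurable[OF h])
      show "integrable lborel ?w"
        using integrable_norm[OF schwartz_integrable[OF h]] by (intro Bochner_Integration.integrable_sum) simp
      show "norm ((aexp t \<xi> *v g k \<xi>) $ i) \<le> ?w \<xi>" for k \<xi>
        unfolding matrix_vector_mult_def g_def vec_lambda_beta
      proof (rule sum_norm_le)
        fix j
        show "norm (aexp t \<xi> $ i $ j * (h j \<xi> * cutoff (e k *\<^sub>R \<xi>))) \<le> C * (norm (h j \<xi>) * Q)"
          unfolding norm_mult using Q C by (intro mult_mono aexp_entry_bound) auto
      qed
      show "(\<lambda>k. (aexp t \<xi> *v g k \<xi>) $ i) \<longlonglongrightarrow> (\<Sum>j\<in>UNIV. aexp t \<xi> $ i $ j * h j \<xi>)" for \<xi>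
        unfolding matrix_vector_mult_def g_def vec_lambda_beta
      proof (rule tendsto_sum, rule tendsto_mult[OF tendsto_const])
        fix j
        have "(\<lambda>k. e k *\<^sub>R \<xi>) \<longlonglongrightarrow> 0 *\<^sub>R \<xi>" by (intro tendsto_intros e0)
        moreover have "isCont cutoff (0 :: real ^ 'n)"
          by (rule differentiable_imp_continuous_within[OF smooth_differentiable[OF smooth_cutoff]])
        ultimately have "(\<lambda>k. cutoff (e k *\<^sub>R \<xi>)) \<longlonglongrightarrow> 1"
          using isCont_tendsto_compose[of "0 :: real ^ 'n" cutoff "\<lambda>k. e k *\<^sub>R \<xi>" sequentially] by (simp add: cutoff_0)
        then have "(\<lambda>k. h j \<xi> * cutoff (e k *\<^sub>R \<xi>)) \<longlonglongrightarrow> h j \<xi> * 1" by (intro tendsto_mult tendsto_const)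
        then show "(\<lambda>k. h j \<xi> * cutoff (e k *\<^sub>R \<xi>)) \<longlonglongrightarrow> h j \<xi>" by simp
      qed
    qed
    then show "(\<lambda>k. sol t (g k) x $ i) \<longlonglongrightarrow> op_fun (aexp t) u x $ i"
      by (simp add: sol_def op_fun_def inv_fourier_vec_def fourier_vec_def matrix_vector_mult_def h_def)
  qed
  have mo: "op_fun (aexp t) u \<in> borel_measurable borel"
    by (rule op_fun_measurable[OF aexp_measurable AE_I2[OF aexp_bounded] u])
  have fat: "lp p (op_fun (aexp t) u) \<and> lpn p (op_fun (aexp t) u) \<le> C * (lpn p u + d)" if d: "0 < d" for d
  proof -
    have "(\<lambda>k. W * e k) \<longlonglongrightarrow> W * 0" by (intro tendsto_intros e0)
    then have "\<forall>\<^sub>F k in sequentially. W * e k < d" using d by (intro order_tendstoD(2)) auto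
    then obtain k0 where k0: "\<And>k. k0 \<le> k \<Longrightarrow> W * e k < d" unfolding eventually_sequentially by blast
    have b: "lpn p (sol t (g (k + k0))) \<le> C * (lpn p u + d)" for k
    proof -
      have "lpn p (sol t (g (k + k0))) \<le> C * lpn p (inv_fourier_vec (g (k + k0)))" by (rule bd[OF g])
      also have "\<dots> \<le> C * (lpn p u + d)" using W[of "k + k0"] k0[of "k + k0"] C by (intro mult_left_mono) auto
      finally show ?thesis .
    qed
    have l: "AE x in lborel. (\<lambda>k. sol t (g (k + k0)) x) \<longlonglongrightarrow> op_fun (aexp t) u x"
      by (intro AE_I2 LIMSEQ_ignore_initial_segment lim)
    show ?thesis using lp_fatou[OF p_ge(2) sol_lp[OF g] b mo l] by blast
  qed
  show "lp p (op_fun (aexp t) u)" using fat[of 1] by simp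
  show "lpn p (op_fun (aexp t) u) \<le> C * lpn p u"
  proof (rule field_le_epsilon)
    fix r :: real assume "0 < r"
    then show "lpn p (op_fun (aexp t) u) \<le> C * lpn p u + r"
      using fat[of "r / C"] C by (simp add: distrib_left)
  qed
qed

lemma aexp_multiplier: "aexp t \<in> multipliers p" "multiplier_norm p (aexp t) \<le> C"
proof -
  have b: "class_of (op_fun (aexp t) u) \<in> Lp p \<and> Lp_norm p (class_of (op_fun (aexp t) u)) \<le> C * Lp_norm p (class_of u)"
    if u: "u \<in> schwartz" for u
  proof
    note l = op_fun_aexp_bound(1)[OF u]
    show "class_of (op_fun (aexp t) u) \<in> Lp p" using class_of_Lp[OF p_ge(2) lp_measurable[OF l]] l by blast
    show "Lp_norm p (class_of (op_fun (aexp t) u)) \<le> C * Lp_norm p (class_of u)"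
      unfolding Lp_norm_class_of[OF p_ge(2) l] Lp_norm_class_of[OF p_ge(2) schwartz_vec_lp[OF u]]
      by (rule op_fun_aexp_bound(2)[OF u])
  qed
  show m: "aexp t \<in> multipliers p"
    unfolding multipliers_def
  proof (intro CollectI conjI)
    show "aexp t \<in> borel_measurable lborel" using aexp_measurable by simp
    show "\<exists>K. AE \<xi> in lborel. norm (aexp t \<xi>) \<le> K" using aexp_bounded by (intro exI AE_I2)
    show "\<exists>c>0. \<forall>u\<in>schwartz. class_of (op_fun (aexp t) u) \<in> Lp p \<and>
        Lp_norm p (class_of (op_fun (aexp t) u)) \<le> c * Lp_norm p (class_of u)"
      using C b by (intro exI[of _ C]) blast
  qed
  note B = multiplier_op_extends[OF m]
  let ?V = "class_of ` (schwartz :: (real ^ 'n \<Rightarrow> complex ^ 'N) set)"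
  show "multiplier_norm p (aexp t) \<le> C"
    unfolding multiplier_norm_def
  proof (rule X.operator_norm_le)
    fix x :: "(real ^ 'n, complex ^ 'N) ae_class" assume x: "x \<in> Lp p"
    show "Lp_norm p (multiplier_op p (aexp t) x) \<le> C * Lp_norm p x"
    proof (rule X.bound_on_dense[OF B(1) _ _ _ _ x, where V="?V"])
      show "?V \<subseteq> Lp p" using class_of_schwartz by blast
      show "\<exists>v\<in>?V. Lp_norm p (v - x) < e" if "x \<in> Lp p" "0 < e"
        for x :: "(real ^ 'n, complex ^ 'N) ae_class" and e
        using testvec_dense[OF that] testvec_schwartz by blast
      show "Lp_norm p (multiplier_op p (aexp t) v) \<le> C * Lp_norm p v" if v: "v \<in> ?V" for v
      proof -
        obtain u where u: "u \<in> schwartz" "v = class_of u" using v by blast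
        show ?thesis unfolding u(2) B(2)[OF u(1)] using b[OF u(1)] by blast
      qed
    qed (use C in simp)
  qed (use C in simp)
qed

end

lemma well_posed_imp_multipliers:
  assumes wp: "well_posed (Lp p) (Lp_norm p) (Lp_domain p a) (Lp_realization p a)" and T: "0 < T"
  shows "\<exists>C>0. \<forall>t\<in>{0..T}. aexp t \<in> multipliers p \<and> multiplier_norm p (aexp t) \<le> C"
proof -
  obtain C where C: "0 < C" "\<And>u0 u t. u0 \<in> Lp_domain p a \<Longrightarrow>
    classical_solution (Lp p) (Lp_norm p) (Lp_domain p a) (Lp_realization p a) u0 u \<Longrightarrow> t \<in> {0..T} \<Longrightarrow>
    Lp_norm p (u t) \<le> C * Lp_norm p u0"
    using wp[unfolded well_posed_def, THEN conjunct2, THEN conjunct2, THEN conjunct2, THEN conjunct2, THEN spec, THEN mp, OF T] by blast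
  have b: "lpn p (sol t g) \<le> C * lpn p (inv_fourier_vec g)" if g: "testvec g" and t: "t \<in> {0..T}" for g t
    using C(2)[OF sol_domain(1)[OF g, of 0, unfolded sol_0] sol_classical[OF g] t]
    unfolding Lp_norm_class_of[OF p_ge(2) sol_lp[OF g]] Lp_norm_class_of[OF p_ge(2) schwartz_vec_lp[OF testvec_schwartz[OF g]]] .
  show ?thesis
  proof (intro exI[of _ C] conjI ballI C(1))
    fix t assume t: "t \<in> {0..T}"
    show "aexp t \<in> multipliers p" by (rule aexp_multiplier(1)[OF C(1) b[OF _ t]])
    show "multiplier_norm p (aexp t) \<le> C" by (rule aexp_multiplier(2)[OF C(1) b[OF _ t]])
  qed
qed

end

section \<open>Bounded multipliers generate the semigroup\<close>

lemma testfun_inv_fourier_fourier: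
  fixes g :: "real ^ 'n \<Rightarrow> complex"
  assumes "testfun g" shows "\<exists>\<psi>. testfun \<psi> \<and> inv_fourier g = fourier \<psi>"
proof (intro exI conjI)
  show "testfun (\<lambda>x. g (- x))" using assms smooth_dilation[of g "-1"] by (auto simp: testfun_def) (metis norm_minus_cancel)
  show "inv_fourier g = fourier (\<lambda>y. g (- y))"
    using inv_fourier_reflect[OF schwartz_measurable[OF testfun_schwartz[OF assms]]] by blast
qed

lemma schwartz_nice: "\<phi> \<in> schwartz \<Longrightarrow> nice (\<phi> :: real ^ 'n \<Rightarrow> complex)"
  unfolding nice_def
proof (intro conjI)
  assume \<phi>: "\<phi> \<in> schwartz"
  show "continuous_on UNIV \<phi>" by (rule smooth_continuous[OF schwartz_smooth[OF \<phi>]])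
  show "\<exists>C. \<forall>x. norm (\<phi> x) \<le> C * wt x" using schwartz_wt[OF \<phi>, of 0] dbound_value by blast
  show "\<exists>C. \<forall>x. norm (inv_fourier \<phi> x) \<le> C * wt x" using schwartz_wt[OF schwartz_inv_fourier[OF \<phi>], of 0] dbound_value by blast
qed

lemma nice_fourier_lp:
  fixes h :: "real ^ 'n \<Rightarrow> complex"
  assumes "1 \<le> p" "nice h" shows "lp p (fourier h)"
proof -
  obtain C where "\<And>x. norm (inv_fourier h x) \<le> C * wt x" using assms(2) unfolding nice_def by blast
  then have "norm (fourier h x) \<le> C * wt x" for x
    by (metis inv_fourier_minus minus_minus wt_minus)
  then show ?thesis by (rule lp_wt_bound(1)[OF assms(1) fourier_measurable[OF nice_measurable[OF assms(2)]]])
qed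

lemma nice_mult_integrable:
  fixes f g :: "real ^ 'n \<Rightarrow> complex"
  assumes "nice f" "nice g" shows "integrable lborel (\<lambda>x. f x * g x)"
proof -
  obtain A B where AB: "\<And>x. norm (f x) \<le> A * wt x" "\<And>x. norm (g x) \<le> B * wt x" using assms unfolding nice_def by blast
  have B: "0 \<le> B" by (rule wt_const_nonneg[OF AB(2) norm_ge_zero])
  have "norm (f x * g x) \<le> (A * B) * wt x" for x
  proof -
    have "norm (g x) \<le> B * 1" by (rule order_trans[OF AB(2) mult_left_mono[OF wt_le_1 B]])
    then have "norm (f x * g x) \<le> (A * wt x) * (B * 1)"
      unfolding norm_mult using AB(1)[of x] order_trans[OF norm_ge_zero AB(1)[of x]] by (intro mult_mono) auto
    then show ?thesis by (simp add: ac_simps)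
  qed
  then show ?thesis
    by (rule integrable_wt_bound[OF borel_measurable_times[OF nice_measurable[OF assms(1)] nice_measurable[OF assms(2)]]])
qed

context conjugate
begin

lemma Lp_eqI_fourier:
  fixes u v :: "(real ^ 'n, complex ^ 'N) ae_class"
  assumes u: "u \<in> Lp p" and v: "v \<in> Lp p"
    and eq: "\<And>\<psi> j. testfun \<psi> \<Longrightarrow> dist_of u (fourier \<psi>) $ j = dist_of v (fourier \<psi>) $ j"
  shows "u = v"
proof (rule Lp_eqI[OF u v])
  fix g :: "real ^ 'n \<Rightarrow> complex" and j assume "testfun g"
  then obtain \<psi> where \<psi>: "testfun \<psi>" "inv_fourier g = fourier \<psi>" using testfun_inv_fourier_fourier by blast
  show "dist_of u (inv_fourier g) $ j = dist_of v (inv_fourier g) $ j" unfolding \<psi>(2) by (rule eq[OF \<psi>(1)])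
qed

lemma Lp_norm_dual_fourier:
  fixes u :: "(real ^ 'n, complex ^ 'N) ae_class"
  assumes u: "u \<in> Lp p" and K: "0 \<le> K"
    and bd: "\<And>\<psi> j. testfun \<psi> \<Longrightarrow> norm (dist_of u (fourier \<psi>) $ j) \<le> K * lpn q (fourier \<psi>)"
  shows "Lp_norm p u \<le> real CARD('N) * K"
proof (rule Lp_norm_dual[OF u K])
  fix g :: "real ^ 'n \<Rightarrow> complex" and j assume "testfun g"
  then obtain \<psi> where \<psi>: "testfun \<psi>" "inv_fourier g = fourier \<psi>" using testfun_inv_fourier_fourier by blast
  show "norm (dist_of u (inv_fourier g) $ j) \<le> K * lpn q (inv_fourier g)" unfolding \<psi>(2) by (rule bd[OF \<psi>(1)])
qed

lemma dist_of_arg_sum: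
  fixes u :: "(real ^ 'n, complex ^ 'N) ae_class"
  assumes u: "u \<in> Lp p" and I: "finite I" and \<phi>: "\<And>l. l \<in> I \<Longrightarrow> lp q (\<phi> l)"
  shows "dist_of u (\<lambda>x. \<Sum>l\<in>I. \<phi> l x) $ j = (\<Sum>l\<in>I. dist_of u (\<phi> l) $ j)"
proof -
  have "dist_of u (\<lambda>x. \<Sum>l\<in>I. \<phi> l x) $ j = (\<integral>x. (\<Sum>l\<in>I. \<phi> l x * rep_ae_class u x $ j) \<partial>lborel)"
    using dist_of_nth[OF u lp_sum(1)[OF p_ge(3) I \<phi>], where j=j] by (simp add: sum_distrib_right)
  also have "\<dots> = (\<Sum>l\<in>I. dist_of u (\<phi> l) $ j)"
    by (subst Bochner_Integration.integral_sum) (auto intro!: pair_integrable(1) rep_nth_lp u \<phi> simp: dist_of_nth[OF u \<phi>])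
  finally show ?thesis .
qed

lemma dist_of_arg_diff_bound:
  fixes u :: "(real ^ 'n, complex ^ 'N) ae_class"
  assumes u: "u \<in> Lp p" and \<phi>: "lp q \<phi>" "lp q \<theta>"
  shows "norm (dist_of u \<phi> $ j - dist_of u \<theta> $ j) \<le> lpn q (\<lambda>x. \<phi> x - \<theta> x) * Lp_norm p u"
proof -
  have "dist_of u (\<lambda>x. \<phi> x - \<theta> x) $ j = dist_of u \<phi> $ j - dist_of u \<theta> $ j"
    unfolding dist_of_nth[OF u \<phi>(1)] dist_of_nth[OF u \<phi>(2)] dist_of_nth[OF u lp_diff(1)[OF p_ge(3) \<phi>]]
    using Bochner_Integration.integral_diff[OF pair_integrable(1)[OF rep_nth_lp[OF u] \<phi>(1), of j] pair_integrable(1)[OF rep_nth_lp[OF u] \<phi>(2), of j]]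
    by (simp add: left_diff_distrib)
  then show ?thesis using dist_of_bound[OF u lp_diff(1)[OF p_ge(3) \<phi>], of j] by simp
qed

text \<open>Functionals given by Lebesgue functions do not notice a cutoff at high frequencies.\<close>

lemma dist_of_cutoff_limit:
  fixes u :: "(real ^ 'n, complex ^ 'N) ae_class"
  assumes u: "u \<in> Lp p" and \<phi>: "\<phi> \<in> schwartz"
  shows "(\<lambda>k. dist_of u (fourier (\<lambda>\<xi>. \<phi> \<xi> * cutoff ((1 / real (Suc k)) *\<^sub>R \<xi>))) $ j) \<longlonglongrightarrow> dist_of u (fourier \<phi>) $ j"
proof -
  let ?e = "\<lambda>k. 1 / real (Suc k)"
  have e0: "?e \<longlonglongrightarrow> 0" using LIMSEQ_inverse_real_of_nat by (simp add: inverse_eq_divide)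
  obtain K where K: "0 \<le> K" "\<And>e x. 0 \<le> e \<Longrightarrow> e \<le> 1 \<Longrightarrow>
    norm (fourier (\<lambda>\<xi>. \<phi> \<xi> * cutoff (e *\<^sub>R \<xi>)) x - fourier \<phi> x) \<le> K * e * wt x" using fourier_cutoff_approx[OF \<phi>] by blast
  let ?F = "\<lambda>k. fourier (\<lambda>\<xi>. \<phi> \<xi> * cutoff (?e k *\<^sub>R \<xi>))"
  have t: "testfun (\<lambda>\<xi>. \<phi> \<xi> * cutoff (?e k *\<^sub>R \<xi>))" for k
    by (rule testfun_mult[OF testfun_dilation[OF testfun_cutoff] schwartz_smooth[OF \<phi>]]) simp
  have l: "lp q (?F k)" "lp q (fourier \<phi>)" for k by (intro schwartz_lp p_ge schwartz_fourier testfun_schwartz t \<phi>)+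
  have "(\<lambda>k. dist_of u (?F k) $ j - dist_of u (fourier \<phi>) $ j) \<longlonglongrightarrow> 0"
  proof (rule Lim_null_comparison)
    show "\<forall>\<^sub>F k in sequentially. norm (dist_of u (?F k) $ j - dist_of u (fourier \<phi>) $ j) \<le>
      ((K * ?e k) * lpn q (wt :: real ^ 'n \<Rightarrow> real)) * Lp_norm p u"
    proof (rule always_eventually, rule allI)
      fix k
      have "lpn q (\<lambda>x. ?F k x - fourier \<phi> x) \<le> (K * ?e k) * lpn q (wt :: real ^ 'n \<Rightarrow> real)"
        by (rule lp_wt_bound(2)[OF p_ge(3) lp_measurable[OF lp_diff(1)[OF p_ge(3) l]]]) (rule K(2); simp)
      then show "norm (dist_of u (?F k) $ j - dist_of u (fourier \<phi>) $ j) \<le>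
          ((K * ?e k) * lpn q (wt :: real ^ 'n \<Rightarrow> real)) * Lp_norm p u"
        by (rule order_trans[OF dist_of_arg_diff_bound[OF u l] mult_right_mono]) (simp add: Lp_norm_lpn)
    qed
    have "(\<lambda>k. ((K * ?e k) * lpn q (wt :: real ^ 'n \<Rightarrow> real)) * Lp_norm p u) \<longlonglongrightarrow> ((K * 0) * lpn q (wt :: real ^ 'n \<Rightarrow> real)) * Lp_norm p u"
      by (intro tendsto_mult tendsto_const e0)
    then show "(\<lambda>k. ((K * ?e k) * lpn q (wt :: real ^ 'n \<Rightarrow> real)) * Lp_norm p u) \<longlonglongrightarrow> 0" by simp
  qed
  then show ?thesis by (rule LIM_zero_cancel)
qed

end

context lp_symbol
begin

text \<open>The pairing of \<open>a ^ k\<close> applied to a class, with all powers moved to the test function.\<close>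

definition pow_pairing :: "(real ^ 'n, complex ^ 'N) ae_class \<Rightarrow> (real ^ 'n \<Rightarrow> complex) \<Rightarrow> 'N \<Rightarrow> nat \<Rightarrow> complex"
  where "pow_pairing x \<psi> i k = (\<Sum>j\<in>UNIV. dist_of x (fourier_apow k i j \<psi>) $ j)"

lemma apow_test: "testfun \<psi> \<Longrightarrow> testfun (\<lambda>\<xi>. apow k i j \<xi> * \<psi> \<xi>)"
  using apow_testfun[of \<psi> 0] by blast

lemma apow_fourier_lp: "testfun \<psi> \<Longrightarrow> lp q (fourier_apow k i j \<psi>)"
  by (intro schwartz_lp p_ge schwartz_fourier testfun_schwartz apow_test)

lemma aexp_fourier_lp: "testfun \<psi> \<Longrightarrow> lp q (fourier_aexp t i j \<psi>)"
  by (rule nice_fourier_lp[OF p_ge(3) aexp_nice])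

lemma apow_dist_bound:
  assumes x: "x \<in> Lp p" and \<psi>: "testfun \<psi>"
  shows "\<exists>C B. 0 \<le> C \<and> 0 \<le> B \<and> (\<forall>k i j. norm (dist_of x (fourier_apow k i j \<psi>) $ j) \<le> C * B ^ k)"
proof -
  obtain C B where CB: "C \<ge> 0" "B \<ge> 0" "\<And>k i j y. norm (fourier_apow k i j \<psi> y) \<le> C * B ^ k * wt y"
    using apow_fourier_bound[OF \<psi>] by blast
  let ?W = "lpn q (wt :: real ^ 'n \<Rightarrow> real) * Lp_norm p x"
  have "norm (dist_of x (fourier_apow k i j \<psi>) $ j) \<le> (C * ?W) * B ^ k" for k i j
  proof -
    have "lpn q (fourier_apow k i j \<psi>) \<le> (C * B ^ k) * lpn q (wt :: real ^ 'n \<Rightarrow> real)"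
      by (rule lp_wt_bound(2)[OF p_ge(3) lp_measurable[OF apow_fourier_lp[OF \<psi>]] CB(3)])
    then have "norm (dist_of x (fourier_apow k i j \<psi>) $ j) \<le> ((C * B ^ k) * lpn q (wt :: real ^ 'n \<Rightarrow> real)) * Lp_norm p x"
      by (rule order_trans[OF dist_of_bound[OF x apow_fourier_lp[OF \<psi>]] mult_right_mono]) (rule X.nrm_nonneg)
    then show ?thesis by (simp only: ac_simps)
  qed
  moreover have "0 \<le> C * ?W" using CB X.nrm_nonneg by simp
  ultimately show ?thesis using CB(2) by blast
qed

lemma pow_pairing_bound:
  assumes x: "x \<in> Lp p" and \<psi>: "testfun \<psi>"
  shows "\<exists>C B. 0 \<le> C \<and> 0 \<le> B \<and> (\<forall>k. norm (pow_pairing x \<psi> i k) \<le> C * B ^ k)"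
proof -
  obtain C B where CB: "0 \<le> C" "0 \<le> B" "\<And>k i j. norm (dist_of x (fourier_apow k i j \<psi>) $ j) \<le> C * B ^ k"
    using apow_dist_bound[OF assms] by blast
  have "norm (pow_pairing x \<psi> i k) \<le> (real CARD('N) * C) * B ^ k" for k
    using sum_norm_le[of "UNIV :: 'N set" "\<lambda>j. dist_of x (fourier_apow k i j \<psi>) $ j" "\<lambda>j. C * B ^ k", OF CB(3)]
    by (simp add: pow_pairing_def)
  then show ?thesis using CB(1,2) by (intro exI[of _ "real CARD('N) * C"] exI[of _ B]) simp
qed

lemma aexp_pairing_eseries:
  assumes x: "x \<in> Lp p" and \<psi>: "testfun \<psi>"
  shows "(\<Sum>j\<in>UNIV. dist_of x (fourier_aexp t i j \<psi>) $ j) = eseries (pow_pairing x \<psi> i) t"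
proof -
  obtain C B where CB: "C \<ge> 0" "B \<ge> 0" "\<And>k i j y. norm (fourier_apow k i j \<psi> y) \<le> C * B ^ k * wt y"
    using apow_fourier_bound[OF \<psi>] by blast
  have CB': "norm (fourier_apow k i j \<psi> y) \<le> (C * wt y) * B ^ k" for k i j y
    using CB(3)[where k=k and i=i and j=j and y=y] by (simp only: ac_simps)
  let ?d = "\<lambda>j k. dist_of x (fourier_apow k i j \<psi>) $ j"
  have "dist_of x (fourier_aexp t i j \<psi>) $ j = eseries (?d j) t" for j
  proof -
    have wti: "integrable lborel (\<lambda>y. wt y * norm (rep_ae_class x y $ j))"
    proof -
      have "integrable lborel (\<lambda>y. complex_of_real (wt y) * rep_ae_class x y $ j)"
        by (rule pair_integrable(1)[OF rep_nth_lp[OF x] lp_wt_bound(1)[OF p_ge(3), of _ 1]]) (auto simp: wt_measurable)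
      from integrable_norm[OF this] show ?thesis by (simp add: norm_mult)
    qed
    have "dist_of x (fourier_aexp t i j \<psi>) $ j =
        (\<integral>y. eseries (\<lambda>k. fourier_apow k i j \<psi> y) t * rep_ae_class x y $ j \<partial>lborel)"
      unfolding dist_of_nth[OF x aexp_fourier_lp[OF \<psi>]] apow_fourier_sums[OF \<psi>] ..
    also have "\<dots> = eseries (\<lambda>k. \<integral>y. fourier_apow k i j \<psi> y * rep_ae_class x y $ j \<partial>lborel) t"
      by (rule eseries_integral[OF pair_integrable(1)[OF rep_nth_lp[OF x] apow_fourier_lp[OF \<psi>]] wti CB'])
    also have "\<dots> = eseries (?d j) t" unfolding dist_of_nth[OF x apow_fourier_lp[OF \<psi>]] ..
    finally show ?thesis .
  qed
  moreover have "(\<Sum>j\<in>UNIV. eseries (?d j) t) = eseries (\<lambda>k. \<Sum>j\<in>UNIV. ?d j k) t"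
  proof (rule eseries_sum[OF finite])
    fix j
    show "\<exists>C B. \<forall>k. norm (?d j k) \<le> C * B ^ k" using apow_dist_bound[OF x \<psi>] by blast
  qed
  ultimately show ?thesis by (simp add: pow_pairing_def[abs_def])
qed

text \<open>
  Shifting the power series of \<open>x\<close> gives that of \<open>op[a] x\<close>: the defining identity of the realization
  is applied to the test functions \<open>a ^ k \<psi>\<close>.
\<close>

lemma pow_pairing_realization:
  assumes x: "x \<in> Lp_domain p a" and \<psi>: "testfun \<psi>"
  shows "pow_pairing (Lp_realization p a x) \<psi> i k = pow_pairing x \<psi> i (Suc k)"
proof -
  note D = domainD[OF x]
  have "dist_of (Lp_realization p a x) (fourier_apow k i j \<psi>) $ j =
      (\<Sum>l\<in>UNIV. dist_of x (fourier (\<lambda>\<xi>. a \<xi> $ j $ l * (apow k i j \<xi> * \<psi> \<xi>))) $ l)" for j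
  proof -
    note S = testfun_schwartz[OF apow_test[OF \<psi>, of k i j]]
    show ?thesis
      using D(3)[unfolded represents_op_iff, rule_format, OF schwartz_fourier[OF S], of j]
      by (simp add: schwartz_fourier_inv(2)[OF S])
  qed
  then have "pow_pairing (Lp_realization p a x) \<psi> i k =
      (\<Sum>j\<in>UNIV. \<Sum>l\<in>UNIV. dist_of x (fourier (\<lambda>\<xi>. a \<xi> $ j $ l * (apow k i j \<xi> * \<psi> \<xi>))) $ l)"
    by (simp add: pow_pairing_def)
  also have "\<dots> = (\<Sum>l\<in>UNIV. \<Sum>j\<in>UNIV. dist_of x (fourier (\<lambda>\<xi>. a \<xi> $ j $ l * (apow k i j \<xi> * \<psi> \<xi>))) $ l)"
    by (rule sum.swap)
  also have "\<dots> = (\<Sum>l\<in>UNIV. dist_of x (fourier (\<lambda>\<xi>. apow (Suc k) i l \<xi> * \<psi> \<xi>)) $ l)"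
  proof (rule sum.cong[OF refl])
    fix l
    have t: "testfun (\<lambda>\<xi>. a \<xi> $ j $ l * (apow k i j \<xi> * \<psi> \<xi>))" for j by (rule a_testfun[OF apow_test[OF \<psi>]])
    have "(\<Sum>j\<in>UNIV. dist_of x (fourier (\<lambda>\<xi>. a \<xi> $ j $ l * (apow k i j \<xi> * \<psi> \<xi>))) $ l) =
        dist_of x (\<lambda>y. \<Sum>j\<in>UNIV. fourier (\<lambda>\<xi>. a \<xi> $ j $ l * (apow k i j \<xi> * \<psi> \<xi>)) y) $ l"
      by (rule dist_of_arg_sum[OF D(1) finite, symmetric]) (intro schwartz_lp p_ge schwartz_fourier testfun_schwartz t)
    also have "(\<lambda>y. \<Sum>j\<in>UNIV. fourier (\<lambda>\<xi>. a \<xi> $ j $ l * (apow k i j \<xi> * \<psi> \<xi>)) y) =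
        fourier (\<lambda>\<xi>. \<Sum>j\<in>UNIV. a \<xi> $ j $ l * (apow k i j \<xi> * \<psi> \<xi>))"
      by (rule ext, rule fourier_sum[symmetric]) (auto intro: testfun_fourier_integrable t)
    also have "(\<lambda>\<xi>. \<Sum>j\<in>UNIV. a \<xi> $ j $ l * (apow k i j \<xi> * \<psi> \<xi>)) = (\<lambda>\<xi>. apow (Suc k) i l \<xi> * \<psi> \<xi>)"
      by (simp add: mpow_Suc' matrix_matrix_mult_def sum_distrib_left sum_distrib_right ac_simps)
    finally show "(\<Sum>j\<in>UNIV. dist_of x (fourier (\<lambda>\<xi>. a \<xi> $ j $ l * (apow k i j \<xi> * \<psi> \<xi>))) $ l) =
      dist_of x (fourier (\<lambda>\<xi>. apow (Suc k) i l \<xi> * \<psi> \<xi>)) $ l" .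
  qed
  finally show ?thesis by (simp add: pow_pairing_def)
qed

text \<open>The density argument for scalar functionals.\<close>

lemma testvec_vanish:
  fixes F :: "(real ^ 'n, complex ^ 'N) ae_class \<Rightarrow> complex"
  assumes zero: "\<And>g. testvec g \<Longrightarrow> F (class_of (inv_fourier_vec g)) = 0"
    and lip: "\<And>x y. x \<in> Lp p \<Longrightarrow> y \<in> Lp p \<Longrightarrow> norm (F x - F y) \<le> K * Lp_norm p (x - y)"
    and x: "x \<in> Lp p"
  shows "F x = 0"
proof (rule ccontr)
  assume "F x \<noteq> 0"
  then have pos: "0 < norm (F x) / (\<bar>K\<bar> + 1)" by simp
  obtain g where g: "testvec g" "Lp_norm p (class_of (inv_fourier_vec g) - x) < norm (F x) / (\<bar>K\<bar> + 1)"
    using testvec_dense[OF x pos] by blast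
  let ?n = "Lp_norm p (class_of (inv_fourier_vec g) - x)"
  have "norm (F x) \<le> K * ?n"
    using lip[OF class_of_schwartz[OF testvec_schwartz[OF g(1)]] x] zero[OF g(1)] by simp
  also have "\<dots> \<le> (\<bar>K\<bar> + 1) * ?n" using X.nrm_nonneg by (intro mult_right_mono) auto
  also have "\<dots> < (\<bar>K\<bar> + 1) * (norm (F x) / (\<bar>K\<bar> + 1))" using g(2) by (intro mult_strict_left_mono) auto
  also have "\<dots> = norm (F x)" using abs_ge_zero[of K] by (simp add: field_simps)
  finally show False by simp
qed

end

lemma (in banach_carrier) bounded_operator_comp:
  assumes "bounded_operator X nrm B" "bounded_operator X nrm C"
  shows "bounded_operator X nrm (\<lambda>x. B (C x))"
proof -
  obtain K L where K: "\<And>x. x \<in> X \<Longrightarrow> nrm (B x) \<le> K * nrm x" and L: "\<And>x. x \<in> X \<Longrightarrow> nrm (C x) \<le> L * nrm x"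
    using assms by (auto simp: bounded_operator_def)
  have "nrm (B (C x)) \<le> (\<bar>K\<bar> * L) * nrm x" if x: "x \<in> X" for x
  proof -
    have "nrm (B (C x)) \<le> K * nrm (C x)" by (rule K[OF bounded_operator_in[OF assms(2) x]])
    also have "\<dots> \<le> \<bar>K\<bar> * nrm (C x)" using nrm_nonneg by (intro mult_right_mono) auto
    also have "\<dots> \<le> \<bar>K\<bar> * (L * nrm x)" by (intro mult_left_mono L x) simp
    finally show ?thesis by (simp only: mult.assoc)
  qed
  moreover have "linear_operator X X (\<lambda>x. B (C x))"
    using assms unfolding bounded_operator_def linear_operator_def by (auto simp: image_subset_iff)
  ultimately show ?thesis unfolding bounded_operator_def by blast
qed

text \<open>The second of the two equivalent conditions, as a standing assumption.\<close>

locale bounded_multipliers = lp_symbol p q a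
  for p q and a :: "real ^ 'n \<Rightarrow> complex ^ 'N ^ 'N" +
  assumes multipliers_bounded: "\<And>T. 0 < T \<Longrightarrow>
    \<exists>C>0. \<forall>t\<in>{0..T}. aexp t \<in> multipliers p \<and> multiplier_norm p (aexp t) \<le> C"
begin

abbreviation S :: "real \<Rightarrow> (real ^ 'n, complex ^ 'N) ae_class \<Rightarrow> (real ^ 'n, complex ^ 'N) ae_class"
  where "S t \<equiv> multiplier_op p (aexp t)"

lemma aexp_multipliers: "0 \<le> t \<Longrightarrow> aexp t \<in> multipliers p"
  using multipliers_bounded[of "t + 1"] by auto

lemma S_bounded: "0 \<le> t \<Longrightarrow> bounded_operator (Lp p) (Lp_norm p) (S t)"
  by (rule multiplier_op_extends(1)[OF aexp_multipliers])

lemma S_locally_bounded: "0 < T \<Longrightarrow> \<exists>C>0. \<forall>t\<in>{0..T}. \<forall>x\<in>Lp p. Lp_norm p (S t x) \<le> C * Lp_norm p x"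
proof -
  assume "0 < T"
  then obtain C where C: "0 < C" "\<And>t. t \<in> {0..T} \<Longrightarrow> multiplier_norm p (aexp t) \<le> C" using multipliers_bounded by blast
  have "Lp_norm p (S t x) \<le> C * Lp_norm p x" if t: "t \<in> {0..T}" and x: "x \<in> Lp p" for t x
  proof -
    have "Lp_norm p (S t x) \<le> multiplier_norm p (aexp t) * Lp_norm p x"
      unfolding multiplier_norm_def by (rule X.operator_norm_bound[OF S_bounded x]) (use t in simp)
    also have "\<dots> \<le> C * Lp_norm p x" by (rule mult_right_mono[OF C(2)[OF t] X.nrm_nonneg])
    finally show ?thesis .
  qed
  then show ?thesis using C(1) by blast
qed

lemma S_in: "0 \<le> t \<Longrightarrow> x \<in> Lp p \<Longrightarrow> S t x \<in> Lp p"
  by (rule X.bounded_operator_in[OF S_bounded])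

lemma S_test: "0 \<le> t \<Longrightarrow> testvec g \<Longrightarrow> S t (class_of (inv_fourier_vec g)) = class_of (sol t g)"
  using multiplier_op_extends(2)[OF aexp_multipliers testvec_schwartz] op_fun_aexp by metis

lemma aexp_product_pairing:
  assumes h: "\<And>j. nice (\<lambda>\<xi>. h \<xi> $ j)" and \<psi>: "testfun \<psi>"
  shows "(\<Sum>j\<in>UNIV. dist_of (class_of (inv_fourier_vec h)) (fourier_aexp t i j \<psi>) $ j) =
    (\<integral>\<xi>. \<psi> \<xi> * (aexp t \<xi> *v h \<xi>) $ i \<partial>lborel)"
proof -
  have "(\<Sum>j\<in>UNIV. dist_of (class_of (inv_fourier_vec h)) (fourier_aexp t i j \<psi>) $ j) =
      (\<Sum>j\<in>UNIV. \<integral>\<xi>. (aexp t \<xi> $ i $ j * \<psi> \<xi>) * h \<xi> $ j \<partial>lborel)"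
    by (rule sum.cong[OF refl], rule nice_vec_pairing[OF h nice_integrable[OF aexp_nice[OF \<psi>]] aexp_fourier_lp[OF \<psi>]])
  also have "\<dots> = (\<integral>\<xi>. (\<Sum>j\<in>UNIV. (aexp t \<xi> $ i $ j * \<psi> \<xi>) * h \<xi> $ j) \<partial>lborel)"
    by (rule Bochner_Integration.integral_sum[symmetric]) (rule nice_mult_integrable[OF aexp_nice[OF \<psi>] h])
  also have "\<dots> = (\<integral>\<xi>. \<psi> \<xi> * (aexp t \<xi> *v h \<xi>) $ i \<partial>lborel)"
    by (simp add: matrix_vector_mult_def sum_distrib_left ac_simps)
  finally show ?thesis .
qed

text \<open>
  The multiplier is moved to the test function. For band-limited functions this is the symmetry of
  the Fourier transform; both sides are continuous on \<open>L\<^sup>p\<close>.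
\<close>

lemma S_pairing:
  assumes t: "0 \<le> t" and x: "x \<in> Lp p" and \<psi>: "testfun \<psi>"
  shows "dist_of (S t x) (fourier \<psi>) $ i = (\<Sum>j\<in>UNIV. dist_of x (fourier_aexp t i j \<psi>) $ j)"
proof -
  let ?f = "\<lambda>j. fourier_aexp t i j \<psi>"
  let ?F = "\<lambda>x. dist_of (S t x) (fourier \<psi>) $ i - (\<Sum>j\<in>UNIV. dist_of x (?f j) $ j)"
  have lq: "lp q (fourier \<psi>)" by (intro schwartz_lp p_ge schwartz_fourier testfun_schwartz \<psi>)
  obtain C where C: "\<And>x. x \<in> Lp p \<Longrightarrow> Lp_norm p (S t x) \<le> C * Lp_norm p x"
    using S_bounded[OF t] unfolding bounded_operator_def by blast
  have "?F x = 0"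
  proof (rule testvec_vanish[OF _ _ x, where K="lpn q (fourier \<psi>) * C + (\<Sum>j\<in>UNIV. lpn q (?f j))"])
    fix g :: "real ^ 'n \<Rightarrow> complex ^ 'N" assume g: "testvec g"
    have gn: "nice (\<lambda>\<xi>. g \<xi> $ j)" for j using g by (intro schwartz_nice testfun_schwartz) (simp add: testvec_def)
    show "?F (class_of (inv_fourier_vec g)) = 0"
      unfolding aexp_product_pairing[OF gn \<psi>] S_test[OF t g] sol_def
      using nice_vec_pairing[OF aexp_vec_nice[OF g] testfun_fourier_integrable[OF \<psi>] lq] by simp
  next
    fix x y :: "(real ^ 'n, complex ^ 'N) ae_class" assume xy: "x \<in> Lp p" "y \<in> Lp p"
    have 1: "norm (dist_of (S t x) (fourier \<psi>) $ i - dist_of (S t y) (fourier \<psi>) $ i) \<le> lpn q (fourier \<psi>) * (C * Lp_norm p (x - y))"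
    proof -
      have "norm (dist_of (S t x) (fourier \<psi>) $ i - dist_of (S t y) (fourier \<psi>) $ i) \<le> lpn q (fourier \<psi>) * Lp_norm p (S t x - S t y)"
        by (rule dist_of_diff_bound[OF S_in[OF t xy(1)] S_in[OF t xy(2)] lq])
      also have "\<dots> \<le> lpn q (fourier \<psi>) * (C * Lp_norm p (x - y))"
        unfolding X.bounded_operator_diff[OF S_bounded[OF t] xy, symmetric]
        by (rule mult_left_mono[OF C[OF X.diff_in[OF xy]] lpn_nonneg])
      finally show ?thesis .
    qed
    have 2: "norm ((\<Sum>j\<in>UNIV. dist_of x (?f j) $ j) - (\<Sum>j\<in>UNIV. dist_of y (?f j) $ j)) \<le> (\<Sum>j\<in>UNIV. lpn q (?f j) * Lp_norm p (x - y))"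
      unfolding sum_subtractf[symmetric] by (rule sum_norm_le) (rule dist_of_diff_bound[OF xy aexp_fourier_lp[OF \<psi>]])
    have "norm (?F x - ?F y) \<le> lpn q (fourier \<psi>) * (C * Lp_norm p (x - y)) + (\<Sum>j\<in>UNIV. lpn q (?f j) * Lp_norm p (x - y))"
    proof -
      have "?F x - ?F y = (dist_of (S t x) (fourier \<psi>) $ i - dist_of (S t y) (fourier \<psi>) $ i) - ((\<Sum>j\<in>UNIV. dist_of x (?f j) $ j) - (\<Sum>j\<in>UNIV. dist_of y (?f j) $ j))"
        by simp
      then show ?thesis using norm_triangle_le_diff[OF add_mono[OF 1 2]] by metis
    qed
    also have "\<dots> = (lpn q (fourier \<psi>) * C + (\<Sum>j\<in>UNIV. lpn q (?f j))) * Lp_norm p (x - y)"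
      by (simp add: distrib_right sum_distrib_right)
    finally show "norm (?F x - ?F y) \<le> (lpn q (fourier \<psi>) * C + (\<Sum>j\<in>UNIV. lpn q (?f j))) * Lp_norm p (x - y)" .
  qed
  then show ?thesis by simp
qed

lemma S_0: assumes x: "x \<in> Lp p" shows "S 0 x = x"
proof (rule Lp_eqI_fourier[OF S_in[OF order_refl x] x])
  fix \<psi> :: "real ^ 'n \<Rightarrow> complex" and i assume \<psi>: "testfun \<psi>"
  have "dist_of x (fourier (\<lambda>\<xi>. aexp 0 \<xi> $ i $ j * \<psi> \<xi>)) $ j = (if j = i then dist_of x (fourier \<psi>) $ j else 0)" for j
  proof -
    have "aexp 0 \<xi> = mat 1" for \<xi> using mat_exp_0[of "a \<xi>"] by simp
    moreover have "fourier (\<lambda>\<xi>. 0) = (\<lambda>x :: real ^ 'n. 0)" by (rule ext) simp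
    ultimately show ?thesis by (auto simp: mat_def dist_of_def)
  qed
  then show "dist_of (S 0 x) (fourier \<psi>) $ i = dist_of x (fourier \<psi>) $ i"
    unfolding S_pairing[OF order_refl x \<psi>] by (simp only:) simp
qed

text \<open>
  On band-limited functions both sides have the transform \<open>exp (s a) exp (t a) g\<close>. The right-hand
  side is identified by pairings, as \<open>exp (t a) g\<close> is not known to be smooth.
\<close>

lemma S_add: assumes s: "0 \<le> s" and t: "0 \<le> t" and x: "x \<in> Lp p" shows "S (s + t) x = S s (S t x)"
proof (rule X.bounded_operator_eq_dense[OF S_bounded X.bounded_operator_comp[OF S_bounded[OF s] S_bounded[OF t]] _ _ _ x,
    where V="{class_of (inv_fourier_vec g) | g. testvec g}"])
  show "0 \<le> s + t" using s t by simp
  show "{class_of (inv_fourier_vec g) | g. testvec g} \<subseteq> (Lp p :: (real ^ 'n, complex ^ 'N) ae_class set)"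
    using class_of_schwartz[OF testvec_schwartz] by blast
  show "\<exists>v\<in>{class_of (inv_fourier_vec g) | g. testvec g}. Lp_norm p (v - x) < e"
    if "x \<in> Lp p" "0 < e" for x :: "(real ^ 'n, complex ^ 'N) ae_class" and e
    using testvec_dense[OF that] by blast
  fix v :: "(real ^ 'n, complex ^ 'N) ae_class" assume "v \<in> {class_of (inv_fourier_vec g) | g. testvec g}"
  then obtain g where g: "testvec g" "v = class_of (inv_fourier_vec g)" by blast
  have st: "0 \<le> s + t" using s t by simp
  have vt: "S t v \<in> Lp p" unfolding g(2) by (rule S_in[OF t class_of_schwartz[OF testvec_schwartz[OF g(1)]]])
  have vst: "S (s + t) v \<in> Lp p" unfolding g(2) by (rule S_in[OF st class_of_schwartz[OF testvec_schwartz[OF g(1)]]])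
  show "S (s + t) v = S s (S t v)"
  proof (rule Lp_eqI_fourier[OF vst S_in[OF s vt]])
    fix \<psi> :: "real ^ 'n \<Rightarrow> complex" and i assume \<psi>: "testfun \<psi>"
    have lq: "lp q (fourier \<psi>)" by (intro schwartz_lp p_ge schwartz_fourier testfun_schwartz \<psi>)
    have "dist_of (S s (S t v)) (fourier \<psi>) $ i = (\<integral>\<xi>. \<psi> \<xi> * (aexp s \<xi> *v (aexp t \<xi> *v g \<xi>)) $ i \<partial>lborel)"
      unfolding S_pairing[OF s vt \<psi>] unfolding g(2) S_test[OF t g(1)] sol_def
      by (rule aexp_product_pairing[OF aexp_vec_nice[OF g(1)] \<psi>])
    also have "\<dots> = (\<integral>\<xi>. \<psi> \<xi> * (aexp (s + t) \<xi> *v g \<xi>) $ i \<partial>lborel)"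
      by (simp add: mat_exp_add matrix_vector_mul_assoc)
    also have "\<dots> = dist_of (S (s + t) v) (fourier \<psi>) $ i"
      unfolding g(2) S_test[OF st g(1)] sol_def
      by (rule nice_vec_pairing[OF aexp_vec_nice[OF g(1)] testfun_fourier_integrable[OF \<psi>] lq, symmetric])
    finally show "dist_of (S (s + t) v) (fourier \<psi>) $ i = dist_of (S s (S t v)) (fourier \<psi>) $ i" ..
  qed
qed

text \<open>
  On the dense class the orbits are Lipschitz continuous; the operators are bounded for \<open>t \<le> 1\<close>.
\<close>

lemma S_continuous_0:
  assumes x: "x \<in> Lp p"
  shows "((\<lambda>t. Lp_norm p (S t x - x)) \<longlongrightarrow> 0) (at_right 0)"
proof (rule tendstoI)
  fix e :: real assume e: "0 < e"
  obtain C where C: "0 < C" "\<And>t x. t \<in> {0..1} \<Longrightarrow> x \<in> Lp p \<Longrightarrow> Lp_norm p (S t x) \<le> C * Lp_norm p x"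
    using S_locally_bounded[of 1] by auto
  have C1: "0 < 2 * (C + 1)" using C(1) by simp
  then have "0 < e / (2 * (C + 1))" using e by simp
  then obtain g where g: "testvec g" "Lp_norm p (class_of (inv_fourier_vec g) - x) < e / (2 * (C + 1))"
    using testvec_dense[OF x] by blast
  let ?v = "class_of (inv_fourier_vec g)"
  have v: "?v \<in> Lp p" by (rule class_of_schwartz[OF testvec_schwartz[OF g(1)]])
  obtain K where K: "0 \<le> K" "\<And>s t. \<bar>s\<bar> \<le> 1 \<Longrightarrow> \<bar>t\<bar> \<le> 1 \<Longrightarrow> Lp_norm p (class_of (sol s g) - class_of (sol t g)) \<le> K * \<bar>s - t\<bar>"
    using sol_estimates[OF g(1), of 1] by blast
  define d where "d = min 1 (e / (2 * (K + 1)))"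
  have K1: "0 < 2 * (K + 1)" using K(1) by simp
  then have d: "0 < d" using e by (simp add: d_def)
  from eventually_at_right_real[OF d] show "\<forall>\<^sub>F t in at_right 0. dist (Lp_norm p (S t x - x)) 0 < e"
  proof eventually_elim
    case (elim t)
    then have t: "0 \<le> t" "t \<in> {0..1}" "\<bar>t\<bar> \<le> 1" "t < e / (2 * (K + 1))" by (auto simp: d_def)
    have "Lp_norm p (S t ?v - ?v) \<le> K * t" using K(2)[of t 0] t by (simp add: S_test[OF t(1) g(1)] sol_0)
    moreover have "K * t \<le> (K + 1) * t" using t by (intro mult_right_mono) auto
    moreover have "(K + 1) * t < (K + 1) * (e / (2 * (K + 1)))" using t K(1) by (intro mult_strict_left_mono) auto
    moreover have "(K + 1) * (e / (2 * (K + 1))) = e / 2" using K1 by (simp add: field_simps)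
    ultimately have 1: "Lp_norm p (S t ?v - ?v) < e / 2" by linarith
    have dec: "S t x - x = S t (x - ?v) + ((S t ?v - ?v) + (?v - x))"
      by (simp add: X.bounded_operator_diff[OF S_bounded[OF t(1)] x v])
    have in1: "S t (x - ?v) \<in> Lp p" "S t ?v - ?v \<in> Lp p" "?v - x \<in> Lp p"
      by (intro S_in t X.diff_in x v)+
    have "Lp_norm p (S t x - x) \<le> Lp_norm p (S t (x - ?v)) + (Lp_norm p (S t ?v - ?v) + Lp_norm p (?v - x))"
      unfolding dec by (rule order_trans[OF X.nrm_triangle[OF in1(1) X.add_in[OF in1(2,3)]] add_left_mono[OF X.nrm_triangle[OF in1(2,3)]]])
    also have "\<dots> \<le> C * Lp_norm p (?v - x) + (Lp_norm p (S t ?v - ?v) + Lp_norm p (?v - x))"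
      using C(2)[OF t(2) X.diff_in[OF x v]] X.nrm_minus_commute[OF x v] by simp
    also have "\<dots> = (C + 1) * Lp_norm p (?v - x) + Lp_norm p (S t ?v - ?v)" by (simp add: distrib_right)
    also have "\<dots> < (C + 1) * (e / (2 * (C + 1))) + e / 2"
      using g(2) C(1) 1 by (intro add_strict_mono mult_strict_left_mono) auto
    also have "(C + 1) * (e / (2 * (C + 1))) = e / 2" using C1 by (simp add: field_simps)
    finally show ?case using X.nrm_nonneg[of "S t x - x"] by (simp add: dist_real_def)
  qed
qed

lemma S_pairing_eseries:
  assumes "0 \<le> t" "x \<in> Lp p" "testfun \<psi>"
  shows "dist_of (S t x) (fourier \<psi>) $ i = eseries (pow_pairing x \<psi> i) t"
  unfolding S_pairing[OF assms] by (rule aexp_pairing_eseries[OF assms(2,3)])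

text \<open>
  On the domain of the realization the orbits are differentiable. Tested against \<open>fourier \<psi>\<close>, the
  derivative of \<open>S t x\<close> is \<open>S t (A x)\<close>; the mean value theorem gives a bound that is uniform in \<open>\<psi>\<close>,
  and duality turns it into one in norm.
\<close>

lemma realization_orbit_derivative:
  assumes x: "x \<in> Lp_domain p a"
  shows "converges_in (Lp_norm p) (\<lambda>h. (1 / h) *\<^sub>R (S h x - x)) (Lp_realization p a x) (at_right 0)"
  unfolding converges_in_def
proof (rule tendstoI)
  fix e :: real assume e: "0 < e"
  let ?y = "Lp_realization p a x"
  note D = domainD[OF x]
  \<comment> \<open>The factor \<open>CARD('N)\<close> is lost in the duality estimate.\<close>
  define \<delta> where "\<delta> = e / (2 * real CARD('N))"
  have N: "0 < real CARD('N)" by simp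
  have \<delta>: "0 < \<delta>" using e N by (simp add: \<delta>_def)
  have "\<forall>\<^sub>F s in at_right 0. Lp_norm p (S s ?y - ?y) < \<delta>"
    using order_tendstoD(2)[OF S_continuous_0[OF D(2)] \<delta>] .
  then obtain b where b: "0 < b" "\<And>s. 0 < s \<Longrightarrow> s < b \<Longrightarrow> Lp_norm p (S s ?y - ?y) < \<delta>"
    unfolding eventually_at_right_field by blast
  have b': "Lp_norm p (S s ?y - ?y) \<le> \<delta>" if "0 \<le> s" "s < b" for s
  proof (cases "s = 0")
    case True
    show ?thesis unfolding True S_0[OF D(2)] using \<delta> by (simp add: X.nrm_0)
  next
    case False
    then show ?thesis using b(2)[of s] that by simp
  qed
  from eventually_at_right_real[OF b(1)]
  show "\<forall>\<^sub>F h in at_right 0. dist (Lp_norm p ((1 / h) *\<^sub>R (S h x - x) - ?y)) 0 < e"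
  proof eventually_elim
    case (elim h)
    then have h: "0 < h" "0 \<le> h" "h < b" by auto
    let ?u = "S h x - x - h *\<^sub>R ?y"
    have u: "?u \<in> Lp p" by (intro X.diff_in X.scaleR_in S_in D h)
    have "Lp_norm p ?u \<le> real CARD('N) * (\<delta> * h)"
    proof (rule Lp_norm_dual_fourier[OF u])
      show "0 \<le> \<delta> * h" using \<delta> h by simp
      fix \<psi> :: "real ^ 'n \<Rightarrow> complex" and i assume \<psi>: "testfun \<psi>"
      have lq: "lp q (fourier \<psi>)" by (intro schwartz_lp p_ge schwartz_fourier testfun_schwartz \<psi>)
      let ?c = "pow_pairing x \<psi> i"
      obtain C B where CB: "\<And>k. norm (?c k) \<le> C * B ^ k" using pow_pairing_bound[OF D(1) \<psi>] by blast
      have c': "(\<lambda>k. ?c (Suc k)) = pow_pairing ?y \<psi> i" by (rule ext) (rule pow_pairing_realization[OF x \<psi>, symmetric])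
      have y0: "eseries (\<lambda>k. ?c (Suc k)) 0 = dist_of ?y (fourier \<psi>) $ i"
        unfolding c' using S_pairing_eseries[OF order_refl D(2) \<psi>, of i] unfolding S_0[OF D(2)] by simp
      have x0: "eseries ?c 0 = dist_of x (fourier \<psi>) $ i"
        using S_pairing_eseries[OF order_refl D(1) \<psi>, of i] unfolding S_0[OF D(1)] by simp
      have "norm (eseries ?c h - eseries ?c 0 - (h - 0) *\<^sub>R eseries (\<lambda>k. ?c (Suc k)) 0) \<le> (lpn q (fourier \<psi>) * \<delta>) * \<bar>h - 0\<bar>"
      proof (rule eseries_mean_value[OF CB])
        fix r assume "r \<in> closed_segment h 0"
        then have r: "0 \<le> r" "r < b" using h by (auto simp: closed_segment_eq_real_ivl)
        have "norm (dist_of (S r ?y) (fourier \<psi>) $ i - dist_of ?y (fourier \<psi>) $ i) \<le> lpn q (fourier \<psi>) * Lp_norm p (S r ?y - ?y)"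
          by (rule dist_of_diff_bound[OF S_in[OF r(1) D(2)] D(2) lq])
        also have "\<dots> \<le> lpn q (fourier \<psi>) * \<delta>" by (rule mult_left_mono[OF b'[OF r] lpn_nonneg])
        finally show "norm (eseries (\<lambda>k. ?c (Suc k)) r - eseries (\<lambda>k. ?c (Suc k)) 0) \<le> lpn q (fourier \<psi>) * \<delta>"
          unfolding y0 unfolding c' S_pairing_eseries[OF r(1) D(2) \<psi>] .
      qed
      moreover have "dist_of ?u (fourier \<psi>) $ i = eseries ?c h - eseries ?c 0 - (h - 0) *\<^sub>R eseries (\<lambda>k. ?c (Suc k)) 0"
        unfolding x0 y0 S_pairing_eseries[OF h(2) D(1) \<psi>, symmetric]
        by (simp add: dist_of_diff[OF X.diff_in[OF S_in[OF h(2) D(1)] D(1)] X.scaleR_in[OF D(2)] lq]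
            dist_of_diff[OF S_in[OF h(2) D(1)] D(1) lq] dist_of_scaleR[OF D(2) lq])
      ultimately show "norm (dist_of ?u (fourier \<psi>) $ i) \<le> (\<delta> * h) * lpn q (fourier \<psi>)"
        using h by (simp add: ac_simps)
    qed
    then have "(1 / h) * Lp_norm p ?u \<le> (1 / h) * (real CARD('N) * (\<delta> * h))" using h by (intro mult_left_mono) auto
    also have "\<dots> = e / 2" using h N by (simp add: \<delta>_def)
    also have "\<dots> < e" using e by simp
    finally have "(1 / h) * Lp_norm p ?u < e" .
    moreover have "(1 / h) *\<^sub>R (S h x - x) - ?y = (1 / h) *\<^sub>R ?u" using h by (simp add: scaleR_diff_right)
    ultimately show ?case using X.nrm_scaleR[OF u, of "1 / h"] h X.nrm_nonneg[of ?u] by (simp add: dist_real_def)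
  qed
qed

text \<open>
  For test functions \<open>\<psi>\<close> of compact support, the derivative at \<open>0\<close> of the pairing with
  \<open>fourier \<psi>\<close> is the linear coefficient of its power series. Tempered distributions are tested with
  all Schwartz functions, which are reached by cutting off \<open>\<psi>\<close>.
\<close>

lemma generator_in_realization:
  assumes x: "x \<in> Lp p" and y: "y \<in> Lp p"
    and lim: "converges_in (Lp_norm p) (\<lambda>h. (1 / h) *\<^sub>R (S h x - x)) y (at_right 0)"
  shows "represents_op a x y"
proof -
  have test: "(\<Sum>j\<in>UNIV. dist_of x (fourier (\<lambda>\<xi>. a \<xi> $ i $ j * \<psi> \<xi>)) $ j) = dist_of y (fourier \<psi>) $ i"
    if \<psi>: "testfun \<psi>" for \<psi> i
  proof -
    have lq: "lp q (fourier \<psi>)" by (intro schwartz_lp p_ge schwartz_fourier testfun_schwartz \<psi>)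
    let ?c = "pow_pairing x \<psi> i"
    let ?D = "\<lambda>h. dist_of ((1 / h) *\<^sub>R (S h x - x)) (fourier \<psi>) $ i"
    obtain C B where CB: "\<And>k. norm (?c k) \<le> C * B ^ k" using pow_pairing_bound[OF x \<psi>] by blast
    have "((\<lambda>h. (eseries ?c h - eseries ?c 0) /\<^sub>R (h - 0)) \<longlongrightarrow> eseries (\<lambda>k. ?c (Suc k)) 0) (at 0 within {0<..})"
      using eseries_derivative[OF CB, of 0 "{0<..}"] unfolding has_vector_derivative_quotient .
    moreover have ev: "\<forall>\<^sub>F h in at_right (0 :: real). 0 < h" by (rule eventually_at_right_less)
    then have "\<forall>\<^sub>F h in at_right 0. (eseries ?c h - eseries ?c 0) /\<^sub>R (h - 0) = ?D h"
    proof eventually_elim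
      case (elim h)
      then have h: "0 \<le> h" by simp
      have x0: "eseries ?c 0 = dist_of x (fourier \<psi>) $ i"
        using S_pairing_eseries[OF order_refl x \<psi>, of i] unfolding S_0[OF x] by simp
      show ?case
        unfolding x0 S_pairing_eseries[OF h x \<psi>, symmetric]
        by (simp add: dist_of_scaleR[OF X.diff_in[OF S_in[OF h x] x] lq] dist_of_diff[OF S_in[OF h x] x lq] divide_inverse)
    qed
    ultimately have 1: "(?D \<longlongrightarrow> ?c 1) (at_right 0)"
      unfolding eseries_at_0 One_nat_def by (rule Lim_transform_eventually)
    have "((\<lambda>h. ?D h - dist_of y (fourier \<psi>) $ i) \<longlongrightarrow> 0) (at_right 0)"
    proof (rule Lim_null_comparison)
      show "((\<lambda>h. lpn q (fourier \<psi>) * Lp_norm p ((1 / h) *\<^sub>R (S h x - x) - y)) \<longlongrightarrow> 0) (at_right 0)"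
        using tendsto_mult[OF tendsto_const[of "lpn q (fourier \<psi>)"] lim[unfolded converges_in_def]] by simp
      show "\<forall>\<^sub>F h in at_right 0. norm (?D h - dist_of y (fourier \<psi>) $ i) \<le> lpn q (fourier \<psi>) * Lp_norm p ((1 / h) *\<^sub>R (S h x - x) - y)"
        using ev
      proof eventually_elim
        case (elim h)
        then have h: "0 \<le> h" by simp
        show ?case by (rule dist_of_diff_bound[OF X.scaleR_in[OF X.diff_in[OF S_in[OF h x] x]] y lq])
      qed
    qed
    then have "(?D \<longlongrightarrow> dist_of y (fourier \<psi>) $ i) (at_right 0)" by (rule LIM_zero_cancel)
    then have "?c 1 = dist_of y (fourier \<psi>) $ i"
      by (rule tendsto_unique[OF trivial_limit_at_right_real 1])
    moreover have "apow 1 i j \<xi> = a \<xi> $ i $ j" for j \<xi> by (simp add: mpow_Suc mpow_0)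
    ultimately show ?thesis by (simp add: pow_pairing_def)
  qed
  show ?thesis
    unfolding represents_op_iff
  proof (intro ballI allI)
    fix \<phi> :: "real ^ 'n \<Rightarrow> complex" and i assume \<phi>: "\<phi> \<in> schwartz"
    let ?\<psi> = "inv_fourier \<phi>" and ?k = "\<lambda>k \<xi>. cutoff ((1 / real (Suc k)) *\<^sub>R \<xi>)"
    have S: "?\<psi> \<in> schwartz" by (rule schwartz_inv_fourier[OF \<phi>])
    have t: "testfun (\<lambda>\<xi>. ?\<psi> \<xi> * ?k k \<xi>)" for k
      by (rule testfun_mult[OF testfun_dilation[OF testfun_cutoff] schwartz_smooth[OF S]]) simp
    have "(\<lambda>k. \<Sum>j\<in>UNIV. dist_of x (fourier (\<lambda>\<xi>. (a \<xi> $ i $ j * ?\<psi> \<xi>) * ?k k \<xi>)) $ j) \<longlonglongrightarrow>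
        (\<Sum>j\<in>UNIV. dist_of x (fourier (\<lambda>\<xi>. a \<xi> $ i $ j * ?\<psi> \<xi>)) $ j)"
      by (intro tendsto_sum dist_of_cutoff_limit[OF x a_schwartz[OF S]])
    moreover have "(\<lambda>k. dist_of y (fourier (\<lambda>\<xi>. ?\<psi> \<xi> * ?k k \<xi>)) $ i) \<longlonglongrightarrow> dist_of y (fourier ?\<psi>) $ i"
      by (rule dist_of_cutoff_limit[OF y S])
    moreover have "(\<Sum>j\<in>UNIV. dist_of x (fourier (\<lambda>\<xi>. (a \<xi> $ i $ j * ?\<psi> \<xi>) * ?k k \<xi>)) $ j) = dist_of y (fourier (\<lambda>\<xi>. ?\<psi> \<xi> * ?k k \<xi>)) $ i" for k
      using test[OF t[of k], of i] by (simp only: mult.assoc)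
    ultimately have "(\<Sum>j\<in>UNIV. dist_of x (fourier (\<lambda>\<xi>. a \<xi> $ i $ j * ?\<psi> \<xi>)) $ j) = dist_of y (fourier ?\<psi>) $ i"
      using LIMSEQ_unique by simp
    then show "(\<Sum>j\<in>UNIV. dist_of x (fourier (\<lambda>\<xi>. a \<xi> $ i $ j * ?\<psi> \<xi>)) $ j) = dist_of y \<phi> $ i"
      by (simp only: schwartz_fourier_inv(1)[OF \<phi>])
  qed
qed

theorem realization_generates:
  "generates_semigroup (Lp p) (Lp_norm p) (Lp_domain p a) (Lp_realization p a) S"
proof -
  have "C0_semigroup (Lp p) (Lp_norm p) S"
    unfolding C0_semigroup_def converges_in_def using S_bounded S_0 S_add S_continuous_0 by blast
  moreover have "Lp_domain p a = {x \<in> Lp p. \<exists>y\<in>Lp p. converges_in (Lp_norm p) (\<lambda>h. (1 / h) *\<^sub>R (S h x - x)) y (at_right 0)}"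
  proof (intro set_eqI iffI)
    fix x assume x: "x \<in> Lp_domain p a"
    show "x \<in> {x \<in> Lp p. \<exists>y\<in>Lp p. converges_in (Lp_norm p) (\<lambda>h. (1 / h) *\<^sub>R (S h x - x)) y (at_right 0)}"
      using domainD[OF x] realization_orbit_derivative[OF x] by blast
  next
    fix x assume "x \<in> {x \<in> Lp p. \<exists>y\<in>Lp p. converges_in (Lp_norm p) (\<lambda>h. (1 / h) *\<^sub>R (S h x - x)) y (at_right 0)}"
    then obtain y where y: "x \<in> Lp p" "y \<in> Lp p" "converges_in (Lp_norm p) (\<lambda>h. (1 / h) *\<^sub>R (S h x - x)) y (at_right 0)" by blast
    show "x \<in> Lp_domain p a" by (rule realization_eqI(1)[OF y(1,2) generator_in_realization[OF y]])
  qed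
  moreover have "\<forall>x\<in>Lp_domain p a. Lp_realization p a x \<in> Lp p \<and>
      converges_in (Lp_norm p) (\<lambda>h. (1 / h) *\<^sub>R (S h x - x)) (Lp_realization p a x) (at_right 0)"
    using domainD(2) realization_orbit_derivative by blast
  ultimately show ?thesis unfolding generates_semigroup_def by blast
qed

theorem realization_well_posed: "well_posed (Lp p) (Lp_norm p) (Lp_domain p a) (Lp_realization p a)"
proof -
  interpret sg: bounded_semigroup "Lp p :: (real ^ 'n, complex ^ 'N) ae_class set" "Lp_norm p" "Lp_domain p a" "Lp_realization p a" S
    by unfold_locales (rule realization_generates, rule S_locally_bounded)
  show ?thesis by (rule sg.generator_well_posed[OF realization_linear realization_closed realization_dense])
qed

end

section \<open>Symbols\<close>

text \<open>
  A symbol of order \<open>\<mu>\<close> grows at most like the power \<open>\<lceil>\<bar>\<mu>\<bar>\<rceil>\<close> of \<open>1 + norm \<xi>\<close>, and so do its derivatives.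
\<close>

lemma symbols_entry_pgrow:
  fixes a :: "real ^ 'n \<Rightarrow> complex ^ 'N ^ 'N"
  assumes a: "a \<in> symbols \<mu>"
  shows "pgrow (\<lambda>\<xi>. a \<xi> $ i $ j)"
  unfolding pgrow_def
proof (intro conjI allI)
  have sm: "smooth a" using a by (simp add: symbols_def)
  have L: "bounded_linear (\<lambda>M :: complex ^ 'N ^ 'N. M $ i $ j)"
    by (rule bounded_linear_compose[OF bounded_linear_vec_nth bounded_linear_vec_nth])
  show "smooth (\<lambda>\<xi>. a \<xi> $ i $ j)" by (rule smooth_linear[OF L sm])
  fix m
  define k where "k = nat \<lceil>\<bar>\<mu>\<bar>\<rceil>"
  have "\<exists>C. \<forall>x. norm (iter_partial is a x) \<le> C * (1 + norm x) ^ k" for "is"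
  proof -
    obtain C where C: "0 < C" "\<And>\<xi>. norm (iter_partial is a \<xi>) \<le> C * japanese_bracket \<xi> powr (\<mu> - real (length is))"
      using a unfolding symbols_def by blast
    have "japanese_bracket \<xi> powr (\<mu> - real (length is)) \<le> (1 + norm \<xi>) ^ k" for \<xi> :: "real ^ 'n"
    proof -
      have 1: "1 \<le> japanese_bracket \<xi>" unfolding japanese_bracket_def by (rule ge_one_powr_ge_zero) auto
      have "japanese_bracket \<xi> = sqrt (1 + (norm \<xi>)\<^sup>2)" by (simp add: japanese_bracket_def powr_half_sqrt)
      also have "\<dots> \<le> sqrt ((1 + norm \<xi>)\<^sup>2)" by (intro real_sqrt_le_mono) (simp add: power2_sum)
      finally have 2: "japanese_bracket \<xi> \<le> 1 + norm \<xi>" by simp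
      have "\<mu> - real (length is) \<le> real k" unfolding k_def by linarith
      then have "japanese_bracket \<xi> powr (\<mu> - real (length is)) \<le> japanese_bracket \<xi> powr real k"
        using 1 by (rule powr_mono)
      also have "\<dots> = japanese_bracket \<xi> ^ k" using 1 by (intro powr_realpow) simp
      also have "\<dots> \<le> (1 + norm \<xi>) ^ k" using 1 2 by (intro power_mono) auto
      finally show ?thesis .
    qed
    then have "norm (iter_partial is a x) \<le> C * (1 + norm x) ^ k" for x
      using order_trans[OF C(2) mult_left_mono] C(1) by simp
    then show ?thesis by blast
  qed
  then obtain C where "dbound m (\<lambda>x. C * (1 + norm x) ^ k) a"
    using dbound_exists[of a "\<lambda>x. (1 + norm x) ^ k" m] by auto
  moreover have "norm (M $ i $ j) \<le> 1 * norm M" for M :: "complex ^ 'N ^ 'N"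
    using order_trans[OF Finite_Cartesian_Product.norm_nth_le Finite_Cartesian_Product.norm_nth_le] by simp
  ultimately have "dbound m (\<lambda>x. 1 * (C * (1 + norm x) ^ k)) (\<lambda>\<xi>. a \<xi> $ i $ j)"
    by (intro dbound_linear[OF L sm]) auto
  then have "dbound m (\<lambda>x. C * (1 + norm x) ^ k) (\<lambda>\<xi>. a \<xi> $ i $ j)" by simp
  then show "\<exists>C k. dbound m (\<lambda>x. C * (1 + norm x) ^ k) (\<lambda>\<xi>. a \<xi> $ i $ j)" by blast
qed

theorem theorem2p8:
  fixes a :: "real ^ 'n \<Rightarrow> complex ^ 'N ^ 'N" and \<mu> p :: real
  assumes "1 < p"
    and "a \<in> symbols \<mu>"
    and "quasi_hyperbolic a"
  shows "(well_posed (Lp p) (Lp_norm p) (Lp_domain p a) (Lp_realization p a) \<longleftrightarrow>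
      (\<forall>T>0. \<exists>C>0. \<forall>t\<in>{0..T}.
        (\<lambda>\<xi>. mat_exp (t *\<^sub>R a \<xi>)) \<in> multipliers p \<and>
        multiplier_norm p (\<lambda>\<xi>. mat_exp (t *\<^sub>R a \<xi>)) \<le> C)) \<and>
    (well_posed (Lp p) (Lp_norm p) (Lp_domain p a) (Lp_realization p a) \<longrightarrow>
      generates_semigroup (Lp p) (Lp_norm p) (Lp_domain p a) (Lp_realization p a)
        (\<lambda>t. multiplier_op p (\<lambda>\<xi>. mat_exp (t *\<^sub>R a \<xi>))))"
proof -
  define q where "q = p / (p - 1)"
  have q: "1 < q" "1 / p + 1 / q = 1" using assms(1) by (auto simp: q_def field_simps)
  interpret lp_symbol p q a
    by unfold_locales (use assms(1) q symbols_entry_pgrow[OF assms(2)] in auto)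
  let ?W = "well_posed (Lp p) (Lp_norm p) (Lp_domain p a) (Lp_realization p a)"
  let ?M = "\<forall>T>0. \<exists>C>0. \<forall>t\<in>{0..T}. aexp t \<in> multipliers p \<and> multiplier_norm p (aexp t) \<le> C"
  have WM: "?M" if "?W" using well_posed_imp_multipliers[OF that] by blast
  have MW: "?W \<and> generates_semigroup (Lp p) (Lp_norm p) (Lp_domain p a) (Lp_realization p a) (\<lambda>t. multiplier_op p (aexp t))" if M: "?M"
  proof -
    interpret bounded_multipliers p q a by unfold_locales (use M in blast)
    show ?thesis using realization_well_posed realization_generates by blast
  qed
  show ?thesis using WM MW by blast
qed

end
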